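(* Let $n\ge 1$ and let $\Phi$ be the fermionic product channel on $n$ qubits with attenuation coefficients $0\le b_1,\ldots,b_{2n}\le 1$, i.e. the linear map on operators of $(\mathbb{C}^2)^{\otimes n}$ defined by $\Phi(I)=I$ and $\Phi(\hat c(\mathbf x))=\big(\prod_{p:\,x_p=1} b_p\big)\,\hat c(\mathbf x)$ for every $\mathbf x\in\{0,1\}^{2n}$. Denote by $b^{\downarrow}_j$ the $j$-th largest of the coefficients $b_1,\ldots,b_{2n}$. Then \[ C_1^g(\Phi)=n-H\!\left(\frac{1+ b^{\downarrow}_1}{2}\right)-\sum_{j=1}^{n-1} H\!\left(\frac{1+ b^{\downarrow}_{2j}\, b^{\downarrow}_{2j+1}}{2}\right), \] where $H(x)=-x\log_2 x-(1-x)\log_2(1-x)$. Moreover, $C_1(\Phi)=C_1^g(\Phi)$ if $n\le 2$.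
   Context: Majorana operators on $n$ qubits (Jordan–Wigner): $\hat c_{2j-1}=\sigma^z_1\otimes\cdots\otimes\sigma^z_{j-1}\otimes\sigma^x_j\otimes I\otimes\cdots\otimes I$ and $\hat c_{2j}=\sigma^z_1\otimes\cdots\otimes\sigma^z_{j-1}\otimes\sigma^y_j\otimes I\otimes\cdots\otimes I$, $j=1,\ldots,n$. For $\mathbf x=(x_1,\ldots,x_{2n})\in\{0,1\}^{2n}$, $\hat c(\mathbf x)=\hat c_1^{x_1}\hat c_2^{x_2}\cdots\hat c_{2n}^{x_{2n}}$. (The map $\Phi$ is a trace-preserving completely positive map.) For $\lambda=(\lambda_1,\ldots,\lambda_n)$ with $\lambda_j\in[-1,1]$, let $\rho_\lambda=2^{-n}\prod_{j=1}^n(I+\lambda_j\sigma^z_j)$. A state $\rho$ on $n$ qubits is called Gaussian if $\rho=U\rho_\lambda U^\dagger$ for some such $\lambda$ and $U=\exp(iH_2+iH_1)$, where $H_2$ is a Hermitian linear combination of the operators $\hat c_p\hat c_q$ and $H_1$ is a Hermitian linear combination of the operators $\hat c_p$. For an ensemble $\mathcal E=\{p_a,\rho_a\}$ (finite probability distribution $p_a$ over states $\rho_a$), the Holevo quantity is $\chi(\mathcal E)=S(\sum_a p_a\rho_a)-\sum_a p_a S(\rho_a)$, with $S(\rho)=-\mathrm{Tr}\,\rho\log_2\rho$ the von Neumann entropy. The one-shot capacity is $C_1(\Phi)=\sup_{\mathcal E}\chi(\mathcal E)$ over all ensembles of states $\rho_a$ in the image of $\Phi$ (i.e. $\rho_a=\Phi(\sigma_a)$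 for states $\sigma_a$). The Gaussian capacity is $C_1^g(\Phi)=\sup\chi(\mathcal E_g)$ over all ensembles $\mathcal E_g=\{p_a,\Phi(\sigma_a)\}$ with arbitrary probabilities $p_a$ and Gaussian input states $\sigma_a$. *)

theory Defs
  imports "HOL-Analysis.Analysis" "Jordan_Normal_Form.Matrix" "Jordan_Normal_Form.Char_Poly"
begin

definition adj :: "complex mat \<Rightarrow> complex mat" where
  "adj A = mat (dim_col A) (dim_row A) (\<lambda>(i,j). cnj (A $$ (j,i)))"

definition hermitian :: "complex mat \<Rightarrow> bool" where
  "hermitian A \<longleftrightarrow> A = adj A"

definition trace :: "complex mat \<Rightarrow> complex" where
  "trace A = (\<Sum>i<dim_row A. A $$ (i,i))"

definition msum :: "nat \<Rightarrow> ('i \<Rightarrow> complex mat) \<Rightarrow> 'i set \<Rightarrow> complex mat" where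
  "msum N f I = mat N N (\<lambda>ij. \<Sum>k\<in>I. f k $$ ij)"

definition mat_exp :: "complex mat \<Rightarrow> complex mat" where
  "mat_exp A = mat (dim_row A) (dim_col A)
     (\<lambda>(i,j). \<Sum>k. (A ^\<^sub>m k) $$ (i,j) / of_nat (fact k))"

definition is_state :: "nat \<Rightarrow> complex mat \<Rightarrow> bool" where
  "is_state N \<rho> \<longleftrightarrow> \<rho> \<in> carrier_mat N N \<and> hermitian \<rho> \<and>
     (\<forall>v\<in>carrier_vec N. 0 \<le> Re ((\<rho> *\<^sub>v v) \<bullet>c v)) \<and> trace \<rho> = 1"

definition eta :: "real \<Rightarrow> real" where
  "eta x = (if x \<le> 0 then 0 else - x * log 2 x)"

definition Hbin :: "real \<Rightarrow> real" where
  "Hbin x = eta x + eta (1 - x)"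

text \<open>Von Neumann entropy S(rho) = - Tr rho log2 rho, computed from the eigenvalues
  of rho counted with algebraic multiplicity (roots of the characteristic polynomial).\<close>
definition vN_entropy :: "complex mat \<Rightarrow> real" where
  "vN_entropy \<rho> = (\<Sum>a\<in>{a. poly (char_poly \<rho>) a = 0}.
       of_nat (order a (char_poly \<rho>)) * eta (Re a))"

definition pauli_x :: "complex mat" where
  "pauli_x = mat 2 2 (\<lambda>(i,j). if i \<noteq> j then 1 else 0)"
definition pauli_y :: "complex mat" where
  "pauli_y = mat 2 2 (\<lambda>(i,j). if i = 0 \<and> j = 1 then - \<i> else if i = 1 \<and> j = 0 then \<i> else 0)"
definition pauli_z :: "complex mat" where
  "pauli_z = mat 2 2 (\<lambda>(i,j). if i = j then (if i = 0 then 1 else -1) else 0)"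

definition kron :: "complex mat \<Rightarrow> complex mat \<Rightarrow> complex mat" where
  "kron A B = mat (dim_row A * dim_row B) (dim_col A * dim_col B)
     (\<lambda>(i,j). A $$ (i div dim_row B, j div dim_col B) * B $$ (i mod dim_row B, j mod dim_col B))"

text \<open>Kronecker product of a list of factors; the first factor is qubit 1.\<close>
fun kron_list :: "complex mat list \<Rightarrow> complex mat" where
  "kron_list [] = 1\<^sub>m 1"
| "kron_list (A # As) = kron A (kron_list As)"

definition sigz :: "nat \<Rightarrow> nat \<Rightarrow> complex mat" where
  "sigz n j = kron_list (map (\<lambda>k. if k = j then pauli_z else 1\<^sub>m 2) [1..<n+1])"

text \<open>Jordan-Wigner Majorana operator c_p, 1 <= p <= 2n: c_{2j-1} = Z..Z X I..I,
  c_{2j} = Z..Z Y I..I (X resp. Y on qubit j).\<close>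
definition majorana :: "nat \<Rightarrow> nat \<Rightarrow> complex mat" where
  "majorana n p = (let j = (p + 1) div 2 in
     kron_list (map (\<lambda>k. if k < j then pauli_z
                         else if k = j then (if odd p then pauli_x else pauli_y)
                         else 1\<^sub>m 2) [1..<n+1]))"

definition majorana_mono :: "nat \<Rightarrow> (nat \<Rightarrow> bool) \<Rightarrow> complex mat" where
  "majorana_mono n x = foldr (\<lambda>p M. (if x p then majorana n p else 1\<^sub>m (2^n)) * M)
      [1..<2*n+1] (1\<^sub>m (2^n))"

definition rho_lambda :: "nat \<Rightarrow> (nat \<Rightarrow> real) \<Rightarrow> complex mat" where
  "rho_lambda n lam = (1 / 2^n) \<cdot>\<^sub>m
     foldr (\<lambda>j M. (1\<^sub>m (2^n) + complex_of_real (lam j) \<cdot>\<^sub>m sigz n j) * M) [1..<n+1] (1\<^sub>m (2^n))"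

definition gaussian_state :: "nat \<Rightarrow> complex mat \<Rightarrow> bool" where
  "gaussian_state n \<rho> \<longleftrightarrow>
     (\<exists>lam h a. (\<forall>j\<in>{1..n}. -1 \<le> lam j \<and> lam j \<le> 1) \<and>
        (let H2 = msum (2^n) (\<lambda>(p,q). h p q \<cdot>\<^sub>m (majorana n p * majorana n q))
                       ({1..2*n} \<times> {1..2*n});
             H1 = msum (2^n) (\<lambda>p. a p \<cdot>\<^sub>m majorana n p) {1..2*n};
             U = mat_exp (\<i> \<cdot>\<^sub>m (H2 + H1))
         in hermitian H2 \<and> hermitian H1 \<and> \<rho> = U * rho_lambda n lam * adj U))"

definition is_prob :: "nat \<Rightarrow> (nat \<Rightarrow> real) \<Rightarrow> bool" where
  "is_prob m p \<longleftrightarrow> (\<forall>i<m. 0 \<le> p i) \<and> (\<Sum>i<m. p i) = 1"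

definition holevo :: "nat \<Rightarrow> nat \<Rightarrow> (nat \<Rightarrow> real) \<Rightarrow> (nat \<Rightarrow> complex mat) \<Rightarrow> real" where
  "holevo N m p \<rho> = vN_entropy (msum N (\<lambda>i. complex_of_real (p i) \<cdot>\<^sub>m \<rho> i) {..<m})
      - (\<Sum>i<m. p i * vN_entropy (\<rho> i))"

definition one_shot_capacity :: "nat \<Rightarrow> (complex mat \<Rightarrow> complex mat) \<Rightarrow> real" where
  "one_shot_capacity n \<Phi> = Sup {holevo (2^n) m p (\<lambda>i. \<Phi> (\<sigma> i)) | m p \<sigma>.
       is_prob m p \<and> (\<forall>i<m. is_state (2^n) (\<sigma> i))}"

definition gaussian_capacity :: "nat \<Rightarrow> (complex mat \<Rightarrow> complex mat) \<Rightarrow> real" where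
  "gaussian_capacity n \<Phi> = Sup {holevo (2^n) m p (\<lambda>i. \<Phi> (\<sigma> i)) | m p \<sigma>.
       is_prob m p \<and> (\<forall>i<m. is_state (2^n) (\<sigma> i) \<and> gaussian_state n (\<sigma> i))}"

definition bdown :: "nat \<Rightarrow> (nat \<Rightarrow> real) \<Rightarrow> nat \<Rightarrow> real" where
  "bdown n b j = rev (sort (map b [1..<2*n+1])) ! (j - 1)"

end

theory Submission
  imports Defs "HOL-Real_Asymp.Real_Asymp" "Jordan_Normal_Form.Spectral_Radius" "HOL-Combinatorics.Permutations"
begin

text \<open>Together with the parity operator the Majorana operators give $2n+1$ anticommuting Hermitian
  involutions, and the channel is a product of commuting partial flips along the last $2n$ of them.
  A Gaussian state satisfies a linear relation between its commutators and anticommutators with these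
  generators, governed by an antisymmetric real matrix; the relation survives orthogonal rotations and,
  with rescaled rows and columns, the channel. Its output entropy is therefore determined by the
  normal form of the rescaled matrix. Bounding the trace of a product of modes against a flipped state
  gives weak log-majorization of the normal-form entries by the products of consecutive ordered
  attenuation coefficients (with a leading $1$ for the parity), and convexity turns this into the
  entropy bound. It is attained by pairing the generators in that order: the pairing is conjugate to the
  standard one by an involution, realised by a Gaussian unitary, and the sign choices of the base
  state average to the maximally mixed state. For $n \<le> 2$ every pure state satisfies the same linear
  relation, and concavity of the entropy extends the bound to all states.\<close>

subsection \<open>Linear operators on finitely many coordinates\<close>

text \<open>The generators are the parity P and the products \<open>\<i> * P * c\<close>, c a
  Majorana operator. Conjugation by such a product flips the sign of its own c alone, so every
  attenuation is a mixture with a single flip. Moreover P times it equals \<open>\<i> * c\<close>,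
  so linear and quadratic Hamiltonians together are quadratic forms in 2n+1 anticommuting elements,
  and Gaussian unitaries rotate all of them. The channel does not touch P, which enters with weight
  1; the largest attenuation coefficient is paired with this 1 and so stands alone in the formula.

  The obstacle is that expectations of involutions in a state are bounded only by 1, while
  majorization asks for the product of the 2k largest weights. All weights, that of P included, are
  therefore divided by a common c > 0, which divides every normal-form entry by c^2. Weights above c
  now exceed one and positivity is lost, yet the total mass of the resulting quasi-mixture is
  explicit; with c the 2k-th largest weight it becomes exactly the wanted product.\<close>

definition lin :: "((nat \<Rightarrow> complex) \<Rightarrow> (nat \<Rightarrow> complex)) \<Rightarrow> bool" where
  "lin F \<longleftrightarrow> (\<forall>x y. F (\<lambda>i. x i + y i) = (\<lambda>i. F x i + F y i)) \<and> (\<forall>z x. F (\<lambda>i. z * x i) = (\<lambda>i. z * F x i))"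

text \<open>One ring for all dimensions: no carrier side conditions occur in it, so noncommutative
  identities can be left to \<open>algebra_simps\<close>. Matrices enter through \<open>emb\<close>,
  and equations are pulled back by \<open>emb_inj\<close>.\<close>

typedef lop = "{F. lin F}"
  by (rule exI[of _ "\<lambda>x. x"]) (simp add: lin_def)

setup_lifting type_definition_lop

instantiation lop :: ring_1
begin
lift_definition zero_lop :: lop is "\<lambda>x i. 0" by (simp add: lin_def)
lift_definition one_lop :: lop is "\<lambda>x. x" by (simp add: lin_def)
lift_definition plus_lop :: "lop \<Rightarrow> lop \<Rightarrow> lop" is "\<lambda>F G x i. F x i + G x i"
  by (simp add: lin_def algebra_simps)
lift_definition minus_lop :: "lop \<Rightarrow> lop \<Rightarrow> lop" is "\<lambda>F G x i. F x i - G x i"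
  by (simp add: lin_def algebra_simps)
lift_definition uminus_lop :: "lop \<Rightarrow> lop" is "\<lambda>F x i. - F x i"
  by (simp add: lin_def algebra_simps)
lift_definition times_lop :: "lop \<Rightarrow> lop \<Rightarrow> lop" is "\<lambda>F G x. F (G x)"
  by (simp add: lin_def)
instance
proof
  fix a b c :: lop
  show "a * b * c = a * (b * c)" by transfer simp
  show "1 * a = a" by transfer simp
  show "a * 1 = a" by transfer simp
  show "a + b + c = a + (b + c)" by transfer (simp add: algebra_simps)
  show "a + b = b + a" by transfer (simp add: algebra_simps)
  show "0 + a = a" by transfer simp
  show "- a + a = 0" by transfer simp
  show "a - b = a + - b" by transfer simp
  show "(a + b) * c = a * c + b * c" by transfer simp
  show "a * (b + c) = a * b + a * c" by transfer (simp add: lin_def)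
  show "(0::lop) \<noteq> 1" by transfer (metis zero_neq_one)
qed
end

lift_definition cs :: "complex \<Rightarrow> lop \<Rightarrow> lop" (infixr \<open>\<odot>\<close> 76) is "\<lambda>z F x i. z * F x i"
  by (simp add: lin_def algebra_simps)

interpretation lop: vector_space cs
  by unfold_locales (transfer; simp add: algebra_simps fun_eq_iff)+

lemma cs_mult_left [simp]: "(z \<odot> x) * y = z \<odot> (x * y)"
  by transfer simp

lemma cs_mult_right [simp]: "x * (z \<odot> y) = z \<odot> (x * y)"
  by transfer (simp add: lin_def)

lemmas cs_simps = lop.scale_right_distrib lop.scale_left_distrib lop.scale_right_diff_distrib
  lop.scale_left_diff_distrib

lemma cs_one [simp]: "1 \<odot> x = x" by (fact lop.scale_one)

definition dlt :: "nat \<Rightarrow> nat \<Rightarrow> complex" where "dlt k i = (if i = k then 1 else 0)"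

lift_definition ent :: "lop \<Rightarrow> nat \<Rightarrow> nat \<Rightarrow> complex" is "\<lambda>F i j. F (dlt j) i" .

text \<open>Only the leading d-by-d block is traced. Cyclicity can fail for arbitrary operators;
  \<open>trd_comm\<close> restores it when one factor is an embedded matrix.\<close>

definition trd :: "nat \<Rightarrow> lop \<Rightarrow> complex" where "trd d F = (\<Sum>i<d. ent F i i)"

lemma trd_add [simp]: "trd d (x + y) = trd d x + trd d y"
  unfolding trd_def by (transfer) (simp add: sum.distrib)
lemma trd_cs [simp]: "trd d (z \<odot> x) = z * trd d x"
  unfolding trd_def by (transfer) (simp add: sum_distrib_left)
lemma trd_zero [simp]: "trd d 0 = 0"
  unfolding trd_def by (transfer) simp
lemma trd_minus [simp]: "trd d (- x) = - trd d x"
  unfolding trd_def by (transfer) (simp add: sum_negf)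
lemma trd_diff [simp]: "trd d (x - y) = trd d x - trd d y"
  unfolding trd_def by (transfer) (simp add: sum_subtractf)
lemma trd_sum: "trd d (sum f A) = (\<Sum>a\<in>A. trd d (f a))"
  by (induction A rule: infinite_finite_induct) auto
lemma trd_one [simp]: "trd d 1 = of_nat d"
  unfolding trd_def by (transfer) (simp add: dlt_def)

text \<open>The matrix is repeated along consecutive blocks of length d rather than padded by zeros.
  This makes the embedding unital, so that matrix involutions become square roots of the ring
  unit.\<close>

lift_definition emb :: "nat \<Rightarrow> complex mat \<Rightarrow> lop" is
  "\<lambda>d A x i. \<Sum>j<d. A $$ (i mod d, j) * x (i div d * d + j)"
  by (simp add: lin_def algebra_simps sum.distrib sum_distrib_left fun_eq_iff)

lemma emb_add: "d > 0 \<Longrightarrow> A \<in> carrier_mat d d \<Longrightarrow> B \<in> carrier_mat d d \<Longrightarrow> emb d (A + B) = emb d A + emb d B"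
  by transfer (auto simp: fun_eq_iff sum.distrib algebra_simps)

lemma emb_smult: "d > 0 \<Longrightarrow> A \<in> carrier_mat d d \<Longrightarrow> emb d (z \<cdot>\<^sub>m A) = z \<odot> emb d A"
  by transfer (auto simp: fun_eq_iff sum_distrib_left algebra_simps)

lemma emb_one: "d > 0 \<Longrightarrow> emb d (1\<^sub>m d) = 1"
proof (transfer, intro ext)
  fix d :: nat and x :: "nat \<Rightarrow> complex" and i assume d: "d > 0"
  have "(\<Sum>j<d. 1\<^sub>m d $$ (i mod d, j) * x (i div d * d + j)) = (\<Sum>j<d. if j = i mod d then x (i div d * d + j) else 0)"
    using d by (intro sum.cong) auto
  also have "\<dots> = x i" using d by simp
  finally show "(\<Sum>j<d. 1\<^sub>m d $$ (i mod d, j) * x (i div d * d + j)) = x i" .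
qed

lemma emb_mult: "d > 0 \<Longrightarrow> A \<in> carrier_mat d d \<Longrightarrow> B \<in> carrier_mat d d \<Longrightarrow> emb d (A * B) = emb d A * emb d B"
proof (transfer, intro ext)
  fix d and A B :: "complex mat" and x :: "nat \<Rightarrow> complex" and i :: nat assume d: "d > 0" and A: "A \<in> carrier_mat d d" and B: "B \<in> carrier_mat d d"
  have "(\<Sum>j<d. (A * B) $$ (i mod d, j) * x (i div d * d + j))
     = (\<Sum>j<d. (\<Sum>k<d. A $$ (i mod d, k) * B $$ (k,j)) * x (i div d * d + j))"
    using d A B by (intro sum.cong refl) (auto simp: scalar_prod_def atLeast0LessThan)
  also have "\<dots> = (\<Sum>k<d. A $$ (i mod d, k) * (\<Sum>j<d. B $$ (k,j) * x (i div d * d + j)))"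
    unfolding sum_distrib_left sum_distrib_right by (subst sum.swap) (simp add: mult.assoc)
  also have "\<dots> = (\<Sum>k<d. A $$ (i mod d, k) * (\<Sum>j<d. B $$ ((i div d * d + k) mod d,j) * x ((i div d * d + k) div d * d + j)))"
    using d by (intro sum.cong refl) auto
  finally show "(\<Sum>j<d. (A * B) $$ (i mod d, j) * x (i div d * d + j)) = \<dots>" .
qed

lemma lin_add: "lin F \<Longrightarrow> F (\<lambda>i. x i + y i) = (\<lambda>i. F x i + F y i)"
  by (simp add: lin_def)

lemma lin_scale: "lin F \<Longrightarrow> F (\<lambda>i. z * x i) = (\<lambda>i. z * F x i)"
  by (simp add: lin_def)

lemma lin_zero: "lin F \<Longrightarrow> F (\<lambda>i. 0) = (\<lambda>i. 0)"
  using lin_scale[of F 0 "\<lambda>i. 0"] by simp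

lemma lin_sum: "lin F \<Longrightarrow> F (\<lambda>i. \<Sum>k\<in>K. c k * g k i) = (\<lambda>i. \<Sum>k\<in>K. c k * F (g k) i)"
proof (induction K rule: infinite_finite_induct)
  case (insert k K)
  then show ?case
    using lin_add[of F "\<lambda>i. c k * g k i" "\<lambda>i. \<Sum>k\<in>K. c k * g k i"] by (simp add: lin_scale)
qed (simp_all add: lin_zero)

lemma ent_emb_mult: "i < d \<Longrightarrow> ent (emb d A * x) i j = (\<Sum>k<d. A $$ (i,k) * ent x k j)"
  by (simp add: ent.rep_eq times_lop.rep_eq emb.rep_eq)

lemma emb_dlt: assumes "i < d"
  shows "Rep_lop (emb d A) (dlt i) = (\<lambda>m. \<Sum>k<d. A $$ (k,i) * dlt k m)"
proof
  fix m
  have "(\<Sum>j<d. A $$ (m mod d, j) * dlt i (m div d * d + j)) = (\<Sum>j<d. if j = i then (if m < d then A $$ (m,i) else 0) else 0)"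
  proof (intro sum.cong refl)
    fix j assume j: "j \<in> {..<d}"
    have "m div d * d + j = i \<longleftrightarrow> m < d \<and> j = i"
    proof
      assume e: "m div d * d + j = i"
      have "(m div d * d + j) div d = i div d" using e by simp
      then have "m div d = 0" using j assms by simp
      then show "m < d \<and> j = i" using e j by (auto simp: div_eq_0_iff)
    qed auto
    then show "A $$ (m mod d, j) * dlt i (m div d * d + j) = (if j = i then (if m < d then A $$ (m,i) else 0) else 0)"
      by (auto simp: dlt_def)
  qed
  also have "\<dots> = (if m < d then A $$ (m,i) else 0)" using assms by simp
  also have "\<dots> = (\<Sum>k<d. A $$ (k,i) * dlt k m)"
    by (simp add: dlt_def if_distrib[of "(*) _"] cong: if_cong)
  finally show "Rep_lop (emb d A) (dlt i) m = (\<Sum>k<d. A $$ (k,i) * dlt k m)"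
    by (simp add: emb.rep_eq)
qed

lemma ent_emb: "i < d \<Longrightarrow> j < d \<Longrightarrow> A \<in> carrier_mat d d \<Longrightarrow> ent (emb d A) i j = A $$ (i,j)"
  by (simp add: ent.rep_eq emb_dlt) (simp add: dlt_def if_distrib[of "(*) _"] cong: if_cong)

lemma emb_inj: assumes "A \<in> carrier_mat d d" "B \<in> carrier_mat d d" "emb d A = emb d B" shows "A = B"
  by (rule eq_matI) (use assms ent_emb[of _ d _ A] ent_emb[of _ d _ B] in auto)

lemma trd_emb: "A \<in> carrier_mat d d \<Longrightarrow> trd d (emb d A) = trace A"
  by (auto simp: trd_def trace_def ent_emb)

lemma ent_mult_emb: assumes "i < d"
  shows "ent (x * emb d A) j i = (\<Sum>k<d. A $$ (k,i) * ent x j k)"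
proof -
  have "lin (Rep_lop x)" using Rep_lop by auto
  from lin_sum[OF this, of "\<lambda>k. A $$ (k,i)" dlt "{..<d}"]
  show ?thesis by (simp add: ent.rep_eq times_lop.rep_eq emb_dlt[OF assms])
qed

text \<open>An embedded factor maps the leading block to itself, so both traces are the same double
  sum over that block, whatever x does elsewhere.\<close>

lemma trd_comm: "trd d (emb d A * x) = trd d (x * emb d A)"
proof -
  have "trd d (emb d A * x) = (\<Sum>i<d. \<Sum>k<d. A $$ (i,k) * ent x k i)" unfolding trd_def by (simp add: ent_emb_mult)
  also have "\<dots> = trd d (x * emb d A)" unfolding trd_def by (subst sum.swap) (simp add: ent_mult_emb)
  finally show ?thesis .
qed

subsection \<open>Clifford generators and the Wick relation\<close>

definition ip :: "nat \<Rightarrow> (nat \<Rightarrow> real) \<Rightarrow> (nat \<Rightarrow> real) \<Rightarrow> real" where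
  "ip N a b = (\<Sum>p<N. a p * b p)"

text \<open>For \<open>G * G = 1\<close> the map fixes what commutes with G and multiplies by b what
  anticommutes with G. For b between 0 and 1 it conjugates by G with probability (1-b)/2.\<close>

definition flip_mix :: "real \<Rightarrow> lop \<Rightarrow> lop \<Rightarrow> lop" where
  "flip_mix b G X = of_real ((1 + b) / 2) \<odot> X + of_real ((1 - b) / 2) \<odot> (G * X * G)"

definition flip_mixes :: "(nat \<Rightarrow> lop) \<Rightarrow> (nat \<Rightarrow> real) \<Rightarrow> nat list \<Rightarrow> lop \<Rightarrow> lop" where
  "flip_mixes g b is X = foldr (\<lambda>i. flip_mix (b i) (g i)) is X"

text \<open>A form of Wick's theorem that avoids the logarithm of X and so covers pure states. For X
  of unit trace, multiplying by \<open>g q\<close> and tracing shows that M is the covariance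
  matrix: \<open>2 * \<i> * M p q\<close> is the trace of
  \<open>(g q * g p - g p * g q) * X\<close>.\<close>

definition wick :: "nat \<Rightarrow> (nat \<Rightarrow> lop) \<Rightarrow> (nat \<Rightarrow> nat \<Rightarrow> real) \<Rightarrow> lop \<Rightarrow> bool" where
  "wick N g M X \<longleftrightarrow> (\<forall>p<N. g p * X - X * g p
     = \<i> \<odot> (\<Sum>q<N. of_real (M p q) \<odot> (g q * X + X * g q)))"

locale clifford =
  fixes N d :: nat and g :: "nat \<Rightarrow> lop"
  assumes sq: "p < N \<Longrightarrow> g p * g p = 1"
    and anti: "p < N \<Longrightarrow> q < N \<Longrightarrow> p \<noteq> q \<Longrightarrow> g p * g q = - (g q * g p)"
    and trc: "p < N \<Longrightarrow> trd d (g p * x) = trd d (x * g p)"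
begin

definition gam :: "(nat \<Rightarrow> real) \<Rightarrow> lop" where
  "gam a = (\<Sum>p<N. of_real (a p) \<odot> g p)"

lemma sq_left: "p < N \<Longrightarrow> g p * (g p * x) = x"
  by (metis mult.assoc mult_1 sq)

lemma gam_cong: "(\<And>p. p < N \<Longrightarrow> a p = b p) \<Longrightarrow> gam a = gam b"
  unfolding gam_def by (intro sum.cong) auto

lemma gam_scale: "gam (\<lambda>p. c * a p) = of_real c \<odot> gam a"
  by (simp add: gam_def lop.scale_sum_right)

lemma gam_clifford: "gam a * gam b + gam b * gam a = of_real (2 * ip N a b) \<odot> 1"
proof -
  have gg: "g p * g q + g q * g p = (if p = q then 2 \<odot> 1 else 0)" if "p < N" "q < N" for p q
    using sq[of p] anti[OF that] that lop.scale_left_distrib[of 1 1 "1::lop"] by (cases "p = q") simp_all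
  have "gam a * gam b = (\<Sum>p<N. \<Sum>q<N. (of_real (a p) * of_real (b q)) \<odot> (g p * g q))"
    unfolding gam_def sum_product by (simp add: mult.commute)
  moreover have "gam b * gam a = (\<Sum>p<N. \<Sum>q<N. (of_real (a p) * of_real (b q)) \<odot> (g q * g p))"
    unfolding gam_def sum_product by (subst sum.swap) (simp add: mult.commute)
  ultimately have "gam a * gam b + gam b * gam a
     = (\<Sum>p<N. \<Sum>q<N. (of_real (a p) * of_real (b q)) \<odot> (g p * g q + g q * g p))"
    by (simp add: sum.distrib lop.scale_right_distrib)
  also have "\<dots> = (\<Sum>p<N. \<Sum>q<N. if q = p then (of_real (a p) * of_real (b q)) \<odot> 2 \<odot> 1 else 0)"
    using gg by (intro sum.cong refl) auto
  also have "\<dots> = (\<Sum>p<N. of_real (2 * (a p * b p)) \<odot> 1)"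
    by (intro sum.cong refl) (simp add: algebra_simps)
  also have "\<dots> = of_real (2 * ip N a b) \<odot> 1"
    by (simp only: lop.scale_sum_left[symmetric] of_real_sum[symmetric] ip_def sum_distrib_left)
  finally show ?thesis .
qed

lemma gam_sq: "ip N a a = 1 \<Longrightarrow> gam a * gam a = 1"
proof -
  assume "ip N a a = 1"
  then have "gam a * gam a + gam a * gam a = 2 \<odot> 1" using gam_clifford[of a a] by simp
  then have "2 \<odot> (gam a * gam a) = 2 \<odot> 1"
    using lop.scale_left_distrib[of 1 1 "gam a * gam a"] by simp
  then show ?thesis by (metis lop.scale_left_imp_eq zero_neq_numeral)
qed

lemma gam_anti: "ip N a b = 0 \<Longrightarrow> gam a * gam b = - (gam b * gam a)"
  using gam_clifford[of a b] by (simp add: eq_neg_iff_add_eq_0)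

lemma gam_trc: "trd d (gam a * x) = trd d (x * gam a)"
  unfolding gam_def by (simp add: sum_distrib_left sum_distrib_right trd_sum trc)

lemma wick_gam:
  assumes "wick N g M X"
  shows "gam a * X - X * gam a = \<i> \<odot> (gam (\<lambda>q. \<Sum>p<N. a p * M p q) * X + X * gam (\<lambda>q. \<Sum>p<N. a p * M p q))"
proof -
  have "gam a * X - X * gam a = (\<Sum>p<N. of_real (a p) \<odot> (g p * X - X * g p))"
    unfolding gam_def by (simp add: sum_distrib_left sum_distrib_right sum_subtractf lop.scale_right_diff_distrib)
  also have "\<dots> = (\<Sum>p<N. of_real (a p) \<odot> \<i> \<odot> (\<Sum>q<N. of_real (M p q) \<odot> (g q * X + X * g q)))"
    using assms by (intro sum.cong) (auto simp: wick_def)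
  also have "\<dots> = \<i> \<odot> (\<Sum>p<N. \<Sum>q<N. (of_real (a p * M p q)) \<odot> (g q * X + X * g q))"
    by (simp add: lop.scale_sum_right mult.assoc mult.left_commute)
  also have "\<dots> = \<i> \<odot> (\<Sum>q<N. \<Sum>p<N. (of_real (a p * M p q)) \<odot> (g q * X + X * g q))"
    by (subst sum.swap) simp
  also have "\<dots> = \<i> \<odot> (\<Sum>q<N. of_real (\<Sum>p<N. a p * M p q) \<odot> (g q * X + X * g q))"
    by (simp only: lop.scale_sum_left[symmetric] of_real_sum[symmetric])
  also have "\<dots> = \<i> \<odot> (gam (\<lambda>q. \<Sum>p<N. a p * M p q) * X + X * gam (\<lambda>q. \<Sum>p<N. a p * M p q))"
    unfolding gam_def by (simp add: sum_distrib_left sum_distrib_right sum.distrib lop.scale_right_distrib)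
  finally show ?thesis .
qed

lemma half_sum: "of_real ((1 + b) / 2) \<odot> x + of_real ((1 - b) / 2) \<odot> x = x"
  by (simp only: lop.scale_left_distrib[symmetric] of_real_add[symmetric]) (simp add: field_simps)

lemma half_diff: "of_real ((1 + b) / 2) \<odot> x - of_real ((1 - b) / 2) \<odot> x = of_real b \<odot> x"
  by (simp only: lop.scale_left_diff_distrib[symmetric] of_real_diff[symmetric]) (simp add: field_simps)

text \<open>Let T be the mixture and Tm the same combination with the opposite sign in front of the
  flipped part. The commutator of \<open>g p\<close> with T X is \<beta> p times Tm of its
  commutator with X, and Tm of the anticommutator of \<open>g q\<close> with X is \<beta> q times
  its anticommutator with T X. Applying Tm to the relation for X thus yields the relation for T X,
  with one factor per index.\<close>

lemma wick_flip_mix: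
  assumes Q: "wick N g M X" and i: "i < N"
  shows "wick N g (\<lambda>p q. (if p = i then b else 1) * M p q * (if q = i then b else 1)) (flip_mix b (g i) X)"
proof -
  define h k :: complex where "h = of_real ((1 + b) / 2)" and "k = of_real ((1 - b) / 2)"
  define \<beta> where "\<beta> p = (if p = i then b else 1)" for p
  define Tm where "Tm Y = h \<odot> Y - k \<odot> (g i * Y * g i)" for Y
  let ?T = "flip_mix b (g i) X"
  note hk = half_sum[of b, folded h_def k_def] half_diff[of b, folded h_def k_def]
  have T: "?T = h \<odot> X + k \<odot> (g i * X * g i)" by (simp add: flip_mix_def h_def k_def)
  have TmS: "Tm (\<Sum>q<N. c q \<odot> y q) = (\<Sum>q<N. c q \<odot> Tm (y q))" for c :: "nat \<Rightarrow> complex" and y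
    unfolding Tm_def by (simp add: lop.scale_sum_right sum_distrib_left sum_distrib_right sum_subtractf lop.scale_right_diff_distrib mult.commute)
  have Tmi: "Tm (c \<odot> y) = c \<odot> Tm y" for c y
    unfolding Tm_def by (simp add: lop.scale_right_diff_distrib mult.commute)
  have gi: "g i * (g i * x) = x" for x using sq_left[OF i] .
  have gi1: "g i * g i = 1" using sq[OF i] .
  have c: "g p * ?T - ?T * g p = of_real (\<beta> p) \<odot> Tm (g p * X - X * g p)" if p: "p < N" for p
  proof (cases "p = i")
    case True
    have "g i * ?T - ?T * g i = (h \<odot> (g i * X) - k \<odot> (g i * X)) - (h \<odot> (X * g i) - k \<odot> (X * g i))"
      by (simp add: T algebra_simps gi gi1)
    also have "\<dots> = of_real b \<odot> (g i * X - X * g i)" by (simp add: hk lop.scale_right_diff_distrib)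
    also have "g i * X - X * g i = Tm (g i * X - X * g i)"
    proof -
      have "Tm (g i * X - X * g i) = (h \<odot> (g i * X) + k \<odot> (g i * X)) - (h \<odot> (X * g i) + k \<odot> (X * g i))"
        unfolding Tm_def by (simp add: algebra_simps gi gi1)
      then show ?thesis by (simp add: hk)
    qed
    finally show ?thesis using True by (simp add: \<beta>_def)
  next
    case False
    have a: "g i * (g p * x) = - (g p * (g i * x))" for x
      using anti[OF i p] False by (metis mult.assoc mult_minus_left)
    have a1: "g p * g i = - (g i * g p)" using anti[OF p i] False by simp
    show ?thesis using False by (simp add: \<beta>_def T Tm_def algebra_simps a a1)
  qed
  have ac: "Tm (g q * X + X * g q) = of_real (\<beta> q) \<odot> (g q * ?T + ?T * g q)" if q: "q < N" for q
  proof (cases "q = i")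
    case True
    have "Tm (g i * X + X * g i) = (h \<odot> (g i * X) - k \<odot> (g i * X)) + (h \<odot> (X * g i) - k \<odot> (X * g i))"
      unfolding Tm_def by (simp add: algebra_simps gi gi1)
    then have "Tm (g i * X + X * g i) = of_real b \<odot> (g i * X + X * g i)" by (simp add: hk lop.scale_right_distrib)
    moreover have "g i * X + X * g i = g i * ?T + ?T * g i"
    proof -
      have "g i * ?T + ?T * g i = (h \<odot> (g i * X) + k \<odot> (g i * X)) + (h \<odot> (X * g i) + k \<odot> (X * g i))"
        by (simp add: T algebra_simps gi gi1)
      then show ?thesis by (simp add: hk)
    qed
    ultimately show ?thesis using True by (simp add: \<beta>_def)
  next
    case False
    have a: "g i * (g q * x) = - (g q * (g i * x))" for x
      using anti[OF i q] False by (metis mult.assoc mult_minus_left)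
    have a1: "g q * g i = - (g i * g q)" using anti[OF q i] False by simp
    show ?thesis using False by (simp add: \<beta>_def T Tm_def algebra_simps a a1)
  qed
  show ?thesis
    unfolding wick_def
  proof (intro allI impI)
    fix p assume p: "p < N"
    have "g p * ?T - ?T * g p = of_real (\<beta> p) \<odot> Tm (\<i> \<odot> (\<Sum>q<N. of_real (M p q) \<odot> (g q * X + X * g q)))"
      using c[OF p] Q p by (simp add: wick_def)
    also have "\<dots> = of_real (\<beta> p) \<odot> \<i> \<odot> (\<Sum>q<N. of_real (M p q) \<odot> of_real (\<beta> q) \<odot> (g q * ?T + ?T * g q))"
      using ac by (simp add: Tmi TmS)
    also have "\<dots> = \<i> \<odot> (\<Sum>q<N. of_real (\<beta> p * M p q * \<beta> q) \<odot> (g q * ?T + ?T * g q))"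
      by (simp add: lop.scale_sum_right mult_ac)
    finally show "g p * ?T - ?T * g p = \<i> \<odot> (\<Sum>q<N. of_real ((if p = i then b else 1) * M p q * (if q = i then b else 1)) \<odot> (g q * ?T + ?T * g q))"
      by (simp add: \<beta>_def)
  qed
qed

lemma wick_flip_mixes:
  assumes "wick N g M X" "distinct is" "set is \<subseteq> {..<N}"
  shows "wick N g (\<lambda>p q. (if p \<in> set is then b p else 1) * M p q * (if q \<in> set is then b q else 1)) (flip_mixes g b is X)"
  using assms(2,3)
proof (induction "is")
  case Nil
  then show ?case using assms by (simp add: flip_mixes_def)
next
  case (Cons i "is")
  have "wick N g (\<lambda>p q. (if p \<in> set is then b p else 1) * M p q * (if q \<in> set is then b q else 1)) (flip_mixes g b is X)"
    using Cons by simp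
  from wick_flip_mix[OF this, of i "b i"] Cons.prems
  have "wick N g (\<lambda>p q. (if p = i then b i else 1) * ((if p \<in> set is then b p else 1) * M p q * (if q \<in> set is then b q else 1)) * (if q = i then b i else 1)) (flip_mixes g b (i # is) X)"
    by (simp add: flip_mixes_def)
  moreover have "(\<lambda>p q. (if p = i then b i else 1) * ((if p \<in> set is then b p else 1) * M p q * (if q \<in> set is then b q else 1)) * (if q = i then b i else 1))
     = (\<lambda>p q. (if p \<in> set (i # is) then b p else 1) * M p q * (if q \<in> set (i # is) then b q else 1))"
    using Cons.prems(1) by (auto simp: fun_eq_iff)
  ultimately show ?case by simp
qed

definition pair_op :: "(nat \<Rightarrow> real) \<Rightarrow> (nat \<Rightarrow> real) \<Rightarrow> lop" where
  "pair_op a b = (- \<i>) \<odot> (gam a * gam b)"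

end

section \<open>Single modes and orthonormal frames of modes\<close>

text \<open>The Wick relation of one planar block: on the pair G, H the covariance matrix has rows
  (0, -k) and (k, 0).\<close>

definition mode_rel :: "lop \<Rightarrow> lop \<Rightarrow> real \<Rightarrow> lop \<Rightarrow> bool" where
  "mode_rel G H k X \<longleftrightarrow> G * X - X * G = (- (\<i> * of_real k)) \<odot> (H * X + X * H)
     \<and> H * X - X * H = (\<i> * of_real k) \<odot> (G * X + X * G)"

text \<open>The expectation of \<open>- \<i> * G * H\<close> is k even in front of any Y that
  commutes with the mode; this independence makes joint expectations factorize. It follows by
  tracing the first relation against \<open>Y * H\<close>: the commutator contributes -2 tr(G H Y
  X), the anticommutator 2 tr(Y X).\<close>

lemma mode_rel_trace:
  assumes "mode_rel G H k X" and H1: "H * H = 1" and GH: "G * H = - (H * G)"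
    and Y: "Y * G = G * Y" "Y * H = H * Y"
    and tr: "\<And>x. trd d (G * x) = trd d (x * G)" "\<And>x. trd d (H * x) = trd d (x * H)"
  shows "trd d ((- \<i>) \<odot> (G * H) * (Y * X)) = of_real k * trd d (Y * X)"
proof -
  have HH: "H * (H * x) = x" for x using H1 by (metis mult.assoc mult_1)
  have HG: "H * (G * x) = - (G * (H * x))" for x using GH by (metis mult.assoc mult_minus_left minus_minus)
  have Y': "Y * (G * x) = G * (Y * x)" "Y * (H * x) = H * (Y * x)" for x
    using Y by (metis mult.assoc)+
  have "trd d (Y * H * (G * X - X * G)) = trd d (Y * H * G * X) - trd d (Y * H * X * G)"
    by (simp add: algebra_simps)
  also have "trd d (Y * H * X * G) = trd d (G * (H * (Y * X)))"
    using tr(1)[of "Y * H * X"] by (simp add: mult.assoc Y')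
  also have "trd d (Y * H * G * X) = - trd d (G * (H * (Y * X)))"
    by (simp add: mult.assoc Y' HG)
  finally have 1: "trd d (Y * H * (G * X - X * G)) = - 2 * trd d (G * (H * (Y * X)))" by simp
  have "trd d (Y * H * (H * X + X * H)) = trd d (Y * X) + trd d (Y * H * X * H)"
    by (simp add: algebra_simps HH)
  also have "trd d (Y * H * X * H) = trd d (Y * X)"
    using tr(2)[of "Y * H * X"] by (simp add: mult.assoc Y' HH)
  finally have 2: "trd d (Y * H * (H * X + X * H)) = 2 * trd d (Y * X)" by simp
  have "trd d (Y * H * (G * X - X * G)) = - (\<i> * of_real k) * trd d (Y * H * (H * X + X * H))"
    using assms(1) unfolding mode_rel_def by (metis cs_mult_right trd_cs)
  then have "- 2 * trd d (G * (H * (Y * X))) = - (\<i> * of_real k) * (2 * trd d (Y * X))"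
    unfolding 1 2 .
  then have "trd d (G * (H * (Y * X))) = \<i> * of_real k * trd d (Y * X)" by simp
  then show ?thesis by (simp add: mult.assoc)
qed

text \<open>The commutator of \<open>G * H\<close> with X is \<open>c \<odot> D\<close>. Multiplying
  the two relations by G and -H from the right gives \<open>D = (- c) \<odot> Z\<close>, from the
  left \<open>- D = (- c) \<odot> Z\<close>; hence D vanishes.\<close>

lemma mode_rel_commute:
  assumes r: "mode_rel G H k X" and G1: "G * G = 1" and H1: "H * H = 1" and GH: "G * H = - (H * G)"
  shows "X * (G * H) = G * H * X"
proof -
  define c where "c = \<i> * of_real k"
  have r1: "G * X - X * G = (- c) \<odot> (H * X + X * H)" and r2: "H * X - X * H = c \<odot> (G * X + X * G)"
    using r by (auto simp: mode_rel_def c_def)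
  have HH: "H * (H * x) = x" and GG: "G * (G * x) = x" for x using G1 H1 by (metis mult.assoc mult_1)+
  have HG: "H * (G * x) = - (G * (H * x))" for x using GH by (metis mult.assoc mult_minus_left minus_minus)
  define D where "D = G * X * G - H * X * H"
  define Z where "Z = G * X * H + H * X * G"
  have "G * H * X - X * (G * H) = G * (H * X - X * H) + (G * X - X * G) * H"
    by (simp add: algebra_simps)
  also have "\<dots> = c \<odot> D"
    unfolding r1 r2 D_def by (simp add: algebra_simps GG H1)
  finally have A: "G * H * X - X * (G * H) = c \<odot> D" .
  have "(G * X - X * G) * G + (H * X - X * H) * (- H) = D"
    by (simp add: D_def algebra_simps G1 H1)
  then have "D = (- c) \<odot> ((H * X + X * H) * G) - c \<odot> ((G * X + X * G) * H)"
    unfolding r1 r2 by simp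
  also have "\<dots> = (- c) \<odot> Z"
    by (simp add: Z_def algebra_simps GH)
  finally have D1: "D = (- c) \<odot> Z" .
  have "G * (G * X - X * G) + (- H) * (H * X - X * H) = - D"
    by (simp add: D_def algebra_simps GG HH)
  then have "- D = (- c) \<odot> (G * (H * X + X * H)) - c \<odot> (H * (G * X + X * G))"
    unfolding r1 r2 by simp
  also have "\<dots> = (- c) \<odot> Z"
    by (simp add: Z_def algebra_simps HG)
  finally have "D = - D" using D1 by simp
  then have "D + D = 0" by (metis ab_left_minus)
  then have "2 \<odot> D = 0" using lop.scale_left_distrib[of 1 1 D] by simp
  then have "D = 0" by simp
  with A show ?thesis by simp
qed

definition sg :: "nat set \<Rightarrow> nat \<Rightarrow> real" where
  "sg S j = (if j \<in> S then 1 else - 1)"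

lemma sg_sq [simp]: "sg S j * sg S j = 1" by (simp add: sg_def)

text \<open>The vectors select n mutually anticommuting pairs among the real combinations of the N
  generators. In the application N = 2n+1, and one direction stays unpaired.\<close>

locale frame = clifford +
  fixes n :: nat and u v :: "nat \<Rightarrow> nat \<Rightarrow> real"
  assumes uu: "j < n \<Longrightarrow> k < n \<Longrightarrow> ip N (u j) (u k) = (if j = k then 1 else 0)"
    and vv: "j < n \<Longrightarrow> k < n \<Longrightarrow> ip N (v j) (v k) = (if j = k then 1 else 0)"
    and uv: "j < n \<Longrightarrow> k < n \<Longrightarrow> ip N (u j) (v k) = 0"
begin

abbreviation "G j \<equiv> gam (u j)"
abbreviation "H j \<equiv> gam (v j)"
abbreviation "K j \<equiv> pair_op (u j) (v j)"

definition modes :: "(nat \<Rightarrow> real) \<Rightarrow> lop \<Rightarrow> bool" where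
  "modes \<kappa> X \<longleftrightarrow> (\<forall>j<n. mode_rel (G j) (H j) (\<kappa> j) X)"

text \<open>Joint spectral idempotents of the commuting involutions \<open>K j\<close>; S collects
  the indices with eigenvalue +1.\<close>

primrec proj :: "nat set \<Rightarrow> nat \<Rightarrow> lop" where
  "proj S 0 = 1"
| "proj S (Suc k) = (1/2) \<odot> (1 + of_real (sg S k) \<odot> K k) * proj S k"

primrec prodK :: "nat \<Rightarrow> lop" where
  "prodK 0 = 1"
| "prodK (Suc k) = K k * prodK k"

lemma GG: "j < n \<Longrightarrow> G j * G j = 1" using uu[of j j] by (intro gam_sq) simp
lemma HH: "j < n \<Longrightarrow> H j * H j = 1" using vv[of j j] by (intro gam_sq) simp
lemma GH: "j < n \<Longrightarrow> k < n \<Longrightarrow> G j * H k = - (H k * G j)" using uv by (intro gam_anti) simp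
lemma GG': "j < n \<Longrightarrow> k < n \<Longrightarrow> j \<noteq> k \<Longrightarrow> G j * G k = - (G k * G j)" using uu[of j k] by (intro gam_anti) simp
lemma HH': "j < n \<Longrightarrow> k < n \<Longrightarrow> j \<noteq> k \<Longrightarrow> H j * H k = - (H k * H j)" using vv[of j k] by (intro gam_anti) simp

lemma anti_anti_comm: "(x::lop) * a = - (a * x) \<Longrightarrow> x * b = - (b * x) \<Longrightarrow> x * (a * b) = a * b * x"
  by (metis mult.assoc mult_minus_left mult_minus_right minus_minus)

lemma GK: "j < n \<Longrightarrow> k < n \<Longrightarrow> j \<noteq> k \<Longrightarrow> G j * K k = K k * G j"
  using anti_anti_comm[OF GG' GH, of j k k] by (simp only: pair_op_def cs_mult_left cs_mult_right simp_thms)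

lemma HK: assumes "j < n" "k < n" "j \<noteq> k" shows "H j * K k = K k * H j"
proof -
  have "H j * G k = - (G k * H j)" using GH[OF assms(2,1)] by simp
  from anti_anti_comm[OF this HH'[OF assms]] show ?thesis
    by (simp only: pair_op_def cs_mult_left cs_mult_right)
qed

lemma KK: "j < n \<Longrightarrow> K j * K j = 1"
proof -
  assume j: "j < n"
  have "H j * G j = - (G j * H j)" using GH[OF j j] by simp
  then have "G j * (H j * G j) * H j = - (G j * G j * (H j * H j))"
    by (simp only: mult_minus_right mult_minus_left mult.assoc)
  then have "G j * H j * (G j * H j) = - (G j * G j * (H j * H j))" by (simp only: mult.assoc)
  then show ?thesis using GG[OF j] HH[OF j] by (simp add: pair_op_def)
qed

lemma K_comm: "j < n \<Longrightarrow> k < n \<Longrightarrow> K j * K k = K k * K j"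
proof (cases "j = k")
  case False
  assume "j < n" "k < n"
  then have "G j * H j * K k = K k * (G j * H j)"
    using GK[of j k] HK[of j k] False by (metis mult.assoc)
  then show ?thesis by (simp add: pair_op_def[of "u j"])
qed simp

lemma commute_proj: "k \<le> n \<Longrightarrow> (\<And>j. j < k \<Longrightarrow> x * K j = K j * x) \<Longrightarrow> x * proj S k = proj S k * x"
proof (induction k)
  case (Suc k)
  then have a: "x * proj S k = proj S k * x" and b: "x * K k = K k * x" by auto
  have "x * ((1/2) \<odot> (1 + of_real (sg S k) \<odot> K k)) = ((1/2) \<odot> (1 + of_real (sg S k) \<odot> K k)) * x"
    by (simp add: algebra_simps b)
  then show ?case unfolding proj.simps using a by (metis mult.assoc)
qed simp

lemma commute_prodK: "k \<le> n \<Longrightarrow> (\<And>j. j < k \<Longrightarrow> x * K j = K j * x) \<Longrightarrow> x * prodK k = prodK k * x"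
proof (induction k)
  case (Suc k)
  then have a: "x * prodK k = prodK k * x" and b: "x * K k = K k * x" by auto
  then show ?case unfolding prodK.simps by (metis mult.assoc)
qed simp

lemma modes_traceK:
  assumes "modes \<kappa> X" "k < n" "Y * G k = G k * Y" "Y * H k = H k * Y"
  shows "trd d (K k * (Y * X)) = of_real (\<kappa> k) * trd d (Y * X)"
  unfolding pair_op_def
  by (rule mode_rel_trace) (use assms HH GH gam_trc in \<open>auto simp: modes_def\<close>)

text \<open>Modes are split off one at a time: \<open>proj S k\<close> commutes with
  \<open>G k\<close> and \<open>H k\<close>, so it can take the place of Y in
  \<open>modes_traceK\<close>.\<close>

lemma trace_proj:
  assumes X: "modes \<kappa> X"
  shows "k \<le> n \<Longrightarrow> trd d (proj S k * X) = of_real (\<Prod>j<k. (1 + sg S j * \<kappa> j) / 2) * trd d X"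
proof (induction k)
  case (Suc k)
  have c: "proj S k * G k = G k * proj S k" "proj S k * H k = H k * proj S k"
    using commute_proj[of k "G k" S] commute_proj[of k "H k" S] GK HK Suc.prems by auto
  have "trd d (proj S (Suc k) * X) = (1/2) * (trd d (proj S k * X) + of_real (sg S k) * trd d (K k * (proj S k * X)))"
    by (simp add: algebra_simps)
  also have "\<dots> = of_real ((1 + sg S k * \<kappa> k) / 2) * trd d (proj S k * X)"
    using modes_traceK[OF X _ c] Suc.prems by (simp add: algebra_simps)
  finally show ?case using Suc by (simp add: mult_ac)
qed simp

lemma trace_prodK:
  assumes X: "modes \<kappa> X"
  shows "k \<le> n \<Longrightarrow> trd d (prodK k * X) = of_real (\<Prod>j<k. \<kappa> j) * trd d X"
proof (induction k)
  case (Suc k)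
  have c: "prodK k * G k = G k * prodK k" "prodK k * H k = H k * prodK k"
    using commute_prodK[of k "G k"] commute_prodK[of k "H k"] GK HK Suc.prems by auto
  show ?case
    using modes_traceK[OF X _ c] Suc by (simp add: mult_ac)
qed simp

lemma modes_one: "modes (\<lambda>j. 0) 1"
  by (simp add: modes_def mode_rel_def)

text \<open>The ring unit satisfies every mode relation with coefficient 0, so the product formula
  applies to it. For d = 2^n each idempotent has trace one.\<close>

lemma trace_proj_one: "trd d (proj S n) = of_nat d / 2 ^ n"
  using trace_proj[OF modes_one, of n S] by (simp add: power_divide field_simps)

lemma modes_commute:
  assumes "modes \<kappa> X" "k \<le> n" shows "X * proj S k = proj S k * X"
proof (rule commute_proj)
  fix j assume "j < k"
  then have j: "j < n" using assms by simp
  have "mode_rel (G j) (H j) (\<kappa> j) X" using assms(1) j by (simp add: modes_def)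
  from mode_rel_commute[OF this GG[OF j] HH[OF j] GH[OF j j]]
  show "X * K j = K j * X" by (simp only: pair_op_def cs_mult_left cs_mult_right)
qed (use assms in simp)

lemma proj_mult: "k \<le> n \<Longrightarrow> proj S k * proj S' k = (if S \<inter> {..<k} = S' \<inter> {..<k} then proj S k else 0)"
proof (induction k)
  case (Suc k)
  define P where "P S = (1/2) \<odot> (1 + of_real (sg S k) \<odot> K k)" for S
  have IH: "proj S k * proj S' k = (if S \<inter> {..<k} = S' \<inter> {..<k} then proj S k else 0)" using Suc by simp
  have "K k * proj S k = proj S k * K k"
    by (rule commute_proj) (use Suc.prems K_comm in auto)
  then have Pp: "proj S k * P S' = P S' * proj S k" by (simp add: P_def algebra_simps)
  have K1: "K k * K k = 1" using KK Suc.prems by simp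
  have PP: "P S * P S' = (if (k \<in> S) = (k \<in> S') then P S else 0)"
  proof -
    have "P S * P S' = (1/4) \<odot> ((of_real (1 + sg S k * sg S' k)) \<odot> 1 + of_real (sg S k + sg S' k) \<odot> K k)"
      by (simp add: P_def algebra_simps K1 lop.scale_left_distrib)
    also have "\<dots> = (if (k \<in> S) = (k \<in> S') then P S else 0)"
      by (simp add: P_def sg_def lop.scale_right_distrib)
    finally show ?thesis .
  qed
  have "proj S (Suc k) * proj S' (Suc k) = P S * P S' * (proj S k * proj S' k)"
    unfolding proj.simps P_def[symmetric] using Pp by (metis mult.assoc)
  also have "\<dots> = (if S \<inter> {..<Suc k} = S' \<inter> {..<Suc k} then proj S (Suc k) else 0)"
  proof -
    have "S \<inter> {..<Suc k} = S' \<inter> {..<Suc k} \<longleftrightarrow> S \<inter> {..<k} = S' \<inter> {..<k} \<and> (k \<in> S) = (k \<in> S')"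
      by (auto simp: lessThan_Suc)
    then show ?thesis by (simp add: IH PP P_def[symmetric])
  qed
  finally show ?case .
qed simp

end

lemma (in frame) wick_modes:
  assumes "wick N g M X"
    and "\<And>j q. j < n \<Longrightarrow> q < N \<Longrightarrow> (\<Sum>p<N. u j p * M p q) = - \<kappa> j * v j q"
    and "\<And>j q. j < n \<Longrightarrow> q < N \<Longrightarrow> (\<Sum>p<N. v j p * M p q) = \<kappa> j * u j q"
  shows "modes \<kappa> X"
  unfolding modes_def mode_rel_def
proof (intro allI impI)
  fix j assume j: "j < n"
  have 1: "gam (\<lambda>q. \<Sum>p<N. u j p * M p q) = of_real (- \<kappa> j) \<odot> H j"
    unfolding gam_scale[symmetric] by (rule gam_cong) (use assms(2) j in simp)
  have 2: "gam (\<lambda>q. \<Sum>p<N. v j p * M p q) = of_real (\<kappa> j) \<odot> G j"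
    unfolding gam_scale[symmetric] by (rule gam_cong) (use assms(3) j in simp)
  show "G j * X - X * G j = (- (\<i> * of_real (\<kappa> j))) \<odot> (H j * X + X * H j) \<and>
        H j * X - X * H j = (\<i> * of_real (\<kappa> j)) \<odot> (G j * X + X * G j)"
    unfolding wick_gam[OF assms(1)] 1 2 by (simp add: lop.scale_right_distrib lop.scale_right_diff_distrib)
qed

subsection \<open>Jordan--Wigner operators\<close>

lemma sum_lessThan_mult:
  fixes f :: "nat \<Rightarrow> nat \<Rightarrow> 'a::comm_monoid_add"
  shows "(\<Sum>k<a*b. f (k div b) (k mod b)) = (\<Sum>x<a. \<Sum>y<b. f x y)"
proof -
  have "(\<Sum>k<a*b. f (k div b) (k mod b)) = (\<Sum>m<a. \<Sum>k\<in>{m*b..<m*b+b}. f (k div b) (k mod b))"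
    by (rule sum.nat_group[symmetric])
  also have "\<dots> = (\<Sum>m<a. \<Sum>y<b. f m y)"
  proof (rule sum.cong[OF refl])
    fix m
    show "(\<Sum>k\<in>{m*b..<m*b+b}. f (k div b) (k mod b)) = (\<Sum>y<b. f m y)"
    proof (rule sum.reindex_bij_witness[of _ "\<lambda>y. m*b+y" "\<lambda>k. k - m*b"])
      fix k assume k: "k \<in> {m*b..<m*b+b}"
      then have "k = m * b + (k - m*b)" "k - m*b < b" by auto
      then show "f m (k - m * b) = f (k div b) (k mod b)"
        by (metis div_mult_self3 mod_mult_self3 div_less mod_less add_0_right gr_implies_not0)
    qed auto
  qed
  finally show ?thesis .
qed

lemma kron_carrier [simp]: "A \<in> carrier_mat a a \<Longrightarrow> B \<in> carrier_mat b b \<Longrightarrow> kron A B \<in> carrier_mat (a * b) (a * b)"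
  by (auto simp: kron_def)

lemma kron_index: "A \<in> carrier_mat a a \<Longrightarrow> B \<in> carrier_mat b b \<Longrightarrow> i < a * b \<Longrightarrow> j < a * b \<Longrightarrow>
  kron A B $$ (i,j) = A $$ (i div b, j div b) * B $$ (i mod b, j mod b)"
  by (auto simp: kron_def)

lemma div_mod_bounds: "i < a * b \<Longrightarrow> i div b < (a::nat)" "i < a * b \<Longrightarrow> i mod b < b"
  by (auto simp: less_mult_imp_div_less intro!: mod_less_divisor) (metis gr0I mult_0_right not_less0)

lemma kron_mult:
  assumes "A \<in> carrier_mat a a" "C \<in> carrier_mat a a" "B \<in> carrier_mat b b" "D \<in> carrier_mat b b"
  shows "kron A B * kron C D = kron (A * C) (B * D)"
proof (rule eq_matI)
  fix i j assume "i < dim_row (kron (A * C) (B * D))" "j < dim_col (kron (A * C) (B * D))"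
  then have ij: "i < a * b" "j < a * b" using assms by (auto simp: kron_def)
  note dm = div_mod_bounds[OF ij(1)] div_mod_bounds[OF ij(2)]
  have "(kron A B * kron C D) $$ (i,j) = (\<Sum>k<a*b. kron A B $$ (i,k) * kron C D $$ (k,j))"
    using ij kron_carrier[OF assms(1,3)] kron_carrier[OF assms(2,4)] by (auto simp: scalar_prod_def atLeast0LessThan)
  also have "\<dots> = (\<Sum>k<a*b. (\<lambda>x y. (A $$ (i div b, x) * B $$ (i mod b, y)) * (C $$ (x, j div b) * D $$ (y, j mod b))) (k div b) (k mod b))"
    using assms ij by (intro sum.cong refl) (simp add: kron_index[of _ a _ b])
  also have "\<dots> = (\<Sum>x<a. \<Sum>y<b. (A $$ (i div b, x) * B $$ (i mod b, y)) * (C $$ (x, j div b) * D $$ (y, j mod b)))"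
    by (rule sum_lessThan_mult)
  also have "\<dots> = (\<Sum>x<a. A $$ (i div b, x) * C $$ (x, j div b)) * (\<Sum>y<b. B $$ (i mod b, y) * D $$ (y, j mod b))"
    unfolding sum_product by (simp add: mult_ac)
  also have "\<dots> = (A * C) $$ (i div b, j div b) * (B * D) $$ (i mod b, j mod b)"
    using assms dm by (simp add: scalar_prod_def atLeast0LessThan)
  also have "\<dots> = kron (A * C) (B * D) $$ (i,j)"
    using assms ij by (subst kron_index[of _ a _ b]) auto
  finally show "(kron A B * kron C D) $$ (i,j) = kron (A * C) (B * D) $$ (i,j)" .
qed (use assms in \<open>auto simp: kron_def\<close>)

lemma kron_one: "kron (1\<^sub>m a) (1\<^sub>m b) = 1\<^sub>m (a * b)"
proof (rule eq_matI)
  fix i j assume "i < dim_row (1\<^sub>m (a * b))" "j < dim_col (1\<^sub>m (a * b))"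
  then have ij: "i < a * b" "j < a * b" by auto
  have "i div b = j div b \<and> i mod b = j mod b \<longleftrightarrow> i = j" by (metis div_mult_mod_eq)
  then show "kron (1\<^sub>m a) (1\<^sub>m b) $$ (i,j) = 1\<^sub>m (a * b) $$ (i,j)"
    using ij div_mod_bounds[OF ij(1)] div_mod_bounds[OF ij(2)] by (auto simp: kron_def)
qed (auto simp: kron_def)

lemma kron_uminus_left: "A \<in> carrier_mat a a \<Longrightarrow> B \<in> carrier_mat b b \<Longrightarrow> kron (- A) B = - kron A B"
  by (rule eq_matI) (auto simp: kron_def div_mod_bounds)

lemma kron_uminus_right: "A \<in> carrier_mat a a \<Longrightarrow> B \<in> carrier_mat b b \<Longrightarrow> kron A (- B) = - kron A B"
  by (rule eq_matI) (auto simp: kron_def div_mod_bounds)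

lemma kron_add_left: "A \<in> carrier_mat a a \<Longrightarrow> C \<in> carrier_mat a a \<Longrightarrow> B \<in> carrier_mat b b \<Longrightarrow> kron (A + C) B = kron A B + kron C B"
  by (rule eq_matI) (auto simp: kron_def div_mod_bounds algebra_simps)

lemma kron_add_right: "A \<in> carrier_mat a a \<Longrightarrow> B \<in> carrier_mat b b \<Longrightarrow> D \<in> carrier_mat b b \<Longrightarrow> kron A (B + D) = kron A B + kron A D"
  by (rule eq_matI) (auto simp: kron_def div_mod_bounds algebra_simps)

lemma kron_smult_left: "A \<in> carrier_mat a a \<Longrightarrow> B \<in> carrier_mat b b \<Longrightarrow> kron (z \<cdot>\<^sub>m A) B = z \<cdot>\<^sub>m kron A B"
  by (rule eq_matI) (auto simp: kron_def div_mod_bounds algebra_simps)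

lemma kron_smult_right: "A \<in> carrier_mat a a \<Longrightarrow> B \<in> carrier_mat b b \<Longrightarrow> kron A (z \<cdot>\<^sub>m B) = z \<cdot>\<^sub>m kron A B"
  by (rule eq_matI) (auto simp: kron_def div_mod_bounds algebra_simps)

lemma adj_carrier [simp]: "A \<in> carrier_mat a b \<Longrightarrow> adj A \<in> carrier_mat b a"
  by (auto simp: adj_def)

lemma adj_kron: "A \<in> carrier_mat a a \<Longrightarrow> B \<in> carrier_mat b b \<Longrightarrow> adj (kron A B) = kron (adj A) (adj B)"
  by (rule eq_matI) (auto simp: kron_def adj_def div_mod_bounds)

lemma pauli_carrier [simp]: "pauli_x \<in> carrier_mat 2 2" "pauli_y \<in> carrier_mat 2 2" "pauli_z \<in> carrier_mat 2 2"
  by (auto simp: pauli_x_def pauli_y_def pauli_z_def)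

lemma mat2_mult: "A \<in> carrier_mat 2 2 \<Longrightarrow> B \<in> carrier_mat 2 2 \<Longrightarrow> i < 2 \<Longrightarrow> j < 2 \<Longrightarrow>
  (A * B) $$ (i,j) = A $$ (i,0) * B $$ (0,j) + A $$ (i,1) * B $$ (1,j)" for A :: "complex mat"
  by (auto simp: scalar_prod_def numeral_2_eq_2 sum.atLeast0_lessThan_Suc)

lemma pauli_index:
  "i < 2 \<Longrightarrow> j < 2 \<Longrightarrow> pauli_x $$ (i,j) = (if i \<noteq> j then 1 else 0)"
  "i < 2 \<Longrightarrow> j < 2 \<Longrightarrow> pauli_y $$ (i,j) = (if i = 0 \<and> j = 1 then - \<i> else if i = 1 \<and> j = 0 then \<i> else 0)"
  "i < 2 \<Longrightarrow> j < 2 \<Longrightarrow> pauli_z $$ (i,j) = (if i = j then (if i = 0 then 1 else -1) else 0)"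
  by (auto simp: pauli_x_def pauli_y_def pauli_z_def)

lemma pauli_mult:
  "pauli_x * pauli_x = 1\<^sub>m 2" "pauli_y * pauli_y = 1\<^sub>m 2" "pauli_z * pauli_z = 1\<^sub>m 2"
  "pauli_x * pauli_y = \<i> \<cdot>\<^sub>m pauli_z" "pauli_y * pauli_x = - (\<i> \<cdot>\<^sub>m pauli_z)"
  "pauli_y * pauli_z = \<i> \<cdot>\<^sub>m pauli_x" "pauli_z * pauli_y = - (\<i> \<cdot>\<^sub>m pauli_x)"
  "pauli_z * pauli_x = \<i> \<cdot>\<^sub>m pauli_y" "pauli_x * pauli_z = - (\<i> \<cdot>\<^sub>m pauli_y)"
  by - (rule eq_matI; auto simp: pauli_x_def pauli_y_def pauli_z_def scalar_prod_def numeral_2_eq_2 less_Suc_eq)+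

lemma pauli_adj: "adj pauli_x = pauli_x" "adj pauli_y = pauli_y" "adj pauli_z = pauli_z" "adj (1\<^sub>m k) = 1\<^sub>m k"
  by - (rule eq_matI; auto simp: adj_def pauli_x_def pauli_y_def pauli_z_def)+

section \<open>Parity and the qubit recursion of the Majorana operators\<close>

text \<open>Up to a phase this is the product of all 2n Majorana operators, which is why it
  anticommutes with each of them.\<close>

definition parity_op :: "nat \<Rightarrow> complex mat" where
  "parity_op n = kron_list (replicate n pauli_z)"

lemma parity_Suc: "parity_op (Suc n) = kron pauli_z (parity_op n)"
  by (simp add: parity_op_def)

lemma kron_list_one: "kron_list (map (\<lambda>k. 1\<^sub>m 2) xs) = 1\<^sub>m (2 ^ length xs)"
  by (induction xs) (simp_all add: kron_one)

lemma upt_1_Suc: "[1..<Suc n + 1] = 1 # map Suc [1..<n+1]"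
  by (simp add: upt_conv_Cons map_Suc_upt)

lemma majorana_1: "majorana (Suc n) 1 = kron pauli_x (1\<^sub>m (2^n))"
proof -
  have j: "(1 + 1) div 2 = (1::nat)" by simp
  have e: "map (\<lambda>k. if k < 1 then pauli_z else if k = 1 then (if odd (1::nat) then pauli_x else pauli_y) else 1\<^sub>m 2) [1..<Suc n + 1]
    = pauli_x # map (\<lambda>k. 1\<^sub>m 2) [1..<n+1]"
    unfolding upt_1_Suc by auto
  show ?thesis unfolding majorana_def Let_def j e by (simp add: kron_list_one del: upt_Suc)
qed

lemma majorana_2: "majorana (Suc n) 2 = kron pauli_y (1\<^sub>m (2^n))"
proof -
  have j: "(2 + 1) div 2 = (1::nat)" by simp
  have e: "map (\<lambda>k. if k < 1 then pauli_z else if k = 1 then (if odd (2::nat) then pauli_x else pauli_y) else 1\<^sub>m 2) [1..<Suc n + 1]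
    = pauli_y # map (\<lambda>k. 1\<^sub>m 2) [1..<n+1]"
    unfolding upt_1_Suc by auto
  show ?thesis unfolding majorana_def Let_def j e by (simp add: kron_list_one del: upt_Suc)
qed

lemma majorana_Suc: assumes "p \<ge> 1" shows "majorana (Suc n) (p + 2) = kron pauli_z (majorana n p)"
proof -
  define j where "j = (p + 1) div 2"
  have j: "(p + 2 + 1) div 2 = Suc j" "j \<ge> 1" using assms by (auto simp: j_def)
  have o: "odd (p + 2) = odd p" by simp
  let ?W = "if odd p then pauli_x else pauli_y"
  have e: "map (\<lambda>k. if k < Suc j then pauli_z else if k = Suc j then ?W else 1\<^sub>m 2) [1..<Suc n + 1]
    = pauli_z # map (\<lambda>k. if k < j then pauli_z else if k = j then ?W else 1\<^sub>m 2) [1..<n+1]"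
    unfolding upt_1_Suc using j by (simp add: comp_def del: upt_Suc cong: map_cong)
  show ?thesis unfolding majorana_def Let_def j(1) o j_def[symmetric] e by (rule kron_list.simps)
qed

lemma majorana_cases:
  assumes "p \<in> {1..2 * Suc n}"
  obtains "p = 1" | "p = 2" | p' where "p' \<in> {1..2*n}" "p = p' + 2"
proof -
  have "p = 1 \<or> p = 2 \<or> (p - 2 \<in> {1..2*n} \<and> p = (p - 2) + 2)" using assms by auto
  then show ?thesis using that by blast
qed

lemma parity_props:
  "parity_op n \<in> carrier_mat (2^n) (2^n)" "parity_op n * parity_op n = 1\<^sub>m (2^n)" "adj (parity_op n) = parity_op n"
proof (induction n)
  case 0
  { case 1 then show ?case by (simp add: parity_op_def) }
  { case 2 then show ?case by (simp add: parity_op_def) }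
  { case 3 then show ?case by (simp add: parity_op_def pauli_adj) }
next
  case (Suc n)
  { case 1 show ?case using kron_carrier[OF pauli_carrier(3) Suc(1)] by (simp add: parity_Suc) }
  { case 2 show ?case using kron_mult[OF pauli_carrier(3) pauli_carrier(3) Suc(1) Suc(1)]
      by (simp add: parity_Suc Suc pauli_mult kron_one) }
  { case 3 show ?case using adj_kron[OF pauli_carrier(3) Suc(1)] by (simp add: parity_Suc Suc pauli_adj) }
qed

lemma majorana_props:
  "p \<in> {1..2*n} \<Longrightarrow> majorana n p \<in> carrier_mat (2^n) (2^n) \<and> majorana n p * majorana n p = 1\<^sub>m (2^n)
    \<and> adj (majorana n p) = majorana n p \<and> parity_op n * majorana n p = - (majorana n p * parity_op n)"
proof (induction n arbitrary: p)
  case (Suc n)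
  note P = parity_props[of n]
  have o: "1\<^sub>m (2^n) \<in> carrier_mat (2^n) (2^n)" by simp
  from Suc.prems show ?case
  proof (cases rule: majorana_cases)
    case 1
    show ?thesis unfolding 1 majorana_1 parity_Suc using kron_carrier[OF pauli_carrier(1) o]
      by (simp add: kron_mult[where a = 2 and b = "2^n"] P pauli_mult kron_one adj_kron[where a = 2 and b = "2^n"] pauli_adj kron_uminus_left[where a = 2 and b = "2^n"]
          right_mult_one_mat[of _ "2^n" "2^n"] left_mult_one_mat[of _ "2^n" "2^n"])
  next
    case 2
    show ?thesis unfolding 2 majorana_2 parity_Suc using kron_carrier[OF pauli_carrier(2) o]
      by (simp add: kron_mult[where a = 2 and b = "2^n"] P pauli_mult kron_one adj_kron[where a = 2 and b = "2^n"] pauli_adj kron_uminus_left[where a = 2 and b = "2^n"]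
          right_mult_one_mat[of _ "2^n" "2^n"] left_mult_one_mat[of _ "2^n" "2^n"])
  next
    case (3 p')
    note I = Suc.IH[OF 3(1)]
    have M: "majorana (Suc n) p = kron pauli_z (majorana n p')" using 3 majorana_Suc[of p' n] by simp
    show ?thesis unfolding M parity_Suc using kron_carrier[OF pauli_carrier(3), of "majorana n p'" "2^n"] I
      by (auto simp: kron_mult[where a = 2 and b = "2^n"] P pauli_mult kron_one adj_kron[where a = 2 and b = "2^n"] pauli_adj kron_uminus_right[where a = 2 and b = "2^n"]
          mult_carrier_mat[of _ "2^n" "2^n" _ "2^n"])
  qed
qed simp

lemmas majorana_carrier = majorana_props[THEN conjunct1]
  and majorana_sq = majorana_props[THEN conjunct2, THEN conjunct1]
  and majorana_adj = majorana_props[THEN conjunct2, THEN conjunct2, THEN conjunct1]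
  and majorana_parity = majorana_props[THEN conjunct2, THEN conjunct2, THEN conjunct2]

lemma majorana_anti:
  "p \<in> {1..2*n} \<Longrightarrow> q \<in> {1..2*n} \<Longrightarrow> p \<noteq> q \<Longrightarrow> majorana n p * majorana n q = - (majorana n q * majorana n p)"
proof (induction n arbitrary: p q)
  case (Suc n)
  have o: "1\<^sub>m (2^n) \<in> carrier_mat (2^n) (2^n)" by simp
  note simps = kron_mult[where a = 2 and b = "2^n"] pauli_mult kron_uminus_left[where a = 2 and b = "2^n"] kron_uminus_right[where a = 2 and b = "2^n"]
    right_mult_one_mat[of _ "2^n" "2^n"] left_mult_one_mat[of _ "2^n" "2^n"]
  have M: "majorana (Suc n) (p' + 2) = kron pauli_z (majorana n p')" if "p' \<in> {1..2*n}" for p'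
    using that majorana_Suc[of p' n] by simp
  from Suc.prems(1) show ?case
  proof (cases rule: majorana_cases)
    case p: 1
    from Suc.prems(2) show ?thesis
    proof (cases rule: majorana_cases)
      case 2 show ?thesis unfolding p 2 majorana_1 majorana_2 by (simp add: simps)
    next
      case (3 q') show ?thesis unfolding p 3(2) majorana_1 M[OF 3(1)] using majorana_carrier[OF 3(1)] by (simp add: simps)
    qed (use p Suc.prems in simp)
  next
    case p: 2
    from Suc.prems(2) show ?thesis
    proof (cases rule: majorana_cases)
      case 1 show ?thesis unfolding p 1 majorana_1 majorana_2 by (simp add: simps)
    next
      case (3 q') show ?thesis unfolding p 3(2) majorana_2 M[OF 3(1)] using majorana_carrier[OF 3(1)] by (simp add: simps)
    qed (use p Suc.prems in simp)
  next
    case p: (3 p')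
    note c = majorana_carrier[OF p(1)]
    from Suc.prems(2) show ?thesis
    proof (cases rule: majorana_cases)
      case 1 show ?thesis unfolding p(2) 1 majorana_1 M[OF p(1)] using c by (simp add: simps)
    next
      case 2 show ?thesis unfolding p(2) 2 majorana_2 M[OF p(1)] using c by (simp add: simps)
    next
      case (3 q')
      have "p' \<noteq> q'" using 3 p Suc.prems by simp
      from Suc.IH[OF p(1) 3(1) this] show ?thesis
        unfolding p(2) 3(2) M[OF p(1)] M[OF 3(1)] using c majorana_carrier[OF 3(1)] mult_carrier_mat[OF majorana_carrier[OF 3(1)] c]
        by (simp add: simps)
    qed
  qed
qed simp

lemma adj_mult: "A \<in> carrier_mat a b \<Longrightarrow> B \<in> carrier_mat b c \<Longrightarrow> adj (A * B) = adj B * adj A"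
  by (rule eq_matI) (auto simp: adj_def scalar_prod_def mult.commute)

lemma adj_smult: "adj (z \<cdot>\<^sub>m A) = cnj z \<cdot>\<^sub>m adj A"
  by (rule eq_matI) (auto simp: adj_def)

lemma adj_add: "A \<in> carrier_mat a b \<Longrightarrow> B \<in> carrier_mat a b \<Longrightarrow> adj (A + B) = adj A + adj B"
  by (rule eq_matI) (auto simp: adj_def)

lemma adj_adj [simp]: "adj (adj A) = A"
  by (rule eq_matI) (auto simp: adj_def)

lemma emb_uminus: "d > 0 \<Longrightarrow> A \<in> carrier_mat d d \<Longrightarrow> emb d (- A) = - emb d A"
  using emb_smult[of d A "-1"] by (simp add: uminus_mat_def smult_mat_def map_mat_def)

section \<open>Anticommuting generators from parity and Majorana operators\<close>

definition maj :: "nat \<Rightarrow> nat \<Rightarrow> lop" where "maj n p = emb (2^n) (majorana n p)"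

text \<open>Index 0 is the parity. For p > 0 the two factors anticommute, so \<open>\<i>\<close> is
  the phase that makes their product hermitian with square one. In a product of two generators of
  positive index the parities cancel and the product of the Majorana operators remains.\<close>

definition gmat :: "nat \<Rightarrow> nat \<Rightarrow> complex mat" where
  "gmat n p = (if p = 0 then parity_op n else \<i> \<cdot>\<^sub>m (parity_op n * majorana n p))"

definition gop :: "nat \<Rightarrow> nat \<Rightarrow> lop" where "gop n p = emb (2^n) (gmat n p)"

lemma gmat_carrier: "p < 2*n+1 \<Longrightarrow> gmat n p \<in> carrier_mat (2^n) (2^n)"
  using parity_props[of n] majorana_carrier[of p n] by (auto simp: gmat_def)

lemma emb_parity_maj:
  assumes "p \<in> {1..2*n}"
  shows "emb (2^n) (parity_op n) * maj n p = - (maj n p * emb (2^n) (parity_op n))"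
  using arg_cong[OF majorana_parity[OF assms], of "emb (2^n)"] parity_props[of n] majorana_carrier[OF assms]
  by (simp add: maj_def emb_mult emb_uminus mult_carrier_mat[of _ "2^n" "2^n" _ "2^n"])

lemma emb_parity_sq: "emb (2^n) (parity_op n) * emb (2^n) (parity_op n) = 1"
  using arg_cong[OF parity_props(2), of "emb (2^n)" n] parity_props(1)[of n] by (simp add: emb_mult emb_one)

lemma maj_sq: "p \<in> {1..2*n} \<Longrightarrow> maj n p * maj n p = 1"
  using arg_cong[OF majorana_sq, of p n "emb (2^n)"] majorana_carrier[of p n] by (simp add: maj_def emb_mult emb_one)

lemma maj_anti: "p \<in> {1..2*n} \<Longrightarrow> q \<in> {1..2*n} \<Longrightarrow> p \<noteq> q \<Longrightarrow> maj n p * maj n q = - (maj n q * maj n p)"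
  using arg_cong[OF majorana_anti, of p n q "emb (2^n)"] majorana_carrier[of p n] majorana_carrier[of q n]
  by (simp add: maj_def emb_mult emb_uminus mult_carrier_mat[of _ "2^n" "2^n" _ "2^n"])

lemma gop_0: "gop n 0 = emb (2^n) (parity_op n)"
  by (simp add: gop_def gmat_def)

lemma gop_pos: "p \<in> {1..2*n} \<Longrightarrow> gop n p = \<i> \<odot> (gop n 0 * maj n p)"
  using parity_props[of n] majorana_carrier[of p n]
  by (simp add: gop_def gmat_def maj_def emb_mult emb_smult mult_carrier_mat[of _ "2^n" "2^n" _ "2^n"])

lemma gop0_sq: "gop n 0 * gop n 0 = 1" by (simp add: gop_0 emb_parity_sq)

lemma gop0_maj: "p \<in> {1..2*n} \<Longrightarrow> maj n p * gop n 0 = - (gop n 0 * maj n p)"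
  using emb_parity_maj[of p n] by (simp add: gop_0)

lemma gop_mult: 
  assumes "p \<in> {1..2*n}" "q \<in> {1..2*n}"
  shows "gop n p * gop n q = maj n p * maj n q"
proof -
  have "gop n p * gop n q = - (gop n 0 * (maj n p * gop n 0) * maj n q)"
    using assms by (simp add: gop_pos mult.assoc)
  also have "\<dots> = gop n 0 * gop n 0 * (maj n p * maj n q)"
    unfolding gop0_maj[OF assms(1)] by (simp add: mult.assoc)
  finally show ?thesis by (simp add: gop0_sq)
qed

lemma gop0_mult: "p \<in> {1..2*n} \<Longrightarrow> gop n 0 * gop n p = \<i> \<odot> maj n p"
  using gop0_sq[of n] by (simp add: gop_pos mult.assoc[symmetric])

lemma gop_anti0: "p \<in> {1..2*n} \<Longrightarrow> gop n p * gop n 0 = - (gop n 0 * gop n p)"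
  using gop0_maj[of p n] by (simp add: gop_pos mult.assoc)

interpretation cliff: clifford "2*n+1" "2^n" "gop n" for n
proof
  fix p q x assume p: "p < 2*n+1"
  show "gop n p * gop n p = 1"
    using gop_mult[of p n p] maj_sq[of p n] gop0_sq p by (cases "p = 0") auto
  show "trd (2^n) (gop n p * x) = trd (2^n) (x * gop n p)"
    unfolding gop_def by (rule trd_comm)
  assume q: "q < 2*n+1" and pq: "p \<noteq> q"
  show "gop n p * gop n q = - (gop n q * gop n p)"
  proof -
    consider "p = 0" "q \<in> {1..2*n}" | "q = 0" "p \<in> {1..2*n}" | "p \<in> {1..2*n}" "q \<in> {1..2*n}"
      using p q pq by fastforce
    then show ?thesis
    proof cases
      case 1 then show ?thesis using gop_anti0[of q n] by simp
    next
      case 2 then show ?thesis using gop_anti0[of p n] by simp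
    next
      case 3 then show ?thesis using gop_mult[OF 3] gop_mult[OF 3(2,1)] maj_anti[OF 3 pq] by simp
    qed
  qed
qed

lemma gmat_adj: assumes "p < 2*n+1" shows "adj (gmat n p) = gmat n p"
proof (cases "p = 0")
  case False
  then have p: "p \<in> {1..2*n}" using assms by simp
  note c = majorana_carrier[OF p] parity_props(1)[of n]
  have "adj (gmat n p) = (- \<i>) \<cdot>\<^sub>m (majorana n p * parity_op n)"
    using False c by (simp add: gmat_def adj_smult adj_mult[of _ "2^n" "2^n" _ "2^n"] majorana_adj[OF p] parity_props)
  also have "\<dots> = \<i> \<cdot>\<^sub>m (- (majorana n p * parity_op n))"
    by (rule eq_matI) auto
  also have "\<dots> = gmat n p" using False by (simp add: gmat_def majorana_parity[OF p])
  finally show ?thesis .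
qed (simp add: gmat_def parity_props)

lemma gmat_sq: assumes "p < 2*n+1" shows "gmat n p * gmat n p = 1\<^sub>m (2^n)"
proof (rule emb_inj[of _ "2^n"])
  show "emb (2^n) (gmat n p * gmat n p) = emb (2^n) (1\<^sub>m (2^n))"
    using gmat_carrier[OF assms] cliff.sq[OF assms] by (simp add: emb_mult emb_one gop_def[symmetric])
qed (use gmat_carrier[OF assms] in \<open>auto intro: mult_carrier_mat\<close>)

section \<open>The channel as a composition of flip mixtures\<close>

lemma mono_fold_carrier:
  "set ps \<subseteq> {1..2*n} \<Longrightarrow> foldr (\<lambda>p M. (if x p then majorana n p else 1\<^sub>m (2^n)) * M) ps (1\<^sub>m (2^n)) \<in> carrier_mat (2^n) (2^n)"
  by (induction ps) (auto intro!: mult_carrier_mat[of _ "2^n" "2^n" _ "2^n"] majorana_carrier)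

lemma majorana_mono_carrier: "majorana_mono n x \<in> carrier_mat (2^n) (2^n)"
  unfolding majorana_mono_def by (rule mono_fold_carrier) auto

text \<open>Conjugation by parity flips the sign of every Majorana operator, conjugation by the i-th
  one flips all the others; \<open>gop n i\<close> combines both and flips only the i-th. As
  \<open>ps\<close> is distinct, that operator occurs at most once in the word.\<close>

lemma flip_word:
  assumes i: "i \<in> {1..2*n}"
  shows "set ps \<subseteq> {1..2*n} \<Longrightarrow> distinct ps \<Longrightarrow>
    gop n i * emb (2^n) (foldr (\<lambda>p M. (if x p then majorana n p else 1\<^sub>m (2^n)) * M) ps (1\<^sub>m (2^n))) * gop n i
    = (if i \<in> set ps \<and> x i then -1 else 1) \<odot> emb (2^n) (foldr (\<lambda>p M. (if x p then majorana n p else 1\<^sub>m (2^n)) * M) ps (1\<^sub>m (2^n)))"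
proof (induction ps)
  case Nil
  then show ?case using cliff.sq[of i n] i by (simp add: emb_one)
next
  case (Cons p ps)
  define W where "W = foldr (\<lambda>p M. (if x p then majorana n p else 1\<^sub>m (2^n)) * M) ps (1\<^sub>m (2^n))"
  have cW: "W \<in> carrier_mat (2^n) (2^n)" unfolding W_def by (rule mono_fold_carrier) (use Cons in auto)
  have p: "p \<in> {1..2*n}" using Cons.prems by simp
  have IH: "gop n i * emb (2^n) W * gop n i = (if i \<in> set ps \<and> x i then -1 else 1) \<odot> emb (2^n) W"
    using Cons unfolding W_def by simp
  show ?case
  proof (cases "x p")
    case False
    then show ?thesis using IH cW by (auto simp: W_def[symmetric])
  next
    case True
    have e: "emb (2^n) (majorana n p * W) = maj n p * emb (2^n) W"
      using cW majorana_carrier[OF p] by (simp add: emb_mult maj_def)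
    have m: "gop n i * maj n p = (if i = p then -1 else 1) \<odot> (maj n p * gop n i)"
    proof (cases "i = p")
      case True
      have "gop n 0 * maj n p * maj n p = - (maj n p * (gop n 0 * maj n p))"
        using gop0_maj[OF p] by (simp add: mult.assoc[symmetric])
      then show ?thesis using True gop_pos[OF p] by simp
    next
      case False
      have "gop n 0 * maj n i * maj n p = maj n p * (gop n 0 * maj n i)"
        using gop0_maj[OF p] maj_anti[OF i p False] by (simp add: mult.assoc[symmetric]) (simp add: mult.assoc)
      then show ?thesis using False gop_pos[OF i] by simp
    qed
    have "gop n i * (maj n p * emb (2^n) W) * gop n i = gop n i * maj n p * emb (2^n) W * gop n i"
      by (simp add: mult.assoc)
    also have "\<dots> = (if i = p then -1 else 1) \<odot> (maj n p * (gop n i * emb (2^n) W * gop n i))"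
      unfolding m by (simp add: mult.assoc)
    also have "\<dots> = (if i = p then -1 else 1) \<odot> (if i \<in> set ps \<and> x i then -1 else 1) \<odot> (maj n p * emb (2^n) W)"
      unfolding IH by simp
    also have "\<dots> = (if i \<in> set (p # ps) \<and> x i then -1 else 1) \<odot> (maj n p * emb (2^n) W)"
      using Cons.prems True by auto
    finally show ?thesis using True e by (simp add: W_def[symmetric])
  qed
qed

lemma flip_mix_mono:
  assumes "i \<in> {1..2*n}"
  shows "flip_mix c (gop n i) (emb (2^n) (majorana_mono n x)) = (if x i then of_real c else 1) \<odot> emb (2^n) (majorana_mono n x)"
proof -
  have f: "gop n i * emb (2^n) (majorana_mono n x) * gop n i = (if x i then -1 else 1) \<odot> emb (2^n) (majorana_mono n x)"
  proof -
    have "set [1..<2*n+1] \<subseteq> {1..2*n}" "i \<in> set [1..<2*n+1]" using assms by auto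
    then show ?thesis using flip_word[OF assms _ distinct_upt, of 1 "2*n+1" x] by (simp only: majorana_mono_def simp_thms)
  qed
  have "of_real ((1 + c) / 2) + of_real ((1 - c) / 2) = (1::complex)" "of_real ((1 + c) / 2) - of_real ((1 - c) / 2) = complex_of_real c"
    by (simp_all only: of_real_add[symmetric] of_real_diff[symmetric]) (simp_all add: field_simps)
  then show ?thesis unfolding flip_mix_def f
    by (cases "x i") (simp_all add: lop.scale_left_distrib[symmetric] lop.scale_left_diff_distrib[symmetric] del: of_real_divide of_real_add of_real_diff)
qed

lemma flip_mixes_mono:
  "set is \<subseteq> {1..2*n} \<Longrightarrow> flip_mixes (gop n) b is (emb (2^n) (majorana_mono n x))
     = of_real (prod_list (map (\<lambda>i. if x i then b i else 1) is)) \<odot> emb (2^n) (majorana_mono n x)"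
proof (induction "is")
  case (Cons i "is")
  have s: "flip_mix c G (z \<odot> X) = z \<odot> flip_mix c G X" for c G z X
    by (simp add: flip_mix_def lop.scale_right_distrib mult.commute)
  show ?case using Cons by (auto simp: flip_mixes_def s flip_mix_mono)
qed (simp add: flip_mixes_def)

lemma mat2_pauli:
  assumes "A \<in> carrier_mat 2 2"
  obtains a b c e where "A = a \<cdot>\<^sub>m 1\<^sub>m 2 + b \<cdot>\<^sub>m pauli_x + c \<cdot>\<^sub>m pauli_y + e \<cdot>\<^sub>m pauli_z"
proof -
  let ?a = "(A $$ (0,0) + A $$ (1,1)) / 2" and ?e = "(A $$ (0,0) - A $$ (1,1)) / 2"
    and ?b = "(A $$ (0,1) + A $$ (1,0)) / 2" and ?c = "\<i> * (A $$ (0,1) - A $$ (1,0)) / 2"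
  have "A = ?a \<cdot>\<^sub>m 1\<^sub>m 2 + ?b \<cdot>\<^sub>m pauli_x + ?c \<cdot>\<^sub>m pauli_y + ?e \<cdot>\<^sub>m pauli_z"
    by (rule eq_matI) (use assms in \<open>auto simp: pauli_x_def pauli_y_def pauli_z_def numeral_2_eq_2 less_Suc_eq field_simps\<close>)
  then show ?thesis by (rule that)
qed

text \<open>Each Majorana operator of the last n qubits carries one \<open>pauli_z\<close> on the
  new first qubit, and w is the accumulated product. It is chosen before x, so that
  \<open>x 1\<close> and \<open>x 2\<close> stay free in \<open>majorana_span\<close>.\<close>

lemma mono_tail:
  "set ps \<subseteq> {1..2*n} \<Longrightarrow> \<exists>w\<in>{1\<^sub>m 2, pauli_z}. \<forall>x. (\<forall>p\<ge>1. x (p + 2) = x' p) \<longrightarrow>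
     foldr (\<lambda>p M. (if x p then majorana (Suc n) p else 1\<^sub>m (2 ^ Suc n)) * M) (map (\<lambda>p. p + 2) ps) (1\<^sub>m (2 ^ Suc n))
     = kron w (foldr (\<lambda>p M. (if x' p then majorana n p else 1\<^sub>m (2^n)) * M) ps (1\<^sub>m (2^n)))"
proof (induction ps)
  case Nil
  show ?case by (rule bexI[of _ "1\<^sub>m 2"]) (auto simp: kron_one)
next
  case (Cons p ps)
  define W where "W = foldr (\<lambda>p M. (if x' p then majorana n p else 1\<^sub>m (2^n)) * M) ps (1\<^sub>m (2^n))"
  have cW: "W \<in> carrier_mat (2^n) (2^n)" unfolding W_def by (rule mono_fold_carrier) (use Cons in auto)
  have p: "p \<in> {1..2*n}" using Cons.prems by simp
  from Cons obtain w where w: "w \<in> {1\<^sub>m 2, pauli_z}" and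
    IH: "\<And>x. (\<forall>p\<ge>1. x (p + 2) = x' p) \<Longrightarrow> foldr (\<lambda>p M. (if x p then majorana (Suc n) p else 1\<^sub>m (2 ^ Suc n)) * M) (map (\<lambda>p. p + 2) ps) (1\<^sub>m (2 ^ Suc n)) = kron w W"
    unfolding W_def by auto
  have cw: "w \<in> carrier_mat 2 2" using w by auto
  show ?case
  proof (cases "x' p")
    case True
    have "pauli_z * w \<in> {1\<^sub>m 2, pauli_z}" using w by (auto simp: pauli_mult right_mult_one_mat[of _ 2 2])
    moreover have "majorana (Suc n) (p + 2) * kron w W = kron (pauli_z * w) (majorana n p * W)"
      using majorana_Suc[of p n] p cw cW majorana_carrier[OF p] by (simp add: kron_mult[of _ 2 _ _ "2^n"])
    moreover have "(if x (p + 2) then A else B) = A" if "\<forall>p\<ge>1. x (p + 2) = x' p" for x and A B :: "complex mat"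
      using that p True by auto
    ultimately show ?thesis
      by (intro bexI[of _ "pauli_z * w"] allI impI)
        (simp_all only: list.map foldr.simps o_apply if_True IH True W_def[symmetric])
  next
    case False
    have "1\<^sub>m (2 ^ Suc n) * kron w W = kron w W" using kron_carrier[OF cw cW] by simp
    moreover have "1\<^sub>m (2^n) * W = W" using cW by simp
    moreover have "(if x (p + 2) then A else B) = B" if "\<forall>p\<ge>1. x (p + 2) = x' p" for x and A B :: "complex mat"
      using that p False by auto
    ultimately show ?thesis using w
      by (intro bexI[of _ w] allI impI)
        (simp_all only: list.map foldr.simps o_apply if_False IH False W_def[symmetric])
  qed
qed

text \<open>Induction on the qubits. Whatever the tail factor w, the four choices of the first two
  exponents produce all four Pauli matrices on the first qubit up to nonzero scalars. Linearity
  reaches every 2-by-2 first factor, the induction hypothesis every second factor, and matrix units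
  every block matrix.\<close>

lemma majorana_span:
  assumes "A \<in> carrier_mat (2^n) (2^n)"
    and "\<And>A B. A \<in> carrier_mat (2^n) (2^n) \<Longrightarrow> B \<in> carrier_mat (2^n) (2^n) \<Longrightarrow> P A \<Longrightarrow> P B \<Longrightarrow> P (A + B)"
    and "\<And>z A. A \<in> carrier_mat (2^n) (2^n) \<Longrightarrow> P A \<Longrightarrow> P (z \<cdot>\<^sub>m A)"
    and "\<And>x. P (majorana_mono n x)"
  shows "P A"
  using assms
proof (induction n arbitrary: P A)
  case 0
  have "majorana_mono 0 (\<lambda>_. False) = 1\<^sub>m 1" by (simp add: majorana_mono_def)
  moreover have "A = A $$ (0,0) \<cdot>\<^sub>m 1\<^sub>m 1" by (rule eq_matI) (use 0 in auto)
  ultimately show ?case using 0(3)[of "1\<^sub>m 1" "A $$ (0,0)"] 0(4)[of "\<lambda>_. False"] by simp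
next
  case (Suc n P C)
  let ?M = "2^n :: nat"
  have cc: "kron A B \<in> carrier_mat (2 ^ Suc n) (2 ^ Suc n)" if "A \<in> carrier_mat 2 2" "B \<in> carrier_mat ?M ?M" for A B
    using kron_carrier[OF that] by simp
  have scl: "P (kron A B)" if "A \<in> carrier_mat 2 2" "B \<in> carrier_mat ?M ?M" "z \<noteq> 0" "P (kron (z \<cdot>\<^sub>m A) B)" for A B z
  proof -
    have "kron A B = (1/z) \<cdot>\<^sub>m kron (z \<cdot>\<^sub>m A) B"
      using that by (intro eq_matI) (auto simp: kron_smult_left[OF that(1,2)])
    moreover have "kron (z \<cdot>\<^sub>m A) B \<in> carrier_mat (2 ^ Suc n) (2 ^ Suc n)" using that cc by simp
    ultimately show ?thesis using Suc.prems(3) that(4) by metis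
  qed
  have pauli: "P (kron \<sigma> (majorana_mono n x'))" if \<sigma>: "\<sigma> \<in> {1\<^sub>m 2, pauli_x, pauli_y, pauli_z}" for \<sigma> x'
  proof -
    define m where "m = majorana_mono n x'"
    have cm: "m \<in> carrier_mat ?M ?M" unfolding m_def by (rule majorana_mono_carrier)
    have "set [1..<2*n+1] \<subseteq> {1..2*n}" by auto
    from mono_tail[OF this, of x'] obtain w where w: "w \<in> {1\<^sub>m 2, pauli_z}" and
      t: "\<And>x. (\<forall>p\<ge>1. x (p + 2) = x' p) \<Longrightarrow> foldr (\<lambda>p M. (if x p then majorana (Suc n) p else 1\<^sub>m (2 ^ Suc n)) * M) (map (\<lambda>p. p + 2) [1..<2*n+1]) (1\<^sub>m (2 ^ Suc n)) = kron w m"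
      unfolding m_def majorana_mono_def by auto
    have cw: "w \<in> carrier_mat 2 2" using w by auto
    have up: "[1..<2 * Suc n + 1] = 1 # 2 # map (\<lambda>p. p + 2) [1..<2*n+1]"
      by (rule nth_equalityI) (auto simp: nth_Cons split: nat.split simp del: upt_Suc)
    have ab: "P (kron ((if a then pauli_x else 1\<^sub>m 2) * ((if b then pauli_y else 1\<^sub>m 2) * w)) m)" for a b
    proof -
      define x where "x p = (if p = 1 then a else if p = 2 then b else x' (p - 2))" for p :: nat
      have x: "\<forall>p\<ge>1. x (p + 2) = x' p" "x 1 = a" "x 2 = b" by (auto simp: x_def)
      have o: "1\<^sub>m (2 ^ Suc n) = kron (1\<^sub>m 2) (1\<^sub>m ?M)" by (simp add: kron_one)
      have "majorana_mono (Suc n) x = (if a then majorana (Suc n) 1 else 1\<^sub>m (2 ^ Suc n)) * ((if b then majorana (Suc n) 2 else 1\<^sub>m (2 ^ Suc n)) * kron w m)"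
        unfolding majorana_mono_def up using t[OF x(1)] x by simp
      also have "\<dots> = kron (if a then pauli_x else 1\<^sub>m 2) (1\<^sub>m ?M) * (kron (if b then pauli_y else 1\<^sub>m 2) (1\<^sub>m ?M) * kron w m)"
        unfolding majorana_1 majorana_2 o by simp
      also have "\<dots> = kron ((if a then pauli_x else 1\<^sub>m 2) * ((if b then pauli_y else 1\<^sub>m 2) * w)) m"
        using cw cm by (simp add: kron_mult[of _ 2 _ _ "2^n"] mult_carrier_mat[of _ 2 2 _ 2])
      finally show ?thesis using Suc.prems(4)[of x] by simp
    qed
    have z: "pauli_x * (pauli_y * pauli_z) = \<i> \<cdot>\<^sub>m 1\<^sub>m 2"
      by (simp add: pauli_mult mult_smult_distrib[of _ 2 2 _ 2])
    have neg: "- (\<i> \<cdot>\<^sub>m pauli_y) = (-\<i>) \<cdot>\<^sub>m pauli_y" by (rule eq_matI) auto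
    note r1 = right_mult_one_mat[of _ 2 2] left_mult_one_mat[of _ 2 2]
    have "P (kron \<sigma> m)"
    proof (cases "w = 1\<^sub>m 2")
      case True
      have "P (kron (1\<^sub>m 2) m)" "P (kron pauli_y m)" "P (kron pauli_x m)" "P (kron (\<i> \<cdot>\<^sub>m pauli_z) m)"
        using ab[of False False] ab[of False True] ab[of True False] ab[of True True]
        by (simp_all add: True r1 pauli_mult)
      then show ?thesis using \<sigma> scl[OF _ cm, of pauli_z \<i>] by auto
    next
      case False
      then have w: "w = pauli_z" using w by simp
      have "P (kron pauli_z m)" "P (kron (\<i> \<cdot>\<^sub>m pauli_x) m)" "P (kron ((-\<i>) \<cdot>\<^sub>m pauli_y) m)" "P (kron (\<i> \<cdot>\<^sub>m 1\<^sub>m 2) m)"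
        using ab[of False False] ab[of False True] ab[of True False] ab[of True True]
        by (simp_all add: w r1 pauli_mult z neg mult_smult_distrib[of _ 2 2 _ 2])
      then show ?thesis using \<sigma> scl[OF _ cm, of pauli_x \<i>] scl[OF _ cm, of pauli_y "-\<i>"] scl[OF _ cm, of "1\<^sub>m 2" \<i>] by auto
    qed
    then show ?thesis unfolding m_def .
  qed
  have all2: "P (kron A (majorana_mono n x))" if A: "A \<in> carrier_mat 2 2" for A x
  proof -
    define m where "m = majorana_mono n x"
    have cm: "m \<in> carrier_mat ?M ?M" unfolding m_def by (rule majorana_mono_carrier)
    from mat2_pauli[OF A] obtain a b c e where e: "A = a \<cdot>\<^sub>m 1\<^sub>m 2 + b \<cdot>\<^sub>m pauli_x + c \<cdot>\<^sub>m pauli_y + e \<cdot>\<^sub>m pauli_z" .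
    have k: "kron A m = a \<cdot>\<^sub>m kron (1\<^sub>m 2) m + b \<cdot>\<^sub>m kron pauli_x m + c \<cdot>\<^sub>m kron pauli_y m + e \<cdot>\<^sub>m kron pauli_z m"
      unfolding e using cm by (simp add: kron_add_left[of _ 2 _ _ ?M] kron_smult_left[of _ 2 _ ?M])
    have t: "P (z \<cdot>\<^sub>m kron \<sigma> m) \<and> z \<cdot>\<^sub>m kron \<sigma> m \<in> carrier_mat (2 ^ Suc n) (2 ^ Suc n)" if "\<sigma> \<in> {1\<^sub>m 2, pauli_x, pauli_y, pauli_z}" for z \<sigma>
      using pauli[OF that, of x] that cc[OF _ cm, of \<sigma>] Suc.prems(3)[of "kron \<sigma> m" z] unfolding m_def by auto
    have "P (kron A m)" unfolding k
      by (intro Suc.prems(2) add_carrier_mat t[THEN conjunct1] t[THEN conjunct2]) auto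
    then show ?thesis unfolding m_def .
  qed
  have all: "P (kron A B)" if A: "A \<in> carrier_mat 2 2" and B: "B \<in> carrier_mat ?M ?M" for A B
    using B
  proof (rule Suc.IH[of B "\<lambda>B. P (kron A B)"])
    fix B D assume "B \<in> carrier_mat ?M ?M" "D \<in> carrier_mat ?M ?M" "P (kron A B)" "P (kron A D)"
    then show "P (kron A (B + D))" using Suc.prems(2) cc A by (simp add: kron_add_right[OF A])
  next
    fix z B assume "B \<in> carrier_mat ?M ?M" "P (kron A B)"
    then show "P (kron A (z \<cdot>\<^sub>m B))" using Suc.prems(3) cc A by (simp add: kron_smult_right[OF A])
  qed (use all2 A in auto)
  \<comment> \<open>C is cut into four blocks: \<open>E r s\<close> is the matrix unit and
    \<open>B r s\<close> the block at position (r, s).\<close>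
  define E where "E r s = mat 2 2 (\<lambda>(i,j). if i = r \<and> j = s then 1 else 0 :: complex)" for r s :: nat
  define B where "B r s = mat ?M ?M (\<lambda>(i,j). C $$ (r * ?M + i, s * ?M + j))" for r s
  have "C = kron (E 0 0) (B 0 0) + kron (E 0 1) (B 0 1) + kron (E 1 0) (B 1 0) + kron (E 1 1) (B 1 1)"
  proof (rule eq_matI)
    fix i j assume "i < dim_row (kron (E 0 0) (B 0 0) + kron (E 0 1) (B 0 1) + kron (E 1 0) (B 1 0) + kron (E 1 1) (B 1 1))"
      "j < dim_col (kron (E 0 0) (B 0 0) + kron (E 0 1) (B 0 1) + kron (E 1 0) (B 1 0) + kron (E 1 1) (B 1 1))"
    then have ij: "i < 2 * ?M" "j < 2 * ?M" by (auto simp: kron_def E_def B_def)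
    note b = div_mod_bounds[OF ij(1)] div_mod_bounds[OF ij(2)]
    have "i = i div ?M * ?M + i mod ?M" "j = j div ?M * ?M + j mod ?M"
      by (rule div_mult_mod_eq[symmetric])+
    moreover have "i div ?M = 0 \<or> i div ?M = 1" "j div ?M = 0 \<or> j div ?M = 1" using b by linarith+
    ultimately show "C $$ (i,j) = (kron (E 0 0) (B 0 0) + kron (E 0 1) (B 0 1) + kron (E 1 0) (B 1 0) + kron (E 1 1) (B 1 1)) $$ (i,j)"
      using ij b by (auto simp: kron_def E_def B_def)
  qed (use Suc.prems in \<open>auto simp: kron_def E_def B_def\<close>)
  moreover have "P (kron (E r s) (B r s))" "kron (E r s) (B r s) \<in> carrier_mat (2 ^ Suc n) (2 ^ Suc n)" for r s
    by (auto intro!: all cc simp: E_def B_def)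
  ultimately show ?case by (metis Suc.prems(2) add_carrier_mat)
qed

text \<open>Both sides are linear and agree on the Majorana monomials, which span. The same spanning
  argument shows that the image lies in the carrier.\<close>

lemma channel_flip_mixes:
  fixes \<Phi> :: "complex mat \<Rightarrow> complex mat"
  assumes add: "\<forall>A\<in>carrier_mat (2^n) (2^n). \<forall>B\<in>carrier_mat (2^n) (2^n). \<Phi> (A + B) = \<Phi> A + \<Phi> B"
    and smult: "\<forall>A\<in>carrier_mat (2^n) (2^n). \<forall>z. \<Phi> (z \<cdot>\<^sub>m A) = z \<cdot>\<^sub>m \<Phi> A"
    and mono: "\<forall>x. \<Phi> (majorana_mono n x)
                 = complex_of_real (\<Prod>p\<in>{p\<in>{1..2*n}. x p}. b p) \<cdot>\<^sub>m majorana_mono n x"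
    and A: "A \<in> carrier_mat (2^n) (2^n)"
  shows "\<Phi> A \<in> carrier_mat (2^n) (2^n) \<and> emb (2^n) (\<Phi> A) = flip_mixes (gop n) b [1..<2*n+1] (emb (2^n) A)"
  using A
proof (rule majorana_span)
  have fa: "flip_mixes g b is (x + y) = flip_mixes g b is x + flip_mixes g b is y" for g b "is" x y
    by (induction "is") (simp_all add: flip_mixes_def flip_mix_def algebra_simps)
  have fs: "flip_mixes g b is (z \<odot> x) = z \<odot> flip_mixes g b is x" for g b "is" x z
    by (induction "is") (simp_all add: flip_mixes_def flip_mix_def algebra_simps)
  fix A B assume "A \<in> carrier_mat (2^n) (2^n)" "B \<in> carrier_mat (2^n) (2^n)"
    "\<Phi> A \<in> carrier_mat (2^n) (2^n) \<and> emb (2^n) (\<Phi> A) = flip_mixes (gop n) b [1..<2*n+1] (emb (2^n) A)"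
    "\<Phi> B \<in> carrier_mat (2^n) (2^n) \<and> emb (2^n) (\<Phi> B) = flip_mixes (gop n) b [1..<2*n+1] (emb (2^n) B)"
  then show "\<Phi> (A + B) \<in> carrier_mat (2^n) (2^n) \<and> emb (2^n) (\<Phi> (A + B)) = flip_mixes (gop n) b [1..<2*n+1] (emb (2^n) (A + B))"
    using add by (simp add: emb_add fa del: upt_Suc)
next
  have fs: "flip_mixes g b is (z \<odot> x) = z \<odot> flip_mixes g b is x" for g b "is" x z
    by (induction "is") (simp_all add: flip_mixes_def flip_mix_def lop.scale_right_distrib mult.commute)
  fix A z assume "A \<in> carrier_mat (2^n) (2^n)"
    "\<Phi> A \<in> carrier_mat (2^n) (2^n) \<and> emb (2^n) (\<Phi> A) = flip_mixes (gop n) b [1..<2*n+1] (emb (2^n) A)"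
  then show "\<Phi> (z \<cdot>\<^sub>m A) \<in> carrier_mat (2^n) (2^n) \<and> emb (2^n) (\<Phi> (z \<cdot>\<^sub>m A)) = flip_mixes (gop n) b [1..<2*n+1] (emb (2^n) (z \<cdot>\<^sub>m A))"
    using smult by (simp add: emb_smult fs del: upt_Suc)
next
  fix x
  have s: "set [1..<2*n+1] = {1..2*n}" by auto
  have "prod_list (map (\<lambda>i. if x i then b i else 1) [1..<2*n+1]) = (\<Prod>i\<in>{1..2*n}. if x i then b i else 1)"
    using prod.distinct_set_conv_list[of "[1..<2*n+1]" "\<lambda>i. if x i then b i else 1"] s by simp
  also have "\<dots> = (\<Prod>p\<in>{p\<in>{1..2*n}. x p}. b p)" by (rule prod.inter_filter[symmetric]) simp
  finally show "\<Phi> (majorana_mono n x) \<in> carrier_mat (2^n) (2^n) \<and> emb (2^n) (\<Phi> (majorana_mono n x)) = flip_mixes (gop n) b [1..<2*n+1] (emb (2^n) (majorana_mono n x))"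
    using mono majorana_mono_carrier[of n x] flip_mixes_mono[of "[1..<2*n+1]" n b x] s by (simp add: emb_smult del: upt_Suc)
qed

subsection \<open>States and Gaussian base states\<close>

lemma hermitian_carrier_adj: "hermitian A \<Longrightarrow> adj A = A" by (simp add: hermitian_def)

lemma cscalar_adj:
  assumes A: "A \<in> carrier_mat m n" and v: "v \<in> carrier_vec n" and w: "w \<in> carrier_vec m"
  shows "(A *\<^sub>v v) \<bullet>c w = v \<bullet>c (adj A *\<^sub>v w)"
proof -
  have "(A *\<^sub>v v) \<bullet>c w = (\<Sum>i<m. \<Sum>j<n. A $$ (i,j) * v $ j * cnj (w $ i))"
    using assms by (simp add: scalar_prod_def atLeast0LessThan sum_distrib_right mult.assoc)
  also have "\<dots> = (\<Sum>j<n. \<Sum>i<m. A $$ (i,j) * v $ j * cnj (w $ i))" by (rule sum.swap)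
  also have "\<dots> = v \<bullet>c (adj A *\<^sub>v w)"
    using assms by (simp add: scalar_prod_def atLeast0LessThan sum_distrib_left adj_def mult_ac)
  finally show ?thesis .
qed

lemma quad_conj:
  assumes "A \<in> carrier_mat d d" "B \<in> carrier_mat d d" "v \<in> carrier_vec d"
  shows "((adj B * A * B) *\<^sub>v v) \<bullet>c v = (A *\<^sub>v (B *\<^sub>v v)) \<bullet>c (B *\<^sub>v v)"
proof -
  have "(adj B * A * B) *\<^sub>v v = adj B *\<^sub>v (A *\<^sub>v (B *\<^sub>v v))"
    using assms by (simp add: assoc_mult_mat_vec[of _ d d _ d] mult_carrier_mat[of _ d d _ d])
  then show ?thesis using cscalar_adj[of "adj B" d d "A *\<^sub>v (B *\<^sub>v v)" v] assms by simp
qed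

lemma quad_unit_vec:
  fixes A :: "complex mat"
  assumes "A \<in> carrier_mat d d" "i < d"
  shows "(A *\<^sub>v unit_vec d i) \<bullet>c unit_vec d i = A $$ (i,i)"
proof -
  have "conjugate (unit_vec d i :: complex vec) = unit_vec d i"
    by (rule eq_vecI) (auto simp: unit_vec_def)
  moreover have e: "(A *\<^sub>v unit_vec d i) $ k = A $$ (k,i)" if "k < d" for k
    using assms that by (simp add: scalar_prod_def unit_vec_def if_distrib[of "(*) _"] cong: if_cong)
  ultimately show ?thesis
    using assms by (simp add: scalar_prod_def[of _ "unit_vec d i"] e) (simp add: unit_vec_def if_distrib[of "(*) _"] cong: if_cong)
qed

lemma trace_add: "A \<in> carrier_mat d d \<Longrightarrow> B \<in> carrier_mat d d \<Longrightarrow> trace (A + B) = trace A + trace B"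
  by (simp add: trace_def sum.distrib)

lemma trace_smult: "A \<in> carrier_mat d d \<Longrightarrow> trace (z \<cdot>\<^sub>m A) = z * trace A"
  by (simp add: trace_def sum_distrib_left)

lemma trace_mult_comm: "A \<in> carrier_mat d d \<Longrightarrow> B \<in> carrier_mat d d \<Longrightarrow> trace (A * B) = trace (B * A)"
  using trd_emb[of "A * B" d] trd_emb[of "B * A" d] trd_comm[of d A "emb d B"]
  by (cases "d = 0") (simp_all add: emb_mult mult_carrier_mat[of _ d d _ d], simp add: trace_def)

lemma is_state_carrier: "is_state d \<rho> \<Longrightarrow> \<rho> \<in> carrier_mat d d" by (simp add: is_state_def)

lemma smult_mv: "(z \<cdot>\<^sub>m A) *\<^sub>v v = z \<cdot>\<^sub>v (A *\<^sub>v v)" if "dim_col A = dim_vec v" for z :: complex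
  by (rule eq_vecI) (use that in \<open>auto simp: scalar_prod_def sum_distrib_left mult.assoc\<close>)

lemma is_state_mix:
  assumes "is_state d \<rho>" "is_state d \<tau>" "0 \<le> a" "0 \<le> b" "a + b = 1"
  shows "is_state d (complex_of_real a \<cdot>\<^sub>m \<rho> + complex_of_real b \<cdot>\<^sub>m \<tau>)"
  unfolding is_state_def
proof (intro conjI ballI)
  note c = is_state_carrier[OF assms(1)] is_state_carrier[OF assms(2)]
  show "complex_of_real a \<cdot>\<^sub>m \<rho> + complex_of_real b \<cdot>\<^sub>m \<tau> \<in> carrier_mat d d" using c by simp
  have h: "hermitian \<rho>" "hermitian \<tau>" using assms by (auto simp: is_state_def)
  show "hermitian (complex_of_real a \<cdot>\<^sub>m \<rho> + complex_of_real b \<cdot>\<^sub>m \<tau>)"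
    using h c unfolding hermitian_def by (simp add: adj_add[of _ d d] adj_smult)
  show "trace (complex_of_real a \<cdot>\<^sub>m \<rho> + complex_of_real b \<cdot>\<^sub>m \<tau>) = 1"
    using assms c by (simp add: trace_add[of _ d] trace_smult[of _ d] is_state_def of_real_add[symmetric] del: of_real_add)
  fix v :: "complex vec" assume v: "v \<in> carrier_vec d"
  have "((complex_of_real a \<cdot>\<^sub>m \<rho> + complex_of_real b \<cdot>\<^sub>m \<tau>) *\<^sub>v v) \<bullet>c v
     = complex_of_real a * ((\<rho> *\<^sub>v v) \<bullet>c v) + complex_of_real b * ((\<tau> *\<^sub>v v) \<bullet>c v)"
    using c v by (simp add: add_mult_distrib_mat_vec[of _ d d] add_scalar_prod_distrib[of _ d] smult_mv)
  moreover have "0 \<le> Re ((\<rho> *\<^sub>v v) \<bullet>c v)" "0 \<le> Re ((\<tau> *\<^sub>v v) \<bullet>c v)" using assms v by (auto simp: is_state_def)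
  ultimately show "0 \<le> Re (((complex_of_real a \<cdot>\<^sub>m \<rho> + complex_of_real b \<cdot>\<^sub>m \<tau>) *\<^sub>v v) \<bullet>c v)"
    using assms by simp
qed

lemma is_state_conj:
  assumes \<rho>: "is_state d \<rho>" and U: "U \<in> carrier_mat d d" "adj U * U = 1\<^sub>m d"
  shows "is_state d (U * \<rho> * adj U)"
  unfolding is_state_def
proof (intro conjI ballI)
  note c = is_state_carrier[OF \<rho>] U(1) adj_carrier[OF U(1)]
  note m = mult_carrier_mat[of _ d d _ d]
  show cc: "U * \<rho> * adj U \<in> carrier_mat d d" using c by (simp add: m)
  have "adj \<rho> = \<rho>" using \<rho> by (simp add: is_state_def hermitian_def)
  then have "adj (U * \<rho> * adj U) = U * \<rho> * adj U"
    using c by (simp add: adj_mult[of _ d d _ d] m assoc_mult_mat[of _ d d _ d _ d])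
  then show "hermitian (U * \<rho> * adj U)" by (simp add: hermitian_def)
  have "trace (U * \<rho> * adj U) = trace (adj U * (U * \<rho>))"
    using c by (intro trace_mult_comm[of _ d]) (auto simp: m)
  also have "adj U * (U * \<rho>) = \<rho>"
    using c U(2) by (simp add: assoc_mult_mat[of _ d d _ d _ d, symmetric])
  finally show "trace (U * \<rho> * adj U) = 1" using \<rho> by (simp add: is_state_def)
  fix v :: "complex vec" assume v: "v \<in> carrier_vec d"
  have "adj U *\<^sub>v v \<in> carrier_vec d" using mult_mat_vec_carrier[OF adj_carrier[OF U(1)] v] .
  then have "0 \<le> Re ((\<rho> *\<^sub>v (adj U *\<^sub>v v)) \<bullet>c (adj U *\<^sub>v v))"
    using \<rho> unfolding is_state_def by blast
  then show "0 \<le> Re (((U * \<rho> * adj U) *\<^sub>v v) \<bullet>c v)"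
    using quad_conj[OF c(1) c(3) v, unfolded adj_adj] by (simp only: )
qed

section \<open>States under flips and bounds on expectations\<close>

definition state_op :: "nat \<Rightarrow> lop \<Rightarrow> bool" where
  "state_op d X \<longleftrightarrow> (\<exists>\<rho>. is_state d \<rho> \<and> X = emb d \<rho>)"

lemma state_op_flip_mix:
  assumes X: "state_op (2^n) X" and p: "p < 2*n+1" and c: "0 \<le> c" "c \<le> 1"
  shows "state_op (2^n) (flip_mix c (gop n p) X)"
proof -
  from X obtain \<rho> where \<rho>: "is_state (2^n) \<rho>" "X = emb (2^n) \<rho>" by (auto simp: state_op_def)
  let ?G = "gmat n p"
  note g = gmat_carrier[OF p] gmat_adj[OF p] gmat_sq[OF p]
  have s: "is_state (2^n) (?G * \<rho> * ?G)" using is_state_conj[OF \<rho>(1), of ?G] g by simp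
  let ?\<tau> = "complex_of_real ((1 + c) / 2) \<cdot>\<^sub>m \<rho> + complex_of_real ((1 - c) / 2) \<cdot>\<^sub>m (?G * \<rho> * ?G)"
  have "is_state (2^n) ?\<tau>" by (rule is_state_mix[OF \<rho>(1) s]) (use c in \<open>auto simp: field_simps\<close>)
  moreover have "emb (2^n) ?\<tau> = flip_mix c (gop n p) X"
    using is_state_carrier[OF \<rho>(1)] g(1) mult_carrier_mat[of _ "2^n" "2^n" _ "2^n"]
    by (simp add: flip_mix_def \<rho>(2) gop_def emb_add emb_smult emb_mult mult.assoc)
  ultimately show ?thesis unfolding state_op_def by metis
qed

lemma state_op_flip_mixes:
  assumes X: "state_op (2^n) X"
  shows "set is \<subseteq> {..<2*n+1} \<Longrightarrow> (\<And>i. i \<in> set is \<Longrightarrow> 0 \<le> b i \<and> b i \<le> 1) \<Longrightarrow> state_op (2^n) (flip_mixes (gop n) b is X)"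
  by (induction "is") (use X state_op_flip_mix in \<open>auto simp: flip_mixes_def\<close>)

text \<open>For E = 1 + W or E = 1 - W one has E E = 2 E, so 2 tr(\<rho> E) = tr(E \<rho> E) is the
  trace of a matrix with nonnegative diagonal. The two signs give the two inequalities.\<close>

lemma state_trace_bound:
  assumes \<rho>: "is_state d \<rho>" and W: "W \<in> carrier_mat d d" "adj W = W" "W * W = 1\<^sub>m d"
  shows "\<bar>Re (trace (\<rho> * W))\<bar> \<le> 1"
proof -
  note c = is_state_carrier[OF \<rho>]
  note m = mult_carrier_mat[of _ d d _ d]
  have "0 \<le> 1 + s * Re (trace (\<rho> * W))" if s: "s = 1 \<or> s = -1" for s :: real
  proof -
    define E where "E = 1\<^sub>m d + complex_of_real s \<cdot>\<^sub>m W"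
    have cE: "E \<in> carrier_mat d d" using W by (simp add: E_def)
    have aE: "adj E = E" using W by (simp add: E_def adj_add[of _ d d] adj_smult pauli_adj)
    have EE: "E * E = 2 \<cdot>\<^sub>m E"
    proof -
      have "E * E = 1\<^sub>m d + complex_of_real s \<cdot>\<^sub>m W + (complex_of_real s \<cdot>\<^sub>m W + complex_of_real s \<cdot>\<^sub>m (complex_of_real s \<cdot>\<^sub>m (W * W)))"
        unfolding E_def using W(1)
        by (simp add: add_mult_distrib_mat[of _ d d _ _ d] mult_add_distrib_mat[of _ d d _ d] mult_smult_distrib[of _ d d _ d] mult_smult_assoc_mat[of _ d d _ d]
            add_smult_distrib_left_mat[of _ d d] m)
      also have "\<dots> = 2 \<cdot>\<^sub>m E"
        using W s by (intro eq_matI) (auto simp: E_def)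
      finally show ?thesis .
    qed
    have "0 \<le> Re ((E * \<rho> * E) $$ (i,i))" if i: "i < d" for i
    proof -
      have "(E * \<rho> * E) $$ (i,i) = ((adj E * \<rho> * E) *\<^sub>v unit_vec d i) \<bullet>c unit_vec d i"
        using quad_unit_vec[of "E * \<rho> * E" d i] cE c i by (simp add: aE m)
      also have "\<dots> = (\<rho> *\<^sub>v (E *\<^sub>v unit_vec d i)) \<bullet>c (E *\<^sub>v unit_vec d i)"
        using cE c by (intro quad_conj) auto
      finally show ?thesis using \<rho> cE by (simp add: is_state_def)
    qed
    then have "0 \<le> Re (trace (E * \<rho> * E))" using cE c by (auto simp: trace_def intro: sum_nonneg)
    also have "trace (E * \<rho> * E) = trace (\<rho> * (E * E))"
      using trace_mult_comm[of E d "\<rho> * E"] cE c by (simp add: m assoc_mult_mat[of _ d d _ d _ d])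
    also have "\<dots> = 2 * (trace \<rho> + complex_of_real s * trace (\<rho> * W))"
      unfolding EE unfolding E_def using c W(1)
      by (simp add: mult_smult_distrib[of _ d d _ d] trace_smult[of _ d] m mult_add_distrib_mat[of _ d d _ d] trace_add[of _ d])
    finally show ?thesis using \<rho> by (simp add: is_state_def)
  qed
  from this[of 1] this[of "-1"] show ?thesis by auto
qed

definition herm_inv :: "nat \<Rightarrow> lop \<Rightarrow> bool" where
  "herm_inv d x \<longleftrightarrow> (\<exists>W \<in> carrier_mat d d. adj W = W \<and> W * W = 1\<^sub>m d \<and> x = emb d W)"

text \<open>Flips are transferred from the state to the observable, so the class of observables has
  to be stable under conjugation by the generators.\<close>

lemma herm_inv_conj:
  assumes "herm_inv (2^n) x" and p: "p < 2*n+1" shows "herm_inv (2^n) (gop n p * x * gop n p)"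
proof -
  from assms obtain W where W: "W \<in> carrier_mat (2^n) (2^n)" "adj W = W" "W * W = 1\<^sub>m (2^n)" "x = emb (2^n) W"
    by (auto simp: herm_inv_def)
  let ?d = "2^n :: nat"
  note m = mult_carrier_mat[of _ ?d ?d _ ?d] and a = assoc_mult_mat[of _ ?d ?d _ ?d _ ?d]
  let ?G = "gmat n p"
  note g = gmat_carrier[OF p] gmat_adj[OF p] gmat_sq[OF p]
  have "?G * W * ?G * (?G * W * ?G) = ?G * W * (?G * ?G) * (W * ?G)" using W(1) g(1) by (simp add: m a)
  also have "\<dots> = ?G * (W * W) * ?G" using W(1) g by (simp add: m a)
  also have "\<dots> = 1\<^sub>m ?d" using W g by simp
  finally have "?G * W * ?G * (?G * W * ?G) = 1\<^sub>m ?d" .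
  moreover have "adj (?G * W * ?G) = ?G * W * ?G"
    using W g by (simp add: adj_mult[of _ ?d ?d _ ?d] m a)
  moreover have "gop n p * x * gop n p = emb ?d (?G * W * ?G)" using W g by (simp add: gop_def emb_mult m mult.assoc)
  moreover have "?G * W * ?G \<in> carrier_mat ?d ?d" using W g by (simp add: m)
  ultimately show ?thesis unfolding herm_inv_def by blast
qed

text \<open>Sign flips of weight larger than one still act as quasi-mixtures, whose total mass
  is the product of the weights exceeding one.\<close>
lemma trace_flip_mixes_bound:
  assumes X: "state_op (2^n) X"
  shows "set is \<subseteq> {..<2*n+1} \<Longrightarrow> (\<And>i. i \<in> set is \<Longrightarrow> 0 \<le> b i) \<Longrightarrow> herm_inv (2^n) W \<Longrightarrow>
    \<bar>Re (trd (2^n) (W * flip_mixes (gop n) b is X))\<bar> \<le> prod_list (map (\<lambda>i. max 1 (b i)) is)"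
proof (induction "is" arbitrary: W)
  case Nil
  from X obtain \<rho> where \<rho>: "is_state (2^n) \<rho>" "X = emb (2^n) \<rho>" by (auto simp: state_op_def)
  from Nil(3) obtain V where V: "V \<in> carrier_mat (2^n) (2^n)" "adj V = V" "V * V = 1\<^sub>m (2^n)" "W = emb (2^n) V"
    by (auto simp: herm_inv_def)
  have "trd (2^n) (W * X) = trace (\<rho> * V)"
    using is_state_carrier[OF \<rho>(1)] V(1) unfolding V(4) \<rho>(2)
    using trace_mult_comm[of V "2^n" \<rho>] by (simp add: trd_emb emb_mult[symmetric] mult_carrier_mat[of _ "2^n" "2^n" _ "2^n"])
  then show ?case using state_trace_bound[OF \<rho>(1) V(1-3)] by (simp add: flip_mixes_def)
next
  case (Cons i "is")
  define Y where "Y = flip_mixes (gop n) b is X"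
  have i: "i < 2*n+1" using Cons.prems by simp
  let ?P = "prod_list (map (\<lambda>i. max 1 (b i)) is)"
  define s where "s = Re (trd (2^n) (W * Y))"
  define t where "t = Re (trd (2^n) (gop n i * W * gop n i * Y))"
  have s: "\<bar>s\<bar> \<le> ?P" and t: "\<bar>t\<bar> \<le> ?P"
    unfolding s_def t_def Y_def using Cons herm_inv_conj[OF Cons.prems(3) i] by auto
  \<comment> \<open>Passage to the Heisenberg picture: the flip moves from Y to W, and the induction
    hypothesis covers the conjugated observable.\<close>
  have "trd (2^n) (W * (gop n i * Y * gop n i)) = trd (2^n) (gop n i * W * gop n i * Y)"
    using cliff.trc[OF i, of "W * gop n i * Y"] by (simp add: mult.assoc)
  then have "trd (2^n) (W * flip_mixes (gop n) b (i # is) X)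
     = of_real ((1 + b i) / 2) * trd (2^n) (W * Y) + of_real ((1 - b i) / 2) * trd (2^n) (gop n i * W * gop n i * Y)"
    by (simp add: flip_mixes_def Y_def[unfolded flip_mixes_def, symmetric] flip_mix_def algebra_simps)
  then have "Re (trd (2^n) (W * flip_mixes (gop n) b (i # is) X)) = (1 + b i) / 2 * s + (1 - b i) / 2 * t"
    by (simp add: s_def t_def)
  also have "\<bar>\<dots>\<bar> \<le> (1 + b i) / 2 * \<bar>s\<bar> + \<bar>1 - b i\<bar> / 2 * \<bar>t\<bar>"
    using Cons.prems(2)[of i] abs_triangle_ineq[of "(1 + b i) / 2 * s" "(1 - b i) / 2 * t"] by (simp add: abs_mult)
  also have "\<dots> \<le> (1 + b i) / 2 * ?P + \<bar>1 - b i\<bar> / 2 * ?P"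
    using Cons.prems(2)[of i] s t by (intro add_mono mult_left_mono) auto
  \<comment> \<open>The absolute weights add up to (1+b)/2 + |1-b|/2 = max(1, b).\<close>
  also have "\<dots> = max 1 (b i) * ?P" by (auto simp: max_def field_simps abs_if)
  finally show ?case by simp
qed

section \<open>Diagonal base states and their covariance matrix\<close>

lemma sigz_1: "sigz (Suc n) 1 = kron pauli_z (1\<^sub>m (2^n))"
proof -
  have e: "map (\<lambda>k. if k = 1 then pauli_z else 1\<^sub>m 2) [1..<Suc n + 1] = pauli_z # map (\<lambda>k. 1\<^sub>m 2) [1..<n+1]"
    unfolding upt_1_Suc by auto
  show ?thesis unfolding sigz_def e by (simp add: kron_list_one del: upt_Suc)
qed

lemma sigz_Suc: assumes "j \<ge> 1" shows "sigz (Suc n) (Suc j) = kron (1\<^sub>m 2) (sigz n j)"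
proof -
  have e: "map (\<lambda>k. if k = Suc j then pauli_z else 1\<^sub>m 2) [1..<Suc n + 1] = 1\<^sub>m 2 # map (\<lambda>k. if k = j then pauli_z else 1\<^sub>m 2) [1..<n+1]"
    unfolding upt_1_Suc using assms by (simp add: comp_def del: upt_Suc)
  show ?thesis unfolding sigz_def e by (rule kron_list.simps)
qed

lemma sigz_cases:
  assumes "j \<in> {1..Suc n}" obtains "j = 1" | j' where "j' \<in> {1..n}" "j = Suc j'"
  using assms by (cases j) (auto simp: not_less_eq_eq, metis Suc_leI neq0_conv)

definition nonneg_diag :: "nat \<Rightarrow> complex mat \<Rightarrow> bool" where
  "nonneg_diag d A \<longleftrightarrow> A \<in> carrier_mat d d \<and> (\<forall>i<d. \<forall>j<d. i \<noteq> j \<longrightarrow> A $$ (i,j) = 0)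
     \<and> (\<forall>i<d. \<exists>r\<ge>0. A $$ (i,i) = complex_of_real r)"

lemma nonneg_diag_mult:
  assumes "nonneg_diag d A" "nonneg_diag d B" shows "nonneg_diag d (A * B)"
proof -
  have c: "A \<in> carrier_mat d d" "B \<in> carrier_mat d d" using assms by (auto simp: nonneg_diag_def)
  have e: "(A * B) $$ (i,j) = (if i = j then A $$ (i,i) * B $$ (i,i) else 0)" if "i < d" "j < d" for i j
  proof -
    have "(A * B) $$ (i,j) = (\<Sum>k<d. A $$ (i,k) * B $$ (k,j))"
      using c that by (simp add: scalar_prod_def atLeast0LessThan)
    also have "\<dots> = (\<Sum>k<d. if k = i then (if i = j then A $$ (i,i) * B $$ (i,i) else 0) else 0)"
      using assms that by (intro sum.cong refl) (auto simp: nonneg_diag_def)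
    finally show ?thesis using that by simp
  qed
  show ?thesis unfolding nonneg_diag_def
  proof (intro conjI allI impI)
    show "A * B \<in> carrier_mat d d" using c by (rule mult_carrier_mat)
    fix i assume i: "i < d"
    from assms i obtain r s where "r \<ge> 0" "A $$ (i,i) = complex_of_real r" "s \<ge> 0" "B $$ (i,i) = complex_of_real s"
      unfolding nonneg_diag_def by metis
    then show "\<exists>r\<ge>0. (A * B) $$ (i,i) = complex_of_real r" using e[OF i i] by (intro exI[of _ "r * s"]) simp
  qed (use e in auto)
qed

lemma nonneg_diag_state:
  assumes "nonneg_diag d A" "trace A = 1" shows "is_state d A"
  unfolding is_state_def
proof (intro conjI ballI)
  show c: "A \<in> carrier_mat d d" using assms by (simp add: nonneg_diag_def)
  show "trace A = 1" by fact
  show "hermitian A" unfolding hermitian_def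
  proof (rule eq_matI)
    fix i j assume "i < dim_row (adj A)" "j < dim_col (adj A)"
    then have ij: "i < d" "j < d" using c by (auto simp: adj_def)
    show "A $$ (i,j) = adj A $$ (i,j)"
    proof (cases "i = j")
      case True
      then obtain r where "A $$ (i,i) = complex_of_real r" using assms ij unfolding nonneg_diag_def by metis
      then show ?thesis using True ij c by (simp add: adj_def)
    next
      case False then show ?thesis using assms ij c by (simp add: adj_def nonneg_diag_def)
    qed
  qed (use c in \<open>auto simp: adj_def\<close>)
  fix v :: "complex vec" assume v: "v \<in> carrier_vec d"
  have "(A *\<^sub>v v) \<bullet>c v = (\<Sum>i<d. (\<Sum>j<d. A $$ (i,j) * v $ j) * cnj (v $ i))"
    using c v by (simp add: scalar_prod_def atLeast0LessThan)
  also have "\<dots> = (\<Sum>i<d. A $$ (i,i) * v $ i * cnj (v $ i))"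
  proof (intro sum.cong refl)
    fix i assume i: "i \<in> {..<d}"
    have "(\<Sum>j<d. A $$ (i,j) * v $ j) = (\<Sum>j<d. if j = i then A $$ (i,i) * v $ i else 0)"
      using assms i by (intro sum.cong refl) (auto simp: nonneg_diag_def)
    then show "(\<Sum>j<d. A $$ (i,j) * v $ j) * cnj (v $ i) = A $$ (i,i) * v $ i * cnj (v $ i)" using i by simp
  qed
  finally have q: "Re ((A *\<^sub>v v) \<bullet>c v) = (\<Sum>i<d. Re (A $$ (i,i) * v $ i * cnj (v $ i)))" by simp
  show "0 \<le> Re ((A *\<^sub>v v) \<bullet>c v)" unfolding q
  proof (rule sum_nonneg)
    fix i assume "i \<in> {..<d}"
    then obtain r where r: "r \<ge> 0" "A $$ (i,i) = complex_of_real r" using assms unfolding nonneg_diag_def by auto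
    have "Re (A $$ (i,i) * v $ i * cnj (v $ i)) = r * (Re (v $ i) ^ 2 + Im (v $ i) ^ 2)"
      by (simp add: r(2) algebra_simps power2_eq_square)
    then show "0 \<le> Re (A $$ (i,i) * v $ i * cnj (v $ i))" using r by simp
  qed
qed

text \<open>In the product of the two Majorana operators of qubit j the strings of
  \<open>pauli_z\<close> cancel, and \<open>pauli_x * pauli_y\<close> is left at site j. The third
  conjunct makes every factor of \<open>rho_lambda\<close> a nonnegative diagonal matrix.\<close>

lemma sigz_props:
  "j \<in> {1..n} \<Longrightarrow> sigz n j \<in> carrier_mat (2^n) (2^n) \<and> majorana n (2*j-1) * majorana n (2*j) = \<i> \<cdot>\<^sub>m sigz n j
    \<and> (\<forall>r. \<bar>r\<bar> \<le> 1 \<longrightarrow> nonneg_diag (2^n) (1\<^sub>m (2^n) + complex_of_real r \<cdot>\<^sub>m sigz n j))"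
proof (induction n arbitrary: j)
  case (Suc n)
  have o: "1\<^sub>m (2 ^ Suc n) = kron (1\<^sub>m 2) (1\<^sub>m (2^n))" by (simp add: kron_one)
  from Suc.prems show ?case
  proof (cases rule: sigz_cases)
    case 1
    have "nonneg_diag (2 ^ Suc n) (1\<^sub>m (2 ^ Suc n) + complex_of_real r \<cdot>\<^sub>m sigz (Suc n) j)" if "\<bar>r\<bar> \<le> 1" for r
    proof -
      have "(1\<^sub>m (2 ^ Suc n) + complex_of_real r \<cdot>\<^sub>m sigz (Suc n) j) $$ (k,l) = (if k = l then complex_of_real (if k div 2^n = 0 then 1 + r else 1 - r) else 0)"
        if kl: "k < 2 ^ Suc n" "l < 2 ^ Suc n" for k l
      proof -
        have kl': "k < 2 * 2 ^ n" "l < 2 * 2 ^ n" using kl by auto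
        note b = div_mod_bounds[OF kl'(1)] div_mod_bounds[OF kl'(2)]
        have "k div 2^n = l div 2^n \<and> k mod 2^n = l mod 2^n \<longleftrightarrow> k = l" by (metis div_mult_mod_eq)
        then show ?thesis unfolding 1 sigz_1 using kl b
          by (auto simp: kron_def pauli_index carrier_matD[OF pauli_carrier(3)])
      qed
      moreover have "1 + r \<ge> 0" "1 - r \<ge> 0" using that by auto
      moreover have "1\<^sub>m (2 ^ Suc n) + complex_of_real r \<cdot>\<^sub>m sigz (Suc n) j \<in> carrier_mat (2 ^ Suc n) (2 ^ Suc n)"
        unfolding 1 sigz_1 using kron_carrier[of pauli_z 2 "1\<^sub>m (2^n)" "2^n"] by simp
      ultimately show ?thesis unfolding nonneg_diag_def by auto
    qed
    moreover have "majorana (Suc n) (2*j-1) * majorana (Suc n) (2*j) = \<i> \<cdot>\<^sub>m sigz (Suc n) j"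
      using 1 majorana_1[of n] majorana_2[of n] sigz_1[of n]
      by (simp add: kron_mult[of _ 2 _ _ "2^n"] pauli_mult kron_smult_left[of _ 2 _ "2^n"])
    moreover have "sigz (Suc n) j \<in> carrier_mat (2 ^ Suc n) (2 ^ Suc n)"
      unfolding 1 sigz_1 using kron_carrier[of pauli_z 2 "1\<^sub>m (2^n)" "2^n"] by simp
    ultimately show ?thesis by blast
  next
    case (2 j')
    note I = Suc.IH[OF 2(1)]
    have s: "sigz (Suc n) j = kron (1\<^sub>m 2) (sigz n j')" using sigz_Suc[of j' n] 2 by simp
    have cs: "sigz n j' \<in> carrier_mat (2^n) (2^n)" using I by simp
    have "nonneg_diag (2 ^ Suc n) (1\<^sub>m (2 ^ Suc n) + complex_of_real r \<cdot>\<^sub>m sigz (Suc n) j)" if "\<bar>r\<bar> \<le> 1" for r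
    proof -
      define B where "B = 1\<^sub>m (2^n) + complex_of_real r \<cdot>\<^sub>m sigz n j'"
      have cB: "B \<in> carrier_mat (2^n) (2^n)" using cs by (simp add: B_def)
      have B: "nonneg_diag (2^n) B" using I that by (simp add: B_def)
      have e: "1\<^sub>m (2 ^ Suc n) + complex_of_real r \<cdot>\<^sub>m sigz (Suc n) j = kron (1\<^sub>m 2) B"
        unfolding o s B_def using cs by (simp add: kron_add_right[of _ 2 _ "2^n"] kron_smult_right[of _ 2 _ "2^n"])
      have k: "kron (1\<^sub>m 2) B $$ (k,l) = (if k div 2^n = l div 2^n then B $$ (k mod 2^n, l mod 2^n) else 0)"
        if "k < 2 ^ Suc n" "l < 2 ^ Suc n" for k l
        using that cB div_mod_bounds[of k 2 "2^n"] div_mod_bounds[of l 2 "2^n"] by (auto simp: kron_def)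
      have m: "k mod 2^n < 2^n" for k :: nat by simp
      show ?thesis unfolding e nonneg_diag_def
      proof (intro conjI allI impI)
        show "kron (1\<^sub>m 2) B \<in> carrier_mat (2 ^ Suc n) (2 ^ Suc n)" using kron_carrier[of "1\<^sub>m 2" 2 B "2^n"] cB by simp
        fix k assume kk: "k < (2::nat) ^ Suc n"
        show "\<exists>r\<ge>0. kron (1\<^sub>m 2) B $$ (k,k) = complex_of_real r" using k[OF kk kk] B m[of k] by (simp add: nonneg_diag_def)
        fix l assume l: "l < (2::nat) ^ Suc n" and "k \<noteq> l"
        then have "k div 2^n = l div 2^n \<Longrightarrow> k mod 2^n \<noteq> l mod 2^n" by (metis div_mult_mod_eq)
        then show "kron (1\<^sub>m 2) B $$ (k,l) = 0" using k[OF kk l] B m[of k] m[of l] by (auto simp: nonneg_diag_def)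
      qed
    qed
    moreover have "majorana (Suc n) (2*j-1) * majorana (Suc n) (2*j) = \<i> \<cdot>\<^sub>m sigz (Suc n) j"
    proof -
      have j: "2 * j - 1 = (2 * j' - 1) + 2" "2 * j = 2 * j' + 2" and p: "2*j'-1 \<in> {1..2*n}" "2*j' \<in> {1..2*n}" using 2 by auto
      show ?thesis unfolding j s using majorana_Suc[of "2*j'-1" n] majorana_Suc[of "2*j'" n] p
          majorana_carrier[OF p(1)] majorana_carrier[OF p(2)] I
        by (simp add: kron_mult[of _ 2 _ _ "2^n"] pauli_mult kron_smult_right[of _ 2 _ "2^n"])
    qed
    moreover have "sigz (Suc n) j \<in> carrier_mat (2 ^ Suc n) (2 ^ Suc n)"
      using kron_carrier[of "1\<^sub>m 2" 2 "sigz n j'" "2^n"] cs by (simp add: s)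
    ultimately show ?thesis by blast
  qed
qed simp

lemma emb_sigz: assumes "j \<in> {1..n}" shows "emb (2^n) (sigz n j) = (- \<i>) \<odot> (gop n (2*j-1) * gop n (2*j))"
proof -
  have p: "2*j-1 \<in> {1..2*n}" "2*j \<in> {1..2*n}" using assms by auto
  have "\<i> \<odot> emb (2^n) (sigz n j) = maj n (2*j-1) * maj n (2*j)"
    using sigz_props[OF assms] majorana_carrier[OF p(1)] majorana_carrier[OF p(2)]
    by (simp add: maj_def emb_mult[symmetric] emb_smult)
  then have "(- \<i>) \<odot> \<i> \<odot> emb (2^n) (sigz n j) = (- \<i>) \<odot> (gop n (2*j-1) * gop n (2*j))"
    using gop_mult[OF p] by simp
  then show ?thesis by simp
qed

lemma gop_comm_pair:
  assumes "p < 2*n+1" "q < 2*n+1" "r < 2*n+1" "p \<noteq> q" "p \<noteq> r"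
  shows "gop n p * (z \<odot> (gop n q * gop n r)) = z \<odot> (gop n q * gop n r) * gop n p"
proof -
  have "gop n p * (gop n q * gop n r) = - (gop n q * (gop n p * gop n r))"
    using cliff.anti[OF assms(1,2,4)] by (simp add: mult.assoc[symmetric])
  also have "\<dots> = gop n q * gop n r * gop n p"
    using cliff.anti[OF assms(1,3,5)] by (simp add: mult.assoc)
  finally show ?thesis by simp
qed

text \<open>The unnormalized base state over an arbitrary list of qubits, which allows induction on
  the list.\<close>

definition rho_fold :: "nat \<Rightarrow> (nat \<Rightarrow> real) \<Rightarrow> nat list \<Rightarrow> lop" where
  "rho_fold n lam js = foldr (\<lambda>j x. (1 + of_real (lam j) \<odot> emb (2^n) (sigz n j)) * x) js 1"

lemma rho_fold_emb:
  "set js \<subseteq> {1..n} \<Longrightarrow>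
   (foldr (\<lambda>j M. (1\<^sub>m (2^n) + complex_of_real (lam j) \<cdot>\<^sub>m sigz n j) * M) js (1\<^sub>m (2^n))) \<in> carrier_mat (2^n) (2^n) \<and>
   emb (2^n) (foldr (\<lambda>j M. (1\<^sub>m (2^n) + complex_of_real (lam j) \<cdot>\<^sub>m sigz n j) * M) js (1\<^sub>m (2^n))) = rho_fold n lam js"
proof (induction js)
  case (Cons j js)
  have c: "sigz n j \<in> carrier_mat (2^n) (2^n)" using Cons.prems sigz_props[of j n] by simp
  show ?case using Cons c by (auto simp: rho_fold_def emb_mult emb_add emb_smult emb_one mult_carrier_mat[of _ "2^n" "2^n" _ "2^n"])
qed (simp add: rho_fold_def emb_one)

lemma rho_fold_comm:
  "set js \<subseteq> {1..n} \<Longrightarrow> p < 2*n+1 \<Longrightarrow> (\<And>j. j \<in> set js \<Longrightarrow> p \<noteq> 2*j-1 \<and> p \<noteq> 2*j) \<Longrightarrow>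
    gop n p * rho_fold n lam js = rho_fold n lam js * gop n p"
proof (induction js)
  case (Cons j js)
  have j: "j \<in> {1..n}" using Cons.prems by simp
  define A where "A = 1 + of_real (lam j) \<odot> emb (2^n) (sigz n j)"
  have "gop n p * emb (2^n) (sigz n j) = emb (2^n) (sigz n j) * gop n p"
    unfolding emb_sigz[OF j] by (rule gop_comm_pair) (use Cons.prems j in auto)
  then have a: "gop n p * A = A * gop n p" by (simp add: A_def algebra_simps)
  have b: "gop n p * rho_fold n lam js = rho_fold n lam js * gop n p" using Cons by simp
  have "rho_fold n lam (j # js) = A * rho_fold n lam js" by (simp add: rho_fold_def A_def)
  then show ?case using a b by (metis mult.assoc)
qed (simp add: rho_fold_def)

text \<open>The involution K = - \<i> G H anticommutes with G and with H. A commutator with 1 + k K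
  therefore sees only the k-term and an anticommutator only the 1; G K = - \<i> H and H K = \<i> G
  match the two sides.\<close>

lemma mode_rel_factor:
  assumes "G * G = 1" "H * H = 1" "G * H = - (H * G)" and YG: "Y * G = G * Y" and YH: "Y * H = H * Y"
  shows "mode_rel G H k ((1 + of_real k \<odot> (- \<i>) \<odot> (G * H)) * Y)"
proof -
  have GG: "G * (G * x) = x" and HH: "H * (H * x) = x" for x
    using assms(1,2) by (metis mult.assoc mult_1)+
  have HG: "H * (G * x) = - (G * (H * x))" for x
    using assms(3) by (metis mult.assoc mult_minus_left minus_minus)
  have YG': "Y * (G * x) = G * (Y * x)" "Y * (H * x) = H * (Y * x)" for x
    using YG YH by (metis mult.assoc)+
  have two: "2 \<odot> x = x + x" for x using lop.scale_left_distrib[of 1 1 x] by simp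
  show ?thesis unfolding mode_rel_def
    by (simp add: algebra_simps GG HH HG YG YH YG')
qed

lemma mode_rel_left:
  assumes "G * A = A * G" "H * A = A * H" "mode_rel G H k Y"
  shows "mode_rel G H k (A * Y)"
proof -
  have AG: "G * (A * x) = A * (G * x)" "H * (A * x) = A * (H * x)" for x
    using assms by (metis mult.assoc)+
  have "G * (A * Y) - A * Y * G = A * (G * Y - Y * G)" "H * (A * Y) - A * Y * H = A * (H * Y - Y * H)"
    "G * (A * Y) + A * Y * G = A * (G * Y + Y * G)" "H * (A * Y) + A * Y * H = A * (H * Y + Y * H)"
    by (simp_all add: algebra_simps AG)
  then show ?thesis using assms(3) unfolding mode_rel_def by simp
qed

lemma rho_fold_mode:
  "set js \<subseteq> {1..n} \<Longrightarrow> distinct js \<Longrightarrow> j \<in> set js \<Longrightarrow> mode_rel (gop n (2*j-1)) (gop n (2*j)) (lam j) (rho_fold n lam js)"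
proof (induction js)
  case (Cons k js)
  have k: "k \<in> {1..n}" and j: "j \<in> {1..n}" using Cons.prems by auto
  define Y where "Y = rho_fold n lam js"
  let ?G = "gop n (2*j-1)" and ?H = "gop n (2*j)"
  have e: "rho_fold n lam (k # js) = (1 + of_real (lam k) \<odot> emb (2^n) (sigz n k)) * Y" by (simp add: rho_fold_def Y_def)
  show ?case
  proof (cases "k = j")
    case True
    have far: "\<And>i. i \<in> set js \<Longrightarrow> i \<noteq> j \<and> i \<ge> 1" "set js \<subseteq> {1..n}" using Cons.prems True by auto
    have YG: "Y * ?G = ?G * Y"
      unfolding Y_def by (rule rho_fold_comm[symmetric]) (use far j in \<open>fastforce+\<close>)
    have YH: "Y * ?H = ?H * Y"
      unfolding Y_def by (rule rho_fold_comm[symmetric]) (use far j in \<open>fastforce+\<close>)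
    have "?G * ?G = 1" "?H * ?H = 1" "?G * ?H = - (?H * ?G)"
      using j by (auto intro!: cliff.sq cliff.anti)
    from mode_rel_factor[OF this YG YH, of "lam j"] show ?thesis
      unfolding e emb_sigz[OF k] unfolding True .
  next
    case False
    then have r: "mode_rel ?G ?H (lam j) Y" using Cons unfolding Y_def by simp
    define A where "A = 1 + of_real (lam k) \<odot> emb (2^n) (sigz n k)"
    have gs: "gop n p * emb (2^n) (sigz n k) = emb (2^n) (sigz n k) * gop n p" if "p = 2*j-1 \<or> p = 2*j" for p
      unfolding emb_sigz[OF k] by (rule gop_comm_pair) (use j k False that in auto)
    have A: "?G * A = A * ?G" "?H * A = A * ?H" using gs by (auto simp: A_def algebra_simps)
    from mode_rel_left[OF A r] show ?thesis unfolding e A_def .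
  qed
qed simp

lemma rho_fold_trace: "set js \<subseteq> {1..n} \<Longrightarrow> distinct js \<Longrightarrow> trd (2^n) (rho_fold n lam js) = 2^n"
proof (induction js)
  case (Cons j js)
  have j: "j \<in> {1..n}" using Cons.prems by simp
  define Y where "Y = rho_fold n lam js"
  let ?G = "gop n (2*j-1)" and ?H = "gop n (2*j)"
  have far: "\<And>i. i \<in> set js \<Longrightarrow> i \<noteq> j \<and> i \<ge> 1" "set js \<subseteq> {1..n}" using Cons.prems by auto
  have YG: "?G * Y = Y * ?G"
    unfolding Y_def by (rule rho_fold_comm) (use far j in \<open>fastforce+\<close>)
  have YH: "?H * Y = Y * ?H"
    unfolding Y_def by (rule rho_fold_comm) (use far j in \<open>fastforce+\<close>)
  \<comment> \<open>Commuting with both generators is the mode relation with coefficient 0, which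
    kills the trace of the new \<open>sigz\<close> term.\<close>
  have "mode_rel ?G ?H 0 Y" using YG YH by (simp add: mode_rel_def)
  moreover have "?H * ?H = 1" "?G * ?H = - (?H * ?G)" using j by (auto intro!: cliff.sq cliff.anti)
  ultimately have "trd (2^n) ((- \<i>) \<odot> (?G * ?H) * (1 * Y)) = of_real 0 * trd (2^n) (1 * Y)"
    using j by (intro mode_rel_trace cliff.trc) auto
  then have "trd (2^n) (emb (2^n) (sigz n j) * Y) = 0" unfolding emb_sigz[OF j] by simp
  moreover have "rho_fold n lam (j # js) = Y + of_real (lam j) \<odot> (emb (2^n) (sigz n j) * Y)"
    by (simp add: rho_fold_def Y_def distrib_right)
  moreover have "trd (2^n) Y = 2^n" using Cons unfolding Y_def by simp
  ultimately show ?case by simp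
qed (simp add: rho_fold_def)

text \<open>Covariance matrix of the base state: the planar block of qubit j sits on the indices
  2j-1 and 2j, and the parity row vanishes because parity commutes with the base state.\<close>

definition base_mat :: "(nat \<Rightarrow> real) \<Rightarrow> nat \<Rightarrow> nat \<Rightarrow> real" where
  "base_mat lam p q = (if p = 0 then 0 else if odd p \<and> q = p + 1 then - lam ((p + 1) div 2)
     else if even p \<and> q = p - 1 then lam (p div 2) else 0)"

lemma rho_lambda_op: "emb (2^n) (rho_lambda n lam) = (1 / 2^n) \<odot> rho_fold n lam [1..<n+1]"
  and rho_lambda_carrier: "rho_lambda n lam \<in> carrier_mat (2^n) (2^n)"
proof -
  have "set [1..<n+1] \<subseteq> {1..n}" by auto
  from rho_fold_emb[OF this, of lam]
  show "emb (2^n) (rho_lambda n lam) = (1 / 2^n) \<odot> rho_fold n lam [1..<n+1]"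
    "rho_lambda n lam \<in> carrier_mat (2^n) (2^n)"
    unfolding rho_lambda_def by (auto simp: emb_smult simp del: upt_Suc)
qed

lemma rho_lambda_trace: "trace (rho_lambda n lam) = 1"
proof -
  have "trd (2^n) (emb (2^n) (rho_lambda n lam)) = 1"
    unfolding rho_lambda_op by (subst trd_cs, subst rho_fold_trace) auto
  then show ?thesis using trd_emb[OF rho_lambda_carrier] by simp
qed

lemma rho_lambda_wick: "wick (2*n+1) (gop n) (base_mat lam) (emb (2^n) (rho_lambda n lam))"
  unfolding wick_def
proof (intro allI impI)
  let ?X = "emb (2^n) (rho_lambda n lam)"
  define F where "F = rho_fold n lam [1..<n+1]"
  have X: "?X = (1 / 2^n) \<odot> F" unfolding F_def by (rule rho_lambda_op)
  have s: "set [1..<n+1] = {1..n}" by auto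
  have m: "mode_rel (gop n (2*j-1)) (gop n (2*j)) (lam j) ?X" if "j \<in> {1..n}" for j
    using rho_fold_mode[of "[1..<n+1]" n j lam] that s unfolding X F_def[symmetric] mode_rel_def
    by (simp add: lop.scale_right_distrib[symmetric] lop.scale_right_diff_distrib[symmetric] del: upt_Suc)
  fix p assume p: "p < 2*n+1"
  consider "p = 0" | j where "j \<in> {1..n}" "p = 2*j-1" | j where "j \<in> {1..n}" "p = 2*j"
  proof -
    show ?thesis
    proof (cases "even p")
      case True
      then obtain j where "p = 2 * j" by (rule evenE)
      then show ?thesis using that(1) that(3)[of j] p by (cases "j = 0") auto
    next
      case False
      then obtain j where "p = 2 * j + 1" by (rule oddE)
      then show ?thesis using that(2)[of "j + 1"] p by auto
    qed
  qed
  then show "gop n p * ?X - ?X * gop n p = \<i> \<odot> (\<Sum>q<2*n+1. of_real (base_mat lam p q) \<odot> (gop n q * ?X + ?X * gop n q))"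
  proof cases
    case 1
    have "gop n 0 * F = F * gop n 0" unfolding F_def by (rule rho_fold_comm) auto
    then show ?thesis using 1 by (simp add: X base_mat_def)
  next
    case (2 j)
    have "(\<Sum>q<2*n+1. of_real (base_mat lam p q) \<odot> (gop n q * ?X + ?X * gop n q))
      = (\<Sum>q<2*n+1. if q = 2*j then of_real (- lam j) \<odot> (gop n (2*j) * ?X + ?X * gop n (2*j)) else 0)"
      using 2 by (intro sum.cong refl) (auto simp: base_mat_def)
    also have "\<dots> = of_real (- lam j) \<odot> (gop n (2*j) * ?X + ?X * gop n (2*j))"
      using 2 by (subst sum.delta) auto
    finally have e: "(\<Sum>q<2*n+1. of_real (base_mat lam p q) \<odot> (gop n q * ?X + ?X * gop n q))
      = of_real (- lam j) \<odot> (gop n (2*j) * ?X + ?X * gop n (2*j))" .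
    show ?thesis unfolding e using m[OF 2(1)] unfolding mode_rel_def 2(2) by simp
  next
    case (3 j)
    have "(\<Sum>q<2*n+1. of_real (base_mat lam p q) \<odot> (gop n q * ?X + ?X * gop n q))
      = (\<Sum>q<2*n+1. if q = 2*j-1 then of_real (lam j) \<odot> (gop n (2*j-1) * ?X + ?X * gop n (2*j-1)) else 0)"
      using 3 by (intro sum.cong refl) (auto simp: base_mat_def)
    also have "\<dots> = of_real (lam j) \<odot> (gop n (2*j-1) * ?X + ?X * gop n (2*j-1))"
      using 3 by (subst sum.delta) auto
    finally have e: "(\<Sum>q<2*n+1. of_real (base_mat lam p q) \<odot> (gop n q * ?X + ?X * gop n q))
      = of_real (lam j) \<odot> (gop n (2*j-1) * ?X + ?X * gop n (2*j-1))" .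
    show ?thesis unfolding e using m[OF 3(1)] unfolding mode_rel_def 3(2) by simp
  qed
qed

lemma rho_lambda_state: assumes "\<And>j. j \<in> {1..n} \<Longrightarrow> \<bar>lam j\<bar> \<le> 1" shows "is_state (2^n) (rho_lambda n lam)"
proof (rule nonneg_diag_state)
  have d: "nonneg_diag (2^n) (foldr (\<lambda>j M. (1\<^sub>m (2^n) + complex_of_real (lam j) \<cdot>\<^sub>m sigz n j) * M) js (1\<^sub>m (2^n)))"
    if "set js \<subseteq> {1..n}" for js
    using that
  proof (induction js)
    case Nil
    have "\<exists>r\<ge>0. (1::complex) = complex_of_real r" by (intro exI[of _ 1]) simp
    then show ?case by (simp add: nonneg_diag_def)
  next
    case (Cons j js)
    then show ?case using sigz_props[of j n] assms[of j] by (auto intro!: nonneg_diag_mult)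
  qed
  have "nonneg_diag (2^n) (z \<cdot>\<^sub>m A)" if nd: "nonneg_diag (2^n) A" and zr: "z = complex_of_real r" "r \<ge> 0" for z r A
    unfolding nonneg_diag_def
  proof (intro conjI allI impI)
    fix i assume i: "i < (2::nat)^n"
    then obtain t where "t \<ge> 0" "A $$ (i,i) = complex_of_real t" using nd unfolding nonneg_diag_def by metis
    then show "\<exists>r\<ge>0. (z \<cdot>\<^sub>m A) $$ (i,i) = complex_of_real r"
      using nd zr i by (intro exI[of _ "r * t"]) (auto simp: nonneg_diag_def)
  qed (use nd in \<open>auto simp: nonneg_diag_def\<close>)
  note scale = this
  have "set [1..<n+1] \<subseteq> {1..n}" by auto
  from scale[OF d[OF this], of "1 / 2^n" "1 / 2^n"] show "nonneg_diag (2^n) (rho_lambda n lam)"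
    unfolding rho_lambda_def by simp
  show "trace (rho_lambda n lam) = 1" by (rule rho_lambda_trace)
qed

subsection \<open>Entropy\<close>

lemma sum_count_list:
  fixes f :: "'a \<Rightarrow> real"
  shows "finite S \<Longrightarrow> set as \<subseteq> S \<Longrightarrow> (\<Sum>a\<in>S. of_nat (count_list as a) * f a) = (\<Sum>a\<leftarrow>as. f a)"
proof (induction as)
  case (Cons b as)
  have "(\<Sum>a\<in>S. of_nat (count_list (b # as) a) * f a) = (\<Sum>a\<in>S. of_nat (count_list as a) * f a + (if a = b then f b else 0))"
    by (intro sum.cong refl) (auto simp: algebra_simps)
  then show ?case using Cons by (simp add: sum.distrib)
qed simp

lemma vN_entropy_roots:
  assumes "char_poly A = (\<Prod>a\<leftarrow>as. [:- a, 1:])"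
  shows "vN_entropy A = (\<Sum>a\<leftarrow>as. eta (Re a))"
proof -
  have p: "poly (char_poly A) a = 0 \<longleftrightarrow> a \<in> set as" for a
    unfolding assms by (induction as) auto
  have o: "order a (char_poly A) = count_list as a" for a
    unfolding assms
  proof (induction as)
    case (Cons b as)
    have "(\<Prod>a\<leftarrow>as. [:- a, 1:]) \<noteq> (0 :: complex poly)" by (auto simp: prod_list_zero_iff)
    then have "order a (\<Prod>a\<leftarrow>b # as. [:- a, 1:]) = order a [:- b, 1:] + order a (\<Prod>a\<leftarrow>as. [:- a, 1:])"
      by (simp add: order_mult del: mult_pCons_left)
    moreover have "order a [:- b, 1:] = (if b = a then 1 else 0)"
      using order_power_n_n[of a 1] by (auto intro: order_0I)
    ultimately show ?case using Cons by simp
  qed simp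
  have "vN_entropy A = (\<Sum>a\<in>set as. of_nat (count_list as a) * eta (Re a))"
    unfolding vN_entropy_def p o by simp
  also have "\<dots> = (\<Sum>a\<leftarrow>as. eta (Re a))"
    by (rule sum_count_list) simp_all
  finally show ?thesis .
qed

text \<open>The right-hand side is the tangent at y, and the inequality is
  \<open>ln t \<le> t - 1\<close> at t = y / x. The value x = 0 is separate, being governed by the
  convention \<open>eta 0 = 0\<close>.\<close>

lemma eta_concave_tangent:
  assumes "x \<ge> 0" "y > 0" shows "eta x \<le> eta y + (x - y) * (- log 2 y - 1 / ln 2)"
proof (cases "x = 0")
  case True
  then show ?thesis using assms by (simp add: eta_def algebra_simps)
next
  case False
  then have x: "x > 0" using assms by simp
  have "ln (y / x) \<le> y / x - 1" using x assms by (intro ln_le_minus_one) simp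
  then have "x * (ln y - ln x) \<le> y - x" using x assms by (simp add: ln_div field_simps)
  then have "(x * (ln y - ln x)) / ln 2 \<le> (y - x) / ln 2" by (simp add: divide_right_mono)
  then show ?thesis using x assms by (simp add: eta_def log_def field_simps)
qed

text \<open>The tangent at the mean y is averaged. For y = 0 the tangent would be vertical, but then
  every value of positive weight is 0.\<close>

lemma eta_jensen:
  assumes "finite I" "\<And>i. i \<in> I \<Longrightarrow> 0 \<le> w i" "(\<Sum>i\<in>I. w i) = 1" "\<And>i. i \<in> I \<Longrightarrow> 0 \<le> x i"
  shows "(\<Sum>i\<in>I. w i * eta (x i)) \<le> eta (\<Sum>i\<in>I. w i * x i)"
proof -
  define y where "y = (\<Sum>i\<in>I. w i * x i)"
  have y0: "y \<ge> 0" unfolding y_def using assms by (auto intro!: sum_nonneg)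
  show ?thesis
  proof (cases "y = 0")
    case True
    then have "\<forall>i\<in>I. w i * x i = 0" unfolding y_def using assms by (subst (asm) sum_nonneg_eq_0_iff) auto
    then have "w i * eta (x i) = 0" if "i \<in> I" for i using that by (auto simp: eta_def)
    then have "(\<Sum>i\<in>I. w i * eta (x i)) = 0" by (intro sum.neutral) auto
    then show ?thesis using True by (simp add: y_def eta_def)
  next
    case False
    then have y: "y > 0" using y0 by simp
    define c where "c = - log 2 y - 1 / ln 2"
    have "(\<Sum>i\<in>I. w i * eta (x i)) \<le> (\<Sum>i\<in>I. w i * (eta y + (x i - y) * c))"
      unfolding c_def using assms y by (intro sum_mono mult_left_mono eta_concave_tangent) auto
    also have "\<dots> = (\<Sum>i\<in>I. w i * eta y + (w i * x i * c - w i * (y * c)))"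
      by (intro sum.cong refl) (simp add: algebra_simps)
    also have "\<dots> = (\<Sum>i\<in>I. w i) * eta y + ((\<Sum>i\<in>I. w i * x i) * c - (\<Sum>i\<in>I. w i) * (y * c))"
      by (simp only: sum.distrib sum_subtractf sum_distrib_right)
    also have "\<dots> = eta y" using assms by (simp add: y_def)
    finally show ?thesis by (simp add: y_def)
  qed
qed

lemma eta_sum_le_log:
  assumes "finite I" "I \<noteq> {}" "\<And>i. i \<in> I \<Longrightarrow> 0 \<le> x i" "(\<Sum>i\<in>I. x i) = 1"
  shows "(\<Sum>i\<in>I. eta (x i)) \<le> log 2 (card I)"
proof -
  define c where "c = real (card I)"
  have c: "c > 0" using assms by (simp add: c_def card_gt_0_iff)
  have "(\<Sum>i\<in>I. 1 / c * eta (x i)) \<le> eta (\<Sum>i\<in>I. 1 / c * x i)"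
    by (rule eta_jensen) (use assms c in \<open>auto simp: c_def\<close>)
  then have "(\<Sum>i\<in>I. eta (x i)) / c \<le> eta (1 / c)"
    using assms by (simp add: sum_divide_distrib[symmetric])
  also have "eta (1 / c) = log 2 c / c" using c by (simp add: eta_def log_divide)
  finally show ?thesis using c by (simp add: c_def field_simps)
qed

lemma char_poly_diagonalized:
  fixes A V W :: "complex mat"
  assumes A: "A \<in> carrier_mat d d" and V: "V \<in> carrier_mat d d" and W: "W \<in> carrier_mat d d"
    and WV: "W * V = 1\<^sub>m d" and D: "W * A * V = mat d d (\<lambda>(i,j). if i = j then x i else 0)"
  shows "char_poly A = (\<Prod>a\<leftarrow>map x [0..<d]. [:- a, 1:])"
proof -
  let ?D = "mat d d (\<lambda>(i,j). if i = j then x i else 0)"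
  have VW: "V * W = 1\<^sub>m d" by (rule mat_mult_left_right_inverse[OF W V WV])
  note m = mult_carrier_mat[of _ d d _ d] and a = assoc_mult_mat[of _ d d _ d _ d]
  have "V * ?D * W = V * W * A * (V * W)" unfolding D[symmetric] using A V W by (simp add: m a)
  also have "\<dots> = A" using A by (simp add: VW)
  finally have "A = V * ?D * W" by simp
  then have "similar_mat A ?D"
    using A V W VW WV unfolding similar_mat_def similar_mat_wit_def Let_def
    by (intro exI[of _ V] exI[of _ W]) auto
  then have "char_poly A = char_poly ?D" by (rule char_poly_similar)
  also have "\<dots> = (\<Prod>a\<leftarrow>diag_mat ?D. [:- a, 1:])"
    by (rule char_poly_upper_triangular[of _ d]) (auto simp: upper_triangular_def)
  also have "diag_mat ?D = map x [0..<d]" by (auto simp: diag_mat_def)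
  finally show ?thesis .
qed

text \<open>In dimension d, d mutually orthogonal idempotents of trace one are rank-one projections
  along a common, possibly oblique, basis. A column and a row of each, through a nonzero diagonal
  entry, form that basis and its dual. X is diagonal in it because it commutes with every
  idempotent.\<close>

lemma entropy_idempotents:
  assumes X: "X \<in> carrier_mat d d" and I: "bij_betw f {..<d} I"
    and P: "\<And>s. s \<in> I \<Longrightarrow> P s \<in> carrier_mat d d" "\<And>s. s \<in> I \<Longrightarrow> trace (P s) = 1"
    and PP: "\<And>s t. s \<in> I \<Longrightarrow> t \<in> I \<Longrightarrow> P s * P t = (if s = t then P s else 0\<^sub>m d d)"
    and XP: "\<And>s. s \<in> I \<Longrightarrow> X * P s = P s * X"
  shows "vN_entropy X = (\<Sum>s\<in>I. eta (Re (trace (P s * X))))"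
proof -
  note m = mult_carrier_mat[of _ d d _ d] and a = assoc_mult_mat[of _ d d _ d _ d]
  define Q where "Q j = P (f j)" for j
  have fI: "f j \<in> I" if "j < d" for j using I that by (auto simp: bij_betw_def)
  have Q: "Q j \<in> carrier_mat d d" "trace (Q j) = 1" "X * Q j = Q j * X" if "j < d" for j
    using P XP fI[OF that] by (auto simp: Q_def)
  have QQ: "Q j * Q k = (if j = k then Q j else 0\<^sub>m d d)" if "j < d" "k < d" for j k
    using PP[OF fI fI, of j k] that I by (auto simp: Q_def bij_betw_def inj_on_def)
  have "\<exists>i<d. Q j $$ (i,i) \<noteq> 0" if "j < d" for j
  proof (rule ccontr)
    assume "\<not> (\<exists>i<d. Q j $$ (i,i) \<noteq> 0)"
    then have "trace (Q j) = 0" using Q(1)[OF that] by (auto simp: trace_def)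
    then show False using Q(2)[OF that] by simp
  qed
  then obtain i where i: "\<And>j. j < d \<Longrightarrow> i j < d" "\<And>j. j < d \<Longrightarrow> Q j $$ (i j, i j) \<noteq> 0" by metis
  \<comment> \<open>The column is divided by its pivot: row times column is the pivot entry of
    \<open>Q j * Q j = Q j\<close>, so the division normalizes it to one.\<close>
  define V where "V = mat d d (\<lambda>(k,j). Q j $$ (k, i j) / Q j $$ (i j, i j))"
  define W where "W = mat d d (\<lambda>(j,k). Q j $$ (i j, k))"
  have V: "V \<in> carrier_mat d d" and W: "W \<in> carrier_mat d d" by (auto simp: V_def W_def)
  have mm: "(A * B) $$ (p,q) = (\<Sum>k<d. A $$ (p,k) * B $$ (k,q))" if "A \<in> carrier_mat d d" "B \<in> carrier_mat d d" "p < d" "q < d" for A B :: "complex mat" and p q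
    using that by (simp add: scalar_prod_def atLeast0LessThan)
  have WAV: "(W * A * V) $$ (j,k) = (Q j * A * Q k) $$ (i j, i k) / Q k $$ (i k, i k)"
    if A: "A \<in> carrier_mat d d" and jk: "j < d" "k < d" for A j k
  proof -
    have "(W * A * V) $$ (j,k) = (\<Sum>l<d. (W * A) $$ (j,l) * V $$ (l,k))" using A V W jk by (intro mm) (auto simp: m)
    also have "\<dots> = (\<Sum>l<d. (Q j * A) $$ (i j,l) * Q k $$ (l, i k) / Q k $$ (i k, i k))"
    proof (intro sum.cong refl)
      fix l assume l: "l \<in> {..<d}"
      have "(W * A) $$ (j,l) = (Q j * A) $$ (i j, l)"
        using mm[OF W A jk(1), of l] mm[OF Q(1)[OF jk(1)] A i(1)[OF jk(1)], of l] l jk by (simp add: W_def)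
      then show "(W * A) $$ (j,l) * V $$ (l,k) = (Q j * A) $$ (i j,l) * Q k $$ (l, i k) / Q k $$ (i k, i k)"
        using l jk by (simp add: V_def)
    qed
    also have "\<dots> = (Q j * A * Q k) $$ (i j, i k) / Q k $$ (i k, i k)"
      using mm[OF m[OF Q(1)[OF jk(1)] A] Q(1)[OF jk(2)] i(1)[OF jk(1)] i(1)[OF jk(2)]]
      by (simp only: sum_divide_distrib)
    finally show ?thesis .
  qed
  have WV: "W * V = 1\<^sub>m d"
  proof (rule eq_matI)
    fix j k assume "j < dim_row (1\<^sub>m d)" "k < dim_col (1\<^sub>m d)"
    then have jk: "j < d" "k < d" by auto
    have "(W * V) $$ (j,k) = (Q j * Q k) $$ (i j, i k) / Q k $$ (i k, i k)"
      using WAV[OF one_carrier_mat jk] right_mult_one_mat[OF W] right_mult_one_mat[OF Q(1)[OF jk(1)]] by (simp only:)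
    then show "(W * V) $$ (j,k) = 1\<^sub>m d $$ (j,k)" using QQ[OF jk] i jk by auto
  qed (use V W in auto)
  define x where "x j = (Q j * X * Q j) $$ (i j, i j) / Q j $$ (i j, i j)" for j
  have D: "W * X * V = mat d d (\<lambda>(j,k). if j = k then x j else 0)"
  proof (rule eq_matI)
    fix j k assume "j < dim_row (mat d d (\<lambda>(j,k). if j = k then x j else 0))" "k < dim_col (mat d d (\<lambda>(j,k). if j = k then x j else 0))"
    then have jk: "j < d" "k < d" by auto
    have "Q j * X * Q k = Q j * Q k * X" using Q[OF jk(1)] Q[OF jk(2)] X by (simp add: m a)
    then have "j \<noteq> k \<Longrightarrow> (Q j * X * Q k) $$ (i j, i k) = 0" using QQ[OF jk] X i jk by simp
    then show "(W * X * V) $$ (j,k) = mat d d (\<lambda>(j,k). if j = k then x j else 0) $$ (j,k)"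
      using WAV[OF X jk] jk by (simp add: x_def)
  qed (use V W X in auto)
  \<comment> \<open>In the new basis \<open>Q j\<close> is the j-th diagonal matrix unit, so its
    trace against X picks out the j-th eigenvalue.\<close>
  have tr: "x j = trace (Q j * X)" if j: "j < d" for j
  proof -
    have VW: "V * W = 1\<^sub>m d" by (rule mat_mult_left_right_inverse[OF W V WV])
    define E where "E = W * Q j * V"
    have cE: "E \<in> carrier_mat d d" using W V Q[OF j] by (simp add: E_def m)
    have E: "E $$ (p,q) = (if p = j \<and> q = j then 1 else 0)" if "p < d" "q < d" for p q
      using WAV[OF Q(1)[OF j] that] QQ[OF that(1) j] QQ[OF j that(2)] QQ[OF j j] Q[OF that(2)] Q[OF that(1)] i[of j] j i that
      by (auto simp: E_def)
    have "trace (Q j * X) = trace (V * W * (Q j * X))" using Q[OF j] X by (simp add: VW m)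
    also have "\<dots> = trace (V * (W * (Q j * X)))" using Q[OF j] X V W by (simp add: m a)
    also have "\<dots> = trace (W * (Q j * X) * V)" using Q[OF j] X V W by (intro trace_mult_comm[of _ d]) (auto simp: m)
    also have "W * (Q j * X) * V = W * (Q j * (V * W) * X) * V" using Q[OF j] X V W by (simp add: VW m)
    also have "\<dots> = E * (W * X * V)" using Q[OF j] X V W by (simp add: E_def m a)
    also have "trace (E * (W * X * V)) = (\<Sum>p<d. \<Sum>q<d. E $$ (p,q) * (W * X * V) $$ (q,p))"
      using cE V W X mm[OF cE m[OF m[OF W X] V]] by (simp only: trace_def) (auto intro!: sum.cong)
    also have "\<dots> = (\<Sum>p<d. \<Sum>q<d. if q = j then (if p = j then x j else 0) else 0)"
      unfolding D using E j by (intro sum.cong refl) auto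
    also have "\<dots> = x j" using j by simp
    finally show ?thesis by simp
  qed
  have "vN_entropy X = (\<Sum>a\<leftarrow>map x [0..<d]. eta (Re a))"
    by (rule vN_entropy_roots[OF char_poly_diagonalized[OF X V W WV D]])
  also have "\<dots> = (\<Sum>j<d. eta (Re (x j)))" by (simp add: sum_list_sum_nth atLeast0LessThan)
  also have "\<dots> = (\<Sum>j<d. eta (Re (trace (P (f j) * X))))" using tr by (simp add: Q_def)
  also have "\<dots> = (\<Sum>s\<in>I. eta (Re (trace (P s * X))))"
    by (rule sum.reindex_bij_betw[OF I])
  finally show ?thesis .
qed

subsection \<open>Matrix exponential\<close>

text \<open>A crude norm: it dominates every column sum, hence its powers dominate the entries of
  the matrix powers, which gives absolute convergence of the exponential.\<close>

definition mat_bound :: "nat \<Rightarrow> complex mat \<Rightarrow> real" where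
  "mat_bound d A = (\<Sum>i<d. \<Sum>j<d. cmod (A $$ (i,j)))"

lemma mat_pow_entry_bound:
  assumes A: "A \<in> carrier_mat d d"
  shows "i < d \<Longrightarrow> j < d \<Longrightarrow> cmod ((A ^\<^sub>m k) $$ (i,j)) \<le> (mat_bound d A) ^ k"
proof (induction k arbitrary: i j)
  case 0 then show ?case using A by simp
next
  case (Suc k)
  have "(A ^\<^sub>m Suc k) $$ (i,j) = (\<Sum>l<d. (A ^\<^sub>m k) $$ (i,l) * A $$ (l,j))"
    using Suc.prems A pow_carrier_mat[OF A, of k] by (simp add: scalar_prod_def atLeast0LessThan)
  also have "cmod \<dots> \<le> (\<Sum>l<d. (mat_bound d A) ^ k * cmod (A $$ (l,j)))"
    using Suc by (intro sum_norm_le) (auto simp: norm_mult intro!: mult_right_mono)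
  also have "\<dots> = (mat_bound d A) ^ k * (\<Sum>l<d. cmod (A $$ (l,j)))" by (simp add: sum_distrib_left)
  also have "\<dots> \<le> (mat_bound d A) ^ k * mat_bound d A"
  proof (rule mult_left_mono)
    show "(\<Sum>l<d. cmod (A $$ (l,j))) \<le> mat_bound d A"
      unfolding mat_bound_def using Suc.prems by (intro sum_mono member_le_sum) auto
    show "0 \<le> mat_bound d A ^ k" by (simp add: mat_bound_def sum_nonneg)
  qed
  finally show ?case by (simp add: mult.commute)
qed

lemma mat_exp_summable:
  assumes A: "A \<in> carrier_mat d d" and ij: "i < d" "j < d"
  shows "summable (\<lambda>k. cmod ((A ^\<^sub>m k) $$ (i,j) / of_nat (fact k)))"
proof (rule summable_comparison_test')
  show "summable (\<lambda>k. inverse (fact k) * mat_bound d A ^ k)" by (rule summable_exp)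
  show "norm (cmod ((A ^\<^sub>m k) $$ (i,j) / of_nat (fact k))) \<le> inverse (fact k) * mat_bound d A ^ k" for k
    using mat_pow_entry_bound[OF A ij, of k] by (simp add: norm_divide norm_mult norm_inverse divide_inverse mult.commute mult_left_mono)
qed

lemma mat_exp_carrier: "A \<in> carrier_mat d d \<Longrightarrow> mat_exp A \<in> carrier_mat d d"
  by (simp add: mat_exp_def)

lemma mat_exp_sums:
  assumes A: "A \<in> carrier_mat d d" and ij: "i < d" "j < d"
  shows "(\<lambda>k. (A ^\<^sub>m k) $$ (i,j) / of_nat (fact k)) sums (mat_exp A $$ (i,j))"
  using summable_sums[OF summable_norm_cancel[OF mat_exp_summable[OF assms]]] A ij by (simp add: mat_exp_def)

text \<open>If the commutator with A acts on the span of the \<open>Y p\<close> as the matrix L,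
  conjugation by exp A acts as exp L. The identity is proved between coefficients of the power
  series (\<open>key\<close>), where it is finite, and summed by Cauchy products.\<close>

lemma mat_exp_intertwine:
  fixes Y :: "nat \<Rightarrow> complex mat" and L :: "complex mat"
  assumes A: "A \<in> carrier_mat d d" and Y: "\<And>p. p < N \<Longrightarrow> Y p \<in> carrier_mat d d" and L: "L \<in> carrier_mat N N"
    and rel: "\<And>p i j. p < N \<Longrightarrow> i < d \<Longrightarrow> j < d \<Longrightarrow> (A * Y p) $$ (i,j) = (Y p * A) $$ (i,j) + (\<Sum>q<N. L $$ (q,p) * Y q $$ (i,j))"
    and p: "p < N" and ij: "i < d" "j < d"
  shows "(mat_exp A * Y p) $$ (i,j) = (\<Sum>q<N. mat_exp L $$ (q,p) * (Y q * mat_exp A) $$ (i,j))"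
proof -
  define y where "y q i j = Y q $$ (i,j)" for q i j
  define a where "a k i j = (A ^\<^sub>m k) $$ (i,j) / of_nat (fact k)" for k i j
  define l where "l k i j = (L ^\<^sub>m k) $$ (i,j) / of_nat (fact k)" for k i j
  have Ak: "A ^\<^sub>m k \<in> carrier_mat d d" for k using A by simp
  have Lk: "L ^\<^sub>m k \<in> carrier_mat N N" for k using L by simp
  have a0: "a 0 i j = (if i = j then 1 else 0)" if "i < d" "j < d" for i j using that A by (simp add: a_def)
  have l0: "l 0 i j = (if i = j then 1 else 0)" if "i < N" "j < N" for i j using that L by (simp add: l_def)
  have comm: "A ^\<^sub>m Suc k = A * A ^\<^sub>m k" for k
    by (induction k) (use A Ak in \<open>simp_all add: assoc_mult_mat[of _ d d _ d _ d]\<close>)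
  have aS: "of_nat (Suc k) * a (Suc k) i j = (\<Sum>m<d. A $$ (i,m) * a k m j)" if "i < d" "j < d" for k i j
  proof -
    have "of_nat (Suc k) * a (Suc k) i j = (A * A ^\<^sub>m k) $$ (i,j) / of_nat (fact k)"
      unfolding a_def comm 
      by (simp only: fact_Suc of_nat_mult of_nat_id times_divide_eq_right mult_divide_mult_cancel_left[OF of_nat_neq_0])
    also have "\<dots> = (\<Sum>m<d. A $$ (i,m) * a k m j)"
      using A Ak[of k] that by (simp add: scalar_prod_def atLeast0LessThan a_def sum_divide_distrib)
    finally show ?thesis .
  qed
  have lS: "of_nat (Suc k) * l (Suc k) i j = (\<Sum>m<N. l k m j * L $$ (i,m))" if "i < N" "j < N" for k i j
  proof -
    have comm: "L ^\<^sub>m Suc k = L * L ^\<^sub>m k" for k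
      by (induction k) (use L Lk in \<open>simp_all add: assoc_mult_mat[of _ N N _ N _ N]\<close>)
    have "of_nat (Suc k) * l (Suc k) i j = (L * L ^\<^sub>m k) $$ (i,j) / of_nat (fact k)"
      unfolding l_def comm 
      by (simp only: fact_Suc of_nat_mult of_nat_id times_divide_eq_right mult_divide_mult_cancel_left[OF of_nat_neq_0])
    also have "\<dots> = (\<Sum>m<N. l k m j * L $$ (i,m))"
      using L Lk[of k] that by (simp add: scalar_prod_def atLeast0LessThan l_def sum_divide_distrib mult.commute)
    finally show ?thesis .
  qed
  have rel': "(\<Sum>m<d. A $$ (i,m) * y p m j) = (\<Sum>m<d. y p i m * A $$ (m,j)) + (\<Sum>q<N. L $$ (q,p) * y q i j)"
    if "p < N" "i < d" "j < d" for p i j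
    using rel[OF that] A Y[OF that(1)] that by (simp add: scalar_prod_def atLeast0LessThan y_def)
  \<comment> \<open>Coefficient form: A^k/k! times Y is the sum over s + t = k of (L^s/s!) Y
    (A^t/t!). One more factor A on the left either passes Y and raises t, or is absorbed by the
    commutator and raises s.\<close>
  have key: "(\<Sum>m<d. a k i m * y p m j) = (\<Sum>s\<le>k. \<Sum>q<N. \<Sum>m<d. l s q p * (y q i m * a (k - s) m j))"
    if "p < N" "i < d" "j < d" for k p i j
    using that
  proof (induction k arbitrary: p i j)
    case 0
    have "(\<Sum>m<d. a 0 i m * y p m j) = (\<Sum>m<d. if m = i then y p m j else 0)" using 0 by (intro sum.cong) (auto simp: a0)
    also have "\<dots> = y p i j" using 0 by simp
    also have "\<dots> = (\<Sum>q<N. if q = p then y q i j else 0)" using 0 by simp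
    also have "\<dots> = (\<Sum>q<N. \<Sum>m<d. if m = j then (if q = p then y q i m else 0) else 0)" using 0 by simp
    also have "\<dots> = (\<Sum>q<N. \<Sum>m<d. l 0 q p * (y q i m * a 0 m j))" using 0 by (intro sum.cong refl) (auto simp: a0 l0)
    finally show ?case by simp
  next
    case (Suc k)
    define T where "T s t = (\<Sum>q<N. \<Sum>m<d. l s q p * (y q i m * a t m j))" for s t
    have "of_nat (Suc k) * (\<Sum>m<d. a (Suc k) i m * y p m j) = (\<Sum>m<d. (\<Sum>r<d. A $$ (i,r) * a k r m) * y p m j)"
      unfolding sum_distrib_left using Suc.prems by (intro sum.cong refl) (simp add: aS[symmetric] mult.assoc)
    also have "\<dots> = (\<Sum>r<d. A $$ (i,r) * (\<Sum>m<d. a k r m * y p m j))"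
      unfolding sum_distrib_left sum_distrib_right by (subst sum.swap) (simp add: mult.assoc)
    also have "\<dots> = (\<Sum>r<d. A $$ (i,r) * (\<Sum>s\<le>k. \<Sum>q<N. \<Sum>m<d. l s q p * (y q r m * a (k - s) m j)))"
      using Suc by (intro sum.cong refl) auto
    also have "\<dots> = (\<Sum>s\<le>k. \<Sum>q<N. \<Sum>m<d. l s q p * ((\<Sum>r<d. A $$ (i,r) * y q r m) * a (k - s) m j))"
    proof -
      have "(\<Sum>r<d. A $$ (i,r) * (\<Sum>s\<le>k. \<Sum>q<N. \<Sum>m<d. l s q p * (y q r m * a (k - s) m j)))
        = (\<Sum>r<d. \<Sum>s\<le>k. \<Sum>q<N. \<Sum>m<d. l s q p * ((A $$ (i,r) * y q r m) * a (k - s) m j))"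
        by (simp add: sum_distrib_left mult_ac)
      also have "\<dots> = (\<Sum>s\<le>k. \<Sum>r<d. \<Sum>q<N. \<Sum>m<d. l s q p * ((A $$ (i,r) * y q r m) * a (k - s) m j))"
        by (rule sum.swap)
      also have "\<dots> = (\<Sum>s\<le>k. \<Sum>q<N. \<Sum>r<d. \<Sum>m<d. l s q p * ((A $$ (i,r) * y q r m) * a (k - s) m j))"
        by (intro sum.cong refl sum.swap)
      also have "\<dots> = (\<Sum>s\<le>k. \<Sum>q<N. \<Sum>m<d. \<Sum>r<d. l s q p * ((A $$ (i,r) * y q r m) * a (k - s) m j))"
        by (intro sum.cong refl sum.swap)
      finally show ?thesis by (simp add: sum_distrib_left sum_distrib_right)
    qed
    also have "\<dots> = (\<Sum>s\<le>k. \<Sum>q<N. \<Sum>m<d. l s q p * ((\<Sum>r<d. y q i r * A $$ (r,m)) * a (k - s) m j))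
       + (\<Sum>s\<le>k. \<Sum>q<N. \<Sum>m<d. l s q p * ((\<Sum>q'<N. L $$ (q',q) * y q' i m) * a (k - s) m j))"
      using Suc.prems by (simp add: rel' distrib_left distrib_right sum.distrib)
    also have "(\<Sum>s\<le>k. \<Sum>q<N. \<Sum>m<d. l s q p * ((\<Sum>r<d. y q i r * A $$ (r,m)) * a (k - s) m j))
       = (\<Sum>s\<le>k. of_nat (Suc (k - s)) * T s (Suc (k - s)))"
    proof (intro sum.cong refl)
      fix s
      have "(\<Sum>q<N. \<Sum>m<d. l s q p * ((\<Sum>r<d. y q i r * A $$ (r,m)) * a (k - s) m j))
        = (\<Sum>q<N. \<Sum>m<d. \<Sum>r<d. l s q p * (y q i r * (A $$ (r,m) * a (k - s) m j)))"
        by (simp add: sum_distrib_left sum_distrib_right mult_ac)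
      also have "\<dots> = (\<Sum>q<N. \<Sum>r<d. \<Sum>m<d. l s q p * (y q i r * (A $$ (r,m) * a (k - s) m j)))"
        by (intro sum.cong refl sum.swap)
      also have "\<dots> = (\<Sum>q<N. \<Sum>r<d. l s q p * (y q i r * (of_nat (Suc (k - s)) * a (Suc (k - s)) r j)))"
        using Suc.prems by (simp add: aS sum_distrib_left del: of_nat_Suc)
      also have "\<dots> = of_nat (Suc (k - s)) * T s (Suc (k - s))"
        by (simp add: T_def sum_distrib_left mult_ac del: of_nat_Suc)
      finally show "(\<Sum>q<N. \<Sum>m<d. l s q p * ((\<Sum>r<d. y q i r * A $$ (r,m)) * a (k - s) m j)) = of_nat (Suc (k - s)) * T s (Suc (k - s))" .
    qed
    also have "(\<Sum>s\<le>k. \<Sum>q<N. \<Sum>m<d. l s q p * ((\<Sum>q'<N. L $$ (q',q) * y q' i m) * a (k - s) m j))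
       = (\<Sum>s\<le>k. of_nat (Suc s) * T (Suc s) (k - s))"
    proof (intro sum.cong refl)
      fix s
      have "(\<Sum>q<N. \<Sum>m<d. l s q p * ((\<Sum>q'<N. L $$ (q',q) * y q' i m) * a (k - s) m j))
        = (\<Sum>q<N. \<Sum>m<d. \<Sum>q'<N. (l s q p * L $$ (q',q)) * (y q' i m * a (k - s) m j))"
        by (simp add: sum_distrib_left sum_distrib_right mult_ac)
      also have "\<dots> = (\<Sum>q<N. \<Sum>q'<N. \<Sum>m<d. (l s q p * L $$ (q',q)) * (y q' i m * a (k - s) m j))"
        by (intro sum.cong refl sum.swap)
      also have "\<dots> = (\<Sum>q'<N. \<Sum>q<N. \<Sum>m<d. (l s q p * L $$ (q',q)) * (y q' i m * a (k - s) m j))"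
        by (rule sum.swap)
      also have "\<dots> = (\<Sum>q'<N. \<Sum>m<d. \<Sum>q<N. (l s q p * L $$ (q',q)) * (y q' i m * a (k - s) m j))"
        by (intro sum.cong refl sum.swap)
      also have "\<dots> = (\<Sum>q'<N. \<Sum>m<d. (of_nat (Suc s) * l (Suc s) q' p) * (y q' i m * a (k - s) m j))"
        using Suc.prems by (simp add: lS sum_distrib_right del: of_nat_Suc)
      also have "\<dots> = of_nat (Suc s) * T (Suc s) (k - s)"
        by (simp add: T_def sum_distrib_left mult.assoc del: of_nat_Suc)
      finally show "(\<Sum>q<N. \<Sum>m<d. l s q p * ((\<Sum>q'<N. L $$ (q',q) * y q' i m) * a (k - s) m j)) = of_nat (Suc s) * T (Suc s) (k - s)" .
    qed
    \<comment> \<open>Discrete Leibniz rule: after an index shift the weights of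
      \<open>T s (Suc k - s)\<close> in the two sums are \<open>Suc k - s\<close> and s, which add
      up to \<open>Suc k\<close>; the extra boundary terms have weight 0.\<close>
    also have "(\<Sum>s\<le>k. of_nat (Suc (k - s)) * T s (Suc (k - s))) + (\<Sum>s\<le>k. of_nat (Suc s) * T (Suc s) (k - s))
      = of_nat (Suc k) * (\<Sum>s\<le>Suc k. T s (Suc k - s))"
    proof -
      have "(\<Sum>s\<le>k. of_nat (Suc (k - s)) * T s (Suc (k - s))) = (\<Sum>s\<le>Suc k. of_nat (Suc k - s) * T s (Suc k - s))"
        by (simp only: sum.atMost_Suc diff_self_eq_0 of_nat_0 mult_zero_left add_0_right)
          (rule sum.cong[OF refl], simp only: atMost_iff Suc_diff_le)
      moreover have "(\<Sum>s\<le>k. of_nat (Suc s) * T (Suc s) (k - s)) = (\<Sum>s\<le>Suc k. of_nat s * T s (Suc k - s))"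
        by (subst sum.atMost_Suc_shift) (simp del: of_nat_Suc)
      moreover have "(\<Sum>s\<le>Suc k. of_nat (Suc k - s) * T s (Suc k - s)) + (\<Sum>s\<le>Suc k. of_nat s * T s (Suc k - s))
         = (\<Sum>s\<le>Suc k. of_nat (Suc k) * T s (Suc k - s))"
        unfolding sum.distrib[symmetric]
      proof (intro sum.cong refl)
        fix s assume "s \<in> {..Suc k}"
        then have "of_nat (Suc k - s) + of_nat s = (of_nat (Suc k) :: complex)" by (simp add: of_nat_diff)
        then show "of_nat (Suc k - s) * T s (Suc k - s) + of_nat s * T s (Suc k - s) = of_nat (Suc k) * T s (Suc k - s)"
          by (metis distrib_right)
      qed
      ultimately show ?thesis by (simp only: sum_distrib_left)
    qed
    finally have "of_nat (Suc k) * (\<Sum>m<d. a (Suc k) i m * y p m j) = of_nat (Suc k) * (\<Sum>s\<le>Suc k. T s (Suc k - s))" .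
    then have "(\<Sum>m<d. a (Suc k) i m * y p m j) = (\<Sum>s\<le>Suc k. T s (Suc k - s))"
      by (metis mult_left_cancel of_nat_neq_0)
    then show ?case by (simp only: T_def)
  qed
  have sa: "summable (\<lambda>k. norm (a k i j))" if "i < d" "j < d" for i j
    unfolding a_def by (rule mat_exp_summable[OF A that])
  have sl: "summable (\<lambda>k. norm (l k i j))" if "i < N" "j < N" for i j
    unfolding l_def by (rule mat_exp_summable[OF L that])
  have ea: "(\<lambda>k. a k i j) sums (mat_exp A $$ (i,j))" if "i < d" "j < d" for i j
    unfolding a_def by (rule mat_exp_sums[OF A that])
  have el: "(\<lambda>k. l k i j) sums (mat_exp L $$ (i,j))" if "i < N" "j < N" for i j
    unfolding l_def by (rule mat_exp_sums[OF L that])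
  have S1: "(\<lambda>k. \<Sum>m<d. a k i m * y p m j) sums (\<Sum>m<d. mat_exp A $$ (i,m) * y p m j)"
    using ij by (intro sums_sum sums_mult2 ea) auto
  have S2: "(\<lambda>k. \<Sum>q<N. \<Sum>m<d. y q i m * (\<Sum>s\<le>k. l s q p * a (k - s) m j))
      sums (\<Sum>q<N. \<Sum>m<d. y q i m * (mat_exp L $$ (q,p) * mat_exp A $$ (m,j)))"
  proof (intro sums_sum sums_mult)
    fix q m assume "q \<in> {..<N}" "m \<in> {..<d}"
    then have qm: "q < N" "m < d" by auto
    have "(\<lambda>k. \<Sum>s\<le>k. l s q p * a (k - s) m j) sums ((\<Sum>k. l k q p) * (\<Sum>k. a k m j))"
      by (rule Cauchy_product_sums[OF sl[OF qm(1) p] sa[OF qm(2) ij(2)]])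
    then show "(\<lambda>k. \<Sum>s\<le>k. l s q p * a (k - s) m j) sums (mat_exp L $$ (q,p) * mat_exp A $$ (m,j))"
      using sums_unique[OF el[OF qm(1) p]] sums_unique[OF ea[OF qm(2) ij(2)]] by simp
  qed
  have S3: "(\<lambda>k. \<Sum>q<N. \<Sum>m<d. y q i m * (\<Sum>s\<le>k. l s q p * a (k - s) m j)) = (\<lambda>k. \<Sum>m<d. a k i m * y p m j)"
  proof
    fix k
    have "(\<Sum>m<d. a k i m * y p m j) = (\<Sum>q<N. \<Sum>s\<le>k. \<Sum>m<d. l s q p * (y q i m * a (k - s) m j))"
      unfolding key[OF p ij] by (rule sum.swap)
    also have "\<dots> = (\<Sum>q<N. \<Sum>m<d. \<Sum>s\<le>k. l s q p * (y q i m * a (k - s) m j))"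
      by (intro sum.cong refl sum.swap)
    finally show "(\<Sum>q<N. \<Sum>m<d. y q i m * (\<Sum>s\<le>k. l s q p * a (k - s) m j)) = (\<Sum>m<d. a k i m * y p m j)"
      by (simp add: sum_distrib_left mult_ac)
  qed
  have "(\<Sum>m<d. mat_exp A $$ (i,m) * y p m j) = (\<Sum>q<N. \<Sum>m<d. y q i m * (mat_exp L $$ (q,p) * mat_exp A $$ (m,j)))"
    by (rule sums_unique2[OF S1 S2[unfolded S3]])
  moreover have "(mat_exp A * Y p) $$ (i,j) = (\<Sum>m<d. mat_exp A $$ (i,m) * y p m j)"
    using mat_exp_carrier[OF A] Y[OF p] ij by (simp add: scalar_prod_def atLeast0LessThan y_def)
  moreover have "(Y q * mat_exp A) $$ (i,j) = (\<Sum>m<d. y q i m * mat_exp A $$ (m,j))" if "q < N" for q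
    using mat_exp_carrier[OF A] Y[OF that] ij by (simp add: scalar_prod_def atLeast0LessThan y_def)
  ultimately show ?thesis by (simp add: sum_distrib_left mult_ac)
qed

subsection \<open>Log-majorization\<close>

text \<open>The weight d plays the role of the logarithmic derivative of the convex increasing
  function t \<mapsto> h (exp t).\<close>
lemma abel_sum_nonneg:
  fixes w a :: "nat \<Rightarrow> real"
  assumes "\<And>j. j < n \<Longrightarrow> 0 \<le> w j" "\<And>i j. i \<le> j \<Longrightarrow> j < n \<Longrightarrow> w j \<le> w i"
    and "\<And>k. k \<le> n \<Longrightarrow> 0 \<le> (\<Sum>j<k. a j)"
  shows "0 \<le> (\<Sum>j<n. w j * a j)"
proof -
  have "m \<le> n \<Longrightarrow> m > 0 \<Longrightarrow> (\<Sum>j<m. w j * a j) \<ge> w (m - 1) * (\<Sum>j<m. a j)" for m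
  proof (induction m)
    case (Suc m)
    show ?case
    proof (cases "m = 0")
      case False
      then have "(\<Sum>j<m. w j * a j) \<ge> w (m - 1) * (\<Sum>j<m. a j)" using Suc by simp
      moreover have "w (m - 1) * (\<Sum>j<m. a j) \<ge> w m * (\<Sum>j<m. a j)"
        using assms(2)[of "m - 1" m] assms(3)[of m] Suc.prems by (intro mult_right_mono) auto
      ultimately show ?thesis by (simp add: algebra_simps)
    qed simp
  qed simp
  from this[of n] show ?thesis
    using assms(1)[of "n - 1"] assms(3)[of n] by (cases "n = 0") (auto intro: order_trans[OF mult_nonneg_nonneg])
qed

section \<open>Negative binary entropy as a convex function of the logarithm\<close>

definition gain :: "real \<Rightarrow> real" where "gain x = - Hbin ((1 + x) / 2)"

text \<open>This is artanh x / ln 2, the derivative of \<open>gain\<close>. The product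
  \<open>x * gain_slope x\<close> is accordingly the derivative with respect to ln x.\<close>

definition gain_slope :: "real \<Rightarrow> real" where
  "gain_slope x = (ln (1 + x) - ln (1 - x)) / (2 * ln 2)"

lemma gain_inner: "-1 < x \<Longrightarrow> x < 1 \<Longrightarrow>
  gain x = ((1 + x) / 2) * log 2 ((1 + x) / 2) + ((1 - x) / 2) * log 2 ((1 - x) / 2)"
proof -
  assume x: "-1 < x" "x < 1"
  have e: "1 - (1 + x) / 2 = (1 - x) / 2" by (simp add: field_simps)
  have p: "\<not> (1 + x) / 2 \<le> 0" "\<not> (1 - x) / 2 \<le> 0" using x by auto
  show ?thesis unfolding gain_def Hbin_def e eta_def if_not_P[OF p(1)] if_not_P[OF p(2)] by simp
qed

lemma gain_one: "gain 1 = 0" "gain (-1) = 0" by (simp_all add: gain_def Hbin_def eta_def)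

lemma gain_minus: "gain (- x) = gain x"
proof -
  have e: "1 - (1 + x) / 2 = (1 + - x) / 2" "1 - (1 + - x) / 2 = (1 + x) / 2" by (simp_all add: field_simps)
  show ?thesis unfolding gain_def Hbin_def e by simp
qed

lemma gain_deriv:
  assumes "-1 < x" "x < 1" shows "(gain has_real_derivative gain_slope x) (at x)"
proof -
  let ?f = "\<lambda>x. ((1 + x) * (ln (1 + x) - ln 2) + (1 - x) * (ln (1 - x) - ln 2)) / (2 * ln 2)"
  have "1 - x \<noteq> 0" "1 + x \<noteq> 0" using assms by auto
  then have "((1 + x) * (1 / (1 + x))) = 1" "(1 - x) * (- 1 / (1 - x)) = - 1" by simp_all
  moreover have "(?f has_real_derivative ((1 + x) * (1 / (1 + x)) + (ln (1 + x) - ln 2)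
      + ((1 - x) * (- 1 / (1 - x)) - (ln (1 - x) - ln 2))) / (2 * ln 2)) (at x)"
    using assms by (auto intro!: derivative_eq_intros) (simp add: divide_simps)
  ultimately have "(?f has_real_derivative gain_slope x) (at x)"
    by (simp only: gain_slope_def) simp
  moreover have "eventually (\<lambda>y. y \<in> {-1<..<1}) (nhds x)" using assms by (intro eventually_nhds_in_open) auto
  then have "eventually (\<lambda>y. ?f y = gain y) (nhds x)"
  proof eventually_elim
    case (elim y)
    then have "?f y = gain y \<longleftrightarrow> ?f y = ((1 + y) / 2) * log 2 ((1 + y) / 2) + ((1 - y) / 2) * log 2 ((1 - y) / 2)"
      by (simp add: gain_inner)
    moreover have "log 2 ((1 + y) / 2) = (ln (1 + y) - ln 2) / ln 2" "log 2 ((1 - y) / 2) = (ln (1 - y) - ln 2) / ln 2"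
      using elim by (simp_all add: log_def ln_div)
    ultimately show ?case by (simp add: field_simps)
  qed
  ultimately show ?thesis by (simp cong: DERIV_cong_ev)
qed

lemma gain_slope_nonneg: "0 \<le> x \<Longrightarrow> x < 1 \<Longrightarrow> 0 \<le> gain_slope x"
  by (simp add: gain_slope_def)

lemma gain_slope_mono: "0 \<le> x \<Longrightarrow> x \<le> y \<Longrightarrow> y < 1 \<Longrightarrow> gain_slope x \<le> gain_slope y"
  unfolding gain_slope_def by (intro divide_right_mono diff_mono) auto

lemma gain_weight_mono: "0 \<le> x \<Longrightarrow> x \<le> y \<Longrightarrow> y < 1 \<Longrightarrow> x * gain_slope x \<le> y * gain_slope y"
  using gain_slope_nonneg[of x] gain_slope_mono[of x y] by (intro mult_mono) auto

lemma eta_isCont: "x \<ge> 0 \<Longrightarrow> continuous (at x within {0..}) eta"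
proof (cases "x = 0")
  case True
  have "((\<lambda>x::real. - x * log 2 x) \<longlongrightarrow> 0) (at_right 0)" by real_asymp
  then have "(eta \<longlongrightarrow> 0) (at_right 0)"
    by (rule Lim_transform_eventually) (auto simp: eventually_at_right_less eta_def intro!: eventually_at_rightI[of 0 1])
  moreover have "at (0::real) within {0..} = at_right 0" by (rule at_within_Ici_at_right)
  ultimately show ?thesis using True by (simp add: continuous_within eta_def)
next
  case False
  assume "x \<ge> 0"
  with False have x: "x > 0" by simp
  have "isCont (\<lambda>x. - x * log 2 x) x" using x by (auto intro!: continuous_intros)
  moreover have "eventually (\<lambda>y. y \<in> {0<..}) (nhds x)" using x by (intro eventually_nhds_in_open) auto
  then have "eventually (\<lambda>y. eta y = - y * log 2 y) (nhds x)" by eventually_elim (simp add: eta_def)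
  ultimately have "isCont eta x" by (simp add: isCont_cong)
  then show ?thesis by (rule continuous_at_imp_continuous_within)
qed

lemma gain_continuous: "continuous_on {0..1} gain"
proof -
  have e: "continuous_on {0..} eta" using eta_isCont by (simp add: continuous_on_eq_continuous_within)
  have "continuous_on {0..1} (\<lambda>x. - (eta ((1 + x) / 2) + eta (1 - (1 + x) / 2)))"
    by (intro continuous_intros continuous_on_compose2[OF e]) auto
  then show ?thesis by (simp add: gain_def[abs_def] Hbin_def)
qed

lemma gain_mono: assumes "0 \<le> x" "x \<le> y" "y \<le> 1" shows "gain x \<le> gain y"
proof (rule DERIV_nonneg_imp_increasing_open[OF assms(2)])
  show "\<exists>z. DERIV gain t :> z \<and> 0 \<le> z" if "x < t" "t < y" for t
    using gain_deriv[of t] gain_slope_nonneg[of t] assms that by auto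
  show "continuous_on {x..y} gain" by (rule continuous_on_subset[OF gain_continuous]) (use assms in auto)
qed

text \<open>Supporting line at ln x of the convex function sending t to \<open>gain (exp t)\<close>.
  After its subtraction the derivative is nonpositive before x and nonnegative after it, by
  \<open>gain_weight_mono\<close>. The endpoint y = 1, where the slope is infinite, is reached by
  continuity.\<close>

lemma gain_tangent:
  assumes x: "0 < x" "x < 1" and y: "0 < y" "y \<le> 1"
  shows "gain x + (x * gain_slope x) * (ln y - ln x) \<le> gain y"
proof -
  define F where "F t = gain t - (x * gain_slope x) * ln t" for t
  have d: "(F has_real_derivative (t * gain_slope t - x * gain_slope x) / t) (at t)" if "0 < t" "t < 1" for t
    unfolding F_def using that by (auto intro!: derivative_eq_intros gain_deriv simp: field_simps)
  have c: "continuous_on {a..b} F" if "0 < a" "b \<le> 1" for a b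
    unfolding F_def using that by (intro continuous_intros continuous_on_subset[OF gain_continuous]) auto
  have "F x \<le> F y"
  proof (cases "x \<le> y")
    case True
    show ?thesis
    proof (rule DERIV_nonneg_imp_increasing_open[OF True])
      fix t assume "x < t" "t < y"
      then show "\<exists>z. DERIV F t :> z \<and> 0 \<le> z"
        using d[of t] gain_weight_mono[of x t] x y by (intro exI conjI divide_nonneg_pos) auto
    qed (use c x y in auto)
  next
    case False
    show ?thesis
    proof (rule DERIV_nonpos_imp_decreasing_open[of y x F])
      fix t assume "y < t" "t < x"
      then show "\<exists>z. DERIV F t :> z \<and> z \<le> 0"
        using d[of t] gain_weight_mono[of t x] x y
        by (intro exI[of _ "(t * gain_slope t - x * gain_slope x) / t"]) (auto simp: divide_le_0_iff)
    qed (use c x y False in auto)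
  qed
  then show ?thesis by (simp add: F_def algebra_simps)
qed

text \<open>Tangents at \<open>ln (lam j)\<close> have decreasing nonnegative slopes, so Abel
  summation needs only the partial products. Two values escape the logarithmic argument. At
  \<open>lam 0 = 1\<close> the slope is infinite, but \<open>mu 0 = 1\<close> is forced and the pair
  is split off by induction; at entries 0 the logarithm is infinite, and monotonicity of
  \<open>gain\<close> suffices.\<close>

lemma gain_log_majorization:
  fixes lam mu :: "nat \<Rightarrow> real"
  assumes "\<And>j. j < n \<Longrightarrow> 0 \<le> lam j" "\<And>j. j < n \<Longrightarrow> lam j \<le> 1" "\<And>i j. i \<le> j \<Longrightarrow> j < n \<Longrightarrow> lam j \<le> lam i"
    and "\<And>j. j < n \<Longrightarrow> 0 \<le> mu j" "\<And>j. j < n \<Longrightarrow> mu j \<le> 1"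
    and "\<And>k. k \<le> n \<Longrightarrow> (\<Prod>j<k. lam j) \<le> (\<Prod>j<k. mu j)"
  shows "(\<Sum>j<n. gain (lam j)) \<le> (\<Sum>j<n. gain (mu j))"
  using assms
proof (induction n arbitrary: lam mu)
  case (Suc n)
  show ?case
  proof (cases "lam 0 = 1")
    case True
    have "lam 0 \<le> mu 0" using Suc.prems(6)[of 1] by simp
    then have mu0: "mu 0 = 1" using Suc.prems(5)[of 0] True by simp
    have "(\<Sum>j<n. gain (lam (Suc j))) \<le> (\<Sum>j<n. gain (mu (Suc j)))"
    proof (rule Suc.IH)
      fix k assume "k \<le> n"
      then show "(\<Prod>j<k. lam (Suc j)) \<le> (\<Prod>j<k. mu (Suc j))"
        using Suc.prems(6)[of "Suc k"] True mu0 by (simp add: prod.lessThan_Suc_shift del: prod.lessThan_Suc)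
    qed (use Suc.prems in auto)
    then show ?thesis using True mu0 by (simp add: sum.lessThan_Suc_shift del: sum.lessThan_Suc)
  next
    case False
    have l1: "lam j < 1" if "j < Suc n" for j
      using Suc.prems(3)[of 0 j] Suc.prems(2)[of 0] False that by auto
    \<comment> \<open>Position of the first zero of \<open>lam\<close>, or \<open>Suc n\<close> if
      there is none; as \<open>lam\<close> decreases, it vanishes from m on.\<close>
    define m where "m = (LEAST m. m = Suc n \<or> lam m = 0)"
    have "m = Suc n \<or> lam m = 0" unfolding m_def by (rule LeastI[of _ "Suc n"]) simp
    moreover have "m \<le> Suc n" unfolding m_def by (rule Least_le) simp
    ultimately have mz: "lam j = 0" if "m \<le> j" "j < Suc n" for j
      using Suc.prems(3)[of m j] Suc.prems(1)[of j] that by auto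
    have lp: "lam j > 0" if "j < m" for j
    proof -
      have "\<not> (j = Suc n \<or> lam j = 0)" using not_less_Least[of j] that unfolding m_def by blast
      then show ?thesis using Suc.prems(1)[of j] that \<open>m \<le> Suc n\<close> by auto
    qed
    \<comment> \<open>A zero of \<open>mu\<close> below m would make its partial product up to m
      vanish while that of \<open>lam\<close> is positive.\<close>
    have mp: "mu j > 0" if "j < m" for j
    proof (rule ccontr)
      assume "\<not> mu j > 0"
      then have "mu j = 0" using Suc.prems(4)[of j] that \<open>m \<le> Suc n\<close> by auto
      then have "(\<Prod>j<m. mu j) = 0" using that by auto
      moreover have "(\<Prod>j<m. lam j) > 0" using lp by (intro prod_pos) auto
      ultimately show False using Suc.prems(6)[OF \<open>m \<le> Suc n\<close>] by linarith
    qed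
    have "0 \<le> (\<Sum>j<m. (lam j * gain_slope (lam j)) * (ln (mu j) - ln (lam j)))"
    proof (rule abel_sum_nonneg)
      fix j assume j: "j < m"
      show "0 \<le> lam j * gain_slope (lam j)"
        using lp[OF j] l1[of j] gain_slope_nonneg[of "lam j"] j \<open>m \<le> Suc n\<close> by (intro mult_nonneg_nonneg) auto
      fix i assume "i \<le> j"
      then show "lam j * gain_slope (lam j) \<le> lam i * gain_slope (lam i)"
        using lp[OF j] l1[of i] Suc.prems(3)[of i j] j \<open>m \<le> Suc n\<close> by (intro gain_weight_mono) auto
    next
      fix k assume k: "k \<le> m"
      have "ln (\<Prod>j<k. lam j) \<le> ln (\<Prod>j<k. mu j)"
      proof -
        have 1: "(\<Prod>j<k. lam j) > 0"
        proof (rule prod_pos)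
          fix i assume "i \<in> {..<k}"
          then have "i < m" using k by simp
          then show "0 < lam i" by (rule lp)
        qed
        have 2: "(\<Prod>j<k. lam j) \<le> (\<Prod>j<k. mu j)" using Suc.prems(6)[of k] k \<open>m \<le> Suc n\<close> by simp
        show ?thesis using ln_le_cancel_iff[of "\<Prod>j<k. lam j" "\<Prod>j<k. mu j"] 1 2 by linarith
      qed
      moreover have nz: "lam i > 0" "mu i > 0" if "i < k" for i using lp[of i] mp[of i] k that by simp_all
      have "ln (\<Prod>j<k. lam j) = (\<Sum>j<k. ln (lam j))" by (intro ln_prod) (use nz in force)+
      moreover have "ln (\<Prod>j<k. mu j) = (\<Sum>j<k. ln (mu j))" by (intro ln_prod) (use nz in force)+
      ultimately show "0 \<le> (\<Sum>j<k. ln (mu j) - ln (lam j))" by (simp add: sum_subtractf)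
    qed
    also have "\<dots> \<le> (\<Sum>j<m. gain (mu j) - gain (lam j))"
    proof (rule sum_mono)
      fix j assume "j \<in> {..<m}"
      then have j: "j < m" "j < Suc n" using \<open>m \<le> Suc n\<close> by auto
      show "(lam j * gain_slope (lam j)) * (ln (mu j) - ln (lam j)) \<le> gain (mu j) - gain (lam j)"
        using gain_tangent[of "lam j" "mu j"] lp[OF j(1)] l1[OF j(2)] mp[OF j(1)] Suc.prems(5)[OF j(2)] by simp
    qed
    also have "\<dots> \<le> (\<Sum>j<Suc n. gain (mu j) - gain (lam j))"
    proof (rule sum_mono2)
      fix j assume "j \<in> {..<Suc n} - {..<m}"
      then show "0 \<le> gain (mu j) - gain (lam j)"
        using mz[of j] gain_mono[of 0 "mu j"] Suc.prems(4,5)[of j] by auto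
    qed (use \<open>m \<le> Suc n\<close> in auto)
    finally show ?thesis by (simp add: sum_subtractf)
  qed
qed simp

subsection \<open>Hermitian eigenbases\<close>

definition orthonormal :: "nat \<Rightarrow> nat \<Rightarrow> (nat \<Rightarrow> complex vec) \<Rightarrow> bool" where
  "orthonormal d k f \<longleftrightarrow> (\<forall>i<k. f i \<in> carrier_vec d) \<and> (\<forall>i<k. \<forall>j<k. f i \<bullet>c f j = (if i = j then 1 else 0))"

lemma cscalar_sum: "v \<in> carrier_vec d \<Longrightarrow> w \<in> carrier_vec d \<Longrightarrow> v \<bullet>c w = (\<Sum>i<d. v $ i * cnj (w $ i))"
  by (simp add: scalar_prod_def atLeast0LessThan)

lemma cscalar_smult_right:
  assumes v: "v \<in> carrier_vec d" and w: "w \<in> carrier_vec d"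
  shows "v \<bullet>c (z \<cdot>\<^sub>v w) = cnj z * (v \<bullet>c w)"
proof -
  have "v \<bullet>c (z \<cdot>\<^sub>v w) = (\<Sum>i<d. v $ i * cnj ((z \<cdot>\<^sub>v w) $ i))" using w by (intro cscalar_sum v) auto
  also have "\<dots> = (\<Sum>i<d. cnj z * (v $ i * cnj (w $ i)))" using w by (intro sum.cong refl) auto
  finally show ?thesis by (simp add: cscalar_sum[OF v w] sum_distrib_left)
qed

lemma cscalar_self: "v \<in> carrier_vec d \<Longrightarrow> v \<bullet>c v = complex_of_real (\<Sum>i<d. (cmod (v $ i))^2)"
  by (simp add: cscalar_sum complex_norm_square[symmetric])

lemma normalize_vec:
  assumes v: "v \<in> carrier_vec d" "v \<noteq> 0\<^sub>v d"
  obtains r where "r > 0" "(complex_of_real r \<cdot>\<^sub>v v) \<bullet>c (complex_of_real r \<cdot>\<^sub>v v) = 1"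
proof -
  define s where "s = (\<Sum>i<d. (cmod (v $ i))^2)"
  have "\<exists>i<d. v $ i \<noteq> 0" using v by (auto simp: vec_eq_iff)
  then have s: "s > 0" unfolding s_def by (auto intro!: sum_pos2)
  define r where "r = 1 / sqrt s"
  have "r > 0" using s by (simp add: r_def)
  have "(complex_of_real r \<cdot>\<^sub>v v) \<bullet>c (complex_of_real r \<cdot>\<^sub>v v) = complex_of_real (\<Sum>i<d. (r * cmod (v $ i))^2)"
    using v \<open>r > 0\<close> by (subst cscalar_self[of _ d]) (auto simp: norm_mult)
  also have "(\<Sum>i<d. (r * cmod (v $ i))^2) = r^2 * s" by (simp add: s_def power_mult_distrib sum_distrib_left)
  also have "r^2 * s = 1" using s by (simp add: r_def power_divide)
  finally have "(complex_of_real r \<cdot>\<^sub>v v) \<bullet>c (complex_of_real r \<cdot>\<^sub>v v) = 1" by simp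
  then show ?thesis using that[of r] s by (simp add: r_def)
qed

text \<open>Dimension counting by determinants: fewer than d linear conditions, padded with zero
  rows to a square matrix, have a common nonzero solution. The field is general because both complex
  and real vectors are extended this way.\<close>

lemma zero_row_kernel:
  fixes A :: "'a::field mat"
  assumes A: "A \<in> carrier_mat d d" and r: "r < d" "\<And>j. j < d \<Longrightarrow> A $$ (r,j) = 0"
  obtains v where "v \<in> carrier_vec d" "v \<noteq> 0\<^sub>v d" "A *\<^sub>v v = 0\<^sub>v d"
proof -
  have "det A = (\<Sum>j<d. A $$ (r,j) * cofactor A r j)" by (rule laplace_expansion_row[OF A r(1)])
  also have "\<dots> = 0" using r by (intro sum.neutral) auto
  finally have "det A = 0" .
  then show ?thesis using det_0_iff_vec_prod_zero_field[OF A] that by blast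
qed

lemma orthonormal_extend:
  assumes f: "orthonormal d k f" and k: "k < d"
  obtains w where "w \<in> carrier_vec d" "w \<bullet>c w = 1" "\<And>i. i < k \<Longrightarrow> w \<bullet>c f i = 0" "\<And>i. i < k \<Longrightarrow> f i \<bullet>c w = 0"
proof -
  define M where "M = mat d d (\<lambda>(i,j). if i < k then cnj (f i $ j) else 0)"
  have M: "M \<in> carrier_mat d d" by (simp add: M_def)
  obtain v where v: "v \<in> carrier_vec d" "v \<noteq> 0\<^sub>v d" "M *\<^sub>v v = 0\<^sub>v d"
    by (rule zero_row_kernel[OF M k]) (use k in \<open>auto simp: M_def\<close>)
  have o: "(\<Sum>j<d. v $ j * cnj (f i $ j)) = 0" if "i < k" for i
  proof -
    have "(M *\<^sub>v v) $ i = 0" using v that k by simp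
    then show ?thesis using v that k by (simp add: M_def scalar_prod_def atLeast0LessThan mult.commute)
  qed
  from normalize_vec[OF v(1,2)] obtain r where r: "(complex_of_real r \<cdot>\<^sub>v v) \<bullet>c (complex_of_real r \<cdot>\<^sub>v v) = 1" by metis
  let ?w = "complex_of_real r \<cdot>\<^sub>v v"
  have fc: "f i \<in> carrier_vec d" if "i < k" for i using f that by (auto simp: orthonormal_def)
  have 1: "?w \<bullet>c f i = 0" if "i < k" for i
    using o[OF that] fc[OF that] v(1) by (simp add: cscalar_sum[of _ d] mult.assoc sum_distrib_left[symmetric])
  have 2: "f i \<bullet>c ?w = 0" if "i < k" for i
  proof -
    have "f i \<bullet>c ?w = cnj (?w \<bullet>c f i)" using fc[OF that] v(1) by (simp add: cscalar_sum[of _ d] mult.commute)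
    then show ?thesis using 1[OF that] by simp
  qed
  show ?thesis by (rule that[of ?w]) (use v r 1 2 in auto)
qed

lemma orthonormal_insert:
  assumes "orthonormal d k f" "w \<in> carrier_vec d" "w \<bullet>c w = 1" "\<And>i. i < k \<Longrightarrow> w \<bullet>c f i = 0" "\<And>i. i < k \<Longrightarrow> f i \<bullet>c w = 0"
  shows "orthonormal d (Suc k) (f(k := w))"
  using assms by (auto simp: orthonormal_def less_Suc_eq)

lemma orthonormal_complete:
  assumes "orthonormal d k f" "k \<le> d"
  shows "\<exists>g. orthonormal d d g \<and> (\<forall>i<k. g i = f i)"
  using assms
proof (induction "d - k" arbitrary: k f)
  case (Suc m)
  then have k: "k < d" by simp
  obtain w where w: "w \<in> carrier_vec d" "w \<bullet>c w = 1" "\<And>i. i < k \<Longrightarrow> w \<bullet>c f i = 0" "\<And>i. i < k \<Longrightarrow> f i \<bullet>c w = 0"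
    using orthonormal_extend[OF Suc.prems(1) k] by metis
  have "m = d - Suc k" using Suc.hyps(2) by linarith
  from Suc.hyps(1)[OF this orthonormal_insert[OF Suc.prems(1) w]] k
  obtain g where "orthonormal d d g" "\<forall>i<Suc k. g i = (f(k := w)) i" by auto
  then show ?case by (intro exI[of _ g]) auto
qed auto

definition cols_mat :: "nat \<Rightarrow> (nat \<Rightarrow> complex vec) \<Rightarrow> complex mat" where
  "cols_mat d f = mat d d (\<lambda>(i,j). f j $ i)"

lemma cols_mat_unitary:
  assumes f: "orthonormal d d f"
  shows "cols_mat d f \<in> carrier_mat d d" "adj (cols_mat d f) * cols_mat d f = 1\<^sub>m d" "cols_mat d f * adj (cols_mat d f) = 1\<^sub>m d"
proof -
  show c: "cols_mat d f \<in> carrier_mat d d" by (simp add: cols_mat_def)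
  show 1: "adj (cols_mat d f) * cols_mat d f = 1\<^sub>m d"
  proof (rule eq_matI)
    fix i j assume "i < dim_row (1\<^sub>m d)" "j < dim_col (1\<^sub>m d)"
    then have ij: "i < d" "j < d" by auto
    have "(adj (cols_mat d f) * cols_mat d f) $$ (i,j) = (\<Sum>l<d. f j $ l * cnj (f i $ l))"
      using ij by (simp add: cols_mat_def adj_def scalar_prod_def atLeast0LessThan mult.commute)
    also have "\<dots> = f j \<bullet>c f i"
      by (rule cscalar_sum[symmetric]) (use f ij in \<open>auto simp: orthonormal_def\<close>)
    finally have "(adj (cols_mat d f) * cols_mat d f) $$ (i,j) = f j \<bullet>c f i" .
    then show "(adj (cols_mat d f) * cols_mat d f) $$ (i,j) = 1\<^sub>m d $$ (i,j)" using ij f by (auto simp: orthonormal_def)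
  qed (use c in \<open>auto simp: adj_def\<close>)
  show "cols_mat d f * adj (cols_mat d f) = 1\<^sub>m d"
    by (rule mat_mult_left_right_inverse[OF adj_carrier[OF c] c 1])
qed

lemma mat_vec_sum: "A \<in> carrier_mat d d \<Longrightarrow> v \<in> carrier_vec d \<Longrightarrow> i < d \<Longrightarrow> (A *\<^sub>v v) $ i = (\<Sum>j<d. A $$ (i,j) * v $ j)"
  for A :: "complex mat"
  by (simp add: scalar_prod_def atLeast0LessThan)

text \<open>The eigenvectors found so far are completed to an orthonormal basis, in which A becomes
  B. By hermiticity the block of B leading from the complement into their span vanishes, so an
  eigenvector of the remaining square block C, padded with zeros, is an eigenvector of B orthogonal
  to the earlier ones.\<close>

lemma hermitian_eigenbasis_step:
  assumes A: "A \<in> carrier_mat d d" and H: "adj A = A" and f: "orthonormal d k f" and k: "k < d"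
    and ev: "\<And>i. i < k \<Longrightarrow> A *\<^sub>v f i = x i \<cdot>\<^sub>v f i"
  obtains w mu where "w \<in> carrier_vec d" "w \<bullet>c w = 1" "\<And>i. i < k \<Longrightarrow> w \<bullet>c f i = 0" "\<And>i. i < k \<Longrightarrow> f i \<bullet>c w = 0"
    "A *\<^sub>v w = mu \<cdot>\<^sub>v w"
proof -
  from orthonormal_complete[OF f] k obtain g where g: "orthonormal d d g" "\<And>i. i < k \<Longrightarrow> g i = f i" by auto
  have gc: "g i \<in> carrier_vec d" if "i < d" for i using g that by (auto simp: orthonormal_def)
  have gg: "g i \<bullet>c g j = (if i = j then 1 else 0)" if "i < d" "j < d" for i j using g(1) that by (auto simp: orthonormal_def)
  define V where "V = cols_mat d g"
  note V = cols_mat_unitary[OF g(1), folded V_def]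
  define B where "B = mat d d (\<lambda>(i,j). (A *\<^sub>v g j) \<bullet>c g i)"
  have cB: "B \<in> carrier_mat d d" by (simp add: B_def)
  have Vcol: "(V *\<^sub>v c) $ l = (\<Sum>j<d. g j $ l * c $ j)" if "c \<in> carrier_vec d" "l < d" for c l
    unfolding mat_vec_sum[OF V(1) that] using that by (auto simp: V_def cols_mat_def intro!: sum.cong)
  have adjV: "(adj V *\<^sub>v y) $ i = y \<bullet>c g i" if "y \<in> carrier_vec d" "i < d" for y i
    unfolding mat_vec_sum[OF adj_carrier[OF V(1)] that] cscalar_sum[OF that(1) gc[OF that(2)]]
    using that by (auto simp: V_def cols_mat_def adj_def intro!: sum.cong)
  have swap: "(A *\<^sub>v y) \<bullet>c z = y \<bullet>c (A *\<^sub>v z)" if "y \<in> carrier_vec d" "z \<in> carrier_vec d" for y z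
    using cscalar_adj[OF A that] H by simp
  have B0: "B $$ (i,j) = 0" if "i < k" "k \<le> j" "j < d" for i j
  proof -
    have "B $$ (i,j) = g j \<bullet>c (x i \<cdot>\<^sub>v g i)" using that k swap[OF gc gc, of j i] ev g(2) by (simp add: B_def)
    also have "\<dots> = cnj (x i) * (g j \<bullet>c g i)"
      using that k by (intro cscalar_smult_right[of _ d] gc) auto
    finally show ?thesis using gg[of j i] that k by simp
  qed
  define m where "m = d - k"
  have m: "m \<noteq> 0" using k by (simp add: m_def)
  define C where "C = mat m m (\<lambda>(i,j). B $$ (k + i, k + j))"
  have C: "C \<in> carrier_mat m m" by (simp add: C_def)
  from spectrum_non_empty[OF C] m obtain mu where "eigenvalue C mu" by (auto simp: spectrum_def)
  then obtain c where c: "c \<in> carrier_vec m" "c \<noteq> 0\<^sub>v m" "C *\<^sub>v c = mu \<cdot>\<^sub>v c"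
    using C by (auto simp: eigenvalue_def eigenvector_def)
  define e where "e = vec d (\<lambda>j. if j < k then 0 else c $ (j - k))"
  have ce: "e \<in> carrier_vec d" by (simp add: e_def)
  have e0: "e \<noteq> 0\<^sub>v d"
  proof
    assume z: "e = 0\<^sub>v d"
    have ek: "e $ (k + i) = c $ i" if "i < m" for i using that by (simp add: e_def m_def)
    have "c $ i = 0" if "i < m" for i
      using ek[OF that] that unfolding z by (simp add: m_def)
    then show False using c by (auto simp: vec_eq_iff)
  qed
  have split: "(\<Sum>j<d. B $$ (i,j) * e $ j) = (\<Sum>j<m. B $$ (i,k + j) * c $ j)" for i
  proof -
    have "(\<Sum>j<d. B $$ (i,j) * e $ j) = (\<Sum>j\<in>{k..<d}. B $$ (i,j) * c $ (j - k))"
      by (rule sum.mono_neutral_cong_right) (auto simp: e_def)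
    also have "\<dots> = (\<Sum>j<m. B $$ (i,k + j) * c $ j)"
      by (rule sum.reindex_bij_witness[of _ "\<lambda>j. k + j" "\<lambda>j. j - k"]) (auto simp: m_def)
    finally show ?thesis .
  qed
  have Be: "B *\<^sub>v e = mu \<cdot>\<^sub>v e"
  proof (rule eq_vecI)
    fix i assume "i < dim_vec (mu \<cdot>\<^sub>v e)"
    then have i: "i < d" using ce by simp
    show "(B *\<^sub>v e) $ i = (mu \<cdot>\<^sub>v e) $ i"
    proof (cases "i < k")
      case True
      then have "(\<Sum>j<m. B $$ (i,k + j) * c $ j) = 0" using B0 by (intro sum.neutral) (auto simp: m_def)
      then show ?thesis using mat_vec_sum[OF cB ce i] split i True by (simp add: e_def)
    next
      case False
      then have "(C *\<^sub>v c) $ (i - k) = (\<Sum>j<m. B $$ (i,k + j) * c $ j)"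
        using mat_vec_sum[OF C c(1), of "i - k"] i by (simp add: C_def m_def)
      moreover have "(C *\<^sub>v c) $ (i - k) = mu * c $ (i - k)" unfolding c(3) using c(1) i False by (simp add: m_def)
      ultimately show ?thesis using mat_vec_sum[OF cB ce i] split i False by (simp add: e_def)
    qed
  qed (use cB ce in auto)
  define w where "w = V *\<^sub>v e"
  have cw: "w \<in> carrier_vec d" using V(1) ce unfolding w_def by (rule mult_mat_vec_carrier)
  have Vw: "adj V *\<^sub>v w = e"
  proof -
    have "adj V *\<^sub>v w = (adj V * V) *\<^sub>v e" using V(1) ce unfolding w_def by (simp add: assoc_mult_mat_vec[of _ d d _ d])
    then show ?thesis using V(2) ce by simp
  qed
  have bk: "V *\<^sub>v (adj V *\<^sub>v y) = y" if "y \<in> carrier_vec d" for y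
    using V that assoc_mult_mat_vec[OF V(1) adj_carrier[OF V(1)] that] by simp
  have wg: "w \<bullet>c g i = e $ i" if "i < d" for i using adjV[OF cw that] Vw by simp
  have AVB: "adj V *\<^sub>v (A *\<^sub>v w) = B *\<^sub>v e"
  proof (rule eq_vecI)
    fix i assume "i < dim_vec (B *\<^sub>v e)"
    then have i: "i < d" using cB by simp
    have "(adj V *\<^sub>v (A *\<^sub>v w)) $ i = (A *\<^sub>v w) \<bullet>c g i" using adjV[OF mult_mat_vec_carrier[OF A cw] i] .
    also have "\<dots> = w \<bullet>c (A *\<^sub>v g i)" using swap[OF cw gc[OF i]] .
    also have "\<dots> = (\<Sum>l<d. (\<Sum>j<d. g j $ l * e $ j) * cnj ((A *\<^sub>v g i) $ l))"
      using cw mult_mat_vec_carrier[OF A gc[OF i]] Vcol[OF ce] by (simp add: cscalar_sum[of _ d] w_def)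
    also have "\<dots> = (\<Sum>j<d. (\<Sum>l<d. g j $ l * cnj ((A *\<^sub>v g i) $ l)) * e $ j)"
      unfolding sum_distrib_right by (subst sum.swap) (simp add: mult_ac)
    also have "\<dots> = (\<Sum>j<d. (g j \<bullet>c (A *\<^sub>v g i)) * e $ j)"
      using gc mult_mat_vec_carrier[OF A gc[OF i]] by (simp add: cscalar_sum[of _ d])
    also have "\<dots> = (\<Sum>j<d. B $$ (i,j) * e $ j)" using swap[OF gc gc[OF i]] i by (simp add: B_def)
    finally show "(adj V *\<^sub>v (A *\<^sub>v w)) $ i = (B *\<^sub>v e) $ i" using mat_vec_sum[OF cB ce i] by simp
  qed (use V cB in \<open>auto simp: adj_def\<close>)
  have Aw: "A *\<^sub>v w = mu \<cdot>\<^sub>v w"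
  proof -
    have "A *\<^sub>v w = V *\<^sub>v (B *\<^sub>v e)" using bk[OF mult_mat_vec_carrier[OF A cw]] AVB by simp
    also have "\<dots> = mu \<cdot>\<^sub>v w" unfolding Be w_def by (rule mult_mat_vec[OF V(1) ce])
    finally show ?thesis .
  qed
  have "w \<noteq> 0\<^sub>v d"
  proof
    assume "w = 0\<^sub>v d"
    then have "e = adj V *\<^sub>v 0\<^sub>v d" using Vw by simp
    also have "\<dots> = 0\<^sub>v d" using V(1) by (intro eq_vecI) (auto simp: scalar_prod_def adj_def)
    finally show False using e0 by simp
  qed
  from normalize_vec[OF cw this] obtain r where r: "r > 0" "(complex_of_real r \<cdot>\<^sub>v w) \<bullet>c (complex_of_real r \<cdot>\<^sub>v w) = 1" by metis
  let ?w = "complex_of_real r \<cdot>\<^sub>v w"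
  have 1: "?w \<bullet>c f i = 0" if "i < k" for i
  proof -
    have "?w \<bullet>c f i = complex_of_real r * (w \<bullet>c f i)" using cw gc[of i] g(2)[OF that] that k by simp
    then show ?thesis using wg[of i] g(2)[OF that] that k by (simp add: e_def)
  qed
  have 2: "f i \<bullet>c ?w = 0" if "i < k" for i
  proof -
    have "f i \<bullet>c ?w = cnj (?w \<bullet>c f i)" using gc[of i] g(2)[OF that] that k cw by (simp add: cscalar_sum[of _ d] mult.commute)
    then show ?thesis using 1[OF that] by simp
  qed
  have "A *\<^sub>v ?w = mu \<cdot>\<^sub>v ?w"
    using mult_mat_vec[OF A cw] Aw cw by (simp add: smult_smult_assoc mult.commute)
  then show ?thesis using that[of ?w mu] cw r 1 2 by simp
qed

lemma hermitian_eigenbasis: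
  assumes A: "A \<in> carrier_mat d d" and H: "adj A = A"
  obtains f x where "orthonormal d d f" "\<And>i. i < d \<Longrightarrow> A *\<^sub>v f i = complex_of_real (x i) \<cdot>\<^sub>v f i"
proof -
  have "k \<le> d \<Longrightarrow> \<exists>f x. orthonormal d k f \<and> (\<forall>i<k. A *\<^sub>v f i = x i \<cdot>\<^sub>v f i)" for k
  proof (induction k)
    case 0 then show ?case by (auto simp: orthonormal_def)
  next
    case (Suc k)
    then obtain f x where f: "orthonormal d k f" "\<And>i. i < k \<Longrightarrow> A *\<^sub>v f i = x i \<cdot>\<^sub>v f i" by auto
    from Suc have k: "k < d" by simp
    obtain w mu where w: "w \<in> carrier_vec d" "w \<bullet>c w = 1" "\<And>i. i < k \<Longrightarrow> w \<bullet>c f i = 0" "\<And>i. i < k \<Longrightarrow> f i \<bullet>c w = 0"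
      "A *\<^sub>v w = mu \<cdot>\<^sub>v w"
      using hermitian_eigenbasis_step[OF A H f(1) k f(2)] by metis
    show ?case
      by (intro exI[of _ "f(k := w)"] exI[of _ "x(k := mu)"] conjI orthonormal_insert f(1) w(1-4))
        (use f(2) w(5) in \<open>auto simp: less_Suc_eq\<close>)
  qed
  from this[of d] obtain f x where f: "orthonormal d d f" "\<And>i. i < d \<Longrightarrow> A *\<^sub>v f i = x i \<cdot>\<^sub>v f i" by auto
  have "x i = complex_of_real (Re (x i))" if i: "i < d" for i
  proof -
    have c: "f i \<in> carrier_vec d" and n: "f i \<bullet>c f i = 1" using f(1) i by (auto simp: orthonormal_def)
    have "x i = (A *\<^sub>v f i) \<bullet>c f i" using f(2)[OF i] c n by simp
    also have "\<dots> = f i \<bullet>c (A *\<^sub>v f i)" using cscalar_adj[OF A c c] H by simp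
    also have "\<dots> = cnj (x i) * (f i \<bullet>c f i)" unfolding f(2)[OF i] by (rule cscalar_smult_right[OF c c])
    finally have "x i = cnj (x i)" using n by simp
    then show ?thesis by (metis Reals_cnj_iff complex_is_Real_iff of_real_Re)
  qed
  then have "A *\<^sub>v f i = complex_of_real (Re (x i)) \<cdot>\<^sub>v f i" if "i < d" for i using f(2) that by simp
  from that[OF f(1) this] show ?thesis .
qed

lemma entropy_eigenbasis:
  assumes A: "A \<in> carrier_mat d d" and f: "orthonormal d d f" and x: "\<And>i. i < d \<Longrightarrow> A *\<^sub>v f i = complex_of_real (x i) \<cdot>\<^sub>v f i"
  shows "vN_entropy A = (\<Sum>i<d. eta (x i))"
proof -
  note V = cols_mat_unitary[OF f]
  let ?V = "cols_mat d f"
  have fc: "f i \<in> carrier_vec d" if "i < d" for i using f that by (auto simp: orthonormal_def)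
  have col: "col ?V j = f j" if "j < d" for j using fc[OF that] that by (intro eq_vecI) (auto simp: cols_mat_def)
  have AV: "col (A * ?V) j = complex_of_real (x j) \<cdot>\<^sub>v f j" if "j < d" for j
    using col_mult2[OF A V(1) that] x[OF that] col[OF that] by simp
  have D: "adj ?V * A * ?V = mat d d (\<lambda>(i,j). if i = j then complex_of_real (x i) else 0)"
  proof (rule eq_matI)
    fix i j assume "i < dim_row (mat d d (\<lambda>(i,j). if i = j then complex_of_real (x i) else 0))" "j < dim_col (mat d d (\<lambda>(i,j). if i = j then complex_of_real (x i) else 0))"
    then have ij: "i < d" "j < d" by auto
    have "(adj ?V * A * ?V) $$ (i,j) = (adj ?V * (A * ?V)) $$ (i,j)" using A V(1) by (simp add: assoc_mult_mat[of _ d d _ d _ d])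
    also have "\<dots> = row (adj ?V) i \<bullet> (complex_of_real (x j) \<cdot>\<^sub>v f j)"
      using ij A V(1) AV[OF ij(2)] by (subst index_mult_mat) (auto simp: adj_def cols_mat_def)
    also have "\<dots> = complex_of_real (x j) * (f j \<bullet>c f i)"
      using ij fc[of i] fc[of j] by (simp add: cscalar_sum[of _ d] scalar_prod_def atLeast0LessThan adj_def cols_mat_def sum_distrib_left mult_ac)
    also have "f j \<bullet>c f i = (if j = i then 1 else 0)" using f ij by (auto simp: orthonormal_def)
    finally show "(adj ?V * A * ?V) $$ (i,j) = mat d d (\<lambda>(i,j). if i = j then complex_of_real (x i) else 0) $$ (i,j)" using ij by auto
  qed (use A V(1) in \<open>auto simp: adj_def\<close>)
  from vN_entropy_roots[OF char_poly_diagonalized[OF A V(1) adj_carrier[OF V(1)] V(2) D]]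
  show ?thesis by (simp add: sum_list_sum_nth atLeast0LessThan)
qed

subsection \<open>Conjugate matchings\<close>

text \<open>Contracting a pair of edges reduces the claim to a smaller vertex set; the fixed point x
  anchors the reflection.\<close>
lemma matchings_conjugate:
  fixes V :: "'a set"
  assumes "finite V"
    and "\<And>y. y \<in> V \<Longrightarrow> m0 y \<in> V \<and> m0 (m0 y) = y \<and> m0 y \<noteq> y"
    and "\<And>y. y \<in> V \<Longrightarrow> m1 y \<in> V \<and> m1 (m1 y) = y \<and> m1 y \<noteq> y"
    and "x \<in> V"
  shows "\<exists>t. t x = x \<and> (\<forall>y\<in>V. t y \<in> V \<and> t (t y) = y \<and> t (m0 (t y)) = m1 y)"
  using assms
proof (induction "card V" arbitrary: V m0 m1 x rule: less_induct)
  case less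
  define a b where "a = m0 x" and "b = m1 x"
  have a: "a \<in> V" "m0 a = x" "a \<noteq> x" and b: "b \<in> V" "m1 b = x" "b \<noteq> x"
    using less.prems(2,3)[OF less.prems(4)] by (auto simp: a_def b_def)
  have x: "x \<in> V" by fact
  have inj0: "m0 y = m0 z \<Longrightarrow> y = z" and inj1: "m1 y = m1 z \<Longrightarrow> y = z" if "y \<in> V" "z \<in> V" for y z
    using less.prems(2,3) that by metis+
  show ?case
  proof (cases "a = b")
    case True
    let ?V = "V - {x, a}"
    have c: "card ?V < card V" using less.prems(1) x by (intro psubset_card_mono) auto
    have 0: "m0 y \<in> ?V \<and> m0 (m0 y) = y \<and> m0 y \<noteq> y" if "y \<in> ?V" for y
      using that less.prems(2)[of y] a by (auto simp: a_def)
    have 1: "m1 y \<in> ?V \<and> m1 (m1 y) = y \<and> m1 y \<noteq> y" if "y \<in> ?V" for y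
      using that less.prems(3)[of y] b True by (auto simp: b_def)
    \<comment> \<open>A common edge of both matchings is fixed pointwise. The remaining vertices may
      use any anchor z, whose fixed-point property is discarded.\<close>
    obtain t' where t': "\<forall>y\<in>?V. t' y \<in> ?V \<and> t' (t' y) = y \<and> t' (m0 (t' y)) = m1 y"
    proof (cases "?V = {}")
      case True then show ?thesis using that[of id] by auto
    next
      case False
      then obtain z where z: "z \<in> ?V" by auto
      from less.hyps[OF c _ 0 1 z] less.prems(1) show ?thesis using that by auto
    qed
    define t where "t y = (if y \<in> ?V then t' y else y)" for y
    have mx: "m0 x = a" "m1 x = a" "m0 a = x" "m1 a = x" using a b True by (auto simp: a_def b_def)
    have "t x = x" by (simp add: t_def)
    moreover have "t y \<in> V \<and> t (t y) = y \<and> t (m0 (t y)) = m1 y" if y: "y \<in> V" for y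
    proof (cases "y \<in> ?V")
      case True
      have h: "t' y \<in> ?V" "t' (t' y) = y" "t' (m0 (t' y)) = m1 y" using t' True by blast+
      have h0: "m0 (t' y) \<in> ?V" using 0[OF h(1)] by blast
      have "t y = t' y" "t (t' y) = t' (t' y)" "t (m0 (t' y)) = t' (m0 (t' y))"
        using True h(1) h0 unfolding t_def by (simp_all only: if_True)
      then show ?thesis using h by auto
    next
      case False
      then have "y = x \<or> y = a" using y by auto
      then show ?thesis using mx a(1) x by (auto simp: t_def)
    qed
    ultimately show ?thesis by blast
  next
    case False
    define a' b' where "a' = m1 a" and "b' = m0 b"
    have a': "a' \<in> V" "m1 a' = a" "a' \<noteq> a" and b': "b' \<in> V" "m0 b' = b" "b' \<noteq> b"
      using less.prems(2)[OF b(1)] less.prems(3)[OF a(1)] by (auto simp: a'_def b'_def)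
    have d: "a' \<noteq> x" "a' \<noteq> b" "b' \<noteq> x" "b' \<noteq> a"
      using False a b a' b' less.prems(2,3) x by (metis a'_def b'_def a_def b_def)+
    let ?V = "V - {a, b}"
    \<comment> \<open>Contraction of the path a' - a - x - b - b': the \<open>m0\<close>-edges x-a
      and b-b' merge into x-b', the \<open>m1\<close>-edges x-b and a-a' into x-a'. A reflection
      fixing x must exchange a with b, and the contracted instance exchanges a' with b'.\<close>
    define n0 where "n0 y = (if y = x then b' else if y = b' then x else m0 y)" for y
    define n1 where "n1 y = (if y = x then a' else if y = a' then x else m1 y)" for y
    have c: "card ?V < card V" using less.prems(1) a by (intro psubset_card_mono) auto
    have 0: "n0 y \<in> ?V \<and> n0 (n0 y) = y \<and> n0 y \<noteq> y" if "y \<in> ?V" for y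
    proof (cases "y = x \<or> y = b'")
      case True then show ?thesis using b' d x a b by (auto simp: n0_def)
    next
      case F: False
      have "m0 y \<in> V" "m0 (m0 y) = y" "m0 y \<noteq> y" using less.prems(2)[of y] that by auto
      moreover have "m0 y \<noteq> a" "m0 y \<noteq> b" "m0 y \<noteq> x" "m0 y \<noteq> b'"
        using F that a b b' calculation by (metis Diff_iff a_def b'_def insertCI)+
      ultimately show ?thesis using F by (auto simp: n0_def)
    qed
    have 1: "n1 y \<in> ?V \<and> n1 (n1 y) = y \<and> n1 y \<noteq> y" if "y \<in> ?V" for y
    proof (cases "y = x \<or> y = a'")
      case True then show ?thesis using a' d x a b by (auto simp: n1_def)
    next
      case F: False
      have "m1 y \<in> V" "m1 (m1 y) = y" "m1 y \<noteq> y" using less.prems(3)[of y] that by auto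
      moreover have "m1 y \<noteq> a" "m1 y \<noteq> b" "m1 y \<noteq> x" "m1 y \<noteq> a'"
        using F that a b a' calculation by (metis Diff_iff b_def a'_def insertCI)+
      ultimately show ?thesis using F by (auto simp: n1_def)
    qed
    have xV: "x \<in> ?V" using x a b by auto
    from less.hyps[OF c _ 0 1 xV] less.prems(1) obtain t' where
      t': "t' x = x" "\<And>y. y \<in> ?V \<Longrightarrow> t' y \<in> ?V \<and> t' (t' y) = y \<and> t' (n0 (t' y)) = n1 y" by auto
    \<comment> \<open>The conjugation identity read at the anchor x, whose partners are b' under
      \<open>n0\<close> and a' under \<open>n1\<close>.\<close>
    have tb: "t' b' = a'" using t'(2)[OF xV] t'(1) by (simp add: n0_def n1_def)
    have ta: "t' a' = b'" using t'(2)[of b'] b' d tb by auto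
    define t where "t y = (if y = a then b else if y = b then a else t' y)" for y
    have tv: "t y = t' y" if "y \<in> ?V" for y using that by (auto simp: t_def)
    have "t x = x" using t' a b by (auto simp: t_def)
    moreover have "t y \<in> V \<and> t (t y) = y \<and> t (m0 (t y)) = m1 y" if y: "y \<in> V" for y
    proof (cases "y \<in> ?V")
      case True
      have h: "t' y \<in> ?V" "t' (t' y) = y" "t' (n0 (t' y)) = n1 y" using t'(2)[OF True] by auto
      have "t (m0 (t' y)) = m1 y"
      proof (cases "t' y = x")
        case tx: True
        then have "y = x" using h(2) t'(1) by simp
        then show ?thesis using t'(1) by (simp add: t_def a_def[symmetric] b_def)
      next
        case tx: False
        show ?thesis
        proof (cases "t' y = b'")
          case T: True
          then have "y = a'" using h(2) tb by simp
          then show ?thesis using T b' a' False by (simp add: t_def)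
        next
          case F: False
          have yx: "y \<noteq> x" using tx t'(1) by auto
          have ya: "y \<noteq> a'" using F ta by auto
          have "n0 (t' y) = m0 (t' y)" "n1 y = m1 y" using tx F yx ya by (auto simp: n0_def n1_def)
          moreover have "n0 (t' y) \<in> ?V" using 0[OF h(1)] by blast
          ultimately show ?thesis using h(3) tv by metis
        qed
      qed
      then show ?thesis using h tv[OF True] tv[OF h(1)] by auto
    next
      case F: False
      then consider "y = a" | "y = b" using y by auto
      then show ?thesis
      proof cases
        case 1
        have "b' \<in> ?V" using b' d by auto
        then have "t b' = a'" using tv tb by simp
        then show ?thesis using 1 a b False by (simp add: t_def[of a] t_def[of b] b'_def[symmetric] a'_def)
      next
        case 2
        have "t x = x" using tv[OF xV] t'(1) by simp
        then show ?thesis using 2 a b False by (simp add: t_def[of a] t_def[of b])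
      qed
    qed
    ultimately show ?thesis by blast
  qed
qed

subsection \<open>Normal form of antisymmetric forms\<close>

text \<open>Normal form of a real antisymmetric matrix. The next pair of frame vectors maximises
  the bilinear form on the orthogonal complement of the previous ones, which yields the
  coefficients in decreasing order.\<close>

definition bil :: "nat \<Rightarrow> (nat \<Rightarrow> nat \<Rightarrow> real) \<Rightarrow> (nat \<Rightarrow> real) \<Rightarrow> (nat \<Rightarrow> real) \<Rightarrow> real" where
  "bil N M a b = (\<Sum>p<N. \<Sum>q<N. a p * M p q * b q)"

lemma ip_commute: "ip N a b = ip N b a" by (simp add: ip_def mult.commute)

lemma ip_lin: "ip N (\<lambda>p. x * a p + y * b p) c = x * ip N a c + y * ip N b c"
  by (simp add: ip_def algebra_simps sum.distrib sum_distrib_left)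

lemma ip_lin_right: "ip N c (\<lambda>p. x * a p + y * b p) = x * ip N c a + y * ip N c b"
  by (simp add: ip_def algebra_simps sum.distrib sum_distrib_left)

lemma ip_nonneg: "ip N a a \<ge> 0" by (auto simp: ip_def intro: sum_nonneg)

lemma ip_zero: "ip N a a = 0 \<Longrightarrow> p < N \<Longrightarrow> a p = 0"
  by (auto simp: ip_def sum_nonneg_eq_0_iff)

lemma unit_orthogonal_exists:
  fixes F :: "nat \<Rightarrow> nat \<Rightarrow> real"
  assumes "k < N" obtains a where "ip N a a = 1" "\<And>i. i < k \<Longrightarrow> ip N (F i) a = 0" "\<And>p. p \<ge> N \<Longrightarrow> a p = 0"
proof -
  define M where "M = mat N N (\<lambda>(i,j). if i < k then F i j else 0)"
  have M: "M \<in> carrier_mat N N" by (simp add: M_def)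
  obtain v where v: "v \<in> carrier_vec N" "v \<noteq> 0\<^sub>v N" "M *\<^sub>v v = 0\<^sub>v N"
    by (rule zero_row_kernel[OF M assms]) (use assms in \<open>auto simp: M_def\<close>)
  define w where "w p = (if p < N then v $ p else 0)" for p
  have o: "ip N (F i) w = 0" if "i < k" for i
  proof -
    have "(M *\<^sub>v v) $ i = 0" using v that assms by simp
    then show ?thesis using v that assms by (simp add: M_def scalar_prod_def atLeast0LessThan ip_def w_def)
  qed
  have "ip N w w \<noteq> 0" using ip_zero[of N w] v by (auto simp: w_def vec_eq_iff)
  then have s: "ip N w w > 0" using ip_nonneg[of N w] by simp
  define r where "r = 1 / sqrt (ip N w w)"
  show ?thesis
  proof (rule that[of "\<lambda>p. r * w p"])
    have "ip N (\<lambda>p. r * w p) (\<lambda>p. r * w p) = r^2 * ip N w w"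
      by (simp add: ip_def sum_distrib_left power2_eq_square mult_ac)
    then show "ip N (\<lambda>p. r * w p) (\<lambda>p. r * w p) = 1" using s by (simp add: r_def power_divide)
    fix i assume "i < k"
    have "ip N (F i) (\<lambda>p. r * w p) = r * ip N (F i) w" by (simp add: ip_def sum_distrib_left mult_ac)
    then show "ip N (F i) (\<lambda>p. r * w p) = 0" using o[OF \<open>i < k\<close>] by simp
  qed (simp add: w_def)
qed

text \<open>The admissible pairs of the maximization. Vectors are functions on all natural numbers,
  so vanishing from N on is demanded in order that the set be compact.\<close>

definition perp_pairs :: "nat \<Rightarrow> nat \<Rightarrow> (nat \<Rightarrow> nat \<Rightarrow> real) \<Rightarrow> ((nat \<Rightarrow> real) \<times> (nat \<Rightarrow> real)) set" where
  "perp_pairs N k F = {(a, b). ip N a a = 1 \<and> ip N b b = 1 \<and> (\<forall>i<k. ip N (F i) a = 0 \<and> ip N (F i) b = 0)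
     \<and> ip N a b = 0 \<and> (\<forall>p\<ge>N. a p = 0 \<and> b p = 0)}"

lemma continuous_on_coord: "continuous_on S f \<Longrightarrow> continuous_on S (\<lambda>x. (f x :: nat \<Rightarrow> real) p)"
  by (rule continuous_on_product_then_coordinatewise)

lemma ip_continuous: "continuous_on S f \<Longrightarrow> continuous_on S h \<Longrightarrow> continuous_on S (\<lambda>x. ip N (f x) (h x))"
proof -
  assume f: "continuous_on S f" and h: "continuous_on S h"
  note c = continuous_on_coord[OF f] continuous_on_coord[OF h]
  show ?thesis unfolding ip_def by (intro continuous_on_sum continuous_on_mult c)
qed

text \<open>Unit norm bounds each coordinate by one, so the set is a closed part of a product of two
  infinite cubes, compact by Tychonoff.\<close>

lemma perp_pairs_compact: "compact (perp_pairs N k F)"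
proof -
  define B where "B = PiE UNIV (\<lambda>p::nat. {-1..1::real})"
  have "compactin (product_topology (\<lambda>_. euclidean) UNIV) B"
    unfolding B_def by (subst compactin_PiE) auto
  then have "compact B" by (simp add: euclidean_product_topology compactin_euclidean_iff)
  then have c: "compact (B \<times> B)" by (intro compact_Times)
  have "perp_pairs N k F \<subseteq> B \<times> B"
  proof
    fix x assume x: "x \<in> perp_pairs N k F"
    obtain a b where ab: "x = (a, b)" by (cases x)
    have "\<bar>a p\<bar> \<le> 1" if "ip N a a = 1" "\<forall>p\<ge>N. a p = 0" for a p
    proof (cases "p < N")
      case True
      have "a p * a p \<le> ip N a a" unfolding ip_def using True by (intro member_le_sum) auto
      then show ?thesis using that by (simp add: abs_square_le_1 power2_eq_square[symmetric])
    qed (use that in auto)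
    then show "x \<in> B \<times> B" using x unfolding ab perp_pairs_def B_def by (fastforce simp: abs_le_iff)
  qed
  moreover have "closed (perp_pairs N k F)"
  proof -
    have f1: "continuous_on UNIV (\<lambda>x :: (nat \<Rightarrow> real) \<times> (nat \<Rightarrow> real). fst x p)" for p
      by (rule continuous_on_coord[OF continuous_on_fst[OF continuous_on_id]])
    have f2: "continuous_on UNIV (\<lambda>x :: (nat \<Rightarrow> real) \<times> (nat \<Rightarrow> real). snd x p)" for p
      by (rule continuous_on_coord[OF continuous_on_snd[OF continuous_on_id]])
    have "perp_pairs N k F = {x. ip N (fst x) (fst x) = 1} \<inter> {x. ip N (snd x) (snd x) = 1}
        \<inter> (\<Inter>i\<in>{..<k}. {x. ip N (F i) (fst x) = 0} \<inter> {x. ip N (F i) (snd x) = 0})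
        \<inter> {x. ip N (fst x) (snd x) = 0} \<inter> (\<Inter>p\<in>{N..}. {x. fst x p = 0} \<inter> {x. snd x p = 0})"
      by (auto simp: perp_pairs_def)
    also have "closed \<dots>"
      by (intro closed_Int closed_INT ballI closed_Collect_eq ip_continuous continuous_on_const f1 f2
          continuous_on_fst continuous_on_snd continuous_on_id)
    finally show ?thesis .
  qed
  ultimately show ?thesis using c by (metis compact_Int_closed inf.absorb_iff2)
qed

lemma bil_continuous: "continuous_on S f \<Longrightarrow> continuous_on S h \<Longrightarrow> continuous_on S (\<lambda>x. bil N M (f x) (h x))"
proof -
  assume f: "continuous_on S f" and h: "continuous_on S h"
  note c = continuous_on_coord[OF f] continuous_on_coord[OF h]
  show ?thesis unfolding bil_def by (intro continuous_on_sum continuous_on_mult continuous_on_const c)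
qed

text \<open>First-order optimality without derivatives: if c had components l along a and m along b
  with m nonzero, the unit vector proportional to l a + m b would give the value sqrt(l^2 + m^2) >
  l, contradicting maximality of a.\<close>

lemma max_parallel:
  assumes a1: "ip N a a = 1" and max: "\<And>b. ip N b b = 1 \<Longrightarrow> P b \<Longrightarrow> ip N c b \<le> ip N c a"
    and P: "\<And>x y b. P b \<Longrightarrow> P (\<lambda>p. x * a p + y * b p)" and b: "P b" "ip N a b = 0" "ip N b b = 1"
  shows "ip N c b = 0"
proof -
  define l m where "l = ip N c a" and "m = ip N c b"
  have ba: "ip N b a = 0" using b ip_commute by metis
  show ?thesis
  proof (cases "l^2 + m^2 = 0")
    case True then show ?thesis by (simp add: m_def[symmetric])
  next
    case False
    then have s: "l^2 + m^2 > 0" by (simp add: sum_power2_gt_zero_iff)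
    define r where "r = sqrt (l^2 + m^2)"
    have r: "r > 0" "r * r = l^2 + m^2" using s by (auto simp: r_def)
    define b' where "b' = (\<lambda>p. (l / r) * a p + (m / r) * b p)"
    have "ip N b' b' = (l / r) * ip N a b' + (m / r) * ip N b b'" unfolding b'_def by (rule ip_lin)
    also have "ip N a b' = l / r" unfolding b'_def ip_lin_right using a1 b by simp
    also have "ip N b b' = m / r" unfolding b'_def ip_lin_right using b ba by simp
    finally have "ip N b' b' = (l^2 + m^2) / (r * r)" by (simp add: power2_eq_square add_divide_distrib)
    then have "ip N b' b' = 1" unfolding r(2) by (simp only: divide_self[OF less_imp_neq[OF s, symmetric]])
    moreover have "P b'" unfolding b'_def by (rule P[OF b(1)])
    ultimately have "ip N c b' \<le> l" using max by (simp add: l_def)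
    moreover have "ip N c b' = (l / r) * l + (m / r) * m"
      unfolding b'_def ip_lin_right by (simp add: l_def m_def)
    moreover have "(l / r) * l + (m / r) * m = r"
      using r by (simp add: power2_eq_square field_simps)
    ultimately have "r \<le> l" by simp
    then have "r * r \<le> l * l" using r by (intro mult_mono) auto
    then have "m^2 \<le> 0" using r by (simp add: power2_eq_square)
    then show ?thesis by (simp add: m_def)
  qed
qed

text \<open>The block relation is tested only against vectors orthogonal to the earlier ones, since
  that is what a constrained maximum provides; \<open>antisym_frame\<close> removes the restriction.
  The last conjunct keeps the maximality, from which the decreasing order is read off.\<close>

lemma antisym_normal_form:
  fixes M :: "nat \<Rightarrow> nat \<Rightarrow> real"
  assumes anti: "\<And>p q. p < N \<Longrightarrow> q < N \<Longrightarrow> M p q = - M q p" and N: "2 * n \<le> N"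
  shows "\<exists>F lam. (\<forall>i<2*n. \<forall>j<2*n. ip N (F i) (F j) = (if i = j then 1 else 0)) \<and>
    (\<forall>j<n. \<forall>b. (\<forall>i<2*j. ip N (F i) b = 0) \<longrightarrow> bil N M (F (2*j)) b = lam j * ip N (F (2*j+1)) b \<and> bil N M (F (2*j+1)) b = - lam j * ip N (F (2*j)) b)
    \<and> (\<forall>j<n. 0 \<le> lam j) \<and> (\<forall>j<n. \<forall>x\<in>perp_pairs N (2*j) F. bil N M (fst x) (snd x) \<le> lam j)"
  using N
proof (induction n)
  case 0 then show ?case by auto
next
  case (Suc n)
  then obtain F lam where F: "\<forall>i<2*n. \<forall>j<2*n. ip N (F i) (F j) = (if i = j then 1 else 0)"
    and I1: "\<forall>j<n. \<forall>b. (\<forall>i<2*j. ip N (F i) b = 0) \<longrightarrow> bil N M (F (2*j)) b = lam j * ip N (F (2*j+1)) b \<and> bil N M (F (2*j+1)) b = - lam j * ip N (F (2*j)) b"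
    and I2: "\<forall>j<n. 0 \<le> lam j" and I3: "\<forall>j<n. \<forall>x\<in>perp_pairs N (2*j) F. bil N M (fst x) (snd x) \<le> lam j"
    by auto
  have bil_anti: "bil N M a b = - bil N M b a" for a b
  proof -
    have "bil N M a b = (\<Sum>q<N. \<Sum>p<N. a p * M p q * b q)" unfolding bil_def by (rule sum.swap)
    also have "\<dots> = (\<Sum>q<N. \<Sum>p<N. - (b q * M q p * a p))"
    proof (intro sum.cong refl)
      fix q p assume "q \<in> {..<N}" "p \<in> {..<N}"
      then have e: "M p q = - M q p" by (intro anti) auto
      show "a p * M p q * b q = - (b q * M q p * a p)" unfolding e by simp
    qed
    finally show ?thesis by (simp add: bil_def sum_negf)
  qed
  have bil_ip: "bil N M a b = ip N (\<lambda>q. \<Sum>p<N. a p * M p q) b" for a b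
    unfolding bil_def ip_def by (subst sum.swap) (simp add: sum_distrib_right)
  have self: "bil N M a a = 0" for a using bil_anti[of a a] by simp
  obtain a0 where a0: "ip N a0 a0 = 1" "\<And>i. i < 2*n \<Longrightarrow> ip N (F i) a0 = 0" "\<And>p. p \<ge> N \<Longrightarrow> a0 p = 0"
    using unit_orthogonal_exists[of "2*n" N F] Suc.prems by auto
  obtain b0 where b0: "ip N b0 b0 = 1" "\<And>i. i < Suc (2*n) \<Longrightarrow> ip N ((F(2*n := a0)) i) b0 = 0" "\<And>p. p \<ge> N \<Longrightarrow> b0 p = 0"
    using unit_orthogonal_exists[of "Suc (2*n)" N "F(2*n := a0)"] Suc.prems by auto
  have ne: "(a0, b0) \<in> perp_pairs N (2*n) F"
  proof -
    have "ip N (F i) b0 = 0" if "i < 2*n" for i using b0(2)[of i] that by simp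
    moreover have "ip N a0 b0 = 0" using b0(2)[of "2*n"] by simp
    ultimately show ?thesis using a0 b0(1,3) unfolding perp_pairs_def by blast
  qed
  have "\<exists>x\<in>perp_pairs N (2*n) F. \<forall>y\<in>perp_pairs N (2*n) F. bil N M (fst y) (snd y) \<le> bil N M (fst x) (snd x)"
  proof (rule continuous_attains_sup[OF perp_pairs_compact])
    show "continuous_on (perp_pairs N (2*n) F) (\<lambda>x. bil N M (fst x) (snd x))"
      by (intro bil_continuous continuous_on_fst continuous_on_snd continuous_on_id)
  qed (use ne in auto)
  then obtain a b where ab: "(a, b) \<in> perp_pairs N (2*n) F"
    and max: "\<And>a' b'. (a', b') \<in> perp_pairs N (2*n) F \<Longrightarrow> bil N M a' b' \<le> bil N M a b" by fastforce
  define l where "l = bil N M a b"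
  have A: "ip N a a = 1" "ip N b b = 1" "ip N a b = 0" "ip N b a = 0" "\<And>i. i < 2*n \<Longrightarrow> ip N (F i) a = 0" "\<And>i. i < 2*n \<Longrightarrow> ip N (F i) b = 0"
    "\<And>p. p \<ge> N \<Longrightarrow> a p = 0" "\<And>p. p \<ge> N \<Longrightarrow> b p = 0"
    using ab ip_commute[of N a b] by (auto simp: perp_pairs_def)
  have neg: "ip N x (\<lambda>p. - y p) = - ip N x y" "bil N M x (\<lambda>p. - y p) = - bil N M x y" for x y
    by (simp_all add: ip_def bil_def sum_negf)
  \<comment> \<open>Replacing b by -b keeps the pair admissible and reverses the sign of the
    form.\<close>
  have l0: "l \<ge> 0"
  proof -
    have "ip N (\<lambda>p. - b p) (\<lambda>p. - b p) = 1" using A(2) by (simp add: ip_def)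
    then have "(a, \<lambda>p. - b p) \<in> perp_pairs N (2*n) F" using A by (simp add: perp_pairs_def neg)
    from max[OF this] show ?thesis by (simp add: neg l_def)
  qed
  have ipl: "ip N c (\<lambda>p. x * d p + y * e p) = x * ip N c d + y * ip N c e" for c d e x y
    by (rule ip_lin_right)
    \<comment> \<open>Optimality in each slot separately: a unit vector orthogonal to the earlier
      ones and to a and b couples to neither a nor b.\<close>
    have Z: "bil N M a z = 0 \<and> bil N M b z = 0"
    if z: "\<And>i. i < 2*n \<Longrightarrow> ip N (F i) z = 0" "ip N a z = 0" "ip N b z = 0" "ip N z z = 1" "\<And>p. p \<ge> N \<Longrightarrow> z p = 0" for z
  proof
    have "ip N (\<lambda>q. \<Sum>p<N. a p * M p q) z = 0"
    proof (rule max_parallel[of N b "\<lambda>y. (\<forall>i<2*n. ip N (F i) y = 0) \<and> ip N a y = 0 \<and> (\<forall>p\<ge>N. y p = 0)"])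
      fix y assume "ip N y y = 1" "(\<forall>i<2*n. ip N (F i) y = 0) \<and> ip N a y = 0 \<and> (\<forall>p\<ge>N. y p = 0)"
      then have "(a, y) \<in> perp_pairs N (2*n) F" using A by (simp add: perp_pairs_def)
      from max[OF this] show "ip N (\<lambda>q. \<Sum>p<N. a p * M p q) y \<le> ip N (\<lambda>q. \<Sum>p<N. a p * M p q) b" by (simp only: bil_ip)
    qed (use A z in \<open>auto simp: ipl\<close>)
    then show "bil N M a z = 0" by (simp only: bil_ip)
    have "ip N (\<lambda>q. - (\<Sum>p<N. b p * M p q)) z = 0"
    proof (rule max_parallel[of N a "\<lambda>y. (\<forall>i<2*n. ip N (F i) y = 0) \<and> ip N b y = 0 \<and> (\<forall>p\<ge>N. y p = 0)"])
      have e: "ip N (\<lambda>q. - (\<Sum>p<N. b p * M p q)) y = bil N M y b" for y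
        using bil_anti[of y b] bil_ip[of b y] by (simp add: ip_def sum_negf)
      fix y assume "ip N y y = 1" "(\<forall>i<2*n. ip N (F i) y = 0) \<and> ip N b y = 0 \<and> (\<forall>p\<ge>N. y p = 0)"
      then have "(y, b) \<in> perp_pairs N (2*n) F" using A ip_commute[of N y b] by (simp add: perp_pairs_def)
      from max[OF this] show "ip N (\<lambda>q. - (\<Sum>p<N. b p * M p q)) y \<le> ip N (\<lambda>q. - (\<Sum>p<N. b p * M p q)) a" by (simp only: e)
    qed (use A z in \<open>auto simp: ipl\<close>)
    then have "ip N (\<lambda>q. \<Sum>p<N. b p * M p q) z = 0" by (simp add: ip_def sum_negf)
    then show "bil N M b z = 0" by (simp only: bil_ip)
  qed
  have main: "bil N M a c = l * ip N b c \<and> bil N M b c = - l * ip N a c" if c: "\<forall>i<2*n. ip N (F i) c = 0" for c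
  proof -
    define s t where "s = ip N a c" and "t = ip N b c"
    \<comment> \<open>The component of c orthogonal to a and b, cut off at N to be admissible;
      neither \<open>ip\<close> nor \<open>bil\<close> sees the cut.\<close>
    define z where "z p = (if p < N then c p - (s * a p + t * b p) else 0)" for p
    have ipz: "ip N y z = ip N y c - (s * ip N y a + t * ip N y b)" for y
      by (simp add: ip_def z_def algebra_simps sum.distrib sum_subtractf sum_distrib_left)
    have bz: "bil N M y z = bil N M y c - (s * bil N M y a + t * bil N M y b)" for y
      by (simp add: bil_ip ipz)
    have o: "\<And>i. i < 2*n \<Longrightarrow> ip N (F i) z = 0" "ip N a z = 0" "ip N b z = 0"
      using A c by (simp_all add: ipz s_def t_def)
    have "bil N M a z = 0 \<and> bil N M b z = 0"
    proof (cases "ip N z z = 0")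
      case True
      then have "z p = 0" if "p < N" for p using ip_zero that by blast
      then show ?thesis by (simp add: bil_def)
    next
      case False
      define r where "r = 1 / sqrt (ip N z z)"
      have pos: "ip N z z > 0" using False ip_nonneg[of N z] by simp
      have sc: "ip N y (\<lambda>p. r * z p) = r * ip N y z" "bil N M y (\<lambda>p. r * z p) = r * bil N M y z" for y
        by (simp_all add: ip_def bil_def sum_distrib_left mult_ac)
      have "ip N (\<lambda>p. r * z p) (\<lambda>p. r * z p) = r^2 * ip N z z"
        by (simp add: ip_def sum_distrib_left power2_eq_square mult_ac)
      then have "ip N (\<lambda>p. r * z p) (\<lambda>p. r * z p) = 1" using pos by (simp add: r_def power_divide)
      moreover have "r * z p = 0" if "p \<ge> N" for p using that by (simp add: z_def)
      ultimately have "bil N M a (\<lambda>p. r * z p) = 0 \<and> bil N M b (\<lambda>p. r * z p) = 0"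
        by (intro Z) (simp_all add: sc o)
      moreover have "r \<noteq> 0" using pos by (simp add: r_def)
      ultimately show ?thesis by (simp add: sc)
    qed
    moreover have "bil N M a z = bil N M a c - t * l" by (simp add: bz self l_def)
    moreover have "bil N M b z = bil N M b c + s * l" using bil_anti[of b a] by (simp add: bz self l_def)
    ultimately show ?thesis by (simp add: s_def t_def mult.commute eq_neg_iff_add_eq_0)
  qed
  define G where "G = (\<lambda>i. if i = 2*n then a else if i = 2*n+1 then b else F i)"
  define lam' where "lam' = (\<lambda>j. if j = n then l else lam j)"
  have GF: "G i = F i" if "i < 2*n" for i using that by (simp add: G_def)
  have G2: "G (2*n) = a" "G (2*n+1) = b" "G (Suc (2*n)) = b" by (auto simp: G_def)
  have pp: "perp_pairs N (2*j) G = perp_pairs N (2*j) F" if "j \<le> n" for j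
    unfolding perp_pairs_def using that GF by auto
  have FA: "ip N a (F i) = 0" "ip N b (F i) = 0" if "i < 2*n" for i using A that by (metis ip_commute)+
  have "\<forall>i<2*Suc n. \<forall>j<2*Suc n. ip N (G i) (G j) = (if i = j then 1 else 0)"
  proof (intro allI impI)
    fix i j assume "i < 2 * Suc n" "j < 2 * Suc n"
    then have "(i < 2*n \<or> i = 2*n \<or> i = 2*n+1) \<and> (j < 2*n \<or> j = 2*n \<or> j = 2*n+1)" by auto
    then show "ip N (G i) (G j) = (if i = j then 1 else 0)"
      using F A FA by (elim conjE disjE) (simp_all add: G_def)
  qed
  moreover have "\<forall>j<Suc n. \<forall>b. (\<forall>i<2*j. ip N (G i) b = 0) \<longrightarrow> bil N M (G (2*j)) b = lam' j * ip N (G (2*j+1)) b \<and> bil N M (G (2*j+1)) b = - lam' j * ip N (G (2*j)) b"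
  proof (intro allI impI)
    fix j c assume j: "j < Suc n" and c: "\<forall>i<2*j. ip N (G i) c = 0"
    show "bil N M (G (2*j)) c = lam' j * ip N (G (2*j+1)) c \<and> bil N M (G (2*j+1)) c = - lam' j * ip N (G (2*j)) c"
    proof (cases "j = n")
      case True
      then have "\<forall>i<2*n. ip N (F i) c = 0" using c GF by auto
      from main[OF this] show ?thesis using True G2 by (simp add: lam'_def)
    next
      case False
      then have "j < n" "\<forall>i<2*j. ip N (F i) c = 0" using c GF j by auto
      then show ?thesis using I1 GF[of "2*j"] GF[of "2*j+1"] by (simp add: lam'_def)
    qed
  qed
  moreover have "\<forall>j<Suc n. 0 \<le> lam' j" using l0 I2 by (auto simp: lam'_def less_Suc_eq)
  moreover have "\<forall>j<Suc n. \<forall>x\<in>perp_pairs N (2*j) G. bil N M (fst x) (snd x) \<le> lam' j"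
  proof (intro allI impI ballI)
    fix j x assume j: "j < Suc n" and x: "x \<in> perp_pairs N (2*j) G"
    then have x': "x \<in> perp_pairs N (2*j) F" using pp[of j] by simp
    show "bil N M (fst x) (snd x) \<le> lam' j"
    proof (cases "j = n")
      case True then show ?thesis using max[of "fst x" "snd x"] x' by (simp add: lam'_def l_def)
    next
      case False then show ?thesis using I3 x' j by (simp add: lam'_def)
    qed
  qed
  ultimately show ?case by blast
qed

text \<open>An arbitrary b is replaced by its component orthogonal to the earlier frame vectors.
  This changes nothing, because the form vanishes between frame vectors of different blocks: for an
  earlier first argument by the block relation, for a later one by antisymmetry.\<close>

lemma antisym_frame:
  fixes M :: "nat \<Rightarrow> nat \<Rightarrow> real"
  assumes anti: "\<And>p q. p < N \<Longrightarrow> q < N \<Longrightarrow> M p q = - M q p" and N: "2 * n \<le> N"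
  obtains u v lam where "\<And>j k. j < n \<Longrightarrow> k < n \<Longrightarrow> ip N (u j) (u k) = (if j = k then 1 else 0)"
    "\<And>j k. j < n \<Longrightarrow> k < n \<Longrightarrow> ip N (v j) (v k) = (if j = k then 1 else 0)"
    "\<And>j k. j < n \<Longrightarrow> k < n \<Longrightarrow> ip N (u j) (v k) = 0"
    "\<And>j q. j < n \<Longrightarrow> q < N \<Longrightarrow> (\<Sum>p<N. u j p * M p q) = - lam j * v j q"
    "\<And>j q. j < n \<Longrightarrow> q < N \<Longrightarrow> (\<Sum>p<N. v j p * M p q) = lam j * u j q"
    "\<And>j. j < n \<Longrightarrow> 0 \<le> lam j" "\<And>i j. i \<le> j \<Longrightarrow> j < n \<Longrightarrow> lam j \<le> lam i"
proof -
  obtain F lam where F0: "\<forall>i<2*n. \<forall>j<2*n. ip N (F i) (F j) = (if i = j then 1 else 0)"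
    and I10: "\<forall>j<n. \<forall>b. (\<forall>i<2*j. ip N (F i) b = 0) \<longrightarrow> bil N M (F (2*j)) b = lam j * ip N (F (2*j+1)) b \<and> bil N M (F (2*j+1)) b = - lam j * ip N (F (2*j)) b"
    and I20: "\<forall>j<n. 0 \<le> lam j" and I30: "\<forall>j<n. \<forall>x\<in>perp_pairs N (2*j) F. bil N M (fst x) (snd x) \<le> lam j"
    by (atomize_elim, rule antisym_normal_form[OF _ N], rule anti)
  have F: "\<And>i j. i < 2*n \<Longrightarrow> j < 2*n \<Longrightarrow> ip N (F i) (F j) = (if i = j then 1 else 0)" using F0 by blast
  have I1: "\<And>j b. j < n \<Longrightarrow> (\<And>i. i < 2*j \<Longrightarrow> ip N (F i) b = 0) \<Longrightarrow> bil N M (F (2*j)) b = lam j * ip N (F (2*j+1)) b"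
    and I1': "\<And>j b. j < n \<Longrightarrow> (\<And>i. i < 2*j \<Longrightarrow> ip N (F i) b = 0) \<Longrightarrow> bil N M (F (2*j+1)) b = - lam j * ip N (F (2*j)) b"
    using I10 by blast+
  have I2: "\<And>j. j < n \<Longrightarrow> 0 \<le> lam j" using I20 by blast
  have I3: "\<And>j x. j < n \<Longrightarrow> x \<in> perp_pairs N (2*j) F \<Longrightarrow> bil N M (fst x) (snd x) \<le> lam j" using I30 by blast
  have bil_anti: "bil N M a b = - bil N M b a" for a b
  proof -
    have "bil N M a b = (\<Sum>q<N. \<Sum>p<N. a p * M p q * b q)" unfolding bil_def by (rule sum.swap)
    also have "\<dots> = (\<Sum>q<N. \<Sum>p<N. - (b q * M q p * a p))"
    proof (intro sum.cong refl)
      fix q p assume "q \<in> {..<N}" "p \<in> {..<N}"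
      then have e: "M p q = - M q p" by (intro anti) auto
      show "a p * M p q * b q = - (b q * M q p * a p)" unfolding e by simp
    qed
    finally show ?thesis by (simp add: bil_def sum_negf)
  qed
  have prev: "bil N M (F i) (F k) = 0" if "i < 2*j" "k < 2*n" "k \<ge> 2*j" "j \<le> n" for i j k
  proof -
    have d: "i div 2 < n" "i div 2 < j" using that by auto
    have o: "ip N (F l) (F k) = 0" if "l < 2*j" for l using F[of l k] that \<open>k < 2*n\<close> \<open>k \<ge> 2*j\<close> by simp
    have o': "\<And>l. l < 2 * (i div 2) \<Longrightarrow> ip N (F l) (F k) = 0" using o d by auto
    have "i = 2 * (i div 2) \<or> i = 2 * (i div 2) + 1" by presburger
    then show ?thesis
    proof
      assume e: "i = 2 * (i div 2)"
      have "bil N M (F (2 * (i div 2))) (F k) = lam (i div 2) * ip N (F (2 * (i div 2) + 1)) (F k)" by (rule I1[OF d(1) o'])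
      then show ?thesis using o[of "2 * (i div 2) + 1"] d e by simp
    next
      assume e: "i = 2 * (i div 2) + 1"
      have "bil N M (F (2 * (i div 2) + 1)) (F k) = - lam (i div 2) * ip N (F (2 * (i div 2))) (F k)" by (rule I1'[OF d(1) o'])
      then show ?thesis using o[of "2 * (i div 2)"] d e by simp
    qed
  qed
  have full: "bil N M (F (2*j)) b = lam j * ip N (F (2*j+1)) b \<and> bil N M (F (2*j+1)) b = - lam j * ip N (F (2*j)) b" if j: "j < n" for j b
  proof -
    define z where "z p = b p - (\<Sum>i<2*j. ip N (F i) b * F i p)" for p
    have ipz: "ip N c z = ip N c b - (\<Sum>i<2*j. ip N (F i) b * ip N c (F i))" for c
    proof -
      have "ip N c z = (\<Sum>p<N. c p * b p) - (\<Sum>p<N. \<Sum>i<2*j. ip N (F i) b * (c p * F i p))"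
        by (simp add: ip_def[of N c z] z_def right_diff_distrib sum_subtractf sum_distrib_left mult.left_commute)
      also have "(\<Sum>p<N. \<Sum>i<2*j. ip N (F i) b * (c p * F i p)) = (\<Sum>i<2*j. ip N (F i) b * ip N c (F i))"
        by (subst sum.swap) (simp add: ip_def[of N c] sum_distrib_left)
      finally show ?thesis by (simp add: ip_def[of N c b])
    qed
    have bil_ip: "bil N M a y = ip N (\<lambda>q. \<Sum>p<N. a p * M p q) y" for a y
      unfolding bil_def ip_def by (subst sum.swap) (simp add: sum_distrib_right)
    have bz: "bil N M c z = bil N M c b - (\<Sum>i<2*j. ip N (F i) b * bil N M c (F i))" for c
      by (simp add: bil_ip ipz)
    have o: "ip N (F k) z = 0" if k: "k < 2*j" for k
    proof -
      have "(\<Sum>i<2*j. ip N (F i) b * ip N (F k) (F i)) = (\<Sum>i<2*j. if i = k then ip N (F k) b else 0)"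
        using F k j by (intro sum.cong refl) auto
      then show ?thesis using k by (simp add: ipz)
    qed
    have v: "ip N (F k) z = ip N (F k) b" "bil N M (F k) z = bil N M (F k) b" if k: "k \<ge> 2*j" "k < 2*n" for k
    proof -
      have "(\<Sum>i<2*j. ip N (F i) b * ip N (F k) (F i)) = 0" using F k by (intro sum.neutral) auto
      then show "ip N (F k) z = ip N (F k) b" by (simp add: ipz)
      have "bil N M (F k) (F i) = 0" if "i < 2*j" for i using prev[OF that k(2) k(1)] j bil_anti[of "F k" "F i"] by simp
      then have "(\<Sum>i<2*j. ip N (F i) b * bil N M (F k) (F i)) = 0" by (intro sum.neutral) auto
      then show "bil N M (F k) z = bil N M (F k) b" by (simp add: bz)
    qed
    show ?thesis using I1[OF j o] I1'[OF j o] v[of "2*j"] v[of "2*j+1"] j by simp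
  qed
  have coord: "bil N M a (\<lambda>p. if p = q then 1 else 0) = (\<Sum>p<N. a p * M p q)" "ip N a (\<lambda>p. if p = q then 1 else 0) = a q" if "q < N" for a q
    using that by (simp_all add: bil_def ip_def if_distrib[of "(*) _"] cong: if_cong)
  \<comment> \<open>The j-th pair was admissible when the i-th one was chosen as a maximizer; its
    vectors are cut off at N to fit \<open>perp_pairs\<close>.\<close>
  have dec: "lam j \<le> lam i" if ij: "i \<le> j" "j < n" for i j
  proof -
    define t where "t k p = (if p < N then F k p else 0)" for k p
    have tt: "ip N a (t k) = ip N a (F k)" "ip N (t k) a = ip N (F k) a" "bil N M (t k) a = bil N M (F k) a" "bil N M a (t k) = bil N M a (F k)" for a k
      by (auto simp: ip_def bil_def t_def intro!: sum.cong)
    have "(t (2*j), t (2*j+1)) \<in> perp_pairs N (2*i) F"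
      using ij F unfolding perp_pairs_def by (auto simp: tt) (auto simp: t_def)
    from I3[OF _ this] ij have "bil N M (F (2*j)) (F (2*j+1)) \<le> lam i" by (simp add: tt)
    moreover have "bil N M (F (2*j)) (F (2*j+1)) = lam j" using full[OF ij(2), of "F (2*j+1)"] F[of "2*j+1" "2*j+1"] ij by simp
    ultimately show ?thesis by simp
  qed
  show ?thesis
  \<comment> \<open>The roles are exchanged, u taking the odd and v the even vectors, to match the
    signs in \<open>wick_modes\<close>.\<close>
  proof (rule that[of "\<lambda>j. F (2*j+1)" "\<lambda>j. F (2*j)" lam])
    fix j k assume jk: "j < n" "k < n"
    show "ip N (F (2*j+1)) (F (2*k+1)) = (if j = k then 1 else 0)" using F[of "2*j+1" "2*k+1"] jk by simp
    show "ip N (F (2*j)) (F (2*k)) = (if j = k then 1 else 0)" using F[of "2*j" "2*k"] jk by simp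
    have "2*j+1 \<noteq> 2*k" by presburger
    then show "ip N (F (2*j+1)) (F (2*k)) = 0" using F[of "2*j+1" "2*k"] jk by simp
  next
    fix j q assume "j < n" "q < N"
    then show "(\<Sum>p<N. F (2*j+1) p * M p q) = - lam j * F (2*j) q" "(\<Sum>p<N. F (2*j) p * M p q) = lam j * F (2*j+1) q"
      using full[of j "\<lambda>p. if p = q then 1 else 0"] coord[of q] by simp_all
  qed (use I2 dec in auto)
qed

subsection \<open>Entropy of states satisfying the Wick relation\<close>

text \<open>The adjoint as a relation between embedded matrices; a general element of
  \<open>lop\<close> is not of this form.\<close>

definition adjp :: "nat \<Rightarrow> lop \<Rightarrow> lop \<Rightarrow> bool" where
  "adjp d x y \<longleftrightarrow> (\<exists>A\<in>carrier_mat d d. x = emb d A \<and> y = emb d (adj A))"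

lemma mat_mult_sum: "A \<in> carrier_mat d d \<Longrightarrow> B \<in> carrier_mat d d \<Longrightarrow> i < d \<Longrightarrow> j < d \<Longrightarrow>
  (A * B) $$ (i,j) = (\<Sum>m<d. A $$ (i,m) * B $$ (m,j))" for A B :: "complex mat"
  by (simp add: scalar_prod_def atLeast0LessThan)

lemma emb_zero: "d > 0 \<Longrightarrow> emb d (0\<^sub>m d d) = 0"
proof -
  assume d: "d > 0"
  have "0\<^sub>m d d = (0::complex) \<cdot>\<^sub>m 1\<^sub>m d" by (rule eq_matI) auto
  then show ?thesis using emb_smult[OF d one_carrier_mat, of 0] by simp
qed

lemma adjp_mult: "d > 0 \<Longrightarrow> adjp d x x' \<Longrightarrow> adjp d y y' \<Longrightarrow> adjp d (x * y) (y' * x')"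
proof -
  assume d: "d > 0" and "adjp d x x'" "adjp d y y'"
  then obtain A B where A: "A \<in> carrier_mat d d" "x = emb d A" "x' = emb d (adj A)"
    and B: "B \<in> carrier_mat d d" "y = emb d B" "y' = emb d (adj B)" by (auto simp: adjp_def)
  show ?thesis unfolding adjp_def
    by (rule bexI[of _ "A * B"]) (use A B d in \<open>auto simp: emb_mult adj_mult[of _ d d _ d]\<close>)
qed

lemma adjp_add: "d > 0 \<Longrightarrow> adjp d x x' \<Longrightarrow> adjp d y y' \<Longrightarrow> adjp d (x + y) (x' + y')"
proof -
  assume d: "d > 0" and "adjp d x x'" "adjp d y y'"
  then obtain A B where A: "A \<in> carrier_mat d d" "x = emb d A" "x' = emb d (adj A)"
    and B: "B \<in> carrier_mat d d" "y = emb d B" "y' = emb d (adj B)" by (auto simp: adjp_def)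
  show ?thesis unfolding adjp_def
    by (rule bexI[of _ "A + B"]) (use A B d in \<open>auto simp: emb_add adj_add[of _ d d]\<close>)
qed

lemma adjp_cs: "d > 0 \<Longrightarrow> adjp d x x' \<Longrightarrow> adjp d (z \<odot> x) (cnj z \<odot> x')"
proof -
  assume d: "d > 0" and "adjp d x x'"
  then obtain A where A: "A \<in> carrier_mat d d" "x = emb d A" "x' = emb d (adj A)" by (auto simp: adjp_def)
  show ?thesis unfolding adjp_def
    by (rule bexI[of _ "z \<cdot>\<^sub>m A"]) (use A d in \<open>auto simp: emb_smult adj_smult\<close>)
qed

lemma adjp_one: "d > 0 \<Longrightarrow> adjp d 1 1"
  unfolding adjp_def by (rule bexI[of _ "1\<^sub>m d"]) (auto simp: emb_one pauli_adj)

lemma adjp_sum: "d > 0 \<Longrightarrow> finite I \<Longrightarrow> (\<And>i. i \<in> I \<Longrightarrow> adjp d (f i) (h i)) \<Longrightarrow> adjp d (sum f I) (sum h I)"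
proof (induction I rule: infinite_finite_induct)
  case empty
  have "adjp d (0 \<odot> 1) (cnj 0 \<odot> 1)" using empty by (intro adjp_cs adjp_one)
  then show ?case by simp
next
  case (insert i I)
  then show ?case using adjp_add by simp
qed simp

lemma adjp_herm_inv: assumes d: "d > 0" and "adjp d x x" "x * x = 1" shows "herm_inv d x"
proof -
  from assms obtain A where A: "A \<in> carrier_mat d d" "x = emb d A" "emb d A = emb d (adj A)" by (auto simp: adjp_def)
  have "A = adj A" by (rule emb_inj[OF A(1) _ A(3)]) (use A in simp)
  moreover have "A * A = 1\<^sub>m d"
    by (rule emb_inj[of _ d]) (use A d assms(3) in \<open>auto simp: emb_mult emb_one\<close>)
  ultimately show ?thesis using A unfolding herm_inv_def by metis
qed

lemma adjp_gop: "p < 2*n+1 \<Longrightarrow> adjp (2^n) (gop n p) (gop n p)"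
  unfolding adjp_def gop_def by (rule bexI[of _ "gmat n p"]) (auto simp: gmat_adj gmat_carrier)

lemma trd_flip_mix: "i < 2*n+1 \<Longrightarrow> trd (2^n) (flip_mix c (gop n i) X) = trd (2^n) X"
proof -
  assume i: "i < 2*n+1"
  have "trd (2^n) (gop n i * X * gop n i) = trd (2^n) X"
    using cliff.trc[OF i, of "X * gop n i"] cliff.sq[OF i] by (simp add: mult.assoc)
  then have "trd (2^n) (flip_mix c (gop n i) X) = (of_real ((1 + c) / 2) + of_real ((1 - c) / 2)) * trd (2^n) X"
    by (simp add: flip_mix_def distrib_right del: of_real_divide of_real_add of_real_diff)
  also have "of_real ((1 + c) / 2) + of_real ((1 - c) / 2) = (1::complex)"
    by (simp only: of_real_add[symmetric]) (simp add: field_simps)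
  finally show ?thesis by simp
qed

lemma trd_flip_mixes: "set is \<subseteq> {..<2*n+1} \<Longrightarrow> trd (2^n) (flip_mixes (gop n) c is X) = trd (2^n) X"
  by (induction "is") (simp_all add: flip_mixes_def trd_flip_mix)

lemma sum_Pow_Suc: "(\<Sum>S\<in>Pow {..<Suc k}. f S) = (\<Sum>S\<in>Pow {..<k}. f S + f (insert k S))" for f :: "nat set \<Rightarrow> real"
proof -
  have "(\<Sum>S\<in>Pow {..<Suc k}. f S) = (\<Sum>S\<in>Pow {..<k} \<union> insert k ` Pow {..<k}. f S)"
    by (simp add: lessThan_Suc Pow_insert)
  also have "\<dots> = (\<Sum>S\<in>Pow {..<k}. f S) + (\<Sum>S\<in>insert k ` Pow {..<k}. f S)"
    by (rule sum.union_disjoint) auto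
  also have "(\<Sum>S\<in>insert k ` Pow {..<k}. f S) = (\<Sum>S\<in>Pow {..<k}. f (insert k S))"
    by (rule sum.reindex_cong[of "insert k"]) (auto simp: inj_on_def)
  finally show ?thesis by (simp add: sum.distrib)
qed

lemma eta_mult: "x \<ge> 0 \<Longrightarrow> y \<ge> 0 \<Longrightarrow> eta (x * y) = x * eta y + y * eta x"
  by (cases "x = 0"; cases "y = 0") (auto simp: eta_def log_mult algebra_simps mult_le_0_iff)

lemma prob_product_sum:
  "(\<Sum>S\<in>Pow {..<k}. \<Prod>j<k. (1 + sg S j * \<kappa> j) / 2) = 1"
proof (induction k)
  case (Suc k)
  have c: "(\<Prod>j<k. (1 + sg (insert k S) j * \<kappa> j) / 2) = (\<Prod>j<k. (1 + sg S j * \<kappa> j) / 2)" for S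
    by (intro prod.cong refl) (auto simp: sg_def)
  have "(\<Sum>S\<in>Pow {..<Suc k}. \<Prod>j<Suc k. (1 + sg S j * \<kappa> j) / 2) = (\<Sum>S\<in>Pow {..<k}. (\<Prod>j<k. (1 + sg S j * \<kappa> j) / 2))"
    unfolding sum_Pow_Suc by (intro sum.cong refl) (auto simp: c sg_def field_simps)
  then show ?case using Suc by simp
qed simp

text \<open>Additivity of the Shannon entropy for independent signs with means \<kappa> j;
  \<open>eta_mult\<close> is the chain rule that splits off one factor.\<close>

lemma entropy_product:
  "(\<And>j. j < k \<Longrightarrow> \<bar>\<kappa> j\<bar> \<le> 1) \<Longrightarrow>
   (\<Sum>S\<in>Pow {..<k}. eta (\<Prod>j<k. (1 + sg S j * \<kappa> j) / 2)) = (\<Sum>j<k. Hbin ((1 + \<kappa> j) / 2))"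
proof (induction k)
  case 0 then show ?case by (simp add: eta_def)
next
  case (Suc k)
  define P where "P S = (\<Prod>j<k. (1 + sg S j * \<kappa> j) / 2)" for S
  have c: "P (insert k S) = P S" for S unfolding P_def by (intro prod.cong refl) (auto simp: sg_def)
  have P0: "P S \<ge> 0" for S unfolding P_def
  proof (rule prod_nonneg)
    fix j assume "j \<in> {..<k}"
    then have "\<bar>\<kappa> j\<bar> \<le> 1" using Suc.prems[of j] by simp
    then show "0 \<le> (1 + sg S j * \<kappa> j) / 2" by (auto simp: sg_def)
  qed
  have k: "(1 + \<kappa> k) / 2 \<ge> 0" "(1 - \<kappa> k) / 2 \<ge> 0" using Suc.prems[of k] by (auto simp: abs_le_iff)
  have "(\<Sum>S\<in>Pow {..<Suc k}. eta (\<Prod>j<Suc k. (1 + sg S j * \<kappa> j) / 2))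
    = (\<Sum>S\<in>Pow {..<k}. eta (P S * ((1 - \<kappa> k) / 2)) + eta (P S * ((1 + \<kappa> k) / 2)))"
    unfolding sum_Pow_Suc
  proof (intro sum.cong refl)
    fix S assume "S \<in> Pow {..<k}"
    then have "k \<notin> S" by auto
    then have "(\<Prod>j<Suc k. (1 + sg S j * \<kappa> j) / 2) = P S * ((1 - \<kappa> k) / 2)" by (simp add: P_def sg_def)
    moreover have "(\<Prod>j<Suc k. (1 + sg (insert k S) j * \<kappa> j) / 2) = P S * ((1 + \<kappa> k) / 2)"
      using c[of S] by (simp add: P_def) (simp add: sg_def)
    ultimately show "eta (\<Prod>j<Suc k. (1 + sg S j * \<kappa> j) / 2) + eta (\<Prod>j<Suc k. (1 + sg (insert k S) j * \<kappa> j) / 2)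
      = eta (P S * ((1 - \<kappa> k) / 2)) + eta (P S * ((1 + \<kappa> k) / 2))" by simp
  qed
  also have "\<dots> = (\<Sum>S\<in>Pow {..<k}. P S * (eta ((1 - \<kappa> k) / 2) + eta ((1 + \<kappa> k) / 2)) + eta (P S))"
  proof (intro sum.cong refl)
    fix S
    have "(1 - \<kappa> k) / 2 + (1 + \<kappa> k) / 2 = 1" by (simp add: field_simps)
    then have "(1 - \<kappa> k) / 2 * eta (P S) + (1 + \<kappa> k) / 2 * eta (P S) = eta (P S)" by (metis distrib_right mult_1)
    then show "eta (P S * ((1 - \<kappa> k) / 2)) + eta (P S * ((1 + \<kappa> k) / 2)) = P S * (eta ((1 - \<kappa> k) / 2) + eta ((1 + \<kappa> k) / 2)) + eta (P S)"
      unfolding eta_mult[OF P0 k(1)] eta_mult[OF P0 k(2)] by (simp only: distrib_left)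
  qed
  also have "\<dots> = (\<Sum>S\<in>Pow {..<k}. P S) * (eta ((1 - \<kappa> k) / 2) + eta ((1 + \<kappa> k) / 2)) + (\<Sum>S\<in>Pow {..<k}. eta (P S))"
    by (simp only: sum.distrib sum_distrib_right)
  also have "(\<Sum>S\<in>Pow {..<k}. P S) = 1" unfolding P_def by (rule prob_product_sum)
  also have "(\<Sum>S\<in>Pow {..<k}. eta (P S)) = (\<Sum>j<k. Hbin ((1 + \<kappa> j) / 2))" unfolding P_def using Suc by simp
  also have "eta ((1 - \<kappa> k) / 2) + eta ((1 + \<kappa> k) / 2) = Hbin ((1 + \<kappa> k) / 2)"
  proof -
    have "1 - (1 + \<kappa> k) / 2 = (1 - \<kappa> k) / 2" by (simp add: field_simps)
    then show ?thesis unfolding Hbin_def by (simp only: add.commute)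
  qed
  finally show ?case by simp
qed

locale gframe = frame "2*n+1" "2^n" "gop n" n u v for n :: nat and u v :: "nat \<Rightarrow> nat \<Rightarrow> real"
begin

lemma adjp_gam: "adjp (2^n) (gam a) (gam a)"
proof -
  have "adjp (2^n) (of_real (a p) \<odot> gop n p) (of_real (a p) \<odot> gop n p)" if "p < 2*n+1" for p
    using adjp_cs[OF _ adjp_gop[OF that], of "of_real (a p)"] by simp
  then show ?thesis unfolding gam_def by (intro adjp_sum) auto
qed

lemma adjp_K: assumes "j < n" shows "adjp (2^n) (K j) (K j)"
proof -
  have "adjp (2^n) (K j) (cnj (- \<i>) \<odot> (H j * G j))"
    unfolding pair_op_def by (intro adjp_cs adjp_mult adjp_gam) auto
  moreover have "cnj (- \<i>) \<odot> (H j * G j) = K j" unfolding pair_op_def GH[OF assms assms] by simp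
  ultimately show ?thesis by (simp only:)
qed

lemma adjp_prodK: "k \<le> n \<Longrightarrow> adjp (2^n) (prodK k) (prodK k) \<and> prodK k * prodK k = 1"
proof (induction k)
  case (Suc k)
  have c: "K k * prodK k = prodK k * K k"
    by (rule commute_prodK) (use Suc.prems K_comm in auto)
  have "adjp (2^n) (K k * prodK k) (prodK k * K k)"
    using Suc by (intro adjp_mult adjp_K) auto
  moreover have "K k * prodK k * (K k * prodK k) = K k * (prodK k * K k) * prodK k" by (simp only: mult.assoc)
  moreover have "K k * (prodK k * K k) * prodK k = K k * K k * (prodK k * prodK k)" unfolding c[symmetric] by (simp only: mult.assoc)
  moreover have "prodK k * prodK k = 1" "K k * K k = 1" using Suc KK[of k] by auto
  ultimately show ?case unfolding prodK.simps using c by simp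
next
  case 0
  show ?case unfolding prodK.simps using adjp_one[of "2^n"] by simp
qed

lemma adjp_proj: "k \<le> n \<Longrightarrow> \<exists>y. adjp (2^n) (proj S k) y"
proof (induction k)
  case (Suc k)
  then obtain y where y: "adjp (2^n) (proj S k) y" by auto
  have e: "adjp (2^n) ((1/2) \<odot> (1 + of_real (sg S k) \<odot> K k)) (cnj (1/2) \<odot> (1 + cnj (of_real (sg S k)) \<odot> K k))"
    using Suc.prems by (intro adjp_cs adjp_add adjp_one adjp_K) auto
  have "adjp (2^n) ((1/2) \<odot> (1 + of_real (sg S k) \<odot> K k) * proj S k) (y * (cnj (1/2) \<odot> (1 + cnj (of_real (sg S k)) \<odot> K k)))"
    by (rule adjp_mult[OF _ e y]) simp
  then show ?case unfolding proj.simps by (rule exI)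
next
  case 0
  show ?case unfolding proj.simps using adjp_one[of "2^n"] by auto
qed

text \<open>The coefficient is the expectation of the hermitian involution \<open>K j\<close>. With
  the empty list of flips \<open>trace_flip_mixes_bound\<close> is the plain bound for
  states.\<close>

lemma modes_bound:
  assumes m: "modes \<kappa> X" and X: "state_op (2^n) X" and j: "j < n" shows "\<bar>\<kappa> j\<bar> \<le> 1"
proof -
  have "herm_inv (2^n) (K j)" using adjp_K[OF j] KK[OF j] by (intro adjp_herm_inv) auto
  from trace_flip_mixes_bound[OF X, of "[]" "\<lambda>_. 1" "K j"] this
  have "\<bar>Re (trd (2^n) (K j * X))\<bar> \<le> 1" by (simp add: flip_mixes_def)
  moreover have "trd (2^n) X = 1" using X by (auto simp: state_op_def trd_emb is_state_def)
  moreover have "trd (2^n) (K j * (1 * X)) = of_real (\<kappa> j) * trd (2^n) (1 * X)"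
    by (rule modes_traceK[OF m j]) auto
  ultimately show ?thesis by simp
qed

text \<open>The 2^n idempotents \<open>proj S n\<close> have trace one and commute with the state,
  so its eigenvalues are their expectations, which form a product distribution.\<close>

lemma modes_entropy:
  assumes m: "modes \<kappa> (emb (2^n) \<tau>)" and \<tau>: "is_state (2^n) \<tau>"
  shows "vN_entropy \<tau> = (\<Sum>j<n. Hbin ((1 + \<kappa> j) / 2))"
proof -
  have c: "\<tau> \<in> carrier_mat (2^n) (2^n)" "trace \<tau> = 1" using \<tau> by (auto simp: is_state_def)
  have "\<exists>A. A \<in> carrier_mat (2^n) (2^n) \<and> proj S n = emb (2^n) A" for S
    using adjp_proj[of n S] by (auto simp: adjp_def)
  then have "\<forall>S. \<exists>A. A \<in> carrier_mat (2^n) (2^n) \<and> proj S n = emb (2^n) A" by blast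
  from choice[OF this] obtain P where P: "\<And>S. P S \<in> carrier_mat (2^n) (2^n)" "\<And>S. proj S n = emb (2^n) (P S)" by blast
  have "card (Pow {..<n}) = 2^n" by (simp add: card_Pow)
  then obtain f where f: "bij_betw f {..<(2::nat)^n} (Pow {..<n})"
    using ex_bij_betw_nat_finite[of "Pow {..<n}"] by (auto simp: atLeast0LessThan)
  have "vN_entropy \<tau> = (\<Sum>S\<in>Pow {..<n}. eta (Re (trace (P S * \<tau>))))"
  proof (rule entropy_idempotents[OF c(1) f])
    fix S T assume ST: "S \<in> Pow {..<n}" "T \<in> Pow {..<n}"
    show "P S \<in> carrier_mat (2^n) (2^n)" by (rule P)
    show "trace (P S) = 1" using trace_proj_one[of S] trd_emb[OF P(1)[of S]] P(2)[of S] by simp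
    have "S \<inter> {..<n} = T \<inter> {..<n} \<longleftrightarrow> S = T" using ST by auto
    then have "emb (2^n) (P S * P T) = emb (2^n) (if S = T then P S else 0\<^sub>m (2^n) (2^n))"
      using proj_mult[of n S T] P(2) emb_smult[of "2^n" "P S" 0] P(1)[of S]
      by (simp add: emb_mult P(1) emb_zero)
    then show "P S * P T = (if S = T then P S else 0\<^sub>m (2^n) (2^n))"
      by (rule emb_inj[rotated 2]) (use P(1) in \<open>auto intro: mult_carrier_mat\<close>)
    have "emb (2^n) (\<tau> * P S) = emb (2^n) (P S * \<tau>)"
      using modes_commute[OF m, of n S] P by (simp add: emb_mult c)
    then show "\<tau> * P S = P S * \<tau>" by (rule emb_inj[rotated 2]) (use P(1) c in \<open>auto intro: mult_carrier_mat\<close>)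
  qed
  also have "\<dots> = (\<Sum>S\<in>Pow {..<n}. eta (\<Prod>j<n. (1 + sg S j * \<kappa> j) / 2))"
  proof (intro sum.cong refl arg_cong[of _ _ eta])
    fix S
    have "trace (P S * \<tau>) = trd (2^n) (proj S n * emb (2^n) \<tau>)"
      using P c trd_emb[of "P S * \<tau>" "2^n"] by (simp add: emb_mult mult_carrier_mat[of _ "2^n" "2^n" _ "2^n"])
    also have "\<dots> = of_real (\<Prod>j<n. (1 + sg S j * \<kappa> j) / 2)"
      using trace_proj[OF m, of n S] trd_emb[OF c(1)] c(2) by simp
    finally show "Re (trace (P S * \<tau>)) = (\<Prod>j<n. (1 + sg S j * \<kappa> j) / 2)" by (simp del: of_real_prod)
  qed
  also have "\<dots> = (\<Sum>j<n. Hbin ((1 + \<kappa> j) / 2))"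
    using modes_bound[OF m] \<tau> by (intro entropy_product) (auto simp: state_op_def)
  finally show ?thesis .
qed

end

section \<open>Entropy lower bound through log-majorization\<close>

text \<open>The leading 1 is the weight of parity. It shifts the list so that position i, for i > 0,
  holds the i-th largest attenuation coefficient; as these are at most one, the whole list is
  decreasing.\<close>

definition sorted_weights :: "nat \<Rightarrow> (nat \<Rightarrow> real) \<Rightarrow> real list" where
  "sorted_weights n b = 1 # rev (sort (map b [1..<2*n+1]))"

lemma prod_pairs: "(\<Prod>i<2*k. f i) = (\<Prod>j<k. f (2*j) * f (2*j+1))" for f :: "nat \<Rightarrow> real"
  by (induction k) (simp_all add: mult_ac)

lemma sorted_weights_props:
  assumes b: "\<forall>p\<in>{1..2*n}. 0 \<le> b p \<and> b p \<le> 1"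
  shows "length (sorted_weights n b) = 2*n+1"
    "\<And>i j. i \<le> j \<Longrightarrow> j < 2*n+1 \<Longrightarrow> sorted_weights n b ! j \<le> sorted_weights n b ! i"
    "\<And>i. i < 2*n+1 \<Longrightarrow> 0 \<le> sorted_weights n b ! i \<and> sorted_weights n b ! i \<le> 1"
proof -
  let ?bs = "sorted_weights n b"
  show l: "length ?bs = 2*n+1" by (simp add: sorted_weights_def del: upt_Suc)
  have s: "set [1..<2*n+1] = {1..2*n}" by auto
  have r: "set ?bs \<subseteq> {0..1}" using b s by (auto simp: sorted_weights_def simp del: upt_Suc)
  show "0 \<le> ?bs ! i \<and> ?bs ! i \<le> 1" if "i < 2*n+1" for i
    using subsetD[OF r nth_mem[of i ?bs]] l that by simp
  have "sorted (rev ?bs)"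
    using b s by (auto simp: sorted_weights_def sorted_append simp del: upt_Suc)
  then show "?bs ! j \<le> ?bs ! i" if "i \<le> j" "j < 2*n+1" for i j
    using sorted_rev_nth_mono[of ?bs i j] that l by simp
qed

lemma sorted_weights_prod:
  fixes f :: "real \<Rightarrow> real"
  shows "prod_list (map f (sorted_weights n b)) = f 1 * prod_list (map (\<lambda>i. f (b i)) [1..<2*n+1])"
proof -
  have "prod_list (map f (rev (sort (map b [1..<2*n+1])))) = prod_mset (image_mset f (mset (map b [1..<2*n+1])))"
    by (simp add: prod_mset_prod_list[symmetric] del: upt_Suc)
  also have "\<dots> = prod_list (map f (map b [1..<2*n+1]))" by (simp only: mset_map[symmetric] prod_mset_prod_list)
  finally show ?thesis by (simp add: sorted_weights_def comp_def del: upt_Suc)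
qed

text \<open>The product of the k largest normal-form entries is the output expectation of the
  hermitian involution \<open>prodK k\<close>. Bounding it by the product of the 2k largest weights
  is the log-majorization, in which consecutive weights are grouped in pairs.\<close>

lemma wick_entropy_lower:
  assumes \<sigma>: "is_state (2^n) \<sigma>" and W: "wick (2*n+1) (gop n) M (emb (2^n) \<sigma>)"
    and anti: "\<And>p q. p < 2*n+1 \<Longrightarrow> q < 2*n+1 \<Longrightarrow> M p q = - M q p"
    and b: "\<forall>p\<in>{1..2*n}. 0 \<le> b p \<and> b p \<le> 1"
    and \<tau>: "is_state (2^n) \<tau>" "emb (2^n) \<tau> = flip_mixes (gop n) b [1..<2*n+1] (emb (2^n) \<sigma>)"
  shows "(\<Sum>j<n. Hbin ((1 + sorted_weights n b ! (2*j) * sorted_weights n b ! (2*j+1)) / 2)) \<le> vN_entropy \<tau>"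
proof -
  let ?N = "2*n+1"
  let ?bs = "sorted_weights n b"
  note bs = sorted_weights_props[OF b]
  have s1: "set [1..<2*n+1] = {1..2*n}" by auto
  define \<beta> where "\<beta> p = (if p \<in> set [1..<2*n+1] then b p else 1)" for p
  have \<beta>0: "\<beta> p \<ge> 0" for p using b s1 by (auto simp: \<beta>_def simp del: upt_Suc set_upt)
  define A where "A p q = \<beta> p * M p q * \<beta> q" for p q
  have wA: "wick ?N (gop n) A (emb (2^n) \<tau>)"
  proof -
    have "set [1..<2*n+1] \<subseteq> {..<?N}" by auto
    from cliff.wick_flip_mixes[OF W distinct_upt this, of b] show ?thesis
      unfolding \<tau>(2) A_def[abs_def] \<beta>_def .
  qed
  have antiA: "A p q = - A q p" if "p < ?N" "q < ?N" for p q
    unfolding A_def anti[OF that] by simp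
  have N2: "2*n \<le> ?N" by simp
  obtain u v lam where fr: "\<And>j k. j < n \<Longrightarrow> k < n \<Longrightarrow> ip ?N (u j) (u k) = (if j = k then 1 else 0)"
    "\<And>j k. j < n \<Longrightarrow> k < n \<Longrightarrow> ip ?N (v j) (v k) = (if j = k then 1 else 0)"
    "\<And>j k. j < n \<Longrightarrow> k < n \<Longrightarrow> ip ?N (u j) (v k) = 0"
    and ua: "\<And>j q. j < n \<Longrightarrow> q < ?N \<Longrightarrow> (\<Sum>p<?N. u j p * A p q) = - lam j * v j q"
    and va: "\<And>j q. j < n \<Longrightarrow> q < ?N \<Longrightarrow> (\<Sum>p<?N. v j p * A p q) = lam j * u j q"
    and l0: "\<And>j. j < n \<Longrightarrow> 0 \<le> lam j" and dec: "\<And>i j. i \<le> j \<Longrightarrow> j < n \<Longrightarrow> lam j \<le> lam i"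
  proof -
    show thesis
    proof (rule antisym_frame[of ?N A n, OF antiA N2])
      fix u v :: "nat \<Rightarrow> nat \<Rightarrow> real" and lam :: "nat \<Rightarrow> real"
      assume a: "\<And>j k. j < n \<Longrightarrow> k < n \<Longrightarrow> ip ?N (u j) (u k) = (if j = k then 1 else 0)"
        "\<And>j k. j < n \<Longrightarrow> k < n \<Longrightarrow> ip ?N (v j) (v k) = (if j = k then 1 else 0)"
        "\<And>j k. j < n \<Longrightarrow> k < n \<Longrightarrow> ip ?N (u j) (v k) = 0"
        "\<And>j q. j < n \<Longrightarrow> q < ?N \<Longrightarrow> (\<Sum>p<?N. u j p * A p q) = - lam j * v j q"
        "\<And>j q. j < n \<Longrightarrow> q < ?N \<Longrightarrow> (\<Sum>p<?N. v j p * A p q) = lam j * u j q"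
        "\<And>j. j < n \<Longrightarrow> 0 \<le> lam j" "\<And>i j. i \<le> j \<Longrightarrow> j < n \<Longrightarrow> lam j \<le> lam i"
      show thesis by (rule that[of u v lam]; fact a)
    qed
  qed
  interpret gframe n u v
    by unfold_locales (use fr in auto)
  have m: "modes lam (emb (2^n) \<tau>)" by (rule wick_modes[OF wA ua va])
  have st: "state_op (2^n) (emb (2^n) \<tau>)" using \<tau>(1) by (auto simp: state_op_def)
  have st\<sigma>: "state_op (2^n) (emb (2^n) \<sigma>)" using \<sigma> by (auto simp: state_op_def)
  \<comment> \<open>With all weights divided by c the frame still brings the covariance matrix to
    normal form, and every entry is divided by c^2. Weights beyond the first 2k are at most c and
    contribute a factor 1 to the mass; the powers of c cancel in the end.\<close>
  have key: "(\<Prod>j<k. lam j) \<le> (\<Prod>i<2*k. max c (?bs ! i))"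
    if k: "k \<le> n" and c: "0 < c" "\<And>i. 2*k \<le> i \<Longrightarrow> i < ?N \<Longrightarrow> ?bs ! i \<le> c" for k c
  proof -
    define b' where "b' p = \<beta> p / c" for p
    \<comment> \<open>The list starts at 0: the parity direction, untouched by the channel, has to
      be rescaled as well.\<close>
    define Y where "Y = flip_mixes (gop n) b' [0..<?N] (emb (2^n) \<sigma>)"
    define A' where "A' p q = (if p \<in> set [0..<?N] then b' p else 1) * M p q * (if q \<in> set [0..<?N] then b' q else 1)" for p q
    have s: "set [0..<?N] \<subseteq> {..<?N}" by auto
    have wY: "wick ?N (gop n) A' Y"
      using cliff.wick_flip_mixes[OF W distinct_upt s, of b'] unfolding Y_def A'_def[abs_def] .
    have A': "A' p q = A p q / c^2" if "p < ?N" "q < ?N" for p q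
      using that by (simp add: A'_def A_def b'_def power2_eq_square)
    have "modes (\<lambda>j. lam j / c^2) Y"
    proof (rule wick_modes[OF wY])
      fix j q assume j: "j < n" and q: "q < ?N"
      have "(\<Sum>p<?N. x p * A' p q) = (\<Sum>p<?N. x p * A p q) / c^2" for x
        using q by (simp add: A' sum_divide_distrib del: sum.lessThan_Suc)
      then show "(\<Sum>p<?N. u j p * A' p q) = - (lam j / c^2) * v j q" "(\<Sum>p<?N. v j p * A' p q) = lam j / c^2 * u j q"
        using ua[OF j q] va[OF j q] by simp_all
    qed
    from trace_prodK[OF this k] have "trd (2^n) (prodK k * Y) = of_real (\<Prod>j<k. lam j / c^2) * trd (2^n) Y" .
    moreover have "trd (2^n) Y = 1"
      unfolding Y_def trd_flip_mixes[OF s] using \<sigma> by (simp add: trd_emb is_state_def)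
    ultimately have t: "Re (trd (2^n) (prodK k * Y)) = (\<Prod>j<k. lam j / c^2)" by (simp del: of_real_prod)
    have hi: "herm_inv (2^n) (prodK k)" using adjp_prodK[OF k] by (intro adjp_herm_inv) auto
    have "(\<Prod>j<k. lam j / c^2) \<le> prod_list (map (\<lambda>i. max 1 (b' i)) [0..<?N])"
      using trace_flip_mixes_bound[OF st\<sigma> s _ hi, of b'] \<beta>0 c(1) t unfolding Y_def[symmetric] by (auto simp: b'_def)
    also have "\<dots> = max 1 (1 / c) * prod_list (map (\<lambda>i. max 1 (b i / c)) [1..<?N])"
    proof -
      have "[0..<?N] = 0 # [1..<?N]" by (simp add: upt_conv_Cons del: upt_Suc)
      moreover have "map (\<lambda>i. max 1 (b' i)) [1..<?N] = map (\<lambda>i. max 1 (b i / c)) [1..<?N]"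
        by (rule map_cong[OF refl]) (simp only: b'_def \<beta>_def if_True)
      moreover have "b' 0 = 1 / c" by (simp add: b'_def \<beta>_def)
      ultimately show ?thesis by (simp only: list.map prod_list.Cons)
    qed
    also have "\<dots> = prod_list (map (\<lambda>x. max 1 (x / c)) ?bs)" by (rule sorted_weights_prod[symmetric])
    also have "\<dots> = (\<Prod>i<?N. max 1 (?bs ! i / c))"
      by (subst prod.list_conv_set_nth) (auto simp: bs(1) atLeast0LessThan intro!: prod.cong)
    also have "\<dots> = (\<Prod>i<2*k. max 1 (?bs ! i / c))"
    proof (rule prod.mono_neutral_right)
      show "\<forall>i\<in>{..<?N} - {..<2*k}. max 1 (?bs ! i / c) = 1" using c by (auto simp: divide_le_eq)
    qed (use k in auto)
    also have "\<dots> = (\<Prod>i<2*k. max c (?bs ! i) / c)"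
      using c(1) by (intro prod.cong refl) (auto simp: max_def field_simps)
    also have "\<dots> = (\<Prod>i<2*k. max c (?bs ! i)) / c^(2*k)" by (simp add: prod_dividef)
    finally have "(\<Prod>j<k. lam j) / c^(2*k) \<le> (\<Prod>i<2*k. max c (?bs ! i)) / c^(2*k)"
      by (simp add: prod_dividef power_mult)
    then show ?thesis using c(1) by (simp add: divide_le_cancel)
  qed
  define \<mu> where "\<mu> j = ?bs ! (2*j) * ?bs ! (2*j+1)" for j
  have maj: "(\<Prod>j<k. lam j) \<le> (\<Prod>j<k. \<mu> j)" if k: "k \<le> n" for k
  proof (cases "k = 0")
    case False
    have i: "2*k-1 < ?N" using k by simp
    have e: "(\<Prod>j<k. \<mu> j) = (\<Prod>i<2*k. ?bs ! i)" by (simp only: \<mu>_def prod_pairs)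
    show ?thesis
    \<comment> \<open>The natural c is the 2k-th weight, at index 2k-1. If it is 0, the bound is
      obtained as the limit of c tending to 0.\<close>
    proof (cases "?bs ! (2*k-1) > 0")
      case True
      have "(\<Prod>j<k. lam j) \<le> (\<Prod>i<2*k. max (?bs ! (2*k-1)) (?bs ! i))"
        by (rule key[OF k True]) (use bs(2) in auto)
      also have "\<dots> = (\<Prod>i<2*k. ?bs ! i)"
      proof (rule prod.cong[OF refl])
        fix i assume "i \<in> {..<2*k}"
        then show "max (?bs ! (2*k-1)) (?bs ! i) = ?bs ! i" using bs(2)[of i "2*k-1"] i by (intro max_absorb2) auto
      qed
      finally show ?thesis unfolding e .
    next
      case F: False
      then have z: "?bs ! (2*k-1) = 0" using bs(3)[OF i] by simp
      have small: "(\<Prod>j<k. lam j) \<le> c" if c: "0 < c" "c \<le> 1" for c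
      proof -
        have "(\<Prod>j<k. lam j) \<le> (\<Prod>i<2*k. max c (?bs ! i))"
        proof (rule key[OF k c(1)])
          fix i assume "2*k \<le> i" "i < ?N"
          then have "2*k-1 \<le> i" "i < ?N" by auto
          from bs(2)[OF this] show "?bs ! i \<le> c" using z c by linarith
        qed
        also have "{..<2*k} = insert (2*k-1) {..<2*k-1}" using False by auto
        also have "(\<Prod>i\<in>insert (2*k-1) {..<2*k-1}. max c (?bs ! i)) = max c 0 * (\<Prod>i<2*k-1. max c (?bs ! i))"
          by (subst prod.insert) (use z in auto)
        also have "\<dots> \<le> c * 1"
        proof (rule mult_mono)
          show "(\<Prod>i<2*k-1. max c (?bs ! i)) \<le> 1" using bs(3) k c by (intro prod_le_1) auto
          show "0 \<le> (\<Prod>i<2*k-1. max c (?bs ! i))" using c by (intro prod_nonneg) (auto simp: max_def)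
        qed (use c in auto)
        finally show ?thesis by simp
      qed
      have "(\<Prod>j<k. lam j) \<le> 0 + e" if "e > 0" for e
      proof -
        have "(\<Prod>j<k. lam j) \<le> min 1 e" by (rule small) (use that in auto)
        then show ?thesis by simp
      qed
      then have "(\<Prod>j<k. lam j) \<le> 0" by (rule field_le_epsilon)
      moreover have "0 \<le> (\<Prod>i<2*k. ?bs ! i)" using bs(3) k by (intro prod_nonneg) auto
      ultimately show ?thesis unfolding e by linarith
    qed
  qed simp
  have "(\<Sum>j<n. gain (lam j)) \<le> (\<Sum>j<n. gain (\<mu> j))"
  proof (rule gain_log_majorization)
    fix j assume j: "j < n"
    show "0 \<le> lam j" by (rule l0[OF j])
    show "lam j \<le> 1" using modes_bound[OF m st j] by simp
    have "0 \<le> ?bs ! (2*j)" "?bs ! (2*j) \<le> 1" "0 \<le> ?bs ! (2*j+1)" "?bs ! (2*j+1) \<le> 1" using bs(3) j by auto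
    then show "0 \<le> \<mu> j" "\<mu> j \<le> 1" unfolding \<mu>_def by (auto intro: mult_le_one)
  qed (use dec maj in auto)
  then show ?thesis unfolding modes_entropy[OF m \<tau>(1)] \<mu>_def by (simp add: gain_def sum_negf)
qed

subsection \<open>Gaussian unitaries\<close>

lemma emb_msum:
  assumes "d > 0"
  shows "finite I \<Longrightarrow> (\<And>k. k \<in> I \<Longrightarrow> f k \<in> carrier_mat d d) \<Longrightarrow> emb d (msum d f I) = (\<Sum>k\<in>I. emb d (f k))"
proof (induction I rule: finite_induct)
  case empty
  have "msum d f {} = 0\<^sub>m d d" by (rule eq_matI) (auto simp: msum_def)
  then show ?case using emb_zero[OF assms] by simp
next
  case (insert k I)
  have "msum d f (insert k I) = f k + msum d f I"
    using insert by (intro eq_matI) (auto simp: msum_def)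
  moreover have "msum d f I \<in> carrier_mat d d" by (simp add: msum_def)
  ultimately show ?case using insert assms by (simp add: emb_add)
qed

lemma msum_carrier: "msum d f I \<in> carrier_mat d d" by (simp add: msum_def)

lemma ent_add: "ent (x + y) i j = ent x i j + ent y i j" by transfer simp
lemma ent_cs: "ent (z \<odot> x) i j = z * ent x i j" by transfer simp
lemma ent_zero: "ent 0 i j = 0" by transfer simp
lemma ent_sum: "ent (sum f I) i j = (\<Sum>k\<in>I. ent (f k) i j)"
  by (induction I rule: infinite_finite_induct) (simp_all add: ent_add ent_zero)

lemma mat_pow_add: "A \<in> carrier_mat d d \<Longrightarrow> A ^\<^sub>m s * A ^\<^sub>m t = A ^\<^sub>m (s + t)" for A :: "complex mat"
proof (induction t)
  case (Suc t)
  then show ?case using pow_carrier_mat[OF Suc.prems] by (simp add: assoc_mult_mat[of _ d d _ d _ d, symmetric])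
qed simp

lemma mat_pow_uminus: "A \<in> carrier_mat d d \<Longrightarrow> i < d \<Longrightarrow> j < d \<Longrightarrow> ((- A) ^\<^sub>m k) $$ (i,j) = (-1)^k * (A ^\<^sub>m k) $$ (i,j)" for A :: "complex mat"
proof (induction k arbitrary: i j)
  case (Suc k)
  have c: "(- A) ^\<^sub>m k \<in> carrier_mat d d" "A ^\<^sub>m k \<in> carrier_mat d d" using Suc.prems by (auto intro: pow_carrier_mat)
  have "((- A) ^\<^sub>m Suc k) $$ (i,j) = (\<Sum>l<d. ((- A) ^\<^sub>m k) $$ (i,l) * (- A) $$ (l,j))"
    using c Suc.prems mat_mult_sum[OF c(1) uminus_carrier_mat[OF Suc.prems(1)] Suc.prems(2,3)] by (simp only: pow_mat.simps)
  also have "\<dots> = (\<Sum>l<d. (-1)^Suc k * ((A ^\<^sub>m k) $$ (i,l) * A $$ (l,j)))"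
    using Suc by (intro sum.cong refl) auto
  also have "\<dots> = (-1)^Suc k * (A ^\<^sub>m Suc k) $$ (i,j)"
    using c Suc.prems by (simp add: scalar_prod_def atLeast0LessThan sum_distrib_left)
  finally show ?case .
qed simp

text \<open>By the binomial theorem the coefficient of order k in the Cauchy product is (1 - 1)^k
  A^k / k!, so only order 0 survives.\<close>

lemma mat_exp_uminus_mult:
  assumes A: "A \<in> carrier_mat d d" shows "mat_exp A * mat_exp (- A) = 1\<^sub>m d"
proof (rule eq_matI)
  fix i j assume "i < dim_row (1\<^sub>m d)" "j < dim_col (1\<^sub>m d)"
  then have ij: "i < d" "j < d" by auto
  have mA: "- A \<in> carrier_mat d d" using A by simp
  define a where "a k i j = (A ^\<^sub>m k) $$ (i,j) / of_nat (fact k)" for k i j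
  define a' where "a' k i j = ((- A) ^\<^sub>m k) $$ (i,j) / of_nat (fact k)" for k i j
  have "(\<lambda>k. \<Sum>m<d. \<Sum>s\<le>k. a s i m * a' (k - s) m j) sums (\<Sum>m<d. mat_exp A $$ (i,m) * mat_exp (- A) $$ (m,j))"
  proof (rule sums_sum)
    fix m assume "m \<in> {..<d}"
    then have m: "m < d" by simp
    have s: "summable (\<lambda>k. norm (a k i m))" "summable (\<lambda>k. norm (a' k m j))"
      unfolding a_def a'_def using mat_exp_summable[OF A ij(1) m] mat_exp_summable[OF mA m ij(2)] by auto
    have e: "(\<Sum>k. a k i m) = mat_exp A $$ (i,m)" "(\<Sum>k. a' k m j) = mat_exp (- A) $$ (m,j)"
      unfolding a_def a'_def using sums_unique[OF mat_exp_sums[OF A ij(1) m]] sums_unique[OF mat_exp_sums[OF mA m ij(2)]] by auto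
    show "(\<lambda>k. \<Sum>s\<le>k. a s i m * a' (k - s) m j) sums (mat_exp A $$ (i,m) * mat_exp (- A) $$ (m,j))"
      using Cauchy_product_sums[OF s] unfolding e .
  qed
  moreover have "(\<Sum>m<d. \<Sum>s\<le>k. a s i m * a' (k - s) m j) = (if k = 0 then (if i = j then 1 else 0) else 0)" for k
  proof -
    have "(\<Sum>m<d. \<Sum>s\<le>k. a s i m * a' (k - s) m j) = (\<Sum>s\<le>k. \<Sum>m<d. a s i m * a' (k - s) m j)" by (rule sum.swap)
    also have "\<dots> = (\<Sum>s\<le>k. (of_nat (k choose s) * 1 ^ s * (-1) ^ (k - s)) * ((A ^\<^sub>m k) $$ (i,j) / of_nat (fact k)))"
    proof (intro sum.cong refl)
      fix s assume "s \<in> {..k}"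
      then have s: "s \<le> k" by simp
      have "(\<Sum>m<d. a s i m * a' (k - s) m j) = (\<Sum>m<d. (A ^\<^sub>m s) $$ (i,m) * (A ^\<^sub>m (k - s)) $$ (m,j)) * ((-1)^(k - s) / (of_nat (fact s) * of_nat (fact (k - s))))"
        unfolding sum_distrib_right a_def a'_def using ij A by (intro sum.cong refl) (simp add: mat_pow_uminus[OF A])
      also have "(\<Sum>m<d. (A ^\<^sub>m s) $$ (i,m) * (A ^\<^sub>m (k - s)) $$ (m,j)) = (A ^\<^sub>m s * A ^\<^sub>m (k - s)) $$ (i,j)"
        by (rule mat_mult_sum[OF pow_carrier_mat[OF A] pow_carrier_mat[OF A] ij, symmetric])
      also have "A ^\<^sub>m s * A ^\<^sub>m (k - s) = A ^\<^sub>m k" using mat_pow_add[OF A] s by simp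
      finally have e: "(\<Sum>m<d. a s i m * a' (k - s) m j) = (A ^\<^sub>m k) $$ (i,j) * ((-1)^(k - s) / (of_nat (fact s) * of_nat (fact (k - s))))" .
      have ch: "of_nat (k choose s) = (fact k / (fact s * fact (k - s)) :: complex)"
        using binomial_fact[OF s, where 'a = complex] .
      have canc: "x * (y / f) = (c / f * 1 ^ s * y) * (x / c)" if "c \<noteq> 0" for x y f c :: complex
        using that by simp
      show "(\<Sum>m<d. a s i m * a' (k - s) m j) = (of_nat (k choose s) * 1 ^ s * (-1) ^ (k - s)) * ((A ^\<^sub>m k) $$ (i,j) / of_nat (fact k))"
        unfolding e ch of_nat_fact by (rule canc) simp
    qed
    also have "\<dots> = (1 + -1)^k * ((A ^\<^sub>m k) $$ (i,j) / of_nat (fact k))"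
      by (simp only: binomial_ring sum_distrib_right)
    also have "\<dots> = (if k = 0 then (if i = j then 1 else 0) else 0)" using ij A by (auto simp: power_0_left)
    finally show ?thesis .
  qed
  ultimately have S: "(\<lambda>k. if k = 0 then (if i = j then 1 else 0) else 0) sums (\<Sum>m<d. mat_exp A $$ (i,m) * mat_exp (- A) $$ (m,j))"
    by simp
  have "(\<lambda>k::nat. if k = 0 then (if i = j then 1 else 0 :: complex) else 0) sums (if i = j then 1 else 0)"
    using sums_single[of 0 "\<lambda>_. (if i = j then 1 else 0 :: complex)"] by simp
  from sums_unique2[OF S this] show "(mat_exp A * mat_exp (- A)) $$ (i,j) = 1\<^sub>m d $$ (i,j)"
    using ij mat_exp_carrier[OF A] mat_exp_carrier[OF mA] by (simp add: scalar_prod_def atLeast0LessThan)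
qed (use A mat_exp_carrier[of A d] mat_exp_carrier[of "- A" d] in auto)

lemma adj_pow: "A \<in> carrier_mat d d \<Longrightarrow> adj (A ^\<^sub>m k) = adj A ^\<^sub>m k"
proof (induction k)
  case 0
  have "dim_row (adj A) = d" using adj_carrier[OF 0] by (rule carrier_matD)
  then show ?case using 0 by (simp add: pauli_adj)
next
  case (Suc k)
  have "adj (A ^\<^sub>m Suc k) = adj A * adj A ^\<^sub>m k"
    using Suc pow_carrier_mat[OF Suc.prems, of k] by (simp add: adj_mult[of _ d d _ d])
  also have "\<dots> = adj A ^\<^sub>m (1 + k)" using mat_pow_add[OF adj_carrier[OF Suc.prems], of 1 k] Suc.prems by simp
  finally show ?case by simp
qed

lemma adj_mat_exp: assumes A: "A \<in> carrier_mat d d" shows "adj (mat_exp A) = mat_exp (adj A)"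
proof (rule eq_matI)
  have c: "mat_exp (adj A) \<in> carrier_mat d d" "adj (mat_exp A) \<in> carrier_mat d d"
    using mat_exp_carrier[OF A] mat_exp_carrier[OF adj_carrier[OF A]] by auto
  fix i j assume "i < dim_row (mat_exp (adj A))" "j < dim_col (mat_exp (adj A))"
  then have ij: "i < d" "j < d" using c by auto
  have e: "(\<lambda>k. cnj ((A ^\<^sub>m k) $$ (j,i) / of_nat (fact k))) = (\<lambda>k. (adj A ^\<^sub>m k) $$ (i,j) / of_nat (fact k))"
  proof
    fix k
    have "(adj A ^\<^sub>m k) $$ (i,j) = cnj ((A ^\<^sub>m k) $$ (j,i))"
      using ij A pow_carrier_mat[OF A, of k] unfolding adj_pow[OF A, symmetric] by (auto simp: adj_def)
    then show "cnj ((A ^\<^sub>m k) $$ (j,i) / of_nat (fact k)) = (adj A ^\<^sub>m k) $$ (i,j) / of_nat (fact k)" by simp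
  qed
  have "(\<lambda>k. cnj ((A ^\<^sub>m k) $$ (j,i) / of_nat (fact k))) sums cnj (mat_exp A $$ (j,i))"
    unfolding sums_cnj by (rule mat_exp_sums[OF A ij(2,1)])
  from sums_unique2[OF this[unfolded e] mat_exp_sums[OF adj_carrier[OF A] ij]]
  show "adj (mat_exp A) $$ (i,j) = mat_exp (adj A) $$ (i,j)" using ij mat_exp_carrier[OF A] by (auto simp: adj_def)
qed (use mat_exp_carrier[OF A] mat_exp_carrier[OF adj_carrier[OF A]] in \<open>auto simp: adj_def\<close>)

lemma mat_exp_unitary:
  assumes A: "A \<in> carrier_mat d d" and s: "adj A = - A"
  shows "mat_exp A * adj (mat_exp A) = 1\<^sub>m d" "adj (mat_exp A) * mat_exp A = 1\<^sub>m d"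
proof -
  show 1: "mat_exp A * adj (mat_exp A) = 1\<^sub>m d" unfolding adj_mat_exp[OF A] s by (rule mat_exp_uminus_mult[OF A])
  show "adj (mat_exp A) * mat_exp A = 1\<^sub>m d"
    by (rule mat_mult_left_right_inverse[OF mat_exp_carrier[OF A] adj_carrier[OF mat_exp_carrier[OF A]] 1])
qed

lemma mat_exp_real:
  assumes L: "L \<in> carrier_mat N N" and r: "\<And>i j. i < N \<Longrightarrow> j < N \<Longrightarrow> Im (L $$ (i,j)) = 0" and ij: "i < N" "j < N"
  shows "Im (mat_exp L $$ (i,j)) = 0"
proof -
  have p: "Im ((L ^\<^sub>m k) $$ (i,j)) = 0" if "i < N" "j < N" for k i j
    using that
  proof (induction k arbitrary: i j)
    case (Suc k)
    have "(L ^\<^sub>m Suc k) $$ (i,j) = (\<Sum>l<N. (L ^\<^sub>m k) $$ (i,l) * L $$ (l,j))"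
      using Suc.prems L pow_carrier_mat[OF L, of k] by (simp add: scalar_prod_def atLeast0LessThan)
    then show ?case using Suc r by simp
  qed (use L in auto)
  have "(\<lambda>k. Im ((L ^\<^sub>m k) $$ (i,j) / of_nat (fact k))) sums Im (mat_exp L $$ (i,j))"
    by (rule sums_Im[OF mat_exp_sums[OF L ij]])
  moreover have "(\<lambda>k. Im ((L ^\<^sub>m k) $$ (i,j) / of_nat (fact k))) = (\<lambda>k. 0)"
    by (rule ext) (simp only: Im_divide_of_nat p[OF ij] div_0)
  ultimately have "(\<lambda>k::nat. 0::real) sums Im (mat_exp L $$ (i,j))" by simp
  from sums_unique2[OF this sums_zero] show ?thesis .
qed

context clifford begin

lemma gg: "p < N \<Longrightarrow> q < N \<Longrightarrow> g p * g q = (if p = q then 2 \<odot> 1 else 0) - g q * g p"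
  using sq[of p] anti[of p q] lop.scale_left_distrib[of 1 1 "1::lop"] by (cases "p = q") simp_all

lemma quad_commutator:
  assumes "p < N" "q < N" "r < N"
  shows "g p * g q * g r - g r * (g p * g q) = (if q = r then 2 \<odot> g p else 0) - (if p = r then 2 \<odot> g q else 0)"
proof -
  have "g p * g q * g r = g p * ((if q = r then 2 \<odot> 1 else 0) - g r * g q)"
    using gg[OF assms(2,3)] by (simp add: mult.assoc)
  also have "\<dots> = (if q = r then 2 \<odot> g p else 0) - g p * g r * g q" by (simp add: algebra_simps)
  also have "g p * g r * g q = ((if p = r then 2 \<odot> 1 else 0) - g r * g p) * g q"
    using gg[OF assms(1,3)] by simp
  also have "\<dots> = (if p = r then 2 \<odot> g q else 0) - g r * (g p * g q)" by (simp add: algebra_simps)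
  finally show ?thesis by simp
qed

text \<open>Only the antisymmetric part of w acts: under commutators, quadratic forms act on the
  span of the generators as the complexified orthogonal Lie algebra.\<close>

lemma quad_sum_commutator:
  assumes r: "r < N"
  shows "(\<Sum>p<N. \<Sum>q<N. w p q \<odot> (g p * g q)) * g r - g r * (\<Sum>p<N. \<Sum>q<N. w p q \<odot> (g p * g q))
    = (\<Sum>q<N. (2 * (w q r - w r q)) \<odot> g q)"
proof -
  have "(\<Sum>p<N. \<Sum>q<N. w p q \<odot> (g p * g q)) * g r - g r * (\<Sum>p<N. \<Sum>q<N. w p q \<odot> (g p * g q))
    = (\<Sum>p<N. \<Sum>q<N. w p q \<odot> (g p * g q * g r - g r * (g p * g q)))"
    by (simp add: sum_distrib_left sum_distrib_right sum_subtractf lop.scale_right_diff_distrib)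
  also have "\<dots> = (\<Sum>p<N. \<Sum>q<N. (if q = r then (w p r * 2) \<odot> g p else 0) - (if p = r then (w r q * 2) \<odot> g q else 0))"
    using r by (intro sum.cong refl) (auto simp: quad_commutator lop.scale_right_diff_distrib)
  also have "\<dots> = (\<Sum>p<N. (w p r * 2) \<odot> g p) - (\<Sum>p<N. \<Sum>q<N. if p = r then (w r q * 2) \<odot> g q else 0)"
    using r by (simp add: sum_subtractf)
  also have "(\<Sum>p<N. \<Sum>q<N. if p = r then (w r q * 2) \<odot> g q else 0) = (\<Sum>q<N. (w r q * 2) \<odot> g q)"
    by (subst sum.swap) (use r in simp)
  finally show ?thesis
    by (simp only: sum_subtractf[symmetric] lop.scale_left_diff_distrib[symmetric] right_diff_distrib mult.commute[of _ 2])
qed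

lemma trd_gg: "p < N \<Longrightarrow> q < N \<Longrightarrow> trd d (g p * g q) = (if p = q then of_nat d else 0)"
  using trc[of p "g q"] anti[of p q] sq[of p] by (cases "p = q") auto

text \<open>Conjugation preserves the anticommutation relations, which forces the columns of R to be
  orthonormal; the covariance matrix M becomes R M R^T.\<close>

lemma wick_conj:
  assumes W: "wick N g M X" and u: "u * u' = 1" "u' * u = 1"
    and R: "\<And>p. p < N \<Longrightarrow> u * g p = (\<Sum>q<N. of_real (R q p) \<odot> g q) * u"
  shows "(\<forall>p<N. \<forall>q<N. (\<Sum>r<N. R r p * R r q) = (if p = q then 1 else 0)) \<and>
    wick N g (\<lambda>r s. \<Sum>p<N. \<Sum>q<N. R r p * M p q * R s q) (u * X * u')"
proof
  have c: "u * g p * u' = gam (\<lambda>q. R q p)" if "p < N" for p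
    using R[OF that] u by (simp add: gam_def mult.assoc)
  have uu: "u' * (u * x) = x" for x using u by (metis mult.assoc mult_1)
  have m: "u * x * u' * (u * y * u') = u * (x * y) * u'" for x y by (simp add: mult.assoc uu)
  show orth: "\<forall>p<N. \<forall>q<N. (\<Sum>r<N. R r p * R r q) = (if p = q then 1 else 0)"
  proof (intro allI impI)
    fix p q assume p: "p < N" and q: "q < N"
    have "of_real (2 * ip N (\<lambda>r. R r p) (\<lambda>r. R r q)) \<odot> (1::lop) = u * (g p * g q + g q * g p) * u'"
      unfolding gam_clifford[symmetric] c[OF p, symmetric] c[OF q, symmetric] m by (simp add: algebra_simps)
    also have "g p * g q + g q * g p = (if p = q then 2 else 0) \<odot> 1" using gg[OF p q] by simp
    finally have "of_real (2 * ip N (\<lambda>r. R r p) (\<lambda>r. R r q)) \<odot> (1::lop) = (if p = q then 2 else 0) \<odot> 1"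
      using u by (simp split: if_splits)
    then have "complex_of_real (2 * ip N (\<lambda>r. R r p) (\<lambda>r. R r q)) = (if p = q then 2 else 0)"
      by (rule lop.scale_right_imp_eq[OF one_neq_zero])
    from arg_cong[OF this, of Re] have "2 * ip N (\<lambda>r. R r p) (\<lambda>r. R r q) = (if p = q then 2 else 0)"
      by (cases "p = q") simp_all
    then show "(\<Sum>r<N. R r p * R r q) = (if p = q then 1 else 0)" by (auto simp: ip_def split: if_splits)
  qed
  define RM where "RM = mat N N (\<lambda>(i,j). R i j)"
  define RT where "RT = mat N N (\<lambda>(i,j). R j i)"
  \<comment> \<open>A one-sided inverse of a square matrix is two-sided. The resulting
    orthonormality of the rows is what expresses \<open>g r\<close> through the rotated
    generators.\<close>
  have "RT * RM = 1\<^sub>m N"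
  proof (rule eq_matI)
    fix i j assume "i < dim_row (1\<^sub>m N :: real mat)" "j < dim_col (1\<^sub>m N :: real mat)"
    then have ij: "i < N" "j < N" by auto
    have "(RT * RM) $$ (i,j) = (\<Sum>r<N. R r i * R r j)" using ij by (simp add: RT_def RM_def scalar_prod_def atLeast0LessThan)
    then show "(RT * RM) $$ (i,j) = 1\<^sub>m N $$ (i,j)" using orth ij by simp
  qed (auto simp: RT_def RM_def)
  then have "RM * RT = 1\<^sub>m N" by (intro mat_mult_left_right_inverse[of RT N RM]) (auto simp: RT_def RM_def)
  then have orth': "(\<Sum>p<N. R r p * R s p) = (if r = s then 1 else 0)" if "r < N" "s < N" for r s
  proof -
    have "(RM * RT) $$ (r,s) = (\<Sum>p<N. R r p * R s p)" using that by (simp add: RT_def RM_def scalar_prod_def atLeast0LessThan)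
    then show ?thesis using \<open>RM * RT = 1\<^sub>m N\<close> that by simp
  qed
  have g: "g r = (\<Sum>p<N. of_real (R r p) \<odot> gam (\<lambda>q. R q p))" if r: "r < N" for r
  proof -
    have "(\<Sum>p<N. of_real (R r p) \<odot> gam (\<lambda>q. R q p)) = (\<Sum>p<N. \<Sum>q<N. of_real (R r p * R q p) \<odot> g q)"
      by (simp add: gam_def lop.scale_sum_right)
    also have "\<dots> = (\<Sum>q<N. of_real (\<Sum>p<N. R r p * R q p) \<odot> g q)"
      by (subst sum.swap) (simp only: of_real_sum lop.scale_sum_left)
    also have "\<dots> = (\<Sum>q<N. if q = r then g r else 0)" using orth' r by (intro sum.cong refl) auto
    finally show ?thesis using r by simp
  qed
  let ?X = "u * X * u'"
  have cm: "gam (\<lambda>q. R q p) * ?X - ?X * gam (\<lambda>q. R q p) = \<i> \<odot> (\<Sum>q<N. of_real (M p q) \<odot> (gam (\<lambda>r. R r q) * ?X + ?X * gam (\<lambda>r. R r q)))" if p: "p < N" for p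
  proof -
    have "gam (\<lambda>q. R q p) * ?X - ?X * gam (\<lambda>q. R q p) = u * (g p * X - X * g p) * u'"
      unfolding c[OF p, symmetric] m by (simp add: algebra_simps)
    also have "\<dots> = u * (\<i> \<odot> (\<Sum>q<N. of_real (M p q) \<odot> (g q * X + X * g q))) * u'" using W p by (simp add: wick_def)
    also have "\<dots> = \<i> \<odot> (\<Sum>q<N. of_real (M p q) \<odot> (u * (g q * X + X * g q) * u'))"
      by (simp add: sum_distrib_left sum_distrib_right)
    also have "\<dots> = \<i> \<odot> (\<Sum>q<N. of_real (M p q) \<odot> (gam (\<lambda>r. R r q) * ?X + ?X * gam (\<lambda>r. R r q)))"
    proof -
      have "u * (g q * X + X * g q) * u' = gam (\<lambda>r. R r q) * ?X + ?X * gam (\<lambda>r. R r q)" if "q < N" for q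
        unfolding c[OF that, symmetric] m by (simp add: algebra_simps)
      then show ?thesis by simp
    qed
    finally show ?thesis .
  qed
  show "wick N g (\<lambda>r s. \<Sum>p<N. \<Sum>q<N. R r p * M p q * R s q) ?X"
    unfolding wick_def
  proof (intro allI impI)
    fix r assume r: "r < N"
    define Z where "Z s = g s * ?X + ?X * g s" for s
    have ga: "gam (\<lambda>r. R r q) * ?X + ?X * gam (\<lambda>r. R r q) = (\<Sum>s<N. of_real (R s q) \<odot> Z s)" for q
      by (simp add: gam_def Z_def sum_distrib_left sum_distrib_right sum.distrib lop.scale_right_distrib)
    have "g r * ?X - ?X * g r = (\<Sum>p<N. of_real (R r p) \<odot> (gam (\<lambda>q. R q p) * ?X - ?X * gam (\<lambda>q. R q p)))"
      unfolding g[OF r] by (simp only: sum_distrib_left sum_distrib_right sum_subtractf lop.scale_right_diff_distrib cs_mult_left cs_mult_right)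
    also have "\<dots> = (\<Sum>p<N. of_real (R r p) \<odot> \<i> \<odot> (\<Sum>q<N. of_real (M p q) \<odot> (\<Sum>s<N. of_real (R s q) \<odot> Z s)))"
      by (intro sum.cong refl) (simp add: cm ga)
    also have "\<dots> = \<i> \<odot> (\<Sum>p<N. \<Sum>q<N. \<Sum>s<N. of_real (R r p * M p q * R s q) \<odot> Z s)"
      by (simp add: lop.scale_sum_right mult_ac)
    also have "(\<Sum>p<N. \<Sum>q<N. \<Sum>s<N. of_real (R r p * M p q * R s q) \<odot> Z s) = (\<Sum>p<N. \<Sum>s<N. \<Sum>q<N. of_real (R r p * M p q * R s q) \<odot> Z s)"
      by (intro sum.cong refl sum.swap)
    also have "\<dots> = (\<Sum>s<N. \<Sum>p<N. \<Sum>q<N. of_real (R r p * M p q * R s q) \<odot> Z s)" by (rule sum.swap)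
    also have "\<dots> = (\<Sum>s<N. of_real (\<Sum>p<N. \<Sum>q<N. R r p * M p q * R s q) \<odot> Z s)"
      by (simp only: of_real_sum lop.scale_sum_left)
    finally show "g r * ?X - ?X * g r = \<i> \<odot> (\<Sum>s<N. of_real (\<Sum>p<N. \<Sum>q<N. R r p * M p q * R s q) \<odot> (g s * ?X + ?X * g s))"
      by (simp only: Z_def)
  qed
qed

end

section \<open>Exponents of Gaussian unitaries as quadratic forms in the generators\<close>

text \<open>Coefficients of \<i> (H2 + H1) in the products of two generators. Row 0 holds the linear
  part without a factor \<i>, because the product of generators 0 and q is already \<i> times the
  q-th Majorana operator.\<close>

definition gen_coeff :: "(nat \<Rightarrow> nat \<Rightarrow> complex) \<Rightarrow> (nat \<Rightarrow> complex) \<Rightarrow> nat \<Rightarrow> nat \<Rightarrow> complex" where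
  "gen_coeff h a p q = (if p = 0 then (if q = 0 then 0 else a q) else if q = 0 then 0 else \<i> * h p q)"

definition gen_mat :: "nat \<Rightarrow> (nat \<Rightarrow> nat \<Rightarrow> complex) \<Rightarrow> (nat \<Rightarrow> complex) \<Rightarrow> complex mat" where
  "gen_mat n h a = \<i> \<cdot>\<^sub>m (msum (2^n) (\<lambda>(p,q). h p q \<cdot>\<^sub>m (majorana n p * majorana n q)) ({1..2*n} \<times> {1..2*n})
      + msum (2^n) (\<lambda>p. a p \<cdot>\<^sub>m majorana n p) {1..2*n})"

lemma gen_mat_carrier: "gen_mat n h a \<in> carrier_mat (2^n) (2^n)"
  by (simp add: gen_mat_def msum_carrier)

lemma gen_mat_op: "emb (2^n) (gen_mat n h a) = (\<Sum>p<2*n+1. \<Sum>q<2*n+1. gen_coeff h a p q \<odot> (gop n p * gop n q))"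
proof -
  have s: "{..<2*n+1} = insert 0 {1..2*n}" by auto
  have m2: "emb (2^n) (h p q \<cdot>\<^sub>m (majorana n p * majorana n q)) = h p q \<odot> (gop n p * gop n q)" if "p \<in> {1..2*n}" "q \<in> {1..2*n}" for p q
    using that majorana_carrier[of p n] majorana_carrier[of q n]
    by (simp add: emb_smult emb_mult mult_carrier_mat[of _ "2^n" "2^n" _ "2^n"] gop_mult maj_def)
  have m1: "emb (2^n) (a p \<cdot>\<^sub>m majorana n p) = (- \<i> * a p) \<odot> (gop n 0 * gop n p)" if "p \<in> {1..2*n}" for p
  proof -
    have "\<i> * a p * \<i> = - a p" by (simp add: complex_eq_iff)
    then show ?thesis using that majorana_carrier[of p n] by (simp add: emb_smult gop0_mult maj_def)
  qed
  have 2: "emb (2^n) (msum (2^n) (\<lambda>(p,q). h p q \<cdot>\<^sub>m (majorana n p * majorana n q)) ({1..2*n} \<times> {1..2*n}))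
    = (\<Sum>p\<in>{1..2*n}. \<Sum>q\<in>{1..2*n}. h p q \<odot> (gop n p * gop n q))"
  proof (subst emb_msum)
    show "(\<Sum>k\<in>{1..2*n} \<times> {1..2*n}. emb (2^n) (case k of (p,q) \<Rightarrow> h p q \<cdot>\<^sub>m (majorana n p * majorana n q)))
      = (\<Sum>p\<in>{1..2*n}. \<Sum>q\<in>{1..2*n}. h p q \<odot> (gop n p * gop n q))"
      unfolding sum.cartesian_product by (intro sum.cong refl) (use m2 in auto)
  qed (auto intro!: smult_carrier_mat mult_carrier_mat[of _ "2^n" "2^n" _ "2^n"] majorana_carrier)
  have 1: "emb (2^n) (msum (2^n) (\<lambda>p. a p \<cdot>\<^sub>m majorana n p) {1..2*n}) = (\<Sum>p\<in>{1..2*n}. (- \<i> * a p) \<odot> (gop n 0 * gop n p))"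
  proof (subst emb_msum)
    show "(\<Sum>k\<in>{1..2*n}. emb (2^n) (a k \<cdot>\<^sub>m majorana n k)) = (\<Sum>p\<in>{1..2*n}. (- \<i> * a p) \<odot> (gop n 0 * gop n p))"
      by (intro sum.cong refl m1)
  qed (auto intro!: smult_carrier_mat majorana_carrier)
  have "emb (2^n) (gen_mat n h a) = \<i> \<odot> ((\<Sum>p\<in>{1..2*n}. \<Sum>q\<in>{1..2*n}. h p q \<odot> (gop n p * gop n q)) + (\<Sum>p\<in>{1..2*n}. (- \<i> * a p) \<odot> (gop n 0 * gop n p)))"
    unfolding gen_mat_def 1[symmetric] 2[symmetric] by (simp add: emb_smult emb_add msum_carrier)
  also have "\<dots> = (\<Sum>p\<in>{1..2*n}. \<Sum>q\<in>{1..2*n}. (\<i> * h p q) \<odot> (gop n p * gop n q)) + (\<Sum>q\<in>{1..2*n}. a q \<odot> (gop n 0 * gop n q))"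
    by (simp add: lop.scale_right_distrib lop.scale_sum_right)
  also have "(\<Sum>p\<in>{1..2*n}. \<Sum>q\<in>{1..2*n}. (\<i> * h p q) \<odot> (gop n p * gop n q)) = (\<Sum>p\<in>{1..2*n}. \<Sum>q<2*n+1. gen_coeff h a p q \<odot> (gop n p * gop n q))"
    unfolding s by (rule sum.cong[OF refl], subst sum.insert) (auto simp: gen_coeff_def intro!: sum.cong)
  also have "(\<Sum>q\<in>{1..2*n}. a q \<odot> (gop n 0 * gop n q)) = (\<Sum>q<2*n+1. gen_coeff h a 0 q \<odot> (gop n 0 * gop n q))"
    unfolding s by (auto simp: gen_coeff_def intro!: sum.cong)
  finally show ?thesis
    unfolding s[symmetric] by (subst (2) s) (simp add: add.commute s[symmetric] del: sum.lessThan_Suc)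
qed

lemma mat_exp_rotate:
  assumes A: "A \<in> carrier_mat d d" and d: "d > 0" and Y: "\<And>p. p < N \<Longrightarrow> Y p \<in> carrier_mat d d" and L: "L \<in> carrier_mat N N"
    and rel: "\<And>p. p < N \<Longrightarrow> emb d A * emb d (Y p) - emb d (Y p) * emb d A = (\<Sum>q<N. L $$ (q,p) \<odot> emb d (Y q))"
    and p: "p < N"
  shows "emb d (mat_exp A) * emb d (Y p) = (\<Sum>q<N. mat_exp L $$ (q,p) \<odot> emb d (Y q)) * emb d (mat_exp A)"
proof -
  note E = mat_exp_carrier[OF A] and m = mult_carrier_mat[of _ d d _ d]
  have r: "(A * Y p) $$ (i,j) = (Y p * A) $$ (i,j) + (\<Sum>q<N. L $$ (q,p) * Y q $$ (i,j))" if "p < N" "i < d" "j < d" for p i j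
  proof -
    have "emb d (A * Y p) = emb d (Y p * A) + (\<Sum>q<N. L $$ (q,p) \<odot> emb d (Y q))"
      using rel[OF that(1)] A Y[OF that(1)] d by (simp add: emb_mult algebra_simps)
    then have "ent (emb d (A * Y p)) i j = ent (emb d (Y p * A)) i j + (\<Sum>q<N. L $$ (q,p) * ent (emb d (Y q)) i j)"
      by (simp only: ent_add ent_sum ent_cs)
    then show ?thesis using that A Y by (simp add: ent_emb m del: index_mult_mat(1))
  qed
  have "mat_exp A * Y p = msum d (\<lambda>q. mat_exp L $$ (q,p) \<cdot>\<^sub>m (Y q * mat_exp A)) {..<N}"
  proof (rule eq_matI)
    fix i j assume "i < dim_row (msum d (\<lambda>q. mat_exp L $$ (q,p) \<cdot>\<^sub>m (Y q * mat_exp A)) {..<N})"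
      "j < dim_col (msum d (\<lambda>q. mat_exp L $$ (q,p) \<cdot>\<^sub>m (Y q * mat_exp A)) {..<N})"
    then have ij: "i < d" "j < d" by (auto simp: msum_def)
    have "(mat_exp L $$ (q,p) \<cdot>\<^sub>m (Y q * mat_exp A)) $$ (i,j) = mat_exp L $$ (q,p) * (Y q * mat_exp A) $$ (i,j)" if "q < N" for q
      using ij E Y[OF that] by (intro index_smult_mat) auto
    then show "(mat_exp A * Y p) $$ (i,j) = msum d (\<lambda>q. mat_exp L $$ (q,p) \<cdot>\<^sub>m (Y q * mat_exp A)) {..<N} $$ (i,j)"
      using mat_exp_intertwine[OF A Y L r p ij] ij by (simp add: msum_def del: index_mult_mat(1))
  qed (use E Y[OF p] in \<open>auto simp: msum_def\<close>)
  moreover have "emb d (msum d (\<lambda>q. mat_exp L $$ (q,p) \<cdot>\<^sub>m (Y q * mat_exp A)) {..<N}) = (\<Sum>q<N. emb d (mat_exp L $$ (q,p) \<cdot>\<^sub>m (Y q * mat_exp A)))"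
    by (rule emb_msum[OF d]) (use E Y in \<open>auto intro!: smult_carrier_mat m\<close>)
  ultimately have "emb d (mat_exp A * Y p) = (\<Sum>q<N. emb d (mat_exp L $$ (q,p) \<cdot>\<^sub>m (Y q * mat_exp A)))" by simp
  then show ?thesis using E Y p d by (simp add: emb_mult emb_smult m sum_distrib_right)
qed

lemma trace_adj: "A \<in> carrier_mat d d \<Longrightarrow> trace (adj A) = cnj (trace A)"
  by (auto simp: trace_def adj_def)

text \<open>The rotation is real because its Lie algebra matrix L is. For a skew-hermitian exponent
  the commutator with a generator is hermitian, and \<open>L $$ (q,r)\<close> is, up to the
  dimension, the trace of its product with the hermitian generator q.\<close>

lemma gen_mat_rotation:
  assumes s: "adj (gen_mat n h a) = - gen_mat n h a"
  obtains R :: "nat \<Rightarrow> nat \<Rightarrow> real" where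
    "\<And>p. p < 2*n+1 \<Longrightarrow> emb (2^n) (mat_exp (gen_mat n h a)) * gop n p = (\<Sum>q<2*n+1. of_real (R q p) \<odot> gop n q) * emb (2^n) (mat_exp (gen_mat n h a))"
proof -
  let ?N = "2*n+1" and ?d = "2^n :: nat" and ?A = "gen_mat n h a"
  define L where "L = mat ?N ?N (\<lambda>(q,r). 2 * (gen_coeff h a q r - gen_coeff h a r q))"
  have L: "L \<in> carrier_mat ?N ?N" by (simp add: L_def)
  note A = gen_mat_carrier[of n h a]
  have com: "emb ?d ?A * gop n r - gop n r * emb ?d ?A = (\<Sum>q<?N. L $$ (q,r) \<odot> gop n q)" if r: "r < ?N" for r
    unfolding gen_mat_op cliff.quad_sum_commutator[OF r] using r by (intro sum.cong refl) (simp add: L_def)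
  have re: "Im (L $$ (q,r)) = 0" if q: "q < ?N" and r: "r < ?N" for q r
  proof -
    let ?C = "?A * gmat n r - gmat n r * ?A"
    note gq = gmat_carrier[OF q] gmat_adj[OF q] and gr = gmat_carrier[OF r] gmat_adj[OF r]
    note m = mult_carrier_mat[of _ ?d ?d _ ?d]
    have C: "?C \<in> carrier_mat ?d ?d" using A gr by (intro minus_carrier_mat m)
    have neg: "adj (x - y) = adj x - adj y" if "x \<in> carrier_mat ?d ?d" "y \<in> carrier_mat ?d ?d" for x y
      by (rule eq_matI) (use that in \<open>auto simp: adj_def\<close>)
    have "adj ?C = gmat n r * (- ?A) - (- ?A) * gmat n r"
      using A gr s by (simp add: neg m adj_mult[of _ ?d ?d _ ?d])
    also have "\<dots> = ?C" using A gr by (intro eq_matI) auto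
    finally have aC: "adj ?C = ?C" .
    have "cnj (trace (gmat n q * ?C)) = trace (adj (gmat n q * ?C))"
      by (rule trace_adj[OF m[OF gq(1) C], symmetric])
    also have "adj (gmat n q * ?C) = ?C * gmat n q" using gq C aC by (simp add: adj_mult[of _ ?d ?d _ ?d])
    also have "trace (?C * gmat n q) = trace (gmat n q * ?C)" by (rule trace_mult_comm[OF C gq(1)])
    finally have "cnj (trace (gmat n q * ?C)) = trace (gmat n q * ?C)" .
    from arg_cong[OF this, of Im] have "Im (trace (gmat n q * ?C)) = 0" by simp
    moreover have "trace (gmat n q * ?C) = of_nat ?d * L $$ (q,r)"
    proof -
      have "emb ?d ?C = emb ?d ?A * gop n r - gop n r * emb ?d ?A"
      proof -
        have "?C = ?A * gmat n r + (-1) \<cdot>\<^sub>m (gmat n r * ?A)" using A gr by (intro eq_matI) auto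
        then show ?thesis using A gr by (simp add: emb_add emb_smult emb_mult m gop_def)
      qed
      then have "emb ?d (gmat n q * ?C) = gop n q * (\<Sum>s<?N. L $$ (s,r) \<odot> gop n s)"
        using gq C com[OF r] by (simp add: emb_mult gop_def)
      then have "trace (gmat n q * ?C) = (\<Sum>s<?N. L $$ (s,r) * trd ?d (gop n q * gop n s))"
        using trd_emb[OF m[OF gq(1) C]] by (simp add: sum_distrib_left trd_sum del: sum.lessThan_Suc)
      also have "\<dots> = (\<Sum>s<?N. if s = q then L $$ (q,r) * of_nat ?d else 0)"
        using q by (intro sum.cong refl) (auto simp: cliff.trd_gg)
      finally show ?thesis using q by simp
    qed
    ultimately show ?thesis by simp
  qed
  define R where "R q p = Re (mat_exp L $$ (q,p))" for q p
  show ?thesis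
  proof (rule that[of R])
    fix p assume p: "p < ?N"
    have "mat_exp L $$ (q,p) = of_real (R q p)" if "q < ?N" for q
      using mat_exp_real[OF L re that p] by (simp add: R_def complex_eq_iff)
    moreover have "emb ?d (mat_exp ?A) * gop n p = (\<Sum>q<?N. mat_exp L $$ (q,p) \<odot> gop n q) * emb ?d (mat_exp ?A)"
      unfolding gop_def by (rule mat_exp_rotate[OF A _ gmat_carrier L _ p]) (use com in \<open>auto simp: gop_def\<close>)
    ultimately show "emb ?d (mat_exp ?A) * gop n p = (\<Sum>q<?N. of_real (R q p) \<odot> gop n q) * emb ?d (mat_exp ?A)" by simp
  qed
qed

lemma gen_mat_skew:
  assumes "hermitian (msum (2^n) (\<lambda>(p,q). h p q \<cdot>\<^sub>m (majorana n p * majorana n q)) ({1..2*n} \<times> {1..2*n}))"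
    and "hermitian (msum (2^n) (\<lambda>p. a p \<cdot>\<^sub>m majorana n p) {1..2*n})"
  shows "adj (gen_mat n h a) = - gen_mat n h a"
proof -
  have "adj (gen_mat n h a) = (- \<i>) \<cdot>\<^sub>m (msum (2^n) (\<lambda>(p,q). h p q \<cdot>\<^sub>m (majorana n p * majorana n q)) ({1..2*n} \<times> {1..2*n}) + msum (2^n) (\<lambda>p. a p \<cdot>\<^sub>m majorana n p) {1..2*n})"
    unfolding gen_mat_def adj_smult adj_add[OF msum_carrier msum_carrier] hermitian_carrier_adj[OF assms(1)] hermitian_carrier_adj[OF assms(2)] by simp
  also have "\<dots> = - gen_mat n h a" unfolding gen_mat_def by (rule eq_matI) auto
  finally show ?thesis .
qed

lemma gaussian_state_wick:
  assumes "gaussian_state n \<rho>"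
  obtains M where "wick (2*n+1) (gop n) M (emb (2^n) \<rho>)" "\<And>p q. p < 2*n+1 \<Longrightarrow> q < 2*n+1 \<Longrightarrow> M p q = - M q p"
proof -
  let ?N = "2*n+1" and ?d = "2^n :: nat"
  from assms obtain lam h a where
    H: "hermitian (msum ?d (\<lambda>(p,q). h p q \<cdot>\<^sub>m (majorana n p * majorana n q)) ({1..2*n} \<times> {1..2*n}))"
      "hermitian (msum ?d (\<lambda>p. a p \<cdot>\<^sub>m majorana n p) {1..2*n})"
    and \<rho>: "\<rho> = mat_exp (gen_mat n h a) * rho_lambda n lam * adj (mat_exp (gen_mat n h a))"
    unfolding gaussian_state_def Let_def gen_mat_def by auto
  let ?A = "gen_mat n h a"
  note A = gen_mat_carrier[of n h a]
  have s: "adj ?A = - ?A" by (rule gen_mat_skew[OF H])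
  obtain R where R: "\<And>p. p < ?N \<Longrightarrow> emb ?d (mat_exp ?A) * gop n p = (\<Sum>q<?N. of_real (R q p) \<odot> gop n q) * emb ?d (mat_exp ?A)"
    using gen_mat_rotation[OF s] by blast
  let ?u = "emb ?d (mat_exp ?A)" and ?u' = "emb ?d (adj (mat_exp ?A))"
  note E = mat_exp_carrier[OF A] adj_carrier[OF mat_exp_carrier[OF A]]
  have u: "?u * ?u' = 1" "?u' * ?u = 1"
    using mat_exp_unitary[OF A s] E by (simp_all add: emb_mult[symmetric] emb_one)
  have e: "emb ?d \<rho> = ?u * emb ?d (rho_lambda n lam) * ?u'"
    using E rho_lambda_carrier[of n lam] by (simp add: \<rho> emb_mult mult_carrier_mat[of _ ?d ?d _ ?d])
  define M where "M r s = (\<Sum>p<?N. \<Sum>q<?N. R r p * base_mat lam p q * R s q)" for r s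
  have "wick ?N (gop n) M (emb ?d \<rho>)"
    using cliff.wick_conj[OF rho_lambda_wick u R] unfolding e M_def[abs_def] by blast
  moreover have "M r s = - M s r" for r s
  proof -
    have "M s r = (\<Sum>q<?N. \<Sum>p<?N. R s p * base_mat lam p q * R r q)" unfolding M_def by (rule sum.swap)
    also have "\<dots> = (\<Sum>q<?N. \<Sum>p<?N. - (R r q * base_mat lam q p * R s p))"
    proof (intro sum.cong refl)
      fix p q
      have "base_mat lam p q = - base_mat lam q p" by (auto simp: base_mat_def)
      then show "R s p * base_mat lam p q * R r q = - (R r q * base_mat lam q p * R s p)" by simp
    qed
    finally have "M s r = - M r s" unfolding M_def[of r s] sum_negf .
    then show ?thesis by simp
  qed
  ultimately show ?thesis by (rule that)
qed

subsection \<open>Concavity of the entropy\<close>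

lemma is_state_msum:
  assumes p: "is_prob m p" and \<sigma>: "\<And>i. i < m \<Longrightarrow> is_state d (\<sigma> i)"
  shows "is_state d (msum d (\<lambda>i. complex_of_real (p i) \<cdot>\<^sub>m \<sigma> i) {..<m})"
proof -
  let ?A = "msum d (\<lambda>i. complex_of_real (p i) \<cdot>\<^sub>m \<sigma> i) {..<m}"
  have c: "\<sigma> i \<in> carrier_mat d d" if "i < m" for i using \<sigma>[OF that] by (simp add: is_state_def)
  have e: "?A $$ (k,l) = (\<Sum>i<m. complex_of_real (p i) * \<sigma> i $$ (k,l))" if "k < d" "l < d" for k l
  proof -
    have "(complex_of_real (p i) \<cdot>\<^sub>m \<sigma> i) $$ (k,l) = complex_of_real (p i) * \<sigma> i $$ (k,l)" if "i < m" for i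
      using c[OF that] \<open>k < d\<close> \<open>l < d\<close> by (intro index_smult_mat) auto
    then show ?thesis using that by (simp add: msum_def)
  qed
  have A: "?A \<in> carrier_mat d d" by (simp add: msum_def)
  have "?A = adj ?A"
  proof (rule eq_matI)
    fix k l assume "k < dim_row (adj ?A)" "l < dim_col (adj ?A)"
    then have kl: "k < d" "l < d" by (auto simp: adj_def msum_def)
    have "\<sigma> i $$ (k,l) = cnj (\<sigma> i $$ (l,k))" if "i < m" for i
    proof -
      have "\<sigma> i = adj (\<sigma> i)" using \<sigma>[OF that] by (simp add: is_state_def hermitian_def)
      then have "\<sigma> i $$ (k,l) = adj (\<sigma> i) $$ (k,l)" by simp
      then show ?thesis using kl c[OF that] by (auto simp: adj_def)
    qed
    then have "?A $$ (k,l) = cnj (?A $$ (l,k))" unfolding e[OF kl] e[OF kl(2,1)] cnj_sum by (intro sum.cong) auto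
    then show "?A $$ (k,l) = adj ?A $$ (k,l)" using kl A by (auto simp: adj_def)
  qed (auto simp: adj_def msum_def)
  moreover have "0 \<le> Re ((?A *\<^sub>v v) \<bullet>c v)" if v: "v \<in> carrier_vec d" for v
  proof -
    have q: "(B *\<^sub>v v) \<bullet>c v = (\<Sum>k<d. \<Sum>l<d. B $$ (k,l) * v $ l * cnj (v $ k))" if "B \<in> carrier_mat d d" for B
      using cscalar_sum[OF mult_mat_vec_carrier[OF that v] v] mat_vec_sum[OF that v] by (simp add: sum_distrib_right)
    have "(?A *\<^sub>v v) \<bullet>c v = (\<Sum>k<d. \<Sum>l<d. \<Sum>i<m. complex_of_real (p i) * (\<sigma> i $$ (k,l) * v $ l * cnj (v $ k)))"
      unfolding q[OF A] by (intro sum.cong refl) (simp add: e sum_distrib_right mult.assoc)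
    also have "\<dots> = (\<Sum>k<d. \<Sum>i<m. \<Sum>l<d. complex_of_real (p i) * (\<sigma> i $$ (k,l) * v $ l * cnj (v $ k)))"
      by (intro sum.cong refl sum.swap)
    also have "\<dots> = (\<Sum>i<m. \<Sum>k<d. \<Sum>l<d. complex_of_real (p i) * (\<sigma> i $$ (k,l) * v $ l * cnj (v $ k)))"
      by (rule sum.swap)
    also have "\<dots> = (\<Sum>i<m. complex_of_real (p i) * ((\<sigma> i *\<^sub>v v) \<bullet>c v))"
      by (intro sum.cong refl) (simp add: q c sum_distrib_left)
    finally have "Re ((?A *\<^sub>v v) \<bullet>c v) = (\<Sum>i<m. p i * Re ((\<sigma> i *\<^sub>v v) \<bullet>c v))" by simp
    also have "\<dots> \<ge> 0" using p \<sigma> v by (intro sum_nonneg mult_nonneg_nonneg) (auto simp: is_prob_def is_state_def)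
    finally show ?thesis .
  qed
  moreover have "trace ?A = 1"
  proof -
    have "trace ?A = (\<Sum>k<d. \<Sum>i<m. complex_of_real (p i) * \<sigma> i $$ (k,k))" unfolding trace_def carrier_matD(1)[OF A] by (intro sum.cong refl) (simp add: e)
    also have "\<dots> = (\<Sum>i<m. complex_of_real (p i) * trace (\<sigma> i))"
      by (subst sum.swap) (use c in \<open>auto simp: trace_def sum_distrib_left intro!: sum.cong\<close>)
    also have "\<dots> = complex_of_real (\<Sum>i<m. p i)" using \<sigma> by (simp add: is_state_def)
    finally show ?thesis using p by (simp add: is_prob_def del: of_real_sum)
  qed
  ultimately show ?thesis using A by (simp add: is_state_def hermitian_def)
qed

lemma state_eigenbasis:
  assumes "is_state d \<rho>"
  shows "\<exists>f x. orthonormal d d f \<and> (\<forall>i<d. \<rho> *\<^sub>v f i = complex_of_real (x i) \<cdot>\<^sub>v f i) \<and>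
    (\<forall>i<d. 0 \<le> x i) \<and> (\<Sum>i<d. x i) = 1 \<and> vN_entropy \<rho> = (\<Sum>i<d. eta (x i)) \<and>
    (\<forall>k<d. \<forall>l<d. \<rho> $$ (k,l) = (\<Sum>i<d. complex_of_real (x i) * (f i $ k * cnj (f i $ l))))"
proof -
  have c: "\<rho> \<in> carrier_mat d d" and h: "adj \<rho> = \<rho>" and pos: "\<And>v. v \<in> carrier_vec d \<Longrightarrow> 0 \<le> Re ((\<rho> *\<^sub>v v) \<bullet>c v)"
    and tr: "trace \<rho> = 1"
    using assms by (auto simp: is_state_def hermitian_def)
  obtain f x where f: "orthonormal d d f" and x: "\<And>i. i < d \<Longrightarrow> \<rho> *\<^sub>v f i = complex_of_real (x i) \<cdot>\<^sub>v f i"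
    by (rule hermitian_eigenbasis[OF c h]) blast
  have fc: "f i \<in> carrier_vec d" "f i \<bullet>c f i = 1" if "i < d" for i using f that by (auto simp: orthonormal_def)
  have x0: "0 \<le> x i" if "i < d" for i
  proof -
    have "(\<rho> *\<^sub>v f i) \<bullet>c f i = complex_of_real (x i)"
      unfolding x[OF that] using fc[OF that] by simp
    then show ?thesis using pos[OF fc(1)[OF that]] by simp
  qed
  note U = cols_mat_unitary[OF f]
  let ?V = "cols_mat d f"
  have dec: "\<rho> $$ (k,l) = (\<Sum>i<d. complex_of_real (x i) * (f i $ k * cnj (f i $ l)))" if kl: "k < d" "l < d" for k l
  proof -
    have rv: "(\<rho> * ?V) $$ (k,i) = complex_of_real (x i) * f i $ k" if "i < d" for i
    proof -
      have "(\<rho> * ?V) $$ (k,i) = (\<rho> *\<^sub>v f i) $ k"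
        using that kl c U(1) fc(1)[OF that] unfolding mat_vec_sum[OF c fc(1)[OF that] kl(1)]
        by (simp add: scalar_prod_def cols_mat_def atLeast0LessThan)
      then show ?thesis unfolding x[OF that] using fc(1)[OF that] kl by simp
    qed
    have "\<rho> = \<rho> * ?V * adj ?V" using c U by (simp add: assoc_mult_mat[of _ d d _ d _ d])
    then have "\<rho> $$ (k,l) = (\<rho> * ?V * adj ?V) $$ (k,l)" by simp
    also have "\<dots> = (\<Sum>i<d. (\<rho> * ?V) $$ (k,i) * adj ?V $$ (i,l))"
      by (rule mat_mult_sum[OF mult_carrier_mat[OF c U(1)] adj_carrier[OF U(1)] kl])
    also have "\<dots> = (\<Sum>i<d. complex_of_real (x i) * (f i $ k * cnj (f i $ l)))"
      using kl U(1) by (intro sum.cong refl) (simp add: rv mult.assoc del: index_mult_mat(1), simp add: adj_def cols_mat_def)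
    finally show ?thesis .
  qed
  have "complex_of_real (\<Sum>i<d. x i) = (\<Sum>i<d. complex_of_real (x i) * (f i \<bullet>c f i))" using fc(2) by simp
  also have "\<dots> = (\<Sum>i<d. \<Sum>k<d. complex_of_real (x i) * (f i $ k * cnj (f i $ k)))"
    using fc(1) by (intro sum.cong refl) (simp add: cscalar_sum[of _ d] sum_distrib_left)
  also have "\<dots> = trace \<rho>" by (subst sum.swap) (use c in \<open>auto simp: trace_def dec intro!: sum.cong\<close>)
  finally have "complex_of_real (\<Sum>i<d. x i) = complex_of_real 1" using tr by simp
  then have "(\<Sum>i<d. x i) = 1" by (simp only: of_real_eq_iff)
  with f x x0 entropy_eigenbasis[OF c f x] dec show ?thesis by (intro exI[of _ f] exI[of _ x]) simp
qed

lemma state_entropy_le: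
  assumes "is_state (2^n) \<rho>" shows "vN_entropy \<rho> \<le> real n"
proof -
  obtain f x where "\<And>i. i < 2^n \<Longrightarrow> 0 \<le> x i" "(\<Sum>i<(2::nat)^n. x i) = 1" and e: "vN_entropy \<rho> = (\<Sum>i<(2::nat)^n. eta (x i))"
    using state_eigenbasis[OF assms] by blast
  then have "(\<Sum>i<(2::nat)^n. eta (x i)) \<le> log 2 (card {..<(2::nat)^n})"
    by (intro eta_sum_le_log) (auto simp: lessThan_empty_iff)
  also have "\<dots> = real n" by (simp add: log_nat_power)
  finally show ?thesis unfolding e .
qed

text \<open>Everything is compared through the diagonal entries z of the components in an eigenbasis
  of the mixture. Jensen is applied twice: passing to these diagonals does not decrease the entropy
  of a component, and averaging them over the ensemble gives the eigenvalues of the mixture.\<close>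

lemma entropy_concave:
  assumes p: "is_prob m p" and \<sigma>: "\<And>i. i < m \<Longrightarrow> is_state d (\<sigma> i)"
  shows "(\<Sum>i<m. p i * vN_entropy (\<sigma> i)) \<le> vN_entropy (msum d (\<lambda>i. complex_of_real (p i) \<cdot>\<^sub>m \<sigma> i) {..<m})"
proof -
  let ?A = "msum d (\<lambda>i. complex_of_real (p i) \<cdot>\<^sub>m \<sigma> i) {..<m}"
  have A: "is_state d ?A" by (rule is_state_msum[OF p \<sigma>])
  obtain g y where g: "orthonormal d d g" and y: "\<And>i. i < d \<Longrightarrow> ?A *\<^sub>v g i = complex_of_real (y i) \<cdot>\<^sub>v g i"
    and ent: "vN_entropy ?A = (\<Sum>i<d. eta (y i))"
    using state_eigenbasis[OF A] by blast
  have gc: "g a \<in> carrier_vec d" "g a \<bullet>c g a = 1" if "a < d" for a using g that by (auto simp: orthonormal_def)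
  define z where "z i a = Re ((\<sigma> i *\<^sub>v g a) \<bullet>c g a)" for i a
  have q: "(B *\<^sub>v g a) \<bullet>c g a = (\<Sum>k<d. \<Sum>l<d. B $$ (k,l) * g a $ l * cnj (g a $ k))" if "B \<in> carrier_mat d d" "a < d" for B a
    using cscalar_sum[OF mult_mat_vec_carrier[OF that(1) gc(1)[OF that(2)]] gc(1)[OF that(2)]]
      mat_vec_sum[OF that(1) gc(1)[OF that(2)]] by (simp add: sum_distrib_right)
  have yz: "y a = (\<Sum>i<m. p i * z i a)" if a: "a < d" for a
  proof -
    have cA: "?A \<in> carrier_mat d d" by (simp add: msum_def)
    have c: "\<sigma> i \<in> carrier_mat d d" if "i < m" for i using \<sigma>[OF that] by (simp add: is_state_def)
    have e: "?A $$ (k,l) = (\<Sum>i<m. complex_of_real (p i) * \<sigma> i $$ (k,l))" if "k < d" "l < d" for k l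
    proof -
      have "(complex_of_real (p i) \<cdot>\<^sub>m \<sigma> i) $$ (k,l) = complex_of_real (p i) * \<sigma> i $$ (k,l)" if "i < m" for i
        using c[OF that] \<open>k < d\<close> \<open>l < d\<close> by (intro index_smult_mat) auto
      then show ?thesis using that by (simp add: msum_def)
    qed
    have "(?A *\<^sub>v g a) \<bullet>c g a = (\<Sum>k<d. \<Sum>l<d. \<Sum>i<m. complex_of_real (p i) * (\<sigma> i $$ (k,l) * g a $ l * cnj (g a $ k)))"
      unfolding q[OF cA a] by (intro sum.cong refl) (simp add: e sum_distrib_right mult.assoc)
    also have "\<dots> = (\<Sum>k<d. \<Sum>i<m. \<Sum>l<d. complex_of_real (p i) * (\<sigma> i $$ (k,l) * g a $ l * cnj (g a $ k)))"
      by (intro sum.cong refl sum.swap)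
    also have "\<dots> = (\<Sum>i<m. \<Sum>k<d. \<Sum>l<d. complex_of_real (p i) * (\<sigma> i $$ (k,l) * g a $ l * cnj (g a $ k)))"
      by (rule sum.swap)
    also have "\<dots> = (\<Sum>i<m. complex_of_real (p i) * ((\<sigma> i *\<^sub>v g a) \<bullet>c g a))"
      using a by (intro sum.cong refl) (simp add: q c sum_distrib_left)
    finally have "Re ((?A *\<^sub>v g a) \<bullet>c g a) = (\<Sum>i<m. p i * z i a)" by (simp add: z_def)
    moreover have "(?A *\<^sub>v g a) \<bullet>c g a = complex_of_real (y a)" unfolding y[OF a] using gc[OF a] by simp
    ultimately show ?thesis by simp
  qed
  have z0: "0 \<le> z i a" if "i < m" "a < d" for i a
    using \<sigma>[OF that(1)] gc(1)[OF that(2)] by (simp add: z_def is_state_def)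
  have comp: "vN_entropy (\<sigma> i) \<le> (\<Sum>a<d. eta (z i a))" if i: "i < m" for i
  proof -
    obtain f x where f: "orthonormal d d f" and x0: "\<And>k. k < d \<Longrightarrow> 0 \<le> x k"
      and ei: "vN_entropy (\<sigma> i) = (\<Sum>k<d. eta (x k))"
      and dec: "\<And>k l. k < d \<Longrightarrow> l < d \<Longrightarrow> \<sigma> i $$ (k,l) = (\<Sum>r<d. complex_of_real (x r) * (f r $ k * cnj (f r $ l)))"
      using state_eigenbasis[OF \<sigma>[OF i]] by blast
    \<comment> \<open>Squared overlaps of two orthonormal bases form a doubly stochastic matrix; row
      sums one serve Jensen, column sums one recover the entropy of the component.\<close>
    define w where "w a r = (cmod (f r \<bullet>c g a))^2" for a r
    have fc: "f r \<in> carrier_vec d" if "r < d" for r using f that by (auto simp: orthonormal_def)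
    let ?F = "cols_mat d f" and ?G = "cols_mat d g"
    note UF = cols_mat_unitary[OF f] and UG = cols_mat_unitary[OF g]
    define W where "W = adj ?G * ?F"
    have W: "W \<in> carrier_mat d d" using UF(1) UG(1) by (simp add: W_def mult_carrier_mat[of _ d d _ d])
    have aW: "adj W = adj ?F * ?G" using UF(1) UG(1) by (simp add: W_def adj_mult[of _ d d _ d])
    have WW: "W * adj W = 1\<^sub>m d" "adj W * W = 1\<^sub>m d"
    proof -
      have "W * adj W = adj ?G * (?F * adj ?F) * ?G" unfolding aW unfolding W_def using UF(1) UG(1)
        by (simp add: assoc_mult_mat[of _ d d _ d _ d] mult_carrier_mat[of _ d d _ d])
      then show 1: "W * adj W = 1\<^sub>m d" using right_mult_one_mat[OF adj_carrier[OF UG(1)]] UG(2) unfolding UF(3) by simp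
      show "adj W * W = 1\<^sub>m d" by (rule mat_mult_left_right_inverse[OF W adj_carrier[OF W] 1])
    qed
    have We: "W $$ (a,r) = f r \<bullet>c g a" if "a < d" "r < d" for a r
      using that UF(1) UG(1) cscalar_sum[OF fc[OF that(2)] gc(1)[OF that(1)]]
      by (simp add: W_def scalar_prod_def atLeast0LessThan adj_def cols_mat_def mult.commute)
    have w1: "(\<Sum>r<d. w a r) = 1" if a: "a < d" for a
    proof -
      have "(W * adj W) $$ (a,a) = (\<Sum>r<d. W $$ (a,r) * cnj (W $$ (a,r)))"
        using W a by (auto simp: scalar_prod_def atLeast0LessThan adj_def intro!: sum.cong)
      then have "1 = (\<Sum>r<d. complex_of_real (w a r))"
        using a unfolding WW by (simp add: We w_def complex_norm_square[symmetric] del: of_real_power)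
      then have "complex_of_real 1 = complex_of_real (\<Sum>r<d. w a r)" by simp
      then show ?thesis by (simp only: of_real_eq_iff)
    qed
    have w2: "(\<Sum>a<d. w a r) = 1" if r: "r < d" for r
    proof -
      have "(adj W * W) $$ (r,r) = (\<Sum>a<d. W $$ (a,r) * cnj (W $$ (a,r)))"
        using W r by (auto simp: scalar_prod_def atLeast0LessThan adj_def mult.commute intro!: sum.cong)
      then have "1 = (\<Sum>a<d. complex_of_real (w a r))"
        using r unfolding WW by (simp add: We w_def complex_norm_square[symmetric] del: of_real_power)
      then have "complex_of_real 1 = complex_of_real (\<Sum>a<d. w a r)" by simp
      then show ?thesis by (simp only: of_real_eq_iff)
    qed
    have zw: "z i a = (\<Sum>r<d. w a r * x r)" if a: "a < d" for a
    proof -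
      have ci: "\<sigma> i \<in> carrier_mat d d" using \<sigma>[OF i] by (simp add: is_state_def)
      have "(\<sigma> i *\<^sub>v g a) \<bullet>c g a = (\<Sum>k<d. \<Sum>l<d. \<Sum>r<d. complex_of_real (x r) * ((f r $ k * cnj (g a $ k)) * cnj (f r $ l * cnj (g a $ l))))"
        unfolding q[OF ci a] by (intro sum.cong refl) (simp add: dec sum_distrib_right sum_distrib_left mult_ac)
      also have "\<dots> = (\<Sum>k<d. \<Sum>r<d. \<Sum>l<d. complex_of_real (x r) * ((f r $ k * cnj (g a $ k)) * cnj (f r $ l * cnj (g a $ l))))"
        by (intro sum.cong refl sum.swap)
      also have "\<dots> = (\<Sum>r<d. \<Sum>k<d. \<Sum>l<d. complex_of_real (x r) * ((f r $ k * cnj (g a $ k)) * cnj (f r $ l * cnj (g a $ l))))"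
        by (rule sum.swap)
      also have "\<dots> = (\<Sum>r<d. complex_of_real (x r) * ((f r \<bullet>c g a) * cnj (f r \<bullet>c g a)))"
      proof (intro sum.cong refl)
        fix r assume "r \<in> {..<d}"
        then have r: "r < d" by simp
        show "(\<Sum>k<d. \<Sum>l<d. complex_of_real (x r) * ((f r $ k * cnj (g a $ k)) * cnj (f r $ l * cnj (g a $ l)))) = complex_of_real (x r) * ((f r \<bullet>c g a) * cnj (f r \<bullet>c g a))"
          unfolding cscalar_sum[OF fc[OF r] gc(1)[OF a]] cnj_sum sum_product by (simp only: sum_distrib_left)
      qed
      also have "\<dots> = complex_of_real (\<Sum>r<d. w a r * x r)"
        by (simp add: w_def complex_norm_square[symmetric] mult.commute del: of_real_power)
      finally show ?thesis by (simp add: z_def)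
    qed
    have "(\<Sum>k<d. eta (x k)) = (\<Sum>r<d. (\<Sum>a<d. w a r) * eta (x r))" using w2 by simp
    also have "\<dots> = (\<Sum>a<d. \<Sum>r<d. w a r * eta (x r))" unfolding sum_distrib_right by (rule sum.swap)
    also have "\<dots> \<le> (\<Sum>a<d. eta (z i a))"
    proof (rule sum_mono)
      fix a assume "a \<in> {..<d}"
      then have a: "a < d" by simp
      show "(\<Sum>r<d. w a r * eta (x r)) \<le> eta (z i a)"
        unfolding zw[OF a] by (rule eta_jensen) (use w1[OF a] x0 in \<open>auto simp: w_def\<close>)
    qed
    finally show ?thesis unfolding ei .
  qed
  have "(\<Sum>i<m. p i * vN_entropy (\<sigma> i)) \<le> (\<Sum>i<m. p i * (\<Sum>a<d. eta (z i a)))"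
    using p comp by (intro sum_mono mult_left_mono) (auto simp: is_prob_def)
  also have "\<dots> = (\<Sum>a<d. \<Sum>i<m. p i * eta (z i a))" unfolding sum_distrib_left by (rule sum.swap)
  also have "\<dots> \<le> (\<Sum>a<d. eta (y a))"
  proof (rule sum_mono)
    fix a assume "a \<in> {..<d}"
    then have a: "a < d" by simp
    show "(\<Sum>i<m. p i * eta (z i a)) \<le> eta (y a)"
      unfolding yz[OF a] by (rule eta_jensen) (use p z0 a in \<open>auto simp: is_prob_def\<close>)
  qed
  finally show ?thesis unfolding ent .
qed

lemma channel_state:
  fixes \<Phi> :: "complex mat \<Rightarrow> complex mat"
  assumes b: "\<forall>p\<in>{1..2*n}. 0 \<le> b p \<and> b p \<le> 1"
    and \<Phi>: "\<And>A. A \<in> carrier_mat (2^n) (2^n) \<Longrightarrow> \<Phi> A \<in> carrier_mat (2^n) (2^n) \<and> emb (2^n) (\<Phi> A) = flip_mixes (gop n) b [1..<2*n+1] (emb (2^n) A)"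
    and \<sigma>: "is_state (2^n) \<sigma>"
  shows "is_state (2^n) (\<Phi> \<sigma>)"
proof -
  have c: "\<sigma> \<in> carrier_mat (2^n) (2^n)" using \<sigma> by (simp add: is_state_def)
  have "state_op (2^n) (emb (2^n) (\<Phi> \<sigma>))"
    unfolding \<Phi>[OF c, THEN conjunct2]
    by (rule state_op_flip_mixes) (use \<sigma> b in \<open>auto simp: state_op_def simp del: upt_Suc\<close>)
  then obtain \<rho> where \<rho>: "is_state (2^n) \<rho>" "emb (2^n) (\<Phi> \<sigma>) = emb (2^n) \<rho>" by (auto simp: state_op_def)
  have "\<Phi> \<sigma> = \<rho>" by (rule emb_inj[OF _ _ \<rho>(2)]) (use \<Phi>[OF c] \<rho>(1) in \<open>auto simp: is_state_def\<close>)
  then show ?thesis using \<rho>(1) by simp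
qed

subsection \<open>An optimal Gaussian ensemble\<close>

lemma mat_exp_1: "mat_exp (mat 1 1 (\<lambda>_. \<mu>)) $$ (0,0) = exp \<mu>"
proof -
  let ?L = "mat 1 1 (\<lambda>_. \<mu>) :: complex mat"
  have L: "?L \<in> carrier_mat 1 1" by simp
  have p: "(?L ^\<^sub>m k) $$ (0,0) = \<mu> ^ k" for k
  proof (induction k)
    case (Suc k)
    have "(?L ^\<^sub>m Suc k) $$ (0,0) = (\<Sum>m<1. (?L ^\<^sub>m k) $$ (0,m) * ?L $$ (m,0))"
      unfolding pow_mat.simps by (rule mat_mult_sum[OF pow_carrier_mat[OF L] L]) simp_all
    then show ?case using Suc by simp
  qed simp
  have "(\<lambda>k. \<mu> ^ k /\<^sub>R fact k) = (\<lambda>k. \<mu> ^ k / of_nat (fact k))"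
    by (simp add: fun_eq_iff scaleR_conv_of_real divide_inverse mult.commute)
  then have "(\<lambda>k. \<mu> ^ k / of_nat (fact k)) sums exp \<mu>" using exp_converges[of \<mu>] by simp
  moreover have "(\<lambda>k. (?L ^\<^sub>m k) $$ (0,0) / of_nat (fact k)) sums mat_exp ?L $$ (0,0)"
    by (rule mat_exp_sums[OF L]) simp_all
  ultimately show ?thesis unfolding p by (rule sums_unique2[symmetric])
qed

text \<open>The case of a one-dimensional invariant span: Y is an eigenvector of the commutator with
  A.\<close>

lemma mat_exp_eigen:
  assumes A: "A \<in> carrier_mat d d" and d: "d > 0" and Y: "Y \<in> carrier_mat d d"
    and rel: "emb d A * emb d Y - emb d Y * emb d A = \<mu> \<odot> emb d Y"
  shows "emb d (mat_exp A) * emb d Y = exp \<mu> \<odot> (emb d Y * emb d (mat_exp A))"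
proof -
  have "emb d (mat_exp A) * emb d Y = (\<Sum>q<1. mat_exp (mat 1 1 (\<lambda>_. \<mu>)) $$ (q,0) \<odot> emb d Y) * emb d (mat_exp A)"
    by (rule mat_exp_rotate[OF A d, of 1 "\<lambda>_. Y"]) (use Y rel in auto)
  then show ?thesis using mat_exp_1[of \<mu>] by simp
qed

context clifford begin

lemma matching_commutator:
  assumes t: "\<And>y. y < N \<Longrightarrow> t y < N \<and> t (t y) = y" and r: "r < N"
  shows "(\<Sum>q<N. (2 * ((if q < r \<and> t q = r then c else 0) - (if r < q \<and> t r = q then c else 0))) \<odot> g q)
    = (2 * c * (if t r < r then 1 else if r < t r then - 1 else 0)) \<odot> g (t r)"
proof -
  have "(\<Sum>q<N. (2 * ((if q < r \<and> t q = r then c else 0) - (if r < q \<and> t r = q then c else 0))) \<odot> g q)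
    = (\<Sum>q<N. if q = t r then (2 * c * (if t r < r then 1 else if r < t r then - 1 else 0)) \<odot> g (t r) else 0)"
  proof (intro sum.cong refl)
    fix q assume "q \<in> {..<N}"
    then have "t q = r \<longleftrightarrow> q = t r" using t[of q] t[OF r] by auto
    then show "(2 * ((if q < r \<and> t q = r then c else 0) - (if r < q \<and> t r = q then c else 0))) \<odot> g q
      = (if q = t r then (2 * c * (if t r < r then 1 else if r < t r then - 1 else 0)) \<odot> g (t r) else 0)"
      by (cases "q = t r") auto
  qed
  then show ?thesis using t[OF r] by simp
qed

end

lemma hermitian_msum:
  assumes "\<And>k. k \<in> I \<Longrightarrow> f k \<in> carrier_mat d d \<and> adj (f k) = f k"
  shows "hermitian (msum d f I)"
  unfolding hermitian_def
proof (rule eq_matI)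
  fix i j assume "i < dim_row (adj (msum d f I))" "j < dim_col (adj (msum d f I))"
  then have ij: "i < d" "j < d" by (auto simp: adj_def msum_def)
  have "f k $$ (i,j) = cnj (f k $$ (j,i))" if "k \<in> I" for k
  proof -
    have c: "f k \<in> carrier_mat d d" and e: "adj (f k) = f k" using assms[OF that] by auto
    have "adj (f k) $$ (i,j) = cnj (f k $$ (j,i))" using carrier_matD[OF c] ij by (simp add: adj_def)
    then show ?thesis by (simp only: e)
  qed
  then show "msum d f I $$ (i,j) = adj (msum d f I) $$ (i,j)" using ij by (simp add: adj_def msum_def)
qed (auto simp: adj_def msum_def)

text \<open>Recombines two eigenoperators: adding the relations for z and -z cancels the terms with
  y and p.\<close>

lemma lop_half_sum:
  assumes 1: "x + z \<odot> y = (- (z * e)) \<odot> p + e \<odot> q" and 2: "x + (- z) \<odot> y = (z * e) \<odot> p + e \<odot> q"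
  shows "x = e \<odot> q"
proof -
  have "x + x = e \<odot> q + e \<odot> q" using arg_cong2[OF 1 2, of "(+)"] by simp
  then have "2 \<odot> x = 2 \<odot> (e \<odot> q)" using lop.scale_left_distrib[of 1 1 x] lop.scale_left_distrib[of 1 1 "e \<odot> q"] by simp
  then show ?thesis by (rule lop.scale_left_imp_eq[rotated]) simp
qed

text \<open>One quarter turn in the plane of each pair exchanged by t. The planes are disjoint, so a
  single exponent serves them all, and fixed points of t commute with it.\<close>

lemma matching_rotation:
  assumes t: "\<And>y. y < 2*n+1 \<Longrightarrow> t y < 2*n+1 \<and> t (t y) = y"
  shows "\<exists>h a s. hermitian (msum (2^n) (\<lambda>(p,q). h p q \<cdot>\<^sub>m (majorana n p * majorana n q)) ({1..2*n} \<times> {1..2*n}))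
    \<and> hermitian (msum (2^n) (\<lambda>p. a p \<cdot>\<^sub>m majorana n p) {1..2*n})
    \<and> (\<forall>r. \<bar>s r\<bar> = (1::real)) \<and>
    (\<forall>r<2*n+1. emb (2^n) (mat_exp (gen_mat n h a)) * gop n r = of_real (s r) \<odot> (gop n (t r) * emb (2^n) (mat_exp (gen_mat n h a))))"
proof -
  let ?N = "2*n+1" and ?d = "2^n :: nat"
  \<comment> \<open>The commutator doubles the coefficient, so pi/4 produces a rotation by pi/2,
    which exchanges the two generators of a pair up to sign.\<close>
  define c0 where "c0 = complex_of_real (pi / 4)"
  \<comment> \<open>The factor -\<i> makes the quadratic term hermitian and cancels the \<i> of the
    exponent, leaving c0; the condition p < q counts each pair once.\<close>
  define h where "h p q = (if p < q \<and> t p = q then - (\<i> * c0) else 0)" for p q :: nat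
  define a where "a q = (if t 0 = q then c0 else 0)" for q
  define \<epsilon> where "\<epsilon> r = (if t r < r then 1 else if r < t r then - 1 else (0::complex))" for r
  have gc: "gen_coeff h a p q = (if p < q \<and> t p = q then c0 else 0)" for p q
    by (auto simp: gen_coeff_def h_def a_def mult.assoc[symmetric])
  have H2: "hermitian (msum ?d (\<lambda>(p,q). h p q \<cdot>\<^sub>m (majorana n p * majorana n q)) ({1..2*n} \<times> {1..2*n}))"
  proof (rule hermitian_msum)
    fix k assume k: "k \<in> {1..2*n} \<times> {1..2*n}"
    obtain p q where kk: "k = (p,q)" by (cases k)
    have p: "p \<in> {1..2*n}" and q: "q \<in> {1..2*n}" using k kk by auto
    note m = mult_carrier_mat[of _ ?d ?d _ ?d] and cp = majorana_carrier[OF p] and cq = majorana_carrier[OF q]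
    have "adj (h p q \<cdot>\<^sub>m (majorana n p * majorana n q)) = h p q \<cdot>\<^sub>m (majorana n p * majorana n q)"
    proof (cases "p < q \<and> t p = q")
      case True
      have "adj (h p q \<cdot>\<^sub>m (majorana n p * majorana n q)) = (\<i> * c0) \<cdot>\<^sub>m (majorana n q * majorana n p)"
        using True cp cq by (simp add: adj_smult adj_mult[of _ ?d ?d _ ?d] majorana_adj[OF p] majorana_adj[OF q] h_def c0_def)
      also have "majorana n q * majorana n p = - (majorana n p * majorana n q)" using True by (intro majorana_anti p q) auto
      also have "(\<i> * c0) \<cdot>\<^sub>m - (majorana n p * majorana n q) = (- (\<i> * c0)) \<cdot>\<^sub>m (majorana n p * majorana n q)"
        by (rule eq_matI) (use cp cq in auto)
      finally show ?thesis using True by (simp add: h_def)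
    next
      case False
      then have "h p q = 0" by (auto simp: h_def)
      then show ?thesis using cp cq by (intro eq_matI) (auto simp: adj_def)
    qed
    then show "(case k of (p,q) \<Rightarrow> h p q \<cdot>\<^sub>m (majorana n p * majorana n q)) \<in> carrier_mat ?d ?d \<and>
      adj (case k of (p,q) \<Rightarrow> h p q \<cdot>\<^sub>m (majorana n p * majorana n q)) = (case k of (p,q) \<Rightarrow> h p q \<cdot>\<^sub>m (majorana n p * majorana n q))"
      using m[OF cp cq] by (simp add: kk)
  qed
  have H1: "hermitian (msum ?d (\<lambda>p. a p \<cdot>\<^sub>m majorana n p) {1..2*n})"
  proof (rule hermitian_msum)
    fix p assume p: "p \<in> {1..2*n}"
    have "cnj (a p) = a p" by (simp add: a_def c0_def)
    then show "a p \<cdot>\<^sub>m majorana n p \<in> carrier_mat ?d ?d \<and> adj (a p \<cdot>\<^sub>m majorana n p) = a p \<cdot>\<^sub>m majorana n p"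
      using majorana_carrier[OF p] majorana_adj[OF p] by (simp add: adj_smult)
  qed
  let ?A = "gen_mat n h a"
  note A = gen_mat_carrier[of n h a]
  let ?u = "emb ?d (mat_exp ?A)"
  have com: "emb ?d ?A * gop n r - gop n r * emb ?d ?A = (2 * c0 * \<epsilon> r) \<odot> gop n (t r)" if r: "r < ?N" for r
    unfolding gen_mat_op cliff.quad_sum_commutator[OF r] gc \<epsilon>_def by (rule cliff.matching_commutator[OF t r])
  define s where "s r = (if r < t r then - 1 else 1 :: real)" for r
  have rot: "?u * gop n r = of_real (s r) \<odot> (gop n (t r) * ?u)" if r: "r < ?N" for r
  proof (cases "t r = r")
    case True
    have "?u * gop n r = exp 0 \<odot> (gop n r * ?u)"
      unfolding gop_def by (rule mat_exp_eigen[OF A]) (use gmat_carrier[OF r] com[OF r] True in \<open>auto simp: gop_def \<epsilon>_def\<close>)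
    then show ?thesis using True by (simp add: s_def)
  next
    case False
    have tr: "t r < ?N" "t (t r) = r" using t[OF r] by auto
    have e1: "\<epsilon> r = of_real (s r)" "\<epsilon> (t r) = - of_real (s r)" using False tr(2) by (auto simp: \<epsilon>_def s_def)
    \<comment> \<open>\<open>gop n r + z \<odot> gop n (t r)\<close> with z = \<i> or z = -\<i> is
      an eigenvector of the commutator. Its eigenvalue is \<i> pi/2 up to sign and exponentiates to
      \<i> or -\<i>.\<close>
    have eig: "?u * gop n r + z \<odot> (?u * gop n (t r)) = (- (z * of_real (s r))) \<odot> (gop n r * ?u) + of_real (s r) \<odot> (gop n (t r) * ?u)"
      if z: "z = \<i> \<or> z = - \<i>" for z
    proof -
      define Y where "Y = gmat n r + z \<cdot>\<^sub>m gmat n (t r)"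
      have Y: "Y \<in> carrier_mat ?d ?d" using gmat_carrier[OF r] gmat_carrier[OF tr(1)] by (simp add: Y_def)
      have eY: "emb ?d Y = gop n r + z \<odot> gop n (t r)"
        using gmat_carrier[OF r] gmat_carrier[OF tr(1)] by (simp add: Y_def gop_def emb_add emb_smult)
      have zz: "z * z = - 1" using z by auto
      define \<mu> where "\<mu> = - (z * (2 * c0 * of_real (s r)))"
      have mz: "\<mu> * z = 2 * c0 * of_real (s r)"
      proof -
        have "\<mu> * z = - (z * z) * (2 * c0 * of_real (s r))" by (simp add: \<mu>_def mult_ac)
        then show ?thesis by (simp add: zz)
      qed
      have "emb ?d ?A * emb ?d Y - emb ?d Y * emb ?d ?A
        = (emb ?d ?A * gop n r - gop n r * emb ?d ?A) + z \<odot> (emb ?d ?A * gop n (t r) - gop n (t r) * emb ?d ?A)"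
        unfolding eY by (simp add: distrib_left distrib_right lop.scale_right_diff_distrib)
      also have "\<dots> = (\<mu> * z) \<odot> gop n (t r) + \<mu> \<odot> gop n r"
        unfolding com[OF r] com[OF tr(1)] tr(2) e1 mz by (simp add: \<mu>_def)
      also have "\<dots> = \<mu> \<odot> emb ?d Y" unfolding eY by (simp add: lop.scale_right_distrib add.commute)
      finally have "?u * emb ?d Y = exp \<mu> \<odot> (emb ?d Y * ?u)" by (intro mat_exp_eigen[OF A _ Y]) simp_all
      moreover have "exp \<mu> = - (z * of_real (s r))"
      proof -
        have i: "exp (\<i> * (of_real pi / 2)) = \<i>" "exp (- (\<i> * (of_real pi / 2))) = - \<i>"
          by (simp_all add: complex_eq_iff Re_exp Im_exp)
        have "\<mu> = (\<i> * (of_real pi / 2)) \<or> \<mu> = - (\<i> * (of_real pi / 2))" "\<mu> = - (z * (of_real pi / 2) * of_real (s r))"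
          using z by (auto simp: \<mu>_def c0_def s_def)
        then show ?thesis using z i by (auto simp: s_def split: if_splits)
      qed
      ultimately have "?u * (gop n r + z \<odot> gop n (t r)) = (- (z * of_real (s r))) \<odot> ((gop n r + z \<odot> gop n (t r)) * ?u)"
        unfolding eY by simp
      also have "\<dots> = (- (z * of_real (s r))) \<odot> (gop n r * ?u) + (- (z * z) * of_real (s r)) \<odot> (gop n (t r) * ?u)"
        by (simp add: distrib_right lop.scale_right_distrib mult_ac)
      finally show ?thesis unfolding zz by (simp add: distrib_left)
    qed
    show ?thesis by (rule lop_half_sum[OF eig[of "\<i>"] eig[of "- \<i>", simplified minus_mult_left[symmetric] minus_minus]]) simp_all
  qed
  have "\<bar>s r\<bar> = 1" for r by (simp add: s_def)
  then show ?thesis using H1 H2 rot by (intro exI[of _ h] exI[of _ a] exI[of _ s]) blast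
qed

section \<open>Pairing the generators in a prescribed order\<close>

text \<open>The number of generators is odd, so an auxiliary vertex 2n+1 is added as partner of the
  parity 0, which the base state leaves uncoupled. The other pairs are 2j-1 and 2j.\<close>

definition base_match :: "nat \<Rightarrow> nat \<Rightarrow> nat" where
  "base_match n y = (if y = 0 then 2*n+1 else if y = 2*n+1 then 0 else if odd y then y + 1 else y - 1)"

lemma base_match_props:
  assumes "y \<le> 2*n+1" shows "base_match n y \<le> 2*n+1 \<and> base_match n (base_match n y) = y \<and> base_match n y \<noteq> y"
proof -
  consider "y = 0" | "y = 2*n+1" | k where "y = 2*k+1" "k < n" | k where "y = 2*k+2" "k < n"
  proof -
    have "y = 2 * (y div 2) \<or> y = 2 * (y div 2) + 1" by presburger
    moreover have "y \<noteq> 0 \<Longrightarrow> y = 2 * (y div 2) \<Longrightarrow> y = 2 * (y div 2 - 1) + 2 \<and> y div 2 - 1 < n" using assms by presburger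
    moreover have "y \<noteq> 2*n+1 \<Longrightarrow> y = 2 * (y div 2) + 1 \<Longrightarrow> y div 2 < n" using assms by presburger
    ultimately show ?thesis using that by metis
  qed
  then show ?thesis by cases (auto simp: base_match_def)
qed

lemma base_mat_abs:
  assumes lam: "\<And>j. \<bar>lam j\<bar> = 1" and p: "p < 2*n+1" and q: "q < 2*n+1"
  shows "\<bar>base_mat lam p q\<bar> = (if q = base_match n p then 1 else 0)"
  using p q lam by (cases "p = 0"; cases "odd p") (auto simp: base_mat_def base_match_def)

lemma base_mat_anti: "base_mat lam p q = - base_mat lam q p" by (auto simp: base_mat_def)

lemma flip_mixes_linear:
  "flip_mixes g b is (x + y) = flip_mixes g b is x + flip_mixes g b is y"
  "flip_mixes g b is (z \<odot> x) = z \<odot> flip_mixes g b is x"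
proof (induction "is")
  case (Cons i "is")
  { case 1 show ?case using Cons by (simp add: flip_mixes_def flip_mix_def distrib_left distrib_right lop.scale_right_distrib)
  next
    case 2 show ?case using Cons by (simp add: flip_mixes_def flip_mix_def lop.scale_right_distrib mult_ac) }
qed (simp_all add: flip_mixes_def)

lemma flip_mixes_sum: "flip_mixes g b is (sum f I) = (\<Sum>i\<in>I. flip_mixes g b is (f i))"
proof (induction I rule: infinite_finite_induct)
  case empty
  show ?case using flip_mixes_linear(2)[of g b "is" 0 0] by simp
next
  case (infinite I)
  show ?case using flip_mixes_linear(2)[of g b "is" 0 0] infinite by simp
qed (simp add: flip_mixes_linear)

lemma flip_mixes_one: "set is \<subseteq> {..<2*n+1} \<Longrightarrow> flip_mixes (gop n) b is 1 = 1"
proof (induction "is")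
  case (Cons i "is")
  then show ?case using cliff.sq[of i n] cliff.half_sum[of "b i" 1] by (simp add: flip_mixes_def flip_mix_def del: of_real_divide of_real_add of_real_diff)
qed (simp add: flip_mixes_def)

text \<open>For each j the factors 1 + Z and 1 - Z belonging to the two signs add up to 2.\<close>

lemma sum_rho_fold:
  "distinct js \<Longrightarrow> (\<Sum>S\<in>Pow (set js). rho_fold n (sg S) js) = (2 ^ length js) \<odot> 1"
proof (induction js)
  case Nil show ?case by (simp add: rho_fold_def)
next
  case (Cons j js)
  let ?Z = "emb (2^n) (sigz n j)"
  have c: "rho_fold n lam (j # js) = (1 + of_real (lam j) \<odot> ?Z) * rho_fold n lam js" for lam by (simp add: rho_fold_def)
  have ins: "rho_fold n (sg (insert j S)) js = rho_fold n (sg S) js" for S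
    unfolding rho_fold_def by (rule foldr_cong) (use Cons.prems in \<open>auto simp: sg_def\<close>)
  have "(\<Sum>S\<in>Pow (set (j # js)). rho_fold n (sg S) (j # js))
    = (\<Sum>S\<in>Pow (set js) \<union> insert j ` Pow (set js). rho_fold n (sg S) (j # js))" by (simp add: Pow_insert)
  also have "\<dots> = (\<Sum>S\<in>Pow (set js). rho_fold n (sg S) (j # js)) + (\<Sum>S\<in>insert j ` Pow (set js). rho_fold n (sg S) (j # js))"
    by (rule sum.union_disjoint) (use Cons.prems in auto)
  also have "(\<Sum>S\<in>insert j ` Pow (set js). rho_fold n (sg S) (j # js)) = (\<Sum>S\<in>Pow (set js). rho_fold n (sg (insert j S)) (j # js))"
    by (rule sum.reindex_cong[of "insert j"]) (use Cons.prems in \<open>auto simp: inj_on_def\<close>)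
  also have "(\<Sum>S\<in>Pow (set js). rho_fold n (sg S) (j # js)) + \<dots> = (\<Sum>S\<in>Pow (set js). 2 \<odot> rho_fold n (sg S) js)"
    unfolding sum.distrib[symmetric]
  proof (intro sum.cong refl)
    fix S assume "S \<in> Pow (set js)"
    then have "j \<notin> S" using Cons.prems by auto
    then show "rho_fold n (sg S) (j # js) + rho_fold n (sg (insert j S)) (j # js) = 2 \<odot> rho_fold n (sg S) js"
      unfolding c ins using lop.scale_left_distrib[of 1 1 "rho_fold n (sg S) js"] by (simp add: sg_def algebra_simps)
  qed
  also have "\<dots> = (2 ^ length (j # js)) \<odot> 1" using Cons by (simp add: lop.scale_sum_right[symmetric])
  finally show ?case .
qed

lemma sum_rho_lambda: "(\<Sum>S\<in>Pow {1..n}. emb (2^n) (rho_lambda n (sg S))) = 1"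
proof -
  have s: "set [1..<n+1] = {1..n}" by auto
  have l: "length [1..<n+1] = n" by (simp del: upt_Suc)
  have "(\<Sum>S\<in>Pow {1..n}. emb (2^n) (rho_lambda n (sg S))) = (1 / 2^n) \<odot> (\<Sum>S\<in>Pow (set [1..<n+1]). rho_fold n (sg S) [1..<n+1])"
    unfolding rho_lambda_op s lop.scale_sum_right ..
  also have "\<dots> = 1" by (simp only: sum_rho_fold[OF distinct_upt] l) simp
  finally show ?thesis .
qed

lemma Hbin_abs: "Hbin ((1 + x) / 2) = Hbin ((1 + \<bar>x\<bar>) / 2)"
  using gain_minus[of x] by (simp add: gain_def abs_if)

lemma ip_unit: "a < N \<Longrightarrow> ip N (\<lambda>p. if p = a then 1 else 0) (\<lambda>p. if p = b then 1 else 0) = (if a = b then 1 else 0)"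
  by (simp add: ip_def if_distrib[of "\<lambda>x. x * _"] cong: if_cong)

definition wt :: "nat \<Rightarrow> (nat \<Rightarrow> real) \<Rightarrow> nat \<Rightarrow> real" where
  "wt n b p = (if p \<in> set [1..<2*n+1] then b p else 1)"

text \<open>Only absolute values of the entries of M are prescribed: a sign merely reverses the mode
  coefficient, and the binary entropy of (1 + x)/2 is even in x. The frame consists of coordinate
  vectors, and the generator \<open>\<pi> (2*n)\<close> stays unpaired.\<close>

lemma rotated_modes_entropy:
  assumes W: "wick (2*n+1) (gop n) M (emb (2^n) \<sigma>)" and st: "is_state (2^n) \<tau>"
    and \<tau>: "emb (2^n) \<tau> = flip_mixes (gop n) b [1..<2*n+1] (emb (2^n) \<sigma>)"
    and \<pi>: "\<pi> permutes {..<2*n+1}"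
    and anti: "\<And>p q. p < 2*n+1 \<Longrightarrow> q < 2*n+1 \<Longrightarrow> M p q = - M q p"
    and M1: "\<And>j q. j < n \<Longrightarrow> q < 2*n+1 \<Longrightarrow> \<bar>M (\<pi> (2*j)) q\<bar> = (if q = \<pi> (2*j+1) then 1 else 0)"
    and M2: "\<And>j q. j < n \<Longrightarrow> q < 2*n+1 \<Longrightarrow> \<bar>M (\<pi> (2*j+1)) q\<bar> = (if q = \<pi> (2*j) then 1 else 0)"
    and b0: "\<And>p. wt n b p \<ge> 0"
  shows "vN_entropy \<tau> = (\<Sum>j<n. Hbin ((1 + wt n b (\<pi> (2*j)) * wt n b (\<pi> (2*j+1))) / 2))"
proof -
  let ?N = "2*n+1"
  have pl: "\<pi> i < ?N \<longleftrightarrow> i < ?N" for i using permutes_in_image[OF \<pi>, of i] by simp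
  have pinj: "\<pi> i = \<pi> j \<longleftrightarrow> i = j" for i j using permutes_inj[OF \<pi>] by (auto dest: injD)
  define A where "A p q = wt n b p * M p q * wt n b q" for p q
  have wA: "wick ?N (gop n) A (emb (2^n) \<tau>)"
  proof -
    have "set [1..<2*n+1] \<subseteq> {..<?N}" by auto
    from cliff.wick_flip_mixes[OF W distinct_upt this, of b] show ?thesis
      unfolding \<tau> A_def[abs_def] wt_def .
  qed
  define u v where "u j = (\<lambda>p. if p = \<pi> (2*j) then 1 else 0 :: real)" and "v j = (\<lambda>p. if p = \<pi> (2*j+1) then 1 else 0 :: real)" for j
  interpret gframe n u v
  proof unfold_locales
    fix j k assume jk: "j < n" "k < n"
    then have l: "\<pi> (2*j) < ?N" "\<pi> (2*j+1) < ?N" unfolding pl by auto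
    have neq: "2 * j \<noteq> 2 * k + 1" by presburger
    show "ip ?N (u j) (u k) = (if j = k then 1 else 0)" unfolding u_def ip_unit[OF l(1)] pinj by simp
    show "ip ?N (v j) (v k) = (if j = k then 1 else 0)" unfolding v_def ip_unit[OF l(2)] pinj by simp
    show "ip ?N (u j) (v k) = 0" unfolding u_def v_def ip_unit[OF l(1)] pinj using neq by simp
  qed
  define \<kappa> where "\<kappa> j = - A (\<pi> (2*j)) (\<pi> (2*j+1))" for j
  have m: "modes \<kappa> (emb (2^n) \<tau>)"
  proof (rule wick_modes[OF wA])
    fix j q assume j: "j < n" and q: "q < ?N"
    then have l: "\<pi> (2*j) < ?N" "\<pi> (2*j+1) < ?N" unfolding pl by auto
    have "(\<Sum>p<?N. u j p * A p q) = (\<Sum>p<?N. if p = \<pi> (2*j) then A p q else 0)" by (intro sum.cong refl) (simp add: u_def)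
    also have "\<dots> = A (\<pi> (2*j)) q" using l by (subst sum.delta) auto
    also have "\<dots> = - \<kappa> j * v j q" using M1[OF j q] by (auto simp: \<kappa>_def v_def A_def split: if_splits)
    finally show "(\<Sum>p<?N. u j p * A p q) = - \<kappa> j * v j q" .
    have "(\<Sum>p<?N. v j p * A p q) = (\<Sum>p<?N. if p = \<pi> (2*j+1) then A p q else 0)" by (intro sum.cong refl) (simp add: v_def)
    also have "\<dots> = A (\<pi> (2*j+1)) q" using l by (subst sum.delta) auto
    also have "\<dots> = \<kappa> j * u j q" using M2[OF j q] anti[OF l] by (auto simp: \<kappa>_def u_def A_def split: if_splits)
    finally show "(\<Sum>p<?N. v j p * A p q) = \<kappa> j * u j q" .
  qed
  have "\<bar>\<kappa> j\<bar> = wt n b (\<pi> (2*j)) * wt n b (\<pi> (2*j+1))" if j: "j < n" for j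
  proof -
    have "\<pi> (2*j+1) < ?N" unfolding pl using j by simp
    from M1[OF j this] show ?thesis using b0 by (simp add: \<kappa>_def A_def abs_mult)
  qed
  then show ?thesis unfolding modes_entropy[OF m st] Hbin_abs[of "\<kappa> _"] by (intro sum.cong) auto
qed

lemma emb_msum_smult:
  fixes m :: nat
  assumes "d > 0" "\<And>i. i < m \<Longrightarrow> \<rho> i \<in> carrier_mat d d"
  shows "emb d (msum d (\<lambda>i. c i \<cdot>\<^sub>m \<rho> i) {..<m}) = (\<Sum>i<m. c i \<odot> emb d (\<rho> i))"
proof -
  have "emb d (msum d (\<lambda>i. c i \<cdot>\<^sub>m \<rho> i) {..<m}) = (\<Sum>i<m. emb d (c i \<cdot>\<^sub>m \<rho> i))"
    by (rule emb_msum[OF assms(1) finite_lessThan]) (use assms(2) in \<open>auto intro!: smult_carrier_mat\<close>)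
  also have "\<dots> = (\<Sum>i<m. c i \<odot> emb d (\<rho> i))"
    using assms by (intro sum.cong refl) (simp add: emb_smult)
  finally show ?thesis .
qed

lemma maximally_mixed_entropy:
  assumes T: "is_state (2^n) T" and e: "emb (2^n) T = (1 / 2^n) \<odot> 1"
  shows "vN_entropy T = real n"
proof -
  let ?d = "2^n :: nat"
  have c: "T \<in> carrier_mat ?d ?d" using T by (simp add: is_state_def)
  have T1: "T = (1 / 2^n) \<cdot>\<^sub>m 1\<^sub>m ?d"
    by (rule emb_inj[OF c]) (simp_all add: e emb_smult emb_one)
  obtain f where f: "orthonormal ?d ?d f" using state_eigenbasis[OF T] by blast
  have ev: "T *\<^sub>v f i = complex_of_real (1 / 2^n) \<cdot>\<^sub>v f i" if "i < ?d" for i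
  proof -
    have fi: "f i \<in> carrier_vec ?d" using f that by (auto simp: orthonormal_def)
    have dv: "dim_col (1\<^sub>m ?d :: complex mat) = dim_vec (f i)" using fi by auto
    show ?thesis unfolding T1 smult_mv[OF dv] one_mult_mat_vec[OF fi] by simp
  qed
  have "vN_entropy T = (\<Sum>i<?d. eta (1 / 2^n))" by (rule entropy_eigenbasis[OF c f ev])
  moreover have "log 2 (1 / 2^n) = - real n" by (simp add: log_divide log_nat_power)
  moreover have "\<not> (2::real) ^ n \<le> 0" by (simp add: not_le)
  ultimately show ?thesis by (simp add: eta_def)
qed

text \<open>The matching of \<open>\<pi> (2*j)\<close> with \<open>\<pi> (2*j+1)\<close> is
  conjugated to the base matching by an involution t. Anchoring it at the auxiliary vertex makes t
  restrict to the actual generators.\<close>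

lemma matching_unitary:
  assumes \<pi>: "\<pi> permutes {..<2*n+1}"
  shows "\<exists>t. (\<forall>y<2*n+1. t y < 2*n+1 \<and> t (t y) = y) \<and>
    (\<forall>j<n. \<forall>q<2*n+1. (t q = base_match n (t (\<pi> (2*j)))) = (q = \<pi> (2*j+1)) \<and> (t q = base_match n (t (\<pi> (2*j+1)))) = (q = \<pi> (2*j)))"
proof -
  let ?V = "{..2*n+1}"
  \<comment> \<open>Neighbours 2j and 2j+1 are paired up to j = n. As \<pi> fixes the auxiliary
    vertex 2n+1, that vertex becomes the partner of \<open>\<pi> (2*n)\<close>.\<close>
  define e where "e y = (if even y then y + 1 else y - 1)" for y :: nat
  define m1 where "m1 y = \<pi> (e (inv_into UNIV \<pi> y))" for y
  have \<pi>': "\<pi> permutes ?V" by (rule permutes_subset[OF \<pi>]) auto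
  have piV: "\<pi> y \<in> ?V \<longleftrightarrow> y \<in> ?V" and invV: "inv_into UNIV \<pi> y \<in> ?V \<longleftrightarrow> y \<in> ?V" for y
    using permutes_in_image[OF \<pi>'] permutes_in_image[OF permutes_inv[OF \<pi>']] by auto
  note pinv = permutes_inverses[OF \<pi>]
  have ee: "e (e y) = y" "e y \<noteq> y" for y by (cases "even y"; auto simp: e_def elim!: oddE)+
  have eV: "e y \<in> ?V" if "y \<in> ?V" for y
  proof (cases "even y")
    case True
    have "y \<noteq> 2*n+1" using True by auto
    then show ?thesis using that True by (simp add: e_def)
  qed (use that in \<open>simp add: e_def\<close>)
  have "\<exists>t. t (2*n+1) = 2*n+1 \<and> (\<forall>y\<in>?V. t y \<in> ?V \<and> t (t y) = y \<and> t (base_match n (t y)) = m1 y)"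
  proof (rule matchings_conjugate)
    show "finite ?V" "2*n+1 \<in> ?V" by auto
    show "base_match n y \<in> ?V \<and> base_match n (base_match n y) = y \<and> base_match n y \<noteq> y" if "y \<in> ?V" for y
      using base_match_props[of y n] that by simp
    show "m1 y \<in> ?V \<and> m1 (m1 y) = y \<and> m1 y \<noteq> y" if y: "y \<in> ?V" for y
    proof (intro conjI)
      show "m1 y \<in> ?V" unfolding m1_def piV by (rule eV) (use y invV in blast)
      show "m1 (m1 y) = y" by (simp add: m1_def pinv ee)
      show "m1 y \<noteq> y"
      proof
        assume "m1 y = y"
        then have "inv_into UNIV \<pi> (m1 y) = inv_into UNIV \<pi> y" by simp
        then show False using ee(2) by (simp add: m1_def pinv)
      qed
    qed
  qed
  then obtain t where tN: "t (2*n+1) = 2*n+1" and tV: "\<And>y. y \<in> ?V \<Longrightarrow> t y \<in> ?V"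
    and tt: "\<And>y. y \<in> ?V \<Longrightarrow> t (t y) = y" and tm: "\<And>y. y \<in> ?V \<Longrightarrow> t (base_match n (t y)) = m1 y" by blast
  have tl: "t y < 2*n+1 \<and> t (t y) = y" if "y < 2*n+1" for y
  proof -
    have y: "y \<in> ?V" using that by simp
    have "t y \<noteq> 2*n+1"
    proof
      assume "t y = 2*n+1"
      then have "y = 2*n+1" using tt[OF y] tN by simp
      then show False using that by simp
    qed
    moreover have "t y \<le> 2*n+1" using tV[OF y] by simp
    ultimately show ?thesis using tt[OF y] by linarith
  qed
  have mm: "(t q = base_match n (t y)) = (q = m1 y)" if "y < 2*n+1" "q < 2*n+1" for y q
  proof -
    have y: "y \<in> ?V" and q: "q \<in> ?V" using that by auto
    have "base_match n (t y) \<in> ?V" using base_match_props[of "t y" n] tV[OF y] by simp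
    from tt[OF this] have "t (m1 y) = base_match n (t y)" unfolding tm[OF y] .
    then show ?thesis using tt[OF q] tm[OF y] by metis
  qed
  have pl: "\<pi> i < 2*n+1 \<longleftrightarrow> i < 2*n+1" for i using permutes_in_image[OF \<pi>, of i] by simp
  have pair: "m1 (\<pi> (2*j)) = \<pi> (2*j+1)" "m1 (\<pi> (2*j+1)) = \<pi> (2*j)" for j by (simp_all add: m1_def pinv e_def)
  have "\<forall>j<n. \<forall>q<2*n+1. (t q = base_match n (t (\<pi> (2*j)))) = (q = \<pi> (2*j+1)) \<and> (t q = base_match n (t (\<pi> (2*j+1)))) = (q = \<pi> (2*j))"
  proof (intro allI impI)
    fix j q assume j: "j < n" and q: "q < 2*n+1"
    have l: "\<pi> (2*j) < 2*n+1" "\<pi> (2*j+1) < 2*n+1" unfolding pl using j by auto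
    show "(t q = base_match n (t (\<pi> (2*j)))) = (q = \<pi> (2*j+1)) \<and> (t q = base_match n (t (\<pi> (2*j+1)))) = (q = \<pi> (2*j))"
      unfolding mm[OF l(1) q] mm[OF l(2) q] pair by simp
  qed
  then show ?thesis using tl by (intro exI[of _ t]) blast
qed

text \<open>The uniform ensemble over all sign sets S. The average output has maximal entropy n
  because the maximally mixed state survives both the common unitary and the unital channel, while
  the individual output entropies all coincide.\<close>

lemma gaussian_ensemble:
  fixes \<Phi> :: "complex mat \<Rightarrow> complex mat"
  assumes b: "\<forall>p\<in>{1..2*n}. 0 \<le> b p \<and> b p \<le> 1"
    and \<Phi>: "\<And>A. A \<in> carrier_mat (2^n) (2^n) \<Longrightarrow> \<Phi> A \<in> carrier_mat (2^n) (2^n) \<and> emb (2^n) (\<Phi> A) = flip_mixes (gop n) b [1..<2*n+1] (emb (2^n) A)"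
    and \<pi>: "\<pi> permutes {..<2*n+1}"
  shows "\<exists>m p \<sigma>. is_prob m p \<and> (\<forall>i<m. is_state (2^n) (\<sigma> i) \<and> gaussian_state n (\<sigma> i)) \<and>
    holevo (2^n) m p (\<lambda>i. \<Phi> (\<sigma> i)) = real n - (\<Sum>j<n. Hbin ((1 + wt n b (\<pi> (2*j)) * wt n b (\<pi> (2*j+1))) / 2))"
proof -
  let ?N = "2*n+1" and ?d = "2^n :: nat"
  obtain t where t: "\<And>y. y < ?N \<Longrightarrow> t y < ?N \<and> t (t y) = y"
    and tm: "\<And>j q. j < n \<Longrightarrow> q < ?N \<Longrightarrow> (t q = base_match n (t (\<pi> (2*j)))) = (q = \<pi> (2*j+1))"
      "\<And>j q. j < n \<Longrightarrow> q < ?N \<Longrightarrow> (t q = base_match n (t (\<pi> (2*j+1)))) = (q = \<pi> (2*j))"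
    using matching_unitary[OF \<pi>] by blast
  obtain h a s where H2: "hermitian (msum ?d (\<lambda>(p,q). h p q \<cdot>\<^sub>m (majorana n p * majorana n q)) ({1..2*n} \<times> {1..2*n}))"
    and H1: "hermitian (msum ?d (\<lambda>p. a p \<cdot>\<^sub>m majorana n p) {1..2*n})"
    and s1: "\<And>r. \<bar>s r\<bar> = (1::real)"
    and rot: "\<And>r. r < ?N \<Longrightarrow> emb ?d (mat_exp (gen_mat n h a)) * gop n r = of_real (s r) \<odot> (gop n (t r) * emb ?d (mat_exp (gen_mat n h a)))"
    using matching_rotation[of n t] t by blast
  let ?U = "mat_exp (gen_mat n h a)"
  note A = gen_mat_carrier[of n h a]
  note sk = gen_mat_skew[OF H2 H1]
  note U = mat_exp_carrier[OF A] adj_carrier[OF mat_exp_carrier[OF A]]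
  let ?u = "emb ?d ?U" and ?u' = "emb ?d (adj ?U)"
  have u: "?u * ?u' = 1" "?u' * ?u = 1"
    using mat_exp_unitary[OF A sk] U by (simp_all add: emb_mult[symmetric] emb_one)
  define R where "R q p = (if q = t p then s p else 0)" for q p
  have R: "?u * gop n p = (\<Sum>q<?N. of_real (R q p) \<odot> gop n q) * ?u" if p: "p < ?N" for p
  proof -
    have "(\<Sum>q<?N. of_real (R q p) \<odot> gop n q) = (\<Sum>q<?N. if q = t p then of_real (s p) \<odot> gop n (t p) else 0)"
      by (intro sum.cong refl) (auto simp: R_def)
    also have "\<dots> = of_real (s p) \<odot> gop n (t p)" by (subst sum.delta) (use t[OF p] in auto)
    finally show ?thesis using rot[OF p] by simp
  qed
  define \<sigma> where "\<sigma> S = ?U * rho_lambda n (sg S) * adj ?U" for S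
  define M where "M S r s = (\<Sum>p<?N. \<Sum>q<?N. R r p * base_mat (sg S) p q * R s q)" for S r s
  have em: "emb ?d (\<sigma> S) = ?u * emb ?d (rho_lambda n (sg S)) * ?u'" for S
    using U rho_lambda_carrier[of n "sg S"] by (simp add: \<sigma>_def emb_mult mult_carrier_mat[of _ ?d ?d _ ?d])
  have W: "wick ?N (gop n) (M S) (emb ?d (\<sigma> S))" for S
    using cliff.wick_conj[OF rho_lambda_wick u R] unfolding em M_def[abs_def] by blast
  have Meq: "M S r q = s (t r) * base_mat (sg S) (t r) (t q) * s (t q)" if r: "r < ?N" and q: "q < ?N" for S r q
  proof -
    have Rr: "R x p = (if p = t x then s (t x) else 0)" if "x < ?N" "p < ?N" for x p
      using t[OF that(1)] t[OF that(2)] by (auto simp: R_def)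
    have "M S r q = (\<Sum>p<?N. \<Sum>q'<?N. if q' = t q then R r p * base_mat (sg S) p (t q) * s (t q) else 0)"
      unfolding M_def by (intro sum.cong refl) (auto simp: Rr[OF q])
    also have "\<dots> = (\<Sum>p<?N. R r p * base_mat (sg S) p (t q) * s (t q))"
      by (intro sum.cong refl, subst sum.delta) (use t[OF q] in auto)
    also have "\<dots> = (\<Sum>p<?N. if p = t r then s (t r) * base_mat (sg S) (t r) (t q) * s (t q) else 0)"
      by (intro sum.cong refl) (auto simp: Rr[OF r])
    also have "\<dots> = s (t r) * base_mat (sg S) (t r) (t q) * s (t q)" by (subst sum.delta) (use t[OF r] in auto)
    finally show ?thesis .
  qed
  \<comment> \<open>The signs of S and of the rotation drop out of the absolute value; this is why
    the output entropy does not depend on S.\<close>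
  have Mabs: "\<bar>M S r q\<bar> = (if t q = base_match n (t r) then 1 else 0)" if r: "r < ?N" and q: "q < ?N" for S r q
  proof -
    have "\<bar>base_mat (sg S) (t r) (t q)\<bar> = (if t q = base_match n (t r) then 1 else 0)"
      by (rule base_mat_abs) (use t[OF r] t[OF q] in \<open>auto simp: sg_def\<close>)
    then show ?thesis unfolding Meq[OF r q] by (simp add: abs_mult s1)
  qed
  have anti: "M S r q = - M S q r" if r: "r < ?N" and q: "q < ?N" for S r q
    unfolding Meq[OF r q] Meq[OF q r] base_mat_anti[of "sg S" "t r" "t q"] by simp
  have st: "is_state ?d (\<sigma> S)" for S
    unfolding \<sigma>_def by (rule is_state_conj[OF rho_lambda_state U(1) mat_exp_unitary(2)[OF A sk]]) (simp add: sg_def)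
  have cS: "\<sigma> S \<in> carrier_mat ?d ?d" for S using st[of S] by (simp add: is_state_def)
  have pl: "\<pi> i < ?N \<longleftrightarrow> i < ?N" for i using permutes_in_image[OF \<pi>, of i] by simp
  have stP: "is_state ?d (\<Phi> (\<sigma> S))" for S by (rule channel_state[OF b \<Phi> st])
  have ent: "vN_entropy (\<Phi> (\<sigma> S)) = (\<Sum>j<n. Hbin ((1 + wt n b (\<pi> (2*j)) * wt n b (\<pi> (2*j+1))) / 2))" for S
  proof (rule rotated_modes_entropy[OF W stP _ \<pi>])
    show "emb ?d (\<Phi> (\<sigma> S)) = flip_mixes (gop n) b [1..<2*n+1] (emb ?d (\<sigma> S))" using \<Phi>[OF cS] by blast
    show "M S p q = - M S q p" if "p < ?N" "q < ?N" for p q by (rule anti[OF that])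
    show "\<bar>M S (\<pi> (2*j)) q\<bar> = (if q = \<pi> (2*j+1) then 1 else 0)" if j: "j < n" and q: "q < ?N" for j q
    proof -
      have l: "\<pi> (2*j) < ?N" unfolding pl using j by simp
      show ?thesis unfolding Mabs[OF l q] tm(1)[OF j q] ..
    qed
    show "\<bar>M S (\<pi> (2*j+1)) q\<bar> = (if q = \<pi> (2*j) then 1 else 0)" if j: "j < n" and q: "q < ?N" for j q
    proof -
      have l: "\<pi> (2*j+1) < ?N" unfolding pl using j by simp
      show ?thesis unfolding Mabs[OF l q] tm(2)[OF j q] ..
    qed
    have s: "set [1..<2*n+1] = {1..2*n}" by auto
    show "0 \<le> wt n b p" for p unfolding wt_def s using b by simp
  qed
  have gs: "gaussian_state n (\<sigma> S)" for S
    unfolding gaussian_state_def Let_def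
  proof (intro exI conjI)
    show "\<sigma> S = mat_exp (\<i> \<cdot>\<^sub>m (msum ?d (\<lambda>(p,q). h p q \<cdot>\<^sub>m (majorana n p * majorana n q)) ({1..2*n} \<times> {1..2*n}) + msum ?d (\<lambda>p. a p \<cdot>\<^sub>m majorana n p) {1..2*n}))
      * rho_lambda n (sg S) * adj (mat_exp (\<i> \<cdot>\<^sub>m (msum ?d (\<lambda>(p,q). h p q \<cdot>\<^sub>m (majorana n p * majorana n q)) ({1..2*n} \<times> {1..2*n}) + msum ?d (\<lambda>p. a p \<cdot>\<^sub>m majorana n p) {1..2*n})))"
      unfolding \<sigma>_def gen_mat_def ..
    show "\<forall>j\<in>{1..n}. - 1 \<le> sg S j \<and> sg S j \<le> 1" by (simp add: sg_def)
  qed (rule H2, rule H1)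
  have "card (Pow {1..n}) = 2^n" by (simp add: card_Pow)
  then obtain f where f: "bij_betw f {..<?d} (Pow {1..n})"
    using ex_bij_betw_nat_finite[of "Pow {1..n}"] by (auto simp: atLeast0LessThan)
  define p :: "nat \<Rightarrow> real" where "p i = 1 / 2^n" for i
  have prob: "is_prob ?d p" by (simp add: is_prob_def p_def)
  let ?T = "msum ?d (\<lambda>i. complex_of_real (p i) \<cdot>\<^sub>m \<Phi> (\<sigma> (f i))) {..<?d}"
  have T: "is_state ?d ?T" by (rule is_state_msum[OF prob stP])
  have "emb ?d ?T = (\<Sum>i<?d. (1 / 2^n) \<odot> emb ?d (\<Phi> (\<sigma> (f i))))"
    using stP by (subst emb_msum_smult) (simp_all add: p_def is_state_def)
  also have "\<dots> = (\<Sum>i<?d. flip_mixes (gop n) b [1..<?N] ((1 / 2^n) \<odot> emb ?d (\<sigma> (f i))))"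
    by (intro sum.cong refl) (simp only: \<Phi>[OF cS] flip_mixes_linear)
  also have "\<dots> = flip_mixes (gop n) b [1..<?N] ((1 / 2^n) \<odot> (\<Sum>i<?d. emb ?d (\<sigma> (f i))))"
    by (simp only: flip_mixes_sum lop.scale_sum_right)
  also have "(\<Sum>i<?d. emb ?d (\<sigma> (f i))) = (\<Sum>S\<in>Pow {1..n}. emb ?d (\<sigma> S))" by (rule sum.reindex_bij_betw[OF f])
  also have "\<dots> = ?u * (\<Sum>S\<in>Pow {1..n}. emb ?d (rho_lambda n (sg S))) * ?u'"
    by (simp only: em sum_distrib_left sum_distrib_right)
  also have "\<dots> = 1" unfolding sum_rho_lambda using u by simp
  also have "flip_mixes (gop n) b [1..<?N] ((1 / 2^n) \<odot> 1) = (1 / 2^n) \<odot> 1"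
    unfolding flip_mixes_linear by (subst flip_mixes_one) auto
  finally have "vN_entropy ?T = real n" by (rule maximally_mixed_entropy[OF T])
  moreover have "(\<Sum>i<?d. p i * vN_entropy (\<Phi> (\<sigma> (f i)))) = (\<Sum>j<n. Hbin ((1 + wt n b (\<pi> (2*j)) * wt n b (\<pi> (2*j+1))) / 2))"
    unfolding ent by (simp add: p_def)
  ultimately have "holevo ?d ?d p (\<lambda>i. \<Phi> (\<sigma> (f i))) = real n - (\<Sum>j<n. Hbin ((1 + wt n b (\<pi> (2*j)) * wt n b (\<pi> (2*j+1))) / 2))"
    unfolding holevo_def by simp
  then show ?thesis using prob st gs by (intro exI[of _ ?d] exI[of _ p] exI[of _ "\<lambda>i. \<sigma> (f i)"]) simp
qed

subsection \<open>Pure states of one and two qubits\<close>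

definition pure :: "nat \<Rightarrow> complex vec \<Rightarrow> complex mat" where
  "pure d \<psi> = mat d d (\<lambda>(k,l). \<psi> $ k * cnj (\<psi> $ l))"

lemma pure_carrier: "pure d \<psi> \<in> carrier_mat d d" by (simp add: pure_def)

lemma pure_state:
  assumes \<psi>: "\<psi> \<in> carrier_vec d" "\<psi> \<bullet>c \<psi> = 1" shows "is_state d (pure d \<psi>)"
  unfolding is_state_def
proof (intro conjI ballI)
  show "hermitian (pure d \<psi>)" unfolding hermitian_def by (rule eq_matI) (auto simp: pure_def adj_def)
  show "trace (pure d \<psi>) = 1" using cscalar_sum[OF \<psi>(1,1)] \<psi>(2) by (simp add: pure_def trace_def)
  fix v :: "complex vec" assume v: "v \<in> carrier_vec d"
  define z where "z = (\<Sum>k<d. \<psi> $ k * cnj (v $ k))"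
  have "(pure d \<psi> *\<^sub>v v) \<bullet>c v = (\<Sum>k<d. (\<Sum>l<d. pure d \<psi> $$ (k,l) * v $ l) * cnj (v $ k))"
    unfolding cscalar_sum[OF mult_mat_vec_carrier[OF pure_carrier v] v] using mat_vec_sum[OF pure_carrier v] by simp
  also have "\<dots> = (\<Sum>k<d. \<Sum>l<d. (\<psi> $ k * cnj (v $ k)) * cnj (\<psi> $ l * cnj (v $ l)))"
    unfolding sum_distrib_right by (intro sum.cong refl) (simp add: pure_def)
  also have "\<dots> = z * cnj z" unfolding z_def cnj_sum sum_product ..
  finally show "0 \<le> Re ((pure d \<psi> *\<^sub>v v) \<bullet>c v)" by simp
qed (rule pure_carrier)

text \<open>For one and two qubits the generators satisfy a Fierz identity that makes every pure state
  satisfy a linear relation of the same kind as Gaussian states.\<close>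
lemma pure_wick:
  fixes \<psi> :: "complex vec"
  defines "\<gamma> \<equiv> \<lambda>n p k. \<Sum>l<2^n. gmat n p $$ (k,l) * \<psi> $ l"
  assumes fierz: "\<And>p k. p < 2*n+1 \<Longrightarrow> k < 2^n \<Longrightarrow>
      (\<Sum>q<2*n+1. ((\<Sum>j<2^n. cnj (\<gamma> n q j) * \<gamma> n p j) - (\<Sum>j<2^n. cnj (\<gamma> n p j) * \<gamma> n q j)) * \<gamma> n q k)
      = 2 * (\<Sum>j<2^n. cnj (\<psi> $ j) * \<psi> $ j) * \<gamma> n p k - 2 * (\<Sum>j<2^n. cnj (\<psi> $ j) * \<gamma> n p j) * \<psi> $ k"
    and \<psi>: "\<psi> \<in> carrier_vec (2^n)" "\<psi> \<bullet>c \<psi> = 1"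
  shows "\<exists>M. wick (2*n+1) (gop n) M (emb (2^n) (pure (2^n) \<psi>)) \<and> (\<forall>p q. M p q = - M q p)"
proof -
  let ?N = "2*n+1" and ?d = "2^n :: nat" and ?X = "pure (2^n) \<psi>"
  define c where "c p q = (\<Sum>j<?d. cnj (\<gamma> n q j) * \<gamma> n p j)" for p q
  define m where "m p = (\<Sum>j<?d. cnj (\<psi> $ j) * \<gamma> n p j)" for p
  \<comment> \<open>\<open>c p q\<close> is the expectation of the product of generators q and p in
    \<psi>, so its imaginary part is the covariance that the Wick relation demands.\<close>
  define M where "M p q = Im (c p q)" for p q
  have cc: "cnj (c p q) = c q p" for p q by (simp add: c_def mult.commute)
  have cM: "c p q - c q p = 2 * (\<i> * of_real (M p q))" for p q
    unfolding cc[of p q, symmetric] M_def by (simp add: complex_eq_iff)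
  have norm: "(\<Sum>j<?d. cnj (\<psi> $ j) * \<psi> $ j) = 1" using cscalar_sum[OF \<psi>(1,1)] \<psi>(2) by (simp add: mult.commute)
  have id: "\<i> * (\<Sum>q<?N. of_real (M p q) * \<gamma> n q k) = \<gamma> n p k - m p * \<psi> $ k" if p: "p < ?N" and k: "k < ?d" for p k
  proof -
    have "2 * (\<i> * (\<Sum>q<?N. of_real (M p q) * \<gamma> n q k)) = (\<Sum>q<?N. (c p q - c q p) * \<gamma> n q k)"
      unfolding cM sum_distrib_left by (intro sum.cong refl) (simp only: mult.assoc)
    also have "\<dots> = 2 * (\<gamma> n p k - m p * \<psi> $ k)"
      using fierz[OF p k] unfolding norm c_def[symmetric] m_def[symmetric] by (simp add: algebra_simps)
    finally have "2 * (\<i> * (\<Sum>q<?N. of_real (M p q) * \<gamma> n q k)) = 2 * (\<gamma> n p k - m p * \<psi> $ k)" .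
    then show ?thesis by (rule mult_left_cancel[THEN iffD1, rotated]) simp
  qed
  have herm: "cnj (gmat n p $$ (k,l)) = gmat n p $$ (l,k)" if "p < ?N" "k < ?d" "l < ?d" for p k l
  proof -
    have "adj (gmat n p) $$ (l,k) = cnj (gmat n p $$ (k,l))"
      using that carrier_matD[OF gmat_carrier[OF that(1)]] by (simp add: adj_def)
    then show ?thesis unfolding gmat_adj[OF that(1)] by simp
  qed
  have cg: "cnj (\<gamma> n p l) = (\<Sum>k<?d. cnj (\<psi> $ k) * gmat n p $$ (k,l))" if "p < ?N" "l < ?d" for p l
    unfolding \<gamma>_def cnj_sum using that by (intro sum.cong refl) (simp add: herm)
  \<comment> \<open>Expectations of hermitian generators are real; hence the terms with
    \<open>m p\<close> from the ket side and the bra side cancel in the commutator.\<close>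
  have mr: "cnj (m p) = m p" if p: "p < ?N" for p
  proof -
    have "cnj (m p) = (\<Sum>j<?d. \<psi> $ j * cnj (\<gamma> n p j))" by (simp add: m_def)
    also have "\<dots> = (\<Sum>j<?d. \<Sum>k<?d. cnj (\<psi> $ k) * (gmat n p $$ (k,j) * \<psi> $ j))"
      using p by (intro sum.cong refl) (simp add: cg sum_distrib_left mult_ac)
    also have "\<dots> = (\<Sum>k<?d. \<Sum>j<?d. cnj (\<psi> $ k) * (gmat n p $$ (k,j) * \<psi> $ j))" by (rule sum.swap)
    also have "\<dots> = m p" by (simp add: m_def \<gamma>_def sum_distrib_left)
    finally show ?thesis .
  qed
  have left: "(gmat n p * ?X) $$ (k,l) = \<gamma> n p k * cnj (\<psi> $ l)" if "p < ?N" "k < ?d" "l < ?d" for p k l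
    unfolding mat_mult_sum[OF gmat_carrier[OF that(1)] pure_carrier that(2,3)] \<gamma>_def sum_distrib_right
    using that by (intro sum.cong refl) (simp add: pure_def)
  have right: "(?X * gmat n p) $$ (k,l) = \<psi> $ k * cnj (\<gamma> n p l)" if "p < ?N" "k < ?d" "l < ?d" for p k l
    unfolding mat_mult_sum[OF pure_carrier gmat_carrier[OF that(1)] that(2,3)] cg[OF that(1,3)] sum_distrib_left
    using that by (intro sum.cong refl) (simp add: pure_def)
  have "wick ?N (gop n) M (emb ?d ?X)"
    unfolding wick_def
  proof (intro allI impI)
    fix p assume p: "p < ?N"
    note g = gmat_carrier and mc = mult_carrier_mat[of _ ?d ?d _ ?d]
    define Z where "Z = msum ?d (\<lambda>q. of_real (M p q) \<cdot>\<^sub>m (gmat n q * ?X + ?X * gmat n q)) {..<?N}"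
    have Zk: "Z $$ (k,l) = (\<Sum>q<?N. of_real (M p q) * (\<gamma> n q k * cnj (\<psi> $ l) + \<psi> $ k * cnj (\<gamma> n q l)))" if kl: "k < ?d" "l < ?d" for k l
    proof -
      have "(of_real (M p q) \<cdot>\<^sub>m (gmat n q * ?X + ?X * gmat n q)) $$ (k,l) = of_real (M p q) * ((gmat n q * ?X) $$ (k,l) + (?X * gmat n q) $$ (k,l))" if "q < ?N" for q
        using kl mc[OF g[OF that] pure_carrier] mc[OF pure_carrier g[OF that]]
        by (simp add: carrier_matD[OF g[OF that]] carrier_matD[OF pure_carrier] del: index_mult_mat(1))
      then have "(of_real (M p q) \<cdot>\<^sub>m (gmat n q * ?X + ?X * gmat n q)) $$ (k,l) = of_real (M p q) * (\<gamma> n q k * cnj (\<psi> $ l) + \<psi> $ k * cnj (\<gamma> n q l))" if "q < ?N" for q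
        using that by (simp only: left[OF that kl] right[OF that kl])
      moreover have "Z $$ (k,l) = (\<Sum>q<?N. (of_real (M p q) \<cdot>\<^sub>m (gmat n q * ?X + ?X * gmat n q)) $$ (k,l))"
        unfolding Z_def msum_def using kl by (simp only: index_mat split)
      ultimately show ?thesis by simp
    qed
    have E: "gmat n p * ?X = ?X * gmat n p + \<i> \<cdot>\<^sub>m Z"
    proof (rule eq_matI)
      have Zc: "Z \<in> carrier_mat ?d ?d" unfolding Z_def by (rule msum_carrier)
      fix k l assume "k < dim_row (?X * gmat n p + \<i> \<cdot>\<^sub>m Z)" "l < dim_col (?X * gmat n p + \<i> \<cdot>\<^sub>m Z)"
      then have kl: "k < ?d" "l < ?d" using Zc by auto
      have "\<i> * Z $$ (k,l) = (\<i> * (\<Sum>q<?N. of_real (M p q) * \<gamma> n q k)) * cnj (\<psi> $ l) - \<psi> $ k * cnj (\<i> * (\<Sum>q<?N. of_real (M p q) * \<gamma> n q l))"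
        unfolding Zk[OF kl] distrib_left sum.distrib sum_distrib_left sum_distrib_right
        by (simp only: complex_cnj_mult cnj_sum complex_cnj_complex_of_real complex_cnj_i sum_distrib_left sum_distrib_right)
           (simp add: sum_negf sum_distrib_left mult_ac del: sum.lessThan_Suc)
      also have "\<dots> = \<gamma> n p k * cnj (\<psi> $ l) - \<psi> $ k * cnj (\<gamma> n p l)"
        unfolding id[OF p kl(1)] id[OF p kl(2)] by (simp add: mr[OF p] algebra_simps)
      finally have "(gmat n p * ?X) $$ (k,l) = (?X * gmat n p) $$ (k,l) + \<i> * Z $$ (k,l)"
        unfolding left[OF p kl] right[OF p kl] by simp
      then show "(gmat n p * ?X) $$ (k,l) = (?X * gmat n p + \<i> \<cdot>\<^sub>m Z) $$ (k,l)"
        using kl Zc carrier_matD[OF g[OF p]] carrier_matD[OF pure_carrier[of ?d \<psi>]] by (simp del: index_mult_mat(1))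
    qed (use carrier_matD[OF g[OF p]] in \<open>auto simp: Z_def msum_def pure_def\<close>)
    have eZ: "emb ?d Z = (\<Sum>q<?N. of_real (M p q) \<odot> (gop n q * emb ?d ?X + emb ?d ?X * gop n q))"
    proof -
      have "emb ?d Z = (\<Sum>q<?N. of_real (M p q) \<odot> emb ?d (gmat n q * ?X + ?X * gmat n q))"
        unfolding Z_def by (rule emb_msum_smult) (use mc[OF g pure_carrier] mc[OF pure_carrier g] in auto)
      also have "\<dots> = (\<Sum>q<?N. of_real (M p q) \<odot> (gop n q * emb ?d ?X + emb ?d ?X * gop n q))"
      proof (intro sum.cong refl)
        fix q assume "q \<in> {..<?N}"
        then have q: "q < ?N" by simp
        show "of_real (M p q) \<odot> emb ?d (gmat n q * ?X + ?X * gmat n q) = of_real (M p q) \<odot> (gop n q * emb ?d ?X + emb ?d ?X * gop n q)"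
          using g[OF q] pure_carrier[of ?d \<psi>] by (simp add: emb_add emb_mult mc gop_def)
      qed
      finally show ?thesis .
    qed
    have Zc: "Z \<in> carrier_mat ?d ?d" unfolding Z_def by (rule msum_carrier)
    have "gop n p * emb ?d ?X = emb ?d (gmat n p * ?X)" using g[OF p] pure_carrier[of ?d \<psi>] by (simp add: emb_mult gop_def)
    also have "\<dots> = emb ?d ?X * gop n p + \<i> \<odot> emb ?d Z"
      unfolding E using g[OF p] pure_carrier[of ?d \<psi>] Zc by (simp add: emb_mult emb_add emb_smult mc gop_def)
    finally show "gop n p * emb ?d ?X - emb ?d ?X * gop n p = \<i> \<odot> (\<Sum>q<?N. of_real (M p q) \<odot> (gop n q * emb ?d ?X + emb ?d ?X * gop n q))"
      unfolding eZ[symmetric] by simp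
  qed
  moreover have "M p q = - M q p" for p q using arg_cong[OF cc[of p q], of Im] by (simp add: M_def)
  ultimately show ?thesis by blast
qed

lemma smult_entry: "A \<in> carrier_mat d d \<Longrightarrow> i < d \<Longrightarrow> j < d \<Longrightarrow> (z \<cdot>\<^sub>m A) $$ (i,j) = z * A $$ (i,j)"
  by (intro index_smult_mat) auto

lemma kron_one_right: "A \<in> carrier_mat a a \<Longrightarrow> kron A (1\<^sub>m 1) = A"
  by (rule eq_matI) (auto simp: kron_def)

lemma mat2_kron_mult:
  assumes "A \<in> carrier_mat 2 2" "B \<in> carrier_mat 2 2" "C \<in> carrier_mat 2 2" "D \<in> carrier_mat 2 2" "i < 4" "j < 4"
  shows "(kron A B * kron C D) $$ (i,j) = (A $$ (i div 2,0) * C $$ (0,j div 2) + A $$ (i div 2,1) * C $$ (1,j div 2))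
    * (B $$ (i mod 2,0) * D $$ (0,j mod 2) + B $$ (i mod 2,1) * D $$ (1,j mod 2))"
proof -
  have b: "i div 2 < 2" "j div 2 < 2" "i mod 2 < 2" "j mod 2 < 2" using assms(5,6) by auto
  have AC: "A * C \<in> carrier_mat 2 2" "B * D \<in> carrier_mat 2 2" using assms by (auto intro: mult_carrier_mat)
  have "(kron A B * kron C D) $$ (i,j) = kron (A * C) (B * D) $$ (i,j)" using assms by (simp add: kron_mult)
  also have "\<dots> = (A * C) $$ (i div 2, j div 2) * (B * D) $$ (i mod 2, j mod 2)"
    by (rule kron_index[OF AC]) (use assms(5,6) in auto)
  finally show ?thesis
    unfolding mat2_mult[OF assms(1,3) b(1,2)] mat2_mult[OF assms(2,4) b(3,4)] .
qed

section \<open>Explicit generators and Fierz identities in dimensions two and four\<close>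

text \<open>Each generator is a monomial matrix: its only nonzero entry in row k stands in column
  \<open>g2_perm p k\<close> and equals \<open>g2_coeff p k\<close>.\<close>

definition g2_perm :: "nat \<Rightarrow> nat \<Rightarrow> nat" where
  "g2_perm p k = [[0,1,2,3],[2,3,0,1],[2,3,0,1],[1,0,3,2],[1,0,3,2]] ! p ! k"

definition g2_coeff :: "nat \<Rightarrow> nat \<Rightarrow> complex" where
  "g2_coeff p k = [[1,-1,-1,1],[\<i>,-\<i>,-\<i>,\<i>],[1,-1,1,-1],[\<i>,-\<i>,\<i>,-\<i>],[1,1,1,1]] ! p ! k"

lemma lt_4: "i < (4::nat) \<longleftrightarrow> i = 0 \<or> i = 1 \<or> i = 2 \<or> i = 3" by auto
lemma lt_5: "i < (5::nat) \<longleftrightarrow> i = 0 \<or> i = 1 \<or> i = 2 \<or> i = 3 \<or> i = 4" by auto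
lemma lessThan_45: "{..<4::nat} = {0,1,2,3}" "{..<5::nat} = {0,1,2,3,4}" "{..<2::nat} = {0,1}" "{..<3::nat} = {0,1,2}" by auto

lemma gmat_2:
  assumes p: "p < 5" and ij: "i < 4" "j < 4"
  shows "gmat 2 p $$ (i,j) = (if j = g2_perm p i then g2_coeff p i else 0)"
proof -
  have "parity_op 2 = kron pauli_z (kron pauli_z (1\<^sub>m 1))" by (simp add: parity_op_def numeral_2_eq_2)
  then have P: "parity_op 2 = kron pauli_z pauli_z" by (simp only: kron_one_right[OF pauli_carrier(3)])
  have m: "majorana 2 1 = kron pauli_x (1\<^sub>m 2)" "majorana 2 2 = kron pauli_y (1\<^sub>m 2)"
    "majorana 2 3 = kron pauli_z pauli_x" "majorana 2 4 = kron pauli_z pauli_y"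
  proof -
    have e: "Suc 1 = 2" "(1::nat) + 2 = 3" "(2::nat) + 2 = 4" "Suc 0 = 1" by auto
    have k: "majorana 1 1 = pauli_x" "majorana 1 2 = pauli_y"
      using majorana_1[of 0] majorana_2[of 0] kron_one_right[of pauli_x 2] kron_one_right[of pauli_y 2] by (simp_all only: e power_0 pauli_carrier simp_thms)
    show "majorana 2 1 = kron pauli_x (1\<^sub>m 2)" "majorana 2 2 = kron pauli_y (1\<^sub>m 2)"
      using majorana_1[of 1] majorana_2[of 1] by (simp_all only: e power_one_right)
    show "majorana 2 3 = kron pauli_z pauli_x" "majorana 2 4 = kron pauli_z pauli_y"
      using majorana_Suc[of 1 1] majorana_Suc[of 2 1] k by (simp_all only: e k le_refl one_le_numeral simp_thms)
  qed
  have P0: "gmat 2 0 $$ (i,j) = pauli_z $$ (i div 2, j div 2) * pauli_z $$ (i mod 2, j mod 2)"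
    using kron_index[of pauli_z 2 pauli_z 2 i j] ij by (simp add: gmat_def P)
  have Gp: "gmat 2 p $$ (i,j) = \<i> * (parity_op 2 * majorana 2 p) $$ (i,j)" if "p \<noteq> 0"
  proof -
    have "p \<in> {1..2*2}" using p that by auto
    from majorana_carrier[OF this] parity_props(1)[of 2]
    have c: "parity_op 2 * majorana 2 p \<in> carrier_mat 4 4" by (auto intro: mult_carrier_mat)
    have "gmat 2 p = \<i> \<cdot>\<^sub>m (parity_op 2 * majorana 2 p)" using that by (simp only: gmat_def if_False)
    then show ?thesis by (simp only: smult_entry[OF c ij])
  qed
  note kk = mat2_kron_mult[OF _ _ _ _ ij]
  consider "p = 0" | "p = 1" | "p = 2" | "p = 3" | "p = 4" using p unfolding lt_5 by blast
  then show ?thesis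
  proof cases
    case 1 show ?thesis unfolding 1 P0 using ij unfolding lt_4
      by (elim disjE) (simp_all add: pauli_index g2_perm_def g2_coeff_def)
  next
    case 2
    have *: "gmat 2 1 $$ (i,j) = \<i> * (kron pauli_z pauli_z * kron pauli_x (1\<^sub>m 2)) $$ (i,j)" by (rule Gp[unfolded 2 P m(1)]) simp
    show ?thesis unfolding 2 unfolding * unfolding kk[OF pauli_carrier(3) pauli_carrier(3) pauli_carrier(1) one_carrier_mat] using ij unfolding lt_4
      by (elim disjE) (simp_all add: pauli_index g2_perm_def g2_coeff_def)
  next
    case 3
    have *: "gmat 2 2 $$ (i,j) = \<i> * (kron pauli_z pauli_z * kron pauli_y (1\<^sub>m 2)) $$ (i,j)" by (rule Gp[unfolded 3 P m(2)]) simp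
    show ?thesis unfolding 3 unfolding * unfolding kk[OF pauli_carrier(3) pauli_carrier(3) pauli_carrier(2) one_carrier_mat] using ij unfolding lt_4
      by (elim disjE) (simp_all add: pauli_index g2_perm_def g2_coeff_def)
  next
    case 4
    have *: "gmat 2 3 $$ (i,j) = \<i> * (kron pauli_z pauli_z * kron pauli_z pauli_x) $$ (i,j)" by (rule Gp[unfolded 4 P m(3)]) simp
    show ?thesis unfolding 4 unfolding * unfolding kk[OF pauli_carrier(3) pauli_carrier(3) pauli_carrier(3) pauli_carrier(1)] using ij unfolding lt_4
      by (elim disjE) (simp_all add: pauli_index g2_perm_def g2_coeff_def)
  next
    case 5
    have *: "gmat 2 4 $$ (i,j) = \<i> * (kron pauli_z pauli_z * kron pauli_z pauli_y) $$ (i,j)" by (rule Gp[unfolded 5 P m(4)]) simp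
    show ?thesis unfolding 5 unfolding * unfolding kk[OF pauli_carrier(3) pauli_carrier(3) pauli_carrier(3) pauli_carrier(2)] using ij unfolding lt_4
      by (elim disjE) (simp_all add: pauli_index g2_perm_def g2_coeff_def)
  qed
qed

definition g1_perm :: "nat \<Rightarrow> nat \<Rightarrow> nat" where
  "g1_perm p k = [[0,1],[1,0],[1,0]] ! p ! k"

definition g1_coeff :: "nat \<Rightarrow> nat \<Rightarrow> complex" where
  "g1_coeff p k = [[1,-1],[\<i>,-\<i>],[1,1]] ! p ! k"

lemma gmat_1:
  assumes p: "p < 3" and ij: "i < 2" "j < 2"
  shows "gmat 1 p $$ (i,j) = (if j = g1_perm p i then g1_coeff p i else 0)"
proof -
  have P: "parity_op 1 = pauli_z" using kron_one_right[of pauli_z 2] by (simp add: parity_op_def)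
  have e: "Suc 0 = 1" by simp
  have k: "majorana 1 1 = pauli_x" "majorana 1 2 = pauli_y"
    using majorana_1[of 0] majorana_2[of 0] kron_one_right[of pauli_x 2] kron_one_right[of pauli_y 2] by (simp_all only: e power_0 pauli_carrier simp_thms)
  have i: "i = 0 \<or> i = 1" and j: "j = 0 \<or> j = 1" using ij by auto
  consider "p = 0" | "p = 1" | "p = 2" using p by linarith
  then show ?thesis
  proof cases
    case 1
    have *: "gmat 1 p = pauli_z" using 1 P by (simp add: gmat_def)
    show ?thesis unfolding * unfolding 1 using i j by (elim disjE) (simp_all add: pauli_index g1_perm_def g1_coeff_def)
  next
    case 2
    have c: "pauli_z * pauli_x \<in> carrier_mat 2 2" by (rule mult_carrier_mat[OF pauli_carrier(3) pauli_carrier(1)])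
    have G: "gmat 1 p = \<i> \<cdot>\<^sub>m (pauli_z * pauli_x)" unfolding gmat_def 2 P k by simp
    have *: "gmat 1 p $$ (i,j) = \<i> * (pauli_z * pauli_x) $$ (i,j)" unfolding G by (rule smult_entry[OF c ij])
    show ?thesis unfolding * unfolding mat2_mult[OF pauli_carrier(3,1) ij] 2 using i j
      by (elim disjE) (simp_all add: pauli_index g1_perm_def g1_coeff_def)
  next
    case 3
    have c: "pauli_z * pauli_y \<in> carrier_mat 2 2" by (rule mult_carrier_mat[OF pauli_carrier(3) pauli_carrier(2)])
    have G: "gmat 1 p = \<i> \<cdot>\<^sub>m (pauli_z * pauli_y)" unfolding gmat_def 3 P k by simp
    have *: "gmat 1 p $$ (i,j) = \<i> * (pauli_z * pauli_y) $$ (i,j)" unfolding G by (rule smult_entry[OF c ij])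
    show ?thesis unfolding * unfolding mat2_mult[OF pauli_carrier(3,2) ij] 3 using i j
      by (elim disjE) (simp_all add: pauli_index g1_perm_def g1_coeff_def)
  qed
qed

lemma ii_mult: "\<i> * (\<i> * x) = - x" by (simp add: mult.assoc[symmetric])

lemma fierz_1:
  fixes x :: "nat \<Rightarrow> complex"
  defines "\<gamma> \<equiv> \<lambda>p k. g1_coeff p k * x (g1_perm p k)"
  assumes "p < 3" "k < 2"
  shows "(\<Sum>q<3. ((\<Sum>j<2. cnj (\<gamma> q j) * \<gamma> p j) - (\<Sum>j<2. cnj (\<gamma> p j) * \<gamma> q j)) * \<gamma> q k)
      = 2 * (\<Sum>j<2. cnj (x j) * x j) * \<gamma> p k - 2 * (\<Sum>j<2. cnj (x j) * \<gamma> p j) * x k"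
proof -
  have k: "k = 0 \<or> k = 1" and p: "p = 0 \<or> p = 1 \<or> p = 2" using assms by auto
  have v: "\<gamma> 0 0 = x 0" "\<gamma> 0 1 = - x 1" "\<gamma> 1 0 = \<i> * x 1" "\<gamma> 1 1 = - (\<i> * x 0)" "\<gamma> 2 0 = x 1" "\<gamma> 2 1 = x 0"
    by (simp_all add: \<gamma>_def g1_perm_def g1_coeff_def)
  have s: "sum f {..<2} = f 0 + f 1" "sum f {..<3} = f 0 + f 1 + f 2" for f :: "nat \<Rightarrow> complex"
    by (simp_all add: lessThan_45 add.assoc)
  show ?thesis using k p unfolding s
    by (elim disjE; simp only: v; simp add: algebra_simps ii_mult)
qed

text \<open>Verified as a polynomial identity in the coordinates of x and their conjugates, one case
  for each p and k. Behind it stands the transitivity of Spin(5), isomorphic to the compact group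
  Sp(2), on the unit vectors of complex 4-space, as for Spin(3) = SU(2) in dimension two.\<close>

lemma fierz_2:
  fixes x :: "nat \<Rightarrow> complex"
  defines "\<gamma> \<equiv> \<lambda>p k. g2_coeff p k * x (g2_perm p k)"
  assumes "p < 5" "k < 4"
  shows "(\<Sum>q<5. ((\<Sum>j<4. cnj (\<gamma> q j) * \<gamma> p j) - (\<Sum>j<4. cnj (\<gamma> p j) * \<gamma> q j)) * \<gamma> q k)
      = 2 * (\<Sum>j<4. cnj (x j) * x j) * \<gamma> p k - 2 * (\<Sum>j<4. cnj (x j) * \<gamma> p j) * x k"
proof -
  have k: "k = 0 \<or> k = 1 \<or> k = 2 \<or> k = 3" and p: "p = 0 \<or> p = 1 \<or> p = 2 \<or> p = 3 \<or> p = 4" using assms by auto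
  have v: "\<gamma> 0 0 = x 0" "\<gamma> 0 1 = - x 1" "\<gamma> 0 2 = - x 2" "\<gamma> 0 3 = x 3"
    "\<gamma> 1 0 = \<i> * x 2" "\<gamma> 1 1 = - (\<i> * x 3)" "\<gamma> 1 2 = - (\<i> * x 0)" "\<gamma> 1 3 = \<i> * x 1"
    "\<gamma> 2 0 = x 2" "\<gamma> 2 1 = - x 3" "\<gamma> 2 2 = x 0" "\<gamma> 2 3 = - x 1"
    "\<gamma> 3 0 = \<i> * x 1" "\<gamma> 3 1 = - (\<i> * x 0)" "\<gamma> 3 2 = \<i> * x 3" "\<gamma> 3 3 = - (\<i> * x 2)"
    "\<gamma> 4 0 = x 1" "\<gamma> 4 1 = x 0" "\<gamma> 4 2 = x 3" "\<gamma> 4 3 = x 2"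
    by (simp_all add: \<gamma>_def g2_perm_def g2_coeff_def)
  have s: "sum f {..<4} = f 0 + f 1 + f 2 + f 3" "sum f {..<5} = f 0 + f 1 + f 2 + f 3 + f 4" for f :: "nat \<Rightarrow> complex"
    by (simp_all add: lessThan_45 add.assoc)
  show ?thesis using k p unfolding s
    by (elim disjE; simp only: v; simp add: algebra_simps ii_mult)
qed

lemma small_pure_wick:
  assumes n: "n = 1 \<or> n = 2" and \<psi>: "\<psi> \<in> carrier_vec (2^n)" "\<psi> \<bullet>c \<psi> = 1"
  shows "\<exists>M. wick (2*n+1) (gop n) M (emb (2^n) (pure (2^n) \<psi>)) \<and> (\<forall>p q. M p q = - M q p)"
  using n
proof
  assume n: "n = 1"
  have g: "(\<Sum>l<2^n. gmat n p $$ (k,l) * \<psi> $ l) = g1_coeff p k * \<psi> $ (g1_perm p k)" if "p < 3" "k < 2" for p k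
  proof -
    have b: "g1_perm p k < 2" using that by (auto simp: g1_perm_def less_Suc_eq numeral_eq_Suc)
    have "(\<Sum>l<2^n. gmat n p $$ (k,l) * \<psi> $ l) = (\<Sum>l<2. if l = g1_perm p k then g1_coeff p k * \<psi> $ (g1_perm p k) else 0)"
      unfolding n using gmat_1[OF that] by (intro sum.cong) auto
    then show ?thesis using b by simp
  qed
  show ?thesis
  proof (rule pure_wick[OF _ \<psi>])
    fix p k :: nat assume "p < 2*n+1" "k < 2^n"
    then have pk: "p < 3" "k < 2" using n by auto
    have e: "2*n+1 = 3" "2^n = (2::nat)" using n by auto
    show "(\<Sum>q<2*n+1. ((\<Sum>j<2^n. cnj (\<Sum>l<2^n. gmat n q $$ (j,l) * \<psi> $ l) * (\<Sum>l<2^n. gmat n p $$ (j,l) * \<psi> $ l)) - (\<Sum>j<2^n. cnj (\<Sum>l<2^n. gmat n p $$ (j,l) * \<psi> $ l) * (\<Sum>l<2^n. gmat n q $$ (j,l) * \<psi> $ l))) * (\<Sum>l<2^n. gmat n q $$ (k,l) * \<psi> $ l))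
      = 2 * (\<Sum>j<2^n. cnj (\<psi> $ j) * \<psi> $ j) * (\<Sum>l<2^n. gmat n p $$ (k,l) * \<psi> $ l) - 2 * (\<Sum>j<2^n. cnj (\<psi> $ j) * (\<Sum>l<2^n. gmat n p $$ (j,l) * \<psi> $ l)) * \<psi> $ k"
      using fierz_1[OF pk, of "\<lambda>j. \<psi> $ j"] pk g[unfolded e] unfolding e by (simp cong: sum.cong_simp)
  qed
next
  assume n: "n = 2"
  have g: "(\<Sum>l<2^n. gmat n p $$ (k,l) * \<psi> $ l) = g2_coeff p k * \<psi> $ (g2_perm p k)" if "p < 5" "k < 4" for p k
  proof -
    have b: "g2_perm p k < 4" using that unfolding lt_4 lt_5 by (elim disjE) (simp_all add: g2_perm_def)
    have "(\<Sum>l<2^n. gmat n p $$ (k,l) * \<psi> $ l) = (\<Sum>l<4. if l = g2_perm p k then g2_coeff p k * \<psi> $ (g2_perm p k) else 0)"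
      unfolding n using gmat_2[OF that] by (intro sum.cong) auto
    then show ?thesis using b by simp
  qed
  show ?thesis
  proof (rule pure_wick[OF _ \<psi>])
    fix p k :: nat assume "p < 2*n+1" "k < 2^n"
    then have pk: "p < 5" "k < 4" using n by auto
    have e: "2*n+1 = 5" "2^n = (4::nat)" using n by auto
    show "(\<Sum>q<2*n+1. ((\<Sum>j<2^n. cnj (\<Sum>l<2^n. gmat n q $$ (j,l) * \<psi> $ l) * (\<Sum>l<2^n. gmat n p $$ (j,l) * \<psi> $ l)) - (\<Sum>j<2^n. cnj (\<Sum>l<2^n. gmat n p $$ (j,l) * \<psi> $ l) * (\<Sum>l<2^n. gmat n q $$ (j,l) * \<psi> $ l))) * (\<Sum>l<2^n. gmat n q $$ (k,l) * \<psi> $ l))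
      = 2 * (\<Sum>j<2^n. cnj (\<psi> $ j) * \<psi> $ j) * (\<Sum>l<2^n. gmat n p $$ (k,l) * \<psi> $ l) - 2 * (\<Sum>j<2^n. cnj (\<psi> $ j) * (\<Sum>l<2^n. gmat n p $$ (j,l) * \<psi> $ l)) * \<psi> $ k"
      using fierz_2[OF pk, of "\<lambda>j. \<psi> $ j"] pk g[unfolded e] unfolding e by (simp cong: sum.cong_simp)
  qed
qed

lemma small_state_entropy_lower:
  fixes \<Phi> :: "complex mat \<Rightarrow> complex mat"
  assumes n: "n = 1 \<or> n = 2"
    and b: "\<forall>p\<in>{1..2*n}. 0 \<le> b p \<and> b p \<le> 1"
    and \<Phi>: "\<And>A. A \<in> carrier_mat (2^n) (2^n) \<Longrightarrow> \<Phi> A \<in> carrier_mat (2^n) (2^n) \<and> emb (2^n) (\<Phi> A) = flip_mixes (gop n) b [1..<2*n+1] (emb (2^n) A)"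
    and \<sigma>: "is_state (2^n) \<sigma>"
  shows "(\<Sum>j<n. Hbin ((1 + sorted_weights n b ! (2*j) * sorted_weights n b ! (2*j+1)) / 2)) \<le> vN_entropy (\<Phi> \<sigma>)"
proof -
  let ?d = "2^n :: nat"
  let ?L = "\<Sum>j<n. Hbin ((1 + sorted_weights n b ! (2*j) * sorted_weights n b ! (2*j+1)) / 2)"
  obtain f x where f: "orthonormal ?d ?d f" and x: "\<And>i. i < ?d \<Longrightarrow> 0 \<le> x i" "(\<Sum>i<?d. x i) = 1"
    and dec: "\<And>k l. k < ?d \<Longrightarrow> l < ?d \<Longrightarrow> \<sigma> $$ (k,l) = (\<Sum>i<?d. complex_of_real (x i) * (f i $ k * cnj (f i $ l)))"
    using state_eigenbasis[OF \<sigma>] by blast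
  have fc: "f i \<in> carrier_vec ?d" "f i \<bullet>c f i = 1" if "i < ?d" for i using f that by (auto simp: orthonormal_def)
  have c: "\<sigma> \<in> carrier_mat ?d ?d" using \<sigma> by (simp add: is_state_def)
  let ?\<rho> = "\<lambda>i. pure ?d (f i)"
  have s: "\<sigma> = msum ?d (\<lambda>i. complex_of_real (x i) \<cdot>\<^sub>m ?\<rho> i) {..<?d}"
  proof (rule eq_matI)
    fix k l assume "k < dim_row (msum ?d (\<lambda>i. complex_of_real (x i) \<cdot>\<^sub>m ?\<rho> i) {..<?d})" "l < dim_col (msum ?d (\<lambda>i. complex_of_real (x i) \<cdot>\<^sub>m ?\<rho> i) {..<?d})"
    then have kl: "k < ?d" "l < ?d" by (auto simp: msum_def)
    show "\<sigma> $$ (k,l) = msum ?d (\<lambda>i. complex_of_real (x i) \<cdot>\<^sub>m ?\<rho> i) {..<?d} $$ (k,l)"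
      unfolding dec[OF kl] using kl by (simp add: msum_def pure_def)
  qed (use c in \<open>auto simp: msum_def\<close>)
  have st: "is_state ?d (?\<rho> i)" if "i < ?d" for i by (rule pure_state[OF fc[OF that]])
  have stP: "is_state ?d (\<Phi> (?\<rho> i))" if "i < ?d" for i by (rule channel_state[OF b \<Phi> st[OF that]])
  have cP: "\<Phi> (?\<rho> i) \<in> carrier_mat ?d ?d" for i using \<Phi>[OF pure_carrier] by blast
  have "emb ?d (\<Phi> \<sigma>) = flip_mixes (gop n) b [1..<2*n+1] (\<Sum>i<?d. complex_of_real (x i) \<odot> emb ?d (?\<rho> i))"
    unfolding \<Phi>[OF c, THEN conjunct2] by (subst s, subst emb_msum_smult) (simp_all add: pure_carrier)
  also have "\<dots> = (\<Sum>i<?d. complex_of_real (x i) \<odot> emb ?d (\<Phi> (?\<rho> i)))"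
    by (simp only: flip_mixes_sum flip_mixes_linear \<Phi>[OF pure_carrier])
  also have "\<dots> = emb ?d (msum ?d (\<lambda>i. complex_of_real (x i) \<cdot>\<^sub>m \<Phi> (?\<rho> i)) {..<?d})"
    by (rule emb_msum_smult[symmetric]) (simp_all add: cP)
  finally have "\<Phi> \<sigma> = msum ?d (\<lambda>i. complex_of_real (x i) \<cdot>\<^sub>m \<Phi> (?\<rho> i)) {..<?d}"
    by (rule emb_inj[OF \<Phi>[OF c, THEN conjunct1] msum_carrier])
  moreover have pr: "is_prob ?d x" using x by (simp add: is_prob_def)
  ultimately have "(\<Sum>i<?d. x i * vN_entropy (\<Phi> (?\<rho> i))) \<le> vN_entropy (\<Phi> \<sigma>)"
    using entropy_concave[OF pr stP] by simp
  moreover have "?L \<le> vN_entropy (\<Phi> (?\<rho> i))" if i: "i < ?d" for i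
  proof -
    obtain M where M: "wick (2*n+1) (gop n) M (emb ?d (?\<rho> i))" "\<forall>p q. M p q = - M q p"
      using small_pure_wick[OF n fc[OF i]] by blast
    have anti: "M p q = - M q p" for p q using M(2) by blast
    show ?thesis by (rule wick_entropy_lower[OF st[OF i] M(1) anti b stP[OF i] \<Phi>[OF pure_carrier, THEN conjunct2]])
  qed
  then have "(\<Sum>i<?d. x i * ?L) \<le> (\<Sum>i<?d. x i * vN_entropy (\<Phi> (?\<rho> i)))"
    using x(1) by (intro sum_mono mult_left_mono) auto
  moreover have "(\<Sum>i<?d. x i * ?L) = ?L" unfolding sum_distrib_right[symmetric] x(2) by simp
  ultimately show ?thesis by linarith
qed

subsection \<open>Capacities\<close>

text \<open>Sorting becomes a permutation of the generators, parity included with its weight 1, and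
  so tells which generators the optimal ensemble has to pair.\<close>

lemma sorted_weights_permutation:
  "\<exists>\<pi>. \<pi> permutes {..<2*n+1} \<and> (\<forall>i<2*n+1. sorted_weights n b ! i = wt n b (\<pi> i))"
proof -
  let ?ys = "map (wt n b) [0..<2*n+1]"
  have "[0..<2*n+1] = 0 # [1..<2*n+1]" by (simp add: upt_conv_Cons del: upt_Suc)
  moreover have "map (wt n b) [1..<2*n+1] = map b [1..<2*n+1]"
    by (rule map_cong[OF refl]) (simp only: wt_def if_True)
  moreover have "wt n b 0 = 1" by (simp add: wt_def)
  ultimately have ys: "?ys = 1 # map b [1..<2*n+1]" by (simp only: list.map)
  have "mset (sorted_weights n b) = mset ?ys" unfolding ys sorted_weights_def by (simp del: upt_Suc)
  then obtain \<pi> where \<pi>: "\<pi> permutes {..<length ?ys}" "permute_list \<pi> ?ys = sorted_weights n b"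
    by (rule mset_eq_permutation)
  have l: "length ?ys = 2*n+1" by simp
  have "sorted_weights n b ! i = wt n b (\<pi> i)" if i: "i < 2*n+1" for i
  proof -
    have "\<pi> i < 2*n+1" using permutes_in_image[OF \<pi>(1), of i] i unfolding l by simp
    then have "?ys ! \<pi> i = wt n b (\<pi> i)" by (simp del: upt_Suc)
    moreover have "sorted_weights n b ! i = ?ys ! \<pi> i"
      unfolding \<pi>(2)[symmetric] by (rule permute_list_nth[OF \<pi>(1)]) (use i l in simp)
    ultimately show ?thesis by simp
  qed
  then show ?thesis using \<pi>(1) unfolding l by blast
qed

lemma sorted_weights_bdown: "i \<ge> 1 \<Longrightarrow> sorted_weights n b ! i = bdown n b i"
  by (simp add: sorted_weights_def bdown_def nth_Cons' del: upt_Suc)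

theorem theorem1:
  fixes n :: nat and b :: "nat \<Rightarrow> real" and \<Phi> :: "complex mat \<Rightarrow> complex mat"
  assumes n: "n \<ge> 1"
    and b: "\<forall>p\<in>{1..2*n}. 0 \<le> b p \<and> b p \<le> 1"
    and add: "\<forall>A\<in>carrier_mat (2^n) (2^n). \<forall>B\<in>carrier_mat (2^n) (2^n). \<Phi> (A + B) = \<Phi> A + \<Phi> B"
    and smult: "\<forall>A\<in>carrier_mat (2^n) (2^n). \<forall>z. \<Phi> (z \<cdot>\<^sub>m A) = z \<cdot>\<^sub>m \<Phi> A"
    and id: "\<Phi> (1\<^sub>m (2^n)) = 1\<^sub>m (2^n)"
    and mono: "\<forall>x. \<Phi> (majorana_mono n x)
                 = complex_of_real (\<Prod>p\<in>{p\<in>{1..2*n}. x p}. b p) \<cdot>\<^sub>m majorana_mono n x"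
  shows "gaussian_capacity n \<Phi> =
           real n - Hbin ((1 + bdown n b 1) / 2)
             - (\<Sum>j=1..n-1. Hbin ((1 + bdown n b (2*j) * bdown n b (2*j+1)) / 2))
       \<and> (n \<le> 2 \<longrightarrow> one_shot_capacity n \<Phi> = gaussian_capacity n \<Phi>)"
proof -
  let ?bs = "sorted_weights n b" and ?d = "2^n :: nat"
  define L where "L = (\<Sum>j<n. Hbin ((1 + ?bs ! (2*j) * ?bs ! (2*j+1)) / 2))"
  have \<Phi>: "\<Phi> A \<in> carrier_mat ?d ?d \<and> emb ?d (\<Phi> A) = flip_mixes (gop n) b [1..<2*n+1] (emb ?d A)"
    if "A \<in> carrier_mat ?d ?d" for A by (rule channel_flip_mixes[OF add smult mono that])
  obtain \<pi> where \<pi>: "\<pi> permutes {..<2*n+1}" "\<And>i. i < 2*n+1 \<Longrightarrow> ?bs ! i = wt n b (\<pi> i)"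
    using sorted_weights_permutation[of n b] by blast
  have Lp: "(\<Sum>j<n. Hbin ((1 + wt n b (\<pi> (2*j)) * wt n b (\<pi> (2*j+1))) / 2)) = L"
    unfolding L_def
  proof (intro sum.cong refl)
    fix j assume "j \<in> {..<n}"
    then have j: "2*j < 2*n+1" "2*j+1 < 2*n+1" by auto
    show "Hbin ((1 + wt n b (\<pi> (2*j)) * wt n b (\<pi> (2*j+1))) / 2) = Hbin ((1 + ?bs ! (2*j) * ?bs ! (2*j+1)) / 2)"
      unfolding \<pi>(2)[OF j(1)] \<pi>(2)[OF j(2)] ..
  qed
  have L: "L = Hbin ((1 + bdown n b 1) / 2) + (\<Sum>j=1..n-1. Hbin ((1 + bdown n b (2*j) * bdown n b (2*j+1)) / 2))"
  proof -
    \<comment> \<open>The term j = 0 pairs the leading weight 1 with the largest attenuation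
      coefficient and becomes the isolated entropy term.\<close>
    have s: "{..<n} = insert 0 {1..n-1}" using n by auto
    have b0: "?bs ! 0 = 1" by (simp add: sorted_weights_def)
    have "L = Hbin ((1 + ?bs ! 0 * ?bs ! 1) / 2) + (\<Sum>j=1..n-1. Hbin ((1 + ?bs ! (2*j) * ?bs ! (2*j+1)) / 2))"
      unfolding L_def s by (subst sum.insert) auto
    also have "(\<Sum>j=1..n-1. Hbin ((1 + ?bs ! (2*j) * ?bs ! (2*j+1)) / 2)) = (\<Sum>j=1..n-1. Hbin ((1 + bdown n b (2*j) * bdown n b (2*j+1)) / 2))"
    proof (intro sum.cong refl)
      fix j assume "j \<in> {1..n-1}"
      then have j: "2*j \<ge> 1" "2*j+1 \<ge> 1" by auto
      show "Hbin ((1 + ?bs ! (2*j) * ?bs ! (2*j+1)) / 2) = Hbin ((1 + bdown n b (2*j) * bdown n b (2*j+1)) / 2)"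
        unfolding sorted_weights_bdown[OF j(1)] sorted_weights_bdown[OF j(2)] ..
    qed
    finally show ?thesis unfolding b0 sorted_weights_bdown[OF le_refl] by simp
  qed
  have upper: "holevo ?d m p (\<lambda>i. \<Phi> (\<sigma> i)) \<le> real n - L"
    if p: "is_prob m p" and st: "\<And>i. i < m \<Longrightarrow> is_state ?d (\<sigma> i)" and low: "\<And>i. i < m \<Longrightarrow> L \<le> vN_entropy (\<Phi> (\<sigma> i))" for m p \<sigma>
  proof -
    have "is_state ?d (msum ?d (\<lambda>i. complex_of_real (p i) \<cdot>\<^sub>m \<Phi> (\<sigma> i)) {..<m})"
      by (rule is_state_msum[OF p channel_state[OF b \<Phi> st]])
    then have "vN_entropy (msum ?d (\<lambda>i. complex_of_real (p i) \<cdot>\<^sub>m \<Phi> (\<sigma> i)) {..<m}) \<le> real n" by (rule state_entropy_le)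
    moreover have "(\<Sum>i<m. p i * L) \<le> (\<Sum>i<m. p i * vN_entropy (\<Phi> (\<sigma> i)))"
      using p low by (intro sum_mono mult_left_mono) (auto simp: is_prob_def)
    moreover have "(\<Sum>i<m. p i * L) = L" using p by (simp add: sum_distrib_right[symmetric] is_prob_def)
    ultimately show ?thesis unfolding holevo_def by linarith
  qed
  have glow: "L \<le> vN_entropy (\<Phi> \<sigma>)" if st: "is_state ?d \<sigma>" and g: "gaussian_state n \<sigma>" for \<sigma>
  proof -
    have c: "\<sigma> \<in> carrier_mat ?d ?d" using st by (simp add: is_state_def)
    show ?thesis unfolding L_def
    proof (rule gaussian_state_wick[OF g])
      fix M assume M: "wick (2*n+1) (gop n) M (emb ?d \<sigma>)" "\<And>p q. p < 2*n+1 \<Longrightarrow> q < 2*n+1 \<Longrightarrow> M p q = - M q p"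
      show "(\<Sum>j<n. Hbin ((1 + ?bs ! (2*j) * ?bs ! (2*j+1)) / 2)) \<le> vN_entropy (\<Phi> \<sigma>)"
        by (rule wick_entropy_lower[OF st M b channel_state[OF b \<Phi> st] \<Phi>[OF c, THEN conjunct2]])
    qed
  qed
  obtain m p \<sigma> where ex: "is_prob m p" "\<And>i. i < m \<Longrightarrow> is_state ?d (\<sigma> i)" "\<And>i. i < m \<Longrightarrow> gaussian_state n (\<sigma> i)"
    "holevo ?d m p (\<lambda>i. \<Phi> (\<sigma> i)) = real n - L"
    using gaussian_ensemble[OF b \<Phi> \<pi>(1)] unfolding Lp by blast
  have G: "gaussian_capacity n \<Phi> = real n - L"
    unfolding gaussian_capacity_def
  proof (rule cSup_eq_maximum)
    show "real n - L \<in> {holevo ?d m p (\<lambda>i. \<Phi> (\<sigma> i)) | m p \<sigma>. is_prob m p \<and> (\<forall>i<m. is_state ?d (\<sigma> i) \<and> gaussian_state n (\<sigma> i))}"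
      unfolding ex(4)[symmetric] using ex(1-3) by blast
    fix y assume "y \<in> {holevo ?d m p (\<lambda>i. \<Phi> (\<sigma> i)) | m p \<sigma>. is_prob m p \<and> (\<forall>i<m. is_state ?d (\<sigma> i) \<and> gaussian_state n (\<sigma> i))}"
    then show "y \<le> real n - L" by (auto intro!: upper glow)
  qed
  have "one_shot_capacity n \<Phi> = real n - L" if "n \<le> 2"
    unfolding one_shot_capacity_def
  proof (rule cSup_eq_maximum)
    have n12: "n = 1 \<or> n = 2" using n that by auto
    show "real n - L \<in> {holevo ?d m p (\<lambda>i. \<Phi> (\<sigma> i)) | m p \<sigma>. is_prob m p \<and> (\<forall>i<m. is_state ?d (\<sigma> i))}"
      unfolding ex(4)[symmetric] using ex(1-3) by blast
    fix y assume "y \<in> {holevo ?d m p (\<lambda>i. \<Phi> (\<sigma> i)) | m p \<sigma>. is_prob m p \<and> (\<forall>i<m. is_state ?d (\<sigma> i))}"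
    then show "y \<le> real n - L" by (auto intro!: upper small_state_entropy_lower[OF n12 b \<Phi>, folded L_def])
  qed
  then show ?thesis using G L by simp
qed

end
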